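(* Let $X$ be the blow up of $\mathbb{P}^3$ along a line defined over $\mathbb{Q}$. Then $X$ satisfies Manin's conjecture, with Peyre's constant, for any big line bundle over $\mathbb{Q}$. Explicitly, with the notation of the context: let $L$ be a big line bundle on $X$ over $\mathbb{Q}$, with class $x[\tilde D]+y[E]$ in $\mathrm{Pic}(X)_{\mathbb{Q}}$ ($x,y\in\mathbb{Q}$, $x>0$, $x+y>0$), and let $\mathsf H_L(\gamma)=\mathsf H(\gamma,(x,y))$ be the associated height. Then, as $B\to\infty$, $$\#\{\gamma\in U(\mathbb{Q}) \mid \mathsf H_L(\gamma)<B\}\ \sim\ \frac{c(X,L)}{a(L)\,(b(L)-1)!}\,B^{a(L)}(\log B)^{b(L)-1}.$$
   Context: **Variety.** $G=\mathrm{PGL}_2$ is embedded in $\mathbb{P}^3$ by $\begin{pmatrix} a&b\\c&d\end{pmatrix}\mapsto(a:b:c:d)$. The boundary is the quadric $D=\{ad-bc=0\}$, and $l\subset D$ is the line $c=d=0$. $X$ is the blow up of $\mathbb{P}^3$ along $l$, $E$ is the exceptional divisor, $\tilde D$ the strict transform of $D$, and $U\subset X$ is the image of $\mathrm{PGL}_2$, so $U(\mathbb{Q})=\mathrm{PGL}_2(\mathbb{Q})$. The classes of $\tilde D$ and $E$ form a basis of $\mathrm{Pic}(X)_{\mathbb{Q}}$. If $H$ is the pullback of the hyperplane class, then $\mathrm{Pic}(X)=\mathbb{Z}H\oplus\mathbb{Z}E$, $\tilde D=2H-E$, $-K_X=2\tilde D+E$, and the cone of effective divisors $\Lambda_{\rm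 eff}(X)$ is generated by $E$ and $H-E$. The class $x\tilde D+yE$ is big iff $x>0$ and $x+y>0$. **Heights.** For a place $v$ of $\mathbb{Q}$ and $g=\begin{pmatrix} a&b\\c&d\end{pmatrix}\in G(\mathbb{Q}_v)$ put, for $v=p$ finite, $\mathsf H_{1,v}(g)=\max\{|c|_v,|d|_v\}$ and $\mathsf H_{2,v}(g)=\max\{|a|_v,|b|_v,|c|_v,|d|_v\}$, and, for $v=\infty$, $\mathsf H_{1,v}(g)=\sqrt{c^2+d^2}$ and $\mathsf H_{2,v}(g)=\sqrt{a^2+b^2+c^2+d^2}$. Let $\mathsf H_{E,v}=\mathsf H_{2,v}/\mathsf H_{1,v}$, $\mathsf H_{\tilde D,v}=\mathsf H_{1,v}\mathsf H_{2,v}/|ad-bc|_v$, $\mathsf H_v(g,(s,w))=\mathsf H_{\tilde D,v}(g)^s\mathsf H_{E,v}(g)^w$, and $\mathsf H(g,(s,w))=\prod_v\mathsf H_v(g_v,(s,w))$. **Invariants.** $a(L)=\inf\{t\in\mathbb{R}\mid tL+K_X\in\Lambda_{\rm eff}(X)\}$, and $b(L)$ is the codimension of the minimal face of $\Lambda_{\rm eff}(X)$ containing $a(L)[L]+[K_X]$. **Measures.** On $G$ let $\omega$ be the invariant top form, given on the chart $d=1$ by $\dfrac{da\,db\,dc}{(a-bc)^2}$. The local Tamagawa measure $\tau_{X,v}$ on $X(\mathbb{Q}_v)$ is given on $G(\mathbb{Q}_v)$ by $\mathsf H_v(g,(2,1))^{-1}|\omega|_v$, the complement having measure zero. Let $P\subset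 G$ be the Borel subgroup of upper triangular matrices $\begin{pmatrix} t&u\\0&1\end{pmatrix}$, with left Haar measure $|\sigma|_v=|t|_v^{-2}\,dt\,du$ on $P(\mathbb{Q}_v)$ ($dt,du$ being Lebesgue measure for $v=\infty$, and giving $\mathbb{Z}_p$ volume $1$ for $v=p$). **The constant $c(X,L)$** (Peyre for multiples of the anticanonical class, Batyrev–Tschinkel in general) is defined as follows. (i) If $2y=x$ (so $L$ is proportional to $-K_X$): $c(X,L)=\alpha(X,L)\,\tau(X)$, where $\alpha(X,L)=\int_{\mathrm{Nef}_1(X)}e^{-\langle L,\xi\rangle}d\xi$. Here $\mathrm{Nef}_1(X)$ is the cone dual to $\Lambda_{\rm eff}(X)$ in the real dual of $\mathrm{NS}(X)_{\mathbb{R}}$, and $d\xi$ is normalized so that the dual lattice of $\mathrm{NS}(X)=\mathbb{Z}H\oplus\mathbb{Z}E$ has covolume $1$. Moreover $\tau(X)=\tau_{X,\infty}(X(\mathbb{R}))\prod_p(1-p^{-1})^2\tau_{X,p}(X(\mathbb{Q}_p))$. (ii) If $2y>x$ (so $a(L)L+K_X$ is a nonzero rigid effective class proportional to $E$, and $a(L)=2/x$): $c(X,L)=\frac{1}{2x}\,\tau(X,L)$, where $\frac1{2x}=\alpha(X,L)$ and $$\tau(X,L)=\int_{X(\mathbb{R})}\mathsf H_{E,\infty}^{-(2y/x-1)}d\tau_{X,\infty}\cdot\prod_p(1-p^{-1})\int_{X(\mathbb{Q}_p)}\mathsf H_{E,p}^{-(2y/x-1)}d\tau_{X,p}.$$ (iii)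 If $2y<x$ (so $a(L)=3/(x+y)$, and $a(L)L+K_X$ is a positive multiple of $\tilde D-E$ and defines the fibration $f:X\to P\backslash G=\mathbb{P}^1$, $g\mapsto(c:d)$): for $z=(c:d)\in\mathbb{P}^1(\mathbb{Q})$ with $c,d$ coprime integers choose $g_z=\begin{pmatrix} a&b\\c&d\end{pmatrix}\in \mathrm{SL}_2(\mathbb{Z})$, and let $S_z=f^{-1}(z)$, which is the closure of $Pg_z$. Then $$c(X,L)=\sum_{z\in\mathbb{P}^1(\mathbb{Q})}\frac1{x+y}\;\mathsf H\big(g_z,(a(L)x-2,\;a(L)y-1)\big)^{-1}\,\tau(S_z),$$ where $\frac1{x+y}=\alpha(S_z,L)$ and $$\tau(S_z)=\int_{P(\mathbb{R})}\mathsf H_\infty(hg_z,(2,1))^{-1}d|\sigma|_\infty\prod_p(1-p^{-1})\int_{P(\mathbb{Q}_p)}\mathsf H_p(hg_z,(2,1))^{-1}d|\sigma|_p.$$ *)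

theory Defs
  imports "HOL-Analysis.Analysis" "HOL-Algebra.Ring" "HOL-Library.Landau_Symbols"
begin

section \<open>The field of p-adic numbers and its Haar measure\<close>

definition rat_padic_abs :: "nat \<Rightarrow> rat \<Rightarrow> real" where
  "rat_padic_abs p q =
     (if q = 0 then 0
      else let (m, n) = quotient_of q in
        real p powi (int (multiplicity (int p) n) - int (multiplicity (int p) m)))"

definition padic_cauchy :: "nat \<Rightarrow> (nat \<Rightarrow> rat) set" where
  "padic_cauchy p =
     {s. \<forall>e>0. \<exists>N. \<forall>m\<ge>N. \<forall>n\<ge>N. rat_padic_abs p (s m - s n) < e}"

definition padic_rel :: "nat \<Rightarrow> ((nat \<Rightarrow> rat) \<times> (nat \<Rightarrow> rat)) set" where
  "padic_rel p =
     {(s, t). s \<in> padic_cauchy p \<and> t \<in> padic_cauchy p \<and>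
        (\<lambda>n. rat_padic_abs p (s n - t n)) \<longlonglongrightarrow> 0}"

text \<open>The completion of the rationals with respect to the p-adic absolute value. As the prime
  varies inside the statement, it is a ring with explicit carrier and not a type.\<close>

type_synonym padic = "(nat \<Rightarrow> rat) set"

definition padic_of_rat :: "nat \<Rightarrow> rat \<Rightarrow> padic" where
  "padic_of_rat p q = padic_rel p `` {\<lambda>_. q}"

definition Qp :: "nat \<Rightarrow> padic ring" where
  "Qp p = \<lparr>carrier = padic_cauchy p // padic_rel p,
           mult = (\<lambda>X Y. \<Union>s\<in>X. \<Union>t\<in>Y. padic_rel p `` {\<lambda>n. s n * t n}),
           one = padic_of_rat p 1,
           zero = padic_of_rat p 0,
           add = (\<lambda>X Y. \<Union>s\<in>X. \<Union>t\<in>Y. padic_rel p `` {\<lambda>n. s n + t n})\<rparr>"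

definition padic_abs :: "nat \<Rightarrow> padic \<Rightarrow> real" where
  "padic_abs p X = (THE r. \<forall>s\<in>X. (\<lambda>n. rat_padic_abs p (s n)) \<longlonglongrightarrow> r)"

definition padic_cball :: "nat \<Rightarrow> padic \<Rightarrow> int \<Rightarrow> padic set" where
  "padic_cball p a n =
     {x \<in> carrier (Qp p). padic_abs p (x \<ominus>\<^bsub>Qp p\<^esub> a) \<le> real p powi (- n)}"

text \<open>The Haar measure giving the ring of p-adic integers volume 1: the unique measure on the
  Borel sets for which the closed ball of radius \<open>p\<^sup>-\<^sup>n\<close> around \<open>a\<close>, that is
  \<open>a + p\<^sup>n \<int>\<^sub>p\<close>, has volume \<open>p\<^sup>-\<^sup>n\<close>.\<close>

definition padic_haar :: "nat \<Rightarrow> padic measure" where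
  "padic_haar p =
     extend_measure (carrier (Qp p)) (carrier (Qp p) \<times> UNIV)
       (\<lambda>(a, n). padic_cball p a n) (\<lambda>(a, n). ennreal (real p powi (- n)))"

text \<open>Euler products, as convergent infinite products over the primes in increasing order.\<close>

definition euler_prod :: "(nat \<Rightarrow> real) \<Rightarrow> real" where
  "euler_prod f = (\<Prod>p. if prime p then f p else 1)"


section \<open>Rational points\<close>

text \<open>The quadruple \<open>(a, b, c, d)\<close> stands for the matrix with rows \<open>(a, b)\<close> and \<open>(c, d)\<close>.\<close>

type_synonym 'a mat2 = "'a \<times> 'a \<times> 'a \<times> 'a"

fun map_mat2 :: "('a \<Rightarrow> 'b) \<Rightarrow> 'a mat2 \<Rightarrow> 'b mat2" where
  "map_mat2 f (a, b, c, d) = (f a, f b, f c, f d)"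

definition PGL2_Q :: "rat mat2 set set" where
  "PGL2_Q =
     {(a, b, c, d). a * d - b * c \<noteq> 0} //
     {((a, b, c, d), (a', b', c', d')).
        \<exists>k. k \<noteq> 0 \<and> a' = k * a \<and> b' = k * b \<and> c' = k * c \<and> d' = k * d}"

definition P1_Q :: "(rat \<times> rat) set set" where
  "P1_Q = (UNIV - {(0, 0)}) //
     {((c, d), (c', d')). \<exists>k. k \<noteq> 0 \<and> c' = k * c \<and> d' = k * d}"


section \<open>Heights\<close>

fun H1_inf :: "real mat2 \<Rightarrow> real" where
  "H1_inf (a, b, c, d) = sqrt (c\<^sup>2 + d\<^sup>2)"

fun H2_inf :: "real mat2 \<Rightarrow> real" where
  "H2_inf (a, b, c, d) = sqrt (a\<^sup>2 + b\<^sup>2 + c\<^sup>2 + d\<^sup>2)"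

fun absdet_inf :: "real mat2 \<Rightarrow> real" where
  "absdet_inf (a, b, c, d) = \<bar>a * d - b * c\<bar>"

fun H1_fin :: "nat \<Rightarrow> padic mat2 \<Rightarrow> real" where
  "H1_fin p (a, b, c, d) = Max {padic_abs p c, padic_abs p d}"

fun H2_fin :: "nat \<Rightarrow> padic mat2 \<Rightarrow> real" where
  "H2_fin p (a, b, c, d) = Max {padic_abs p a, padic_abs p b, padic_abs p c, padic_abs p d}"

fun absdet_fin :: "nat \<Rightarrow> padic mat2 \<Rightarrow> real" where
  "absdet_fin p (a, b, c, d) =
     padic_abs p (a \<otimes>\<^bsub>Qp p\<^esub> d \<ominus>\<^bsub>Qp p\<^esub> b \<otimes>\<^bsub>Qp p\<^esub> c)"

definition HE_inf :: "real mat2 \<Rightarrow> real" where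
  "HE_inf g = H2_inf g / H1_inf g"

definition HD_inf :: "real mat2 \<Rightarrow> real" where
  "HD_inf g = H1_inf g * H2_inf g / absdet_inf g"

definition HE_fin :: "nat \<Rightarrow> padic mat2 \<Rightarrow> real" where
  "HE_fin p g = H2_fin p g / H1_fin p g"

definition HD_fin :: "nat \<Rightarrow> padic mat2 \<Rightarrow> real" where
  "HD_fin p g = H1_fin p g * H2_fin p g / absdet_fin p g"

definition height_inf :: "real mat2 \<Rightarrow> real \<times> real \<Rightarrow> real" where
  "height_inf g = (\<lambda>(s, w). HD_inf g powr s * HE_inf g powr w)"

definition height_fin :: "nat \<Rightarrow> padic mat2 \<Rightarrow> real \<times> real \<Rightarrow> real" where
  "height_fin p g = (\<lambda>(s, w). HD_fin p g powr s * HE_fin p g powr w)"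

definition height :: "rat mat2 \<Rightarrow> real \<times> real \<Rightarrow> real" where
  "height g sw =
     height_inf (map_mat2 of_rat g) sw *
     euler_prod (\<lambda>p. height_fin p (map_mat2 (padic_of_rat p) g) sw)"

text \<open>The height is invariant under scaling of the matrix, by the product formula, so that
  the choice of the representative does not matter here.\<close>

definition counting :: "real \<times> real \<Rightarrow> real \<Rightarrow> nat" where
  "counting xy B = card {\<gamma> \<in> PGL2_Q. \<exists>g\<in>\<gamma>. height g xy < B}"


section \<open>Divisor classes\<close>

text \<open>The real Neron-Severi space, in coordinates with respect to the basis \<open>H\<close>, \<open>E\<close>.
  Its dual is identified with \<open>real \<times> real\<close> via the inner product, which pairs
  dual bases, so that the dual lattice is the standard lattice and has covolume 1 for \<open>lborel\<close>.\<close>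

definition cls_H :: "real \<times> real" where "cls_H = (1, 0)"
definition cls_E :: "real \<times> real" where "cls_E = (0, 1)"
definition cls_D :: "real \<times> real" where "cls_D = 2 *\<^sub>R cls_H - cls_E"
definition cls_K :: "real \<times> real" where "cls_K = - (2 *\<^sub>R cls_D + cls_E)"

definition Eff :: "(real \<times> real) set" where
  "Eff = convex_cone hull {cls_E, cls_H - cls_E}"

definition Nef1 :: "(real \<times> real) set" where
  "Nef1 = {\<xi>. \<forall>D\<in>Eff. 0 \<le> D \<bullet> \<xi>}"

definition manin_a :: "real \<times> real \<Rightarrow> real" where
  "manin_a L = Inf {t. t *\<^sub>R L + cls_K \<in> Eff}"

definition minimal_face :: "real \<times> real \<Rightarrow> (real \<times> real) set" where
  "minimal_face v = \<Inter>{F. F face_of Eff \<and> v \<in> F}"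

definition manin_b :: "real \<times> real \<Rightarrow> nat" where
  "manin_b L =
     nat (int DIM(real \<times> real) - aff_dim (minimal_face (manin_a L *\<^sub>R L + cls_K)))"


section \<open>Tamagawa measures\<close>

text \<open>Measures on the real or p-adic points of \<open>X\<close> are given in the coordinates
  \<open>(a, b, c)\<close> of the chart \<open>d = 1\<close> of \<open>G\<close>, whose complement is a null set. Division by zero
  makes the densities below vanish on the null set \<open>a = b c\<close> outside of \<open>G\<close>.\<close>

definition omega_inf :: "(real \<times> real \<times> real) measure" where
  "omega_inf = density lborel (\<lambda>(a, b, c). ennreal (1 / \<bar>a - b * c\<bar>\<^sup>2))"

definition tau_inf :: "(real \<times> real \<times> real) measure" where
  "tau_inf =
     density omega_inf (\<lambda>(a, b, c). ennreal (inverse (height_inf (a, b, c, 1) (2, 1))))"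

definition omega_fin :: "nat \<Rightarrow> (padic \<times> padic \<times> padic) measure" where
  "omega_fin p =
     density (padic_haar p \<Otimes>\<^sub>M padic_haar p \<Otimes>\<^sub>M padic_haar p)
       (\<lambda>(a, b, c). ennreal (1 / (padic_abs p (a \<ominus>\<^bsub>Qp p\<^esub> b \<otimes>\<^bsub>Qp p\<^esub> c))\<^sup>2))"

definition tau_fin :: "nat \<Rightarrow> (padic \<times> padic \<times> padic) measure" where
  "tau_fin p =
     density (omega_fin p)
       (\<lambda>(a, b, c). ennreal (inverse (height_fin p (a, b, c, \<one>\<^bsub>Qp p\<^esub>) (2, 1))))"

text \<open>The left Haar measures on the group \<open>P\<close>, in the coordinates \<open>(t, u)\<close>; the density
  vanishes on the null set \<open>t = 0\<close>, again by division by zero.\<close>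

definition sigma_inf :: "(real \<times> real) measure" where
  "sigma_inf = density lborel (\<lambda>(t, u). ennreal (1 / \<bar>t\<bar>\<^sup>2))"

definition sigma_fin :: "nat \<Rightarrow> (padic \<times> padic) measure" where
  "sigma_fin p =
     density (padic_haar p \<Otimes>\<^sub>M padic_haar p) (\<lambda>(t, u). ennreal (1 / (padic_abs p t)\<^sup>2))"


section \<open>The constant\<close>

definition alpha_const :: "real \<times> real \<Rightarrow> real" where
  "alpha_const L = (LINT \<xi>:Nef1|lborel. exp (- (L \<bullet> \<xi>)))"

definition tau_X :: real where
  "tau_X = measure tau_inf (space tau_inf) *
     euler_prod (\<lambda>p. (1 - 1 / real p)\<^sup>2 * measure (tau_fin p) (space (tau_fin p)))"

text \<open>The rigid case; \<open>k\<close> is the exponent \<open>2y/x - 1\<close>.\<close>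

definition tau_rigid :: "real \<Rightarrow> real" where
  "tau_rigid k =
     (LINT (a, b, c)|tau_inf. HE_inf (a, b, c, 1) powr (- k)) *
     euler_prod (\<lambda>p. (1 - 1 / real p) *
       (LINT (a, b, c)|tau_fin p. HE_fin p (a, b, c, \<one>\<^bsub>Qp p\<^esub>) powr (- k)))"

text \<open>The product of the matrix with rows \<open>(t, u)\<close>, \<open>(0, 1)\<close> and a matrix \<open>g\<close>.\<close>

fun P_act_inf :: "real \<times> real \<Rightarrow> real mat2 \<Rightarrow> real mat2" where
  "P_act_inf (t, u) (a, b, c, d) = (t * a + u * c, t * b + u * d, c, d)"

fun P_act_fin :: "nat \<Rightarrow> padic \<times> padic \<Rightarrow> padic mat2 \<Rightarrow> padic mat2" where
  "P_act_fin p (t, u) (a, b, c, d) =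
     (t \<otimes>\<^bsub>Qp p\<^esub> a \<oplus>\<^bsub>Qp p\<^esub> u \<otimes>\<^bsub>Qp p\<^esub> c, t \<otimes>\<^bsub>Qp p\<^esub> b \<oplus>\<^bsub>Qp p\<^esub> u \<otimes>\<^bsub>Qp p\<^esub> d, c, d)"

text \<open>A matrix in \<open>SL\<^sub>2(\<int>)\<close> whose second row represents \<open>z\<close>.\<close>

definition SL2_rep :: "(rat \<times> rat) set \<Rightarrow> rat mat2" where
  "SL2_rep z = map_mat2 of_int
     (SOME (a, b, c, d). a * d - b * c = (1::int) \<and> (of_int c, of_int d) \<in> z)"

definition tau_S :: "(rat \<times> rat) set \<Rightarrow> real" where
  "tau_S z =
     (LINT h|sigma_inf. inverse (height_inf (P_act_inf h (map_mat2 of_rat (SL2_rep z))) (2, 1))) *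
     euler_prod (\<lambda>p. (1 - 1 / real p) *
       (LINT h|sigma_fin p.
          inverse (height_fin p (P_act_fin p h (map_mat2 (padic_of_rat p) (SL2_rep z))) (2, 1))))"

definition pic :: "real \<Rightarrow> real \<Rightarrow> real \<times> real" where
  "pic x y = x *\<^sub>R cls_D + y *\<^sub>R cls_E"

definition manin_c :: "real \<Rightarrow> real \<Rightarrow> real" where
  "manin_c x y =
     (if 2 * y = x then alpha_const (pic x y) * tau_X
      else if 2 * y > x then 1 / (2 * x) * tau_rigid (2 * y / x - 1)
      else (\<Sum>\<^sub>\<infinity>z\<in>P1_Q. 1 / (x + y) *
              inverse (height (SL2_rep z)
                (manin_a (pic x y) * x - 2, manin_a (pic x y) * y - 1)) *
              tau_S z))"

end

theory Submission
  imports Defs "HOL-Number_Theory.Cong"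
begin

text \<open>A rational point of \<open>PGL\<^sub>2\<close> has a unique representative with rows \<open>v\<close> and \<open>g z\<close>, where \<open>z\<close> runs over
  the primitive integer vectors up to sign, \<open>g \<ge> 1\<close>, and \<open>v\<close> and \<open>g\<close> have no common divisor. Its height is
  \<open>|z|\<^bsup>x-y\<^esup> (|v|\<^sup>2 + g\<^sup>2 |z|\<^sup>2)\<^bsup>(x+y)/2\<^esup>\<close>. With \<open>T = B\<^bsup>1/(2x)\<^esup>\<close>, \<open>\<beta> = 2x / (x + y)\<close> and
  \<open>\<rho> = (T / |z|)\<^sup>\<beta>\<close>, counting lattice points in discs for each \<open>g\<close> and sieving by the primes gives
  \<open>2 \<pi> / (3 \<zeta>(3)) |z|\<^sup>2 \<rho>\<^sup>3\<close> points over \<open>z\<close> as \<open>\<rho>\<close> grows, uniformly in \<open>z\<close>. As a power of \<open>|z|\<close> this has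
  exponent \<open>2 - 3 \<beta>\<close>. If \<open>\<beta> > 4/3\<close>, the sum over \<open>z\<close> converges and dominated convergence gives the sum of the
  constants of the fibres. If \<open>\<beta> = 4/3\<close>, it diverges logarithmically, which gives the factor \<open>log B\<close>. If
  \<open>\<beta> < 4/3\<close>, most points have bounded \<open>g\<close> and \<open>|z|\<close> of the order of \<open>T\<close>; here one sums over \<open>z\<close> first for
  fixed \<open>g\<close>, by partial summation, and then over \<open>g\<close> by dominated convergence. The local integrals of
  the constant are elementary at the real place and sums over shells \<open>|x| = p\<^sup>n\<close> at the finite ones, and
  their Euler products are values of \<open>\<zeta>\<close>.\<close>

section \<open>The p-adic absolute value and the completion\<close>

text \<open>The height carries no determinant: by the product formula the finite places return the
  power of |det| that the real place takes, and likewise for \<open>g\<close>. Only norms of integer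
  vectors remain. As \<open>v\<close> runs over all of Z^2 whatever \<open>z\<close> is, a fibre
  enters through the scale |z|^2 alone, and this is the source of the uniformity in
  \<open>z\<close>. The condition det \<noteq> 0 removes just the multiples of \<open>z\<close>.
  Below it \<rho> stays bounded for typical points, so an asymptotic formula inside one fibre says
  nothing about them, which forces the exchange of the sums. In the local integrals the determinant
  cancels too, between the invariant form and the height, so that all densities are functions of
  norms. The obstacle on this side is the Haar measure: it is prescribed by its values on balls, and
  a measure with these values has to be constructed. Both sides are evaluated in full and compared
  as products of \<pi> and zeta values, in the fibration case together with a sum over
  \<open>z\<close>.\<close>

lemma rat_padic_abs_frac:
  assumes p: "prime p" and mn: "m \<noteq> 0" "n \<noteq> (0::int)"
  shows "rat_padic_abs p (of_int m / of_int n) =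
    real p powi (int (multiplicity (int p) n) - int (multiplicity (int p) m))"
proof -
  have pe: "prime_elem (int p)" using p by simp
  define q :: rat where "q = of_int m / of_int n"
  obtain a b where ab: "quotient_of q = (a, b)" by fastforce
  have b: "b > 0" using ab quotient_of_denom_pos by blast
  have q: "q = of_int a / of_int b" using ab quotient_of_div by blast
  have q0: "q \<noteq> 0" using mn by (simp add: q_def)
  with q have a: "a \<noteq> 0" by auto
  have "of_int m * (of_int b :: rat) = of_int a * of_int n"
    using q mn b by (simp add: q_def field_simps)
  hence "m * b = a * n" by (metis of_int_eq_iff of_int_mult)
  hence "multiplicity (int p) m + multiplicity (int p) b = multiplicity (int p) a + multiplicity (int p) n"
    using prime_elem_multiplicity_mult_distrib[OF pe] mn a b by (metis less_irrefl)
  hence "int (multiplicity (int p) b) - int (multiplicity (int p) a) =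
      int (multiplicity (int p) n) - int (multiplicity (int p) m)" by linarith
  thus ?thesis using q0 by (simp add: rat_padic_abs_def q_def[symmetric] ab)
qed

lemma rat_eq_frac: "\<exists>m n. n \<noteq> 0 \<and> q = of_int m / (of_int n :: rat)"
  by (metis less_irrefl quotient_of_div quotient_of_denom_pos prod.exhaust_sel)

text \<open>The radical inverse: the base p digits of \<open>K\<close> are mirrored at the point,
  d_i p^i becoming d_i p^(-1-i). The values represent the classes of Q_p modulo Z_p, each once, and
  will index the balls of a given radius. The guard on \<open>p\<close> makes the recursion
  terminate.\<close>

fun radinv :: "nat \<Rightarrow> nat \<Rightarrow> rat" where
  "radinv p K = (if K = 0 \<or> p < 2 then 0 else (of_nat (K mod p) + radinv p (K div p)) / of_nat p)"

declare radinv.simps[simp del]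

text \<open>The prime varies inside the Euler products, so it is a parameter of a locale; the
  results come back through \<open>padic.intro\<close>.\<close>

locale padic =
  fixes p :: nat
  assumes prime: "prime p"
begin

abbreviation v :: "rat \<Rightarrow> real" where "v \<equiv> rat_padic_abs p"

lemma p_gt1: "real p > 1" "p > 1" and p_pos: "real p > 0"
  using prime_gt_1_nat[OF prime] by auto

lemma powi_le_iff: "real p powi a \<le> real p powi b \<longleftrightarrow> a \<le> b"
  using p_gt1 power_int_strict_increasing[of b a "real p"] power_int_increasing[of a b "real p"]
  by (meson less_imp_le linorder_not_le)

lemma powi_less_iff: "real p powi a < real p powi b \<longleftrightarrow> a < b"
  using powi_le_iff[of b a] by (simp add: not_le[symmetric])

lemma powi_pos: "real p powi a > 0" using p_pos by simp

lemma v_0 [simp]: "v 0 = 0" by (simp add: rat_padic_abs_def)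

lemma v_frac: "m \<noteq> 0 \<Longrightarrow> n \<noteq> 0 \<Longrightarrow> v (of_int m / of_int n) =
    real p powi (int (multiplicity (int p) n) - int (multiplicity (int p) m))"
  using rat_padic_abs_frac[OF prime] .

lemma v_of_int: "m \<noteq> 0 \<Longrightarrow> v (of_int m) = real p powi (- int (multiplicity (int p) m))"
  using v_frac[of m 1] by simp

lemma v_frac': "v (of_int m / of_int n) = v (of_int m) / v (of_int n)"
  using p_pos by (cases "m = 0"; cases "n = 0") (simp_all add: v_frac v_of_int power_int_diff power_int_minus field_simps)

lemma v_values: "q \<noteq> 0 \<Longrightarrow> \<exists>k. v q = real p powi k"
  using rat_eq_frac[of q] v_frac by (metis div_0 of_int_0)

lemma v_pos: "q \<noteq> 0 \<Longrightarrow> v q > 0"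
  using v_values powi_pos by metis

lemma v_nonneg [simp]: "v q \<ge> 0"
  using v_pos[of q] by (cases "q = 0") auto

lemma v_eq_0 [simp]: "v q = 0 \<longleftrightarrow> q = 0"
  using v_pos[of q] by (cases "q = 0") auto

lemma v_mult: "v (q * r) = v q * v r"
proof (cases "q = 0 \<or> r = 0")
  case False
  obtain m n where q: "n \<noteq> 0" "q = of_int m / of_int n" using rat_eq_frac by blast
  obtain k l where r: "l \<noteq> 0" "r = of_int k / of_int l" using rat_eq_frac by blast
  have mk: "m \<noteq> 0" "k \<noteq> 0" using False q r by auto
  have pe: "prime_elem (int p)" using prime by simp
  have "q * r = of_int (m * k) / of_int (n * l)" by (simp add: q r)
  hence "v (q * r) = real p powi (int (multiplicity (int p) (n * l)) - int (multiplicity (int p) (m * k)))"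
    using v_frac[of "m * k" "n * l"] mk q r by simp
  also have "\<dots> = v q * v r" using p_pos mk q(1) r(1)
    unfolding q(2) r(2) by (simp add: v_frac prime_elem_multiplicity_mult_distrib[OF pe] power_int_add[symmetric] algebra_simps)
  finally show ?thesis .
qed auto

lemma v_1 [simp]: "v 1 = 1" using v_of_int[of 1] by simp

lemma v_minus [simp]: "v (- q) = v q"
proof -
  have "v (-1) * v (-1) = 1" using v_mult[of "-1" "-1"] by simp
  hence "v (-1) = 1" using v_nonneg[of "-1"] by (metis abs_of_nonneg abs_mult_self_eq abs_1 mult_eq_1_iff real_sqrt_abs2 real_sqrt_one)
  thus ?thesis using v_mult[of "-1" q] by simp
qed

lemma v_p: "v (of_nat p) = 1 / real p"
proof -
  have "multiplicity (int p) (int p) = 1" using prime by (intro multiplicity_self) auto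
  thus ?thesis using v_of_int[of "int p"] p_pos by (simp add: power_int_minus field_simps)
qed

lemma v_powi: "v (of_nat p powi k) = real p powi (- k)"
proof -
  have *: "v (of_nat p ^ n) = (1 / real p) ^ n" for n by (induction n) (simp_all add: v_mult v_p)
  have "v (inverse q) = inverse (v q)" for q
    using v_mult[of q "inverse q"] by (cases "q = 0") (simp_all add: field_simps)
  thus ?thesis using * p_pos by (cases "k \<ge> 0") (simp_all add: power_int_def field_simps power_one_over)
qed

lemma v_int_dvd: "v (of_int m) \<le> real p powi (- int k) \<longleftrightarrow> int p ^ k dvd m"
proof (cases "m = 0")
  case False
  have "int p ^ k dvd m \<longleftrightarrow> k \<le> multiplicity (int p) m"
    using False prime by (intro power_dvd_iff_le_multiplicity) auto
  thus ?thesis using False by (simp add: v_of_int powi_le_iff)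
qed (use powi_pos[of "- int k"] in simp)

lemma v_of_int_le: "v (of_int m) \<le> 1"
  using v_int_dvd[of m 0] by simp

lemma v_add_int: "v (of_int (m + n)) \<le> max (v (of_int m)) (v (of_int n))"
proof -
  have *: "v (of_int (m + n)) \<le> v (of_int n)" if "v (of_int m) \<le> v (of_int n)" for m n
  proof (cases "n = 0")
    case True thus ?thesis using that by simp
  next
    case False
    have "int p ^ multiplicity (int p) n dvd m" using that v_int_dvd[of m] False by (simp add: v_of_int)
    moreover have "int p ^ multiplicity (int p) n dvd n" by (rule multiplicity_dvd)
    ultimately have "int p ^ multiplicity (int p) n dvd m + n" by (rule dvd_add)
    thus ?thesis using v_int_dvd[of "m + n"] False by (simp add: v_of_int)
  qed
  show ?thesis using *[of m n] *[of n m] by (cases "v (of_int m) \<le> v (of_int n)") (auto simp: add.commute)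
qed

lemma v_add: "v (q + r) \<le> max (v q) (v r)"
proof -
  obtain m n where q: "n \<noteq> 0" "q = of_int m / of_int n" using rat_eq_frac by blast
  obtain k l where r: "l \<noteq> 0" "r = of_int k / of_int l" using rat_eq_frac by blast
  have *: "q + r = of_int (m * l + k * n) / of_int (n * l)"
    "q = of_int (m * l) / of_int (n * l)" "r = of_int (k * n) / of_int (n * l)"
    using q(1) r(1) by (simp_all add: q(2) r(2) field_simps)
  have pos: "v (of_int (n * l)) > 0" using q r by (intro v_pos) simp
  have "v (of_int (m * l + k * n)) / v (of_int (n * l)) \<le>
      max (v (of_int (m * l))) (v (of_int (k * n))) / v (of_int (n * l))"
    using pos v_add_int[of "m * l" "k * n"] by (intro divide_right_mono) (simp_all only: less_imp_le)
  also have "\<dots> = max (v (of_int (m * l)) / v (of_int (n * l))) (v (of_int (k * n)) / v (of_int (n * l)))"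
    using pos by (simp add: max_divide_distrib_right)
  finally have "v (of_int (m * l + k * n) / of_int (n * l)) \<le>
      max (v (of_int (m * l) / of_int (n * l))) (v (of_int (k * n) / of_int (n * l)))"
    by (simp only: v_frac')
  thus ?thesis by (metis *)
qed

lemma v_diff: "v (q - r) \<le> max (v q) (v r)"
  using v_add[of q "- r"] by simp

lemma v_diff_commute: "v (q - r) = v (r - q)"
  using v_minus[of "q - r"] by simp

lemma v_triangle: "v (a - c) \<le> max (v (a - b)) (v (b - c))"
  using v_add[of "a - b" "b - c"] by simp

lemma v_abs_diff: "\<bar>v a - v b\<bar> \<le> v (a - b)"
proof -
  have "v a \<le> max (v (a - b)) (v b)" using v_add[of "a - b" b] by simp
  moreover have "v b \<le> max (v (a - b)) (v a)" using v_add[of "b - a" a] v_diff_commute[of a b] by simp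
  ultimately show ?thesis using v_nonneg[of a] v_nonneg[of b] v_nonneg[of "a - b"] by linarith
qed

text \<open>In an ultrametric triangle the two longest sides are equal. Hence the absolute value is
  locally constant away from zero, which later carries the discreteness of its values over to the
  completion.\<close>

lemma v_eq_of_close: "v (a - b) < v b \<Longrightarrow> v a = v b"
  using v_add[of "a - b" b] v_add[of "b - a" a] v_diff_commute[of a b] unfolding max_def by (auto split: if_splits)

text \<open>The nonzero values are integral powers of \<open>p\<close>, so nothing lies strictly
  between 1/p and 1. This turns strict inequalities into divisibility by \<open>p\<close>.\<close>

lemma v_less_1: "v q < 1 \<Longrightarrow> v q \<le> 1 / real p"
proof (cases "q = 0")
  case False
  assume a: "v q < 1"
  obtain k where k: "v q = real p powi k" using v_values False by blast
  hence "k < 0" using a powi_less_iff[of k 0] by simp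
  hence "v q \<le> real p powi (-1)" unfolding k powi_le_iff by simp
  thus ?thesis by (simp add: power_int_minus field_simps)
qed simp

lemma digit_unique:
  assumes "d < p" "d' < p" "v (of_nat d - of_nat d') < 1"
  shows "d = d'"
proof -
  have "v (of_int (int d - int d')) \<le> real p powi (- int 1)"
    using v_less_1[OF assms(3)] by (simp add: power_int_minus field_simps)
  hence "int p dvd int d - int d'" unfolding v_int_dvd by simp
  thus ?thesis using assms by (metis mod_eq_dvd_iff mod_less of_nat_eq_iff zmod_int)
qed

text \<open>The residue field of the p-local integers is the prime field: an integral fraction in
  lowest terms has a denominator prime to \<open>p\<close>, which can be inverted modulo
  \<open>p\<close>.\<close>

lemma digit_exists:
  assumes "v q \<le> 1"
  shows "\<exists>d<p. v (q - of_nat d) < 1"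
proof -
  obtain m n where q: "quotient_of q = (m, n)" by fastforce
  have n: "n > 0" and cop: "coprime m n" and qe: "q = of_int m / of_int n"
    using q quotient_of_denom_pos quotient_of_coprime quotient_of_div by blast+
  have pn: "\<not> int p dvd n"
  proof
    assume d: "int p dvd n"
    hence "\<not> int p dvd m" using cop prime by (metis coprime_common_divisor not_prime_unit prime_nat_int_transfer)
    hence "v (of_int m) > 1 / real p"
      using v_int_dvd[of m 1] by (simp add: power_int_minus field_simps)
    hence m1: "v (of_int m) = 1" using v_less_1[of "of_int m"] v_of_int_le[of m] by linarith
    have "v (of_int n) \<le> 1 / real p" using v_int_dvd[of n 1] d by (simp add: power_int_minus field_simps)
    moreover have "v (of_int n) > 0" using n by (intro v_pos) simp
    ultimately have "v q > 1" unfolding qe v_frac' m1 using p_gt1 by (smt (verit) divide_less_eq_1_pos less_divide_eq_1_pos)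
    thus False using assms by simp
  qed
  hence "coprime n (int p)" using prime by (metis coprime_commute prime_imp_coprime prime_nat_int_transfer)
  \<comment> \<open>\<open>w\<close> inverts the denominator modulo \<open>p\<close>, so the digit
    is the residue of \<open>m * w\<close>.\<close>
  then obtain w where w: "[n * w = 1] (mod int p)" using cong_solve_coprime_int by blast
  define d where "d = nat ((m * w) mod int p)"
  have dp: "d < p" using p_gt1 by (simp add: d_def nat_less_iff)
  have "int d = (m * w) mod int p" using p_gt1 by (simp add: d_def)
  hence "[int d = m * w] (mod int p)" by (simp add: cong_def)
  hence "[n * int d = m * (n * w)] (mod int p)"
    by (metis cong_scalar_left mult.left_commute)
  hence "[n * int d = m] (mod int p)" using w by (metis cong_scalar_left cong_trans mult.right_neutral)
  hence dv: "int p dvd m - n * int d" by (metis cong_iff_dvd_diff cong_sym)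
  have vn: "v (of_int n) = 1"
  proof -
    have "v (of_int n) > 1 / real p" using v_int_dvd[of n 1] pn by (simp add: power_int_minus field_simps)
    thus ?thesis using v_less_1[of "of_int n"] v_of_int_le[of n] by linarith
  qed
  have "q - of_nat d = of_int (m - n * int d) / of_int n" using n by (simp add: qe field_simps)
  hence "v (q - of_nat d) = v (of_int (m - n * int d))" by (simp only: v_frac' vn)
  also have "\<dots> \<le> 1 / real p" using v_int_dvd[of "m - n * int d" 1] dv by (simp add: power_int_minus field_simps)
  also have "\<dots> < 1" using p_gt1 by simp
  finally show ?thesis using dp by blast
qed

lemma radinv_rec: "of_nat p * radinv p K = of_nat (K mod p) + radinv p (K div p)"
  using p_gt1 by (cases "K = 0") (simp_all add: radinv.simps[of p K] radinv.simps[of p 0])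

text \<open>Multiplication by \<open>p\<close> shifts the lowest digit in front of the point. The
  difference of these digits is integral, so the rest \<open>?r\<close> is integral as well and the
  induction hypothesis makes it vanish; a difference of digits of absolute value below 1 is then
  zero.\<close>

lemma radinv_inj: "v (radinv p K - radinv p K') \<le> 1 \<Longrightarrow> K = K'"
proof (induction "K + K'" arbitrary: K K' rule: less_induct)
  case less
  show ?case
  proof (cases "K = 0 \<and> K' = 0")
    case False
    let ?r = "radinv p (K div p) - radinv p (K' div p)"
    let ?d = "of_nat (K mod p) - of_nat (K' mod p) :: rat"
    have "of_nat p * (radinv p K - radinv p K') = ?d + ?r"
      using radinv_rec[of K] radinv_rec[of K'] by (simp add: algebra_simps)
    hence eq: "v (?d + ?r) = 1 / real p * v (radinv p K - radinv p K')" by (metis v_mult v_p)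
    have "v (?d + ?r) \<le> 1 / real p" unfolding eq using less.prems p_pos by (simp add: divide_right_mono)
    also have "\<dots> < 1" using p_gt1 by simp
    finally have lt: "v (?d + ?r) < 1" .
    have d1: "v ?d \<le> 1" using v_of_int_le[of "int (K mod p) - int (K' mod p)"] by simp
    have "v ?r \<le> 1" using v_diff[of "?d + ?r" ?d] lt d1 by simp
    moreover have "K div p \<le> K" "K' div p \<le> K'" by simp_all
    moreover have "0 < K \<Longrightarrow> K div p < K" "0 < K' \<Longrightarrow> K' div p < K'" using p_gt1 by simp_all
    moreover have "0 < K \<or> 0 < K'" using False by simp
    ultimately have le: "v ?r \<le> 1" and "K div p + K' div p < K + K'" by (simp, linarith)
    hence dd: "K div p = K' div p" using less.hyps by blast
    hence "v ?d < 1" using lt by simp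
    hence "K mod p = K' mod p" using digit_unique p_gt1 by (simp add: less_trans)
    thus ?thesis using dd by (metis div_mult_mod_eq)
  qed simp
qed

text \<open>Multiplying by \<open>p\<close> lowers the exponent \<open>j\<close> by one; the
  integral remainder left by the induction hypothesis supplies one more digit. The final distance is
  below \<open>p\<close>, hence at most 1 because the values are powers of \<open>p\<close>.\<close>

lemma radinv_surj: "v q \<le> real p ^ j \<Longrightarrow> \<exists>K. v (q - radinv p K) \<le> 1"
proof (induction j arbitrary: q)
  case 0
  thus ?case by (intro exI[of _ 0]) (simp add: radinv.simps)
next
  case (Suc j)
  have "v (of_nat p * q) \<le> real p ^ j" using Suc.prems p_pos by (simp add: v_mult v_p field_simps)
  then obtain K where K: "v (of_nat p * q - radinv p K) \<le> 1" using Suc.IH by blast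
  then obtain d where d: "d < p" "v (of_nat p * q - radinv p K - of_nat d) < 1" using digit_exists by blast
  define K' where "K' = p * K + d"
  have "of_nat p * radinv p K' = of_nat d + radinv p K"
    using radinv_rec[of K'] d(1) by (simp add: K'_def)
  hence "of_nat p * (q - radinv p K') = of_nat p * q - radinv p K - of_nat d" by (simp add: algebra_simps)
  hence "v (q - radinv p K') / real p < 1" using d(2) by (metis (no_types) v_mult v_p mult_1 times_divide_eq_left)
  hence lt: "v (q - radinv p K') < real p" using p_pos by simp
  have "v (q - radinv p K') \<le> 1"
  proof (cases "q - radinv p K' = 0")
    case False
    then obtain k where k: "v (q - radinv p K') = real p powi k" using v_values by blast
    hence "k < 1" using lt powi_less_iff[of k 1] by simp
    thus ?thesis unfolding k using powi_le_iff[of k 0] by simp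
  qed simp
  thus ?case by blast
qed


section \<open>The completion as a ring with an absolute value\<close>

lemma CauchyD: "s \<in> padic_cauchy p \<Longrightarrow> e > 0 \<Longrightarrow> \<exists>N. \<forall>m\<ge>N. \<forall>n\<ge>N. v (s m - s n) < e"
  by (simp add: padic_cauchy_def)

lemma Cauchy_const [simp]: "(\<lambda>_. q) \<in> padic_cauchy p"
  by (simp add: padic_cauchy_def)

lemma Cauchy_minus: "s \<in> padic_cauchy p \<Longrightarrow> (\<lambda>n. - s n) \<in> padic_cauchy p"
  unfolding padic_cauchy_def by (simp add: v_diff_commute)

lemma Cauchy_add:
  assumes "s \<in> padic_cauchy p" "t \<in> padic_cauchy p"
  shows "(\<lambda>n. s n + t n) \<in> padic_cauchy p"
  unfolding padic_cauchy_def
proof (intro CollectI allI impI)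
  fix e :: real assume e: "e > 0"
  obtain M where M: "\<forall>m\<ge>M. \<forall>n\<ge>M. v (s m - s n) < e" using CauchyD[OF assms(1) e] by blast
  obtain N where N: "\<forall>m\<ge>N. \<forall>n\<ge>N. v (t m - t n) < e" using CauchyD[OF assms(2) e] by blast
  show "\<exists>N. \<forall>m\<ge>N. \<forall>n\<ge>N. v (s m + t m - (s n + t n)) < e"
  proof (intro exI[of _ "max M N"] allI impI)
    fix m n assume mn: "m \<ge> max M N" "n \<ge> max M N"
    have "v (s m + t m - (s n + t n)) \<le> max (v (s m - s n)) (v (t m - t n))"
      using v_add[of "s m - s n" "t m - t n"] by (simp add: algebra_simps)
    also have "\<dots> < e" using M N mn by simp
    finally show "v (s m + t m - (s n + t n)) < e" .
  qed
qed

lemma Cauchy_diff: "s \<in> padic_cauchy p \<Longrightarrow> t \<in> padic_cauchy p \<Longrightarrow> (\<lambda>n. s n - t n) \<in> padic_cauchy p"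
  using Cauchy_add[OF _ Cauchy_minus, of s t] by simp

lemma Cauchy_bounded:
  assumes "s \<in> padic_cauchy p"
  obtains B where "B > 0" "\<And>n. v (s n) \<le> B"
proof -
  obtain N where N: "\<forall>m\<ge>N. \<forall>n\<ge>N. v (s m - s n) < 1" using CauchyD[OF assms, of 1] by auto
  define B where "B = 1 + (\<Sum>i\<le>N. v (s i))"
  have le: "v (s i) \<le> (\<Sum>i\<le>N. v (s i))" if "i \<le> N" for i
    using that by (intro member_le_sum) auto
  have "v (s n) \<le> B" for n
  proof (cases "n \<le> N")
    case True thus ?thesis using le[of n] by (simp add: B_def)
  next
    case False
    hence "v (s n - s N) < 1" using N by simp
    hence "v (s n) \<le> 1 + v (s N)" using v_abs_diff[of "s n" "s N"] by linarith
    thus ?thesis using le[of N] by (simp add: B_def)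
  qed
  moreover have "B > 0" unfolding B_def by (intro add_pos_nonneg sum_nonneg) auto
  ultimately show ?thesis using that by blast
qed

lemma Cauchy_mult:
  assumes "s \<in> padic_cauchy p" "t \<in> padic_cauchy p"
  shows "(\<lambda>n. s n * t n) \<in> padic_cauchy p"
  unfolding padic_cauchy_def
proof (intro CollectI allI impI)
  fix e :: real assume e: "e > 0"
  obtain A where A: "A > 0" "\<And>n. v (s n) \<le> A" using Cauchy_bounded[OF assms(1)] by blast
  obtain B where B: "B > 0" "\<And>n. v (t n) \<le> B" using Cauchy_bounded[OF assms(2)] by blast
  obtain M where M: "\<forall>m\<ge>M. \<forall>n\<ge>M. v (s m - s n) < e / B" using CauchyD[OF assms(1), of "e / B"] e B by auto
  obtain N where N: "\<forall>m\<ge>N. \<forall>n\<ge>N. v (t m - t n) < e / A" using CauchyD[OF assms(2), of "e / A"] e A by auto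
  show "\<exists>N. \<forall>m\<ge>N. \<forall>n\<ge>N. v (s m * t m - s n * t n) < e"
  proof (intro exI[of _ "max M N"] allI impI)
    fix m n assume mn: "m \<ge> max M N" "n \<ge> max M N"
    have "v ((s m - s n) * t m) \<le> v (s m - s n) * B" unfolding v_mult using B by (intro mult_left_mono) auto
    also have "\<dots> < e" using M mn B by (simp add: pos_less_divide_eq)
    finally have 1: "v ((s m - s n) * t m) < e" .
    have "v (s n * (t m - t n)) \<le> A * v (t m - t n)" unfolding v_mult using A by (intro mult_right_mono) auto
    also have "\<dots> < e" using N mn A by (simp add: pos_less_divide_eq mult.commute)
    finally have 2: "v (s n * (t m - t n)) < e" .
    have "s m * t m - s n * t n = (s m - s n) * t m + s n * (t m - t n)" by (simp add: algebra_simps)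
    thus "v (s m * t m - s n * t n) < e" using v_add[of "(s m - s n) * t m" "s n * (t m - t n)"] 1 2 by simp
  qed
qed

definition cls :: "(nat \<Rightarrow> rat) \<Rightarrow> padic" where "cls s = padic_rel p `` {s}"

lemma null_of_le:
  assumes "(\<lambda>n. v (f n)) \<longlonglongrightarrow> 0" "(\<lambda>n. v (g n)) \<longlonglongrightarrow> 0" "\<And>n. v (h n) \<le> max (v (f n)) (v (g n))"
  shows "(\<lambda>n. v (h n)) \<longlonglongrightarrow> 0"
proof (rule tendsto_sandwich[OF _ _ tendsto_const])
  show "(\<lambda>n. max (v (f n)) (v (g n))) \<longlonglongrightarrow> 0" using tendsto_max[OF assms(1,2)] by simp
qed (use assms(3) in auto)

lemma equiv_padic_rel: "equiv (padic_cauchy p) (padic_rel p)"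
proof (rule equivI)
  show "padic_rel p \<subseteq> padic_cauchy p \<times> padic_cauchy p" by (auto simp: padic_rel_def)
  show "refl_on (padic_cauchy p) (padic_rel p)" by (auto simp: refl_on_def padic_rel_def)
  show "sym (padic_rel p)" by (auto simp: sym_def padic_rel_def v_diff_commute)
  show "trans (padic_rel p)"
    unfolding trans_def padic_rel_def using null_of_le[OF _ _ v_triangle] by blast
qed

lemma cls_eq_iff:
  "s \<in> padic_cauchy p \<Longrightarrow> t \<in> padic_cauchy p \<Longrightarrow> cls s = cls t \<longleftrightarrow> (\<lambda>n. v (s n - t n)) \<longlonglongrightarrow> 0"
  unfolding cls_def using eq_equiv_class_iff[OF equiv_padic_rel] by (auto simp: padic_rel_def)

lemma cls_carrier [simp]: "s \<in> padic_cauchy p \<Longrightarrow> cls s \<in> carrier (Qp p)"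
  by (simp add: Qp_def cls_def quotientI)

lemma carrier_cls:
  assumes "x \<in> carrier (Qp p)" obtains s where "s \<in> padic_cauchy p" "x = cls s"
  using assms by (auto simp: Qp_def cls_def elim: quotientE)

lemma of_rat_cls: "padic_of_rat p q = cls (\<lambda>_. q)"
  by (simp add: padic_of_rat_def cls_def)

lemma of_rat_carrier [simp]: "padic_of_rat p q \<in> carrier (Qp p)"
  by (simp add: of_rat_cls)

lemma zero_cls: "\<zero>\<^bsub>Qp p\<^esub> = cls (\<lambda>_. 0)" and one_cls: "\<one>\<^bsub>Qp p\<^esub> = cls (\<lambda>_. 1)"
  by (simp_all add: Qp_def of_rat_cls)

lemma add_cls:
  assumes "s \<in> padic_cauchy p" "t \<in> padic_cauchy p"
  shows "cls s \<oplus>\<^bsub>Qp p\<^esub> cls t = cls (\<lambda>n. s n + t n)"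
proof -
  have "congruent2 (padic_rel p) (padic_rel p) (\<lambda>s t. padic_rel p `` {\<lambda>n. s n + t n})"
  proof (rule congruent2I', goal_cases)
    case (1 s s' t t')
    hence a: "s \<in> padic_cauchy p" "s' \<in> padic_cauchy p" "(\<lambda>n. v (s n - s' n)) \<longlonglongrightarrow> 0"
        "t \<in> padic_cauchy p" "t' \<in> padic_cauchy p" "(\<lambda>n. v (t n - t' n)) \<longlonglongrightarrow> 0" by (auto simp: padic_rel_def)
    have "v (s n + t n - (s' n + t' n)) \<le> max (v (s n - s' n)) (v (t n - t' n))" for n
      using v_add[of "s n - s' n" "t n - t' n"] by (simp add: algebra_simps)
    from null_of_le[OF a(3,6) this] show ?case
      using cls_eq_iff[OF Cauchy_add[OF a(1,4)] Cauchy_add[OF a(2,5)]] by (simp add: cls_def)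
  qed
  from UN_equiv_class2[OF equiv_padic_rel equiv_padic_rel this assms]
  show ?thesis by (simp add: Qp_def cls_def)
qed

lemma mult_cls:
  assumes "s \<in> padic_cauchy p" "t \<in> padic_cauchy p"
  shows "cls s \<otimes>\<^bsub>Qp p\<^esub> cls t = cls (\<lambda>n. s n * t n)"
proof -
  have "congruent2 (padic_rel p) (padic_rel p) (\<lambda>s t. padic_rel p `` {\<lambda>n. s n * t n})"
  proof (rule congruent2I', goal_cases)
    case (1 s s' t t')
    hence a: "s \<in> padic_cauchy p" "s' \<in> padic_cauchy p" "(\<lambda>n. v (s n - s' n)) \<longlonglongrightarrow> 0"
        "t \<in> padic_cauchy p" "t' \<in> padic_cauchy p" "(\<lambda>n. v (t n - t' n)) \<longlonglongrightarrow> 0" by (auto simp: padic_rel_def)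
    obtain A where A: "A > 0" "\<And>n. v (s' n) \<le> A" using Cauchy_bounded[OF a(2)] by blast
    obtain B where B: "B > 0" "\<And>n. v (t n) \<le> B" using Cauchy_bounded[OF a(4)] by blast
    have "(\<lambda>n. v (s n - s' n) * B) \<longlonglongrightarrow> 0" using tendsto_mult_left_zero[OF a(3)] .
    hence 1: "(\<lambda>n. v ((s n - s' n) * t n)) \<longlonglongrightarrow> 0"
      by (rule tendsto_sandwich[OF _ _ tendsto_const, rotated 2])
        (auto simp: v_mult intro!: mult_left_mono B always_eventually)
    have "(\<lambda>n. A * v (t n - t' n)) \<longlonglongrightarrow> 0" using tendsto_mult_right_zero[OF a(6)] .
    hence 2: "(\<lambda>n. v (s' n * (t n - t' n))) \<longlonglongrightarrow> 0"
      by (rule tendsto_sandwich[OF _ _ tendsto_const, rotated 2])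
        (auto simp: v_mult intro!: mult_right_mono A always_eventually)
    have "v (s n * t n - s' n * t' n) \<le> max (v ((s n - s' n) * t n)) (v (s' n * (t n - t' n)))" for n
      using v_add[of "(s n - s' n) * t n" "s' n * (t n - t' n)"] by (simp add: algebra_simps)
    from null_of_le[OF 1 2 this] show ?case
      using cls_eq_iff[OF Cauchy_mult[OF a(1,4)] Cauchy_mult[OF a(2,5)]] by (simp add: cls_def)
  qed
  from UN_equiv_class2[OF equiv_padic_rel equiv_padic_rel this assms]
  show ?thesis by (simp add: Qp_def cls_def)
qed

lemma Qp_cring: "cring (Qp p)"
proof (rule cringI)
  show "abelian_group (Qp p)"
  proof (rule abelian_groupI)
    fix x assume "x \<in> carrier (Qp p)"
    then obtain s where s: "s \<in> padic_cauchy p" "x = cls s" by (rule carrier_cls)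
    show "\<exists>y\<in>carrier (Qp p). y \<oplus>\<^bsub>Qp p\<^esub> x = \<zero>\<^bsub>Qp p\<^esub>"
      by (rule bexI[of _ "cls (\<lambda>n. - s n)"]) (simp_all add: s add_cls Cauchy_minus zero_cls)
  qed (auto elim!: carrier_cls simp: add_cls Cauchy_add zero_cls algebra_simps)
  show "comm_monoid (Qp p)"
    by (rule comm_monoidI) (auto elim!: carrier_cls simp: mult_cls Cauchy_mult one_cls algebra_simps)
qed (auto elim!: carrier_cls simp: mult_cls add_cls Cauchy_mult Cauchy_add algebra_simps)

sublocale Q: cring "Qp p" by (rule Qp_cring)

lemma minus_cls:
  assumes "s \<in> padic_cauchy p" "t \<in> padic_cauchy p"
  shows "cls s \<ominus>\<^bsub>Qp p\<^esub> cls t = cls (\<lambda>n. s n - t n)"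
proof -
  have "\<ominus>\<^bsub>Qp p\<^esub> cls t = cls (\<lambda>n. - t n)"
    by (rule Q.minus_equality) (use assms in \<open>simp_all add: add_cls Cauchy_minus zero_cls\<close>)
  thus ?thesis using assms by (simp add: a_minus_def add_cls Cauchy_minus)
qed

text \<open>The definition by \<open>THE\<close> asks for one limit common to all representatives.
  It exists because v is 1-Lipschitz: values along a Cauchy sequence converge, and equivalent
  sequences have the same limit.\<close>

lemma abs_lim:
  assumes s: "s \<in> padic_cauchy p"
  shows "(\<lambda>n. v (s n)) \<longlonglongrightarrow> padic_abs p (cls s)"
proof -
  have "Cauchy (\<lambda>n. v (s n))"
  proof (rule CauchyI)
    fix e :: real assume "e > 0"
    then obtain N where "\<forall>m\<ge>N. \<forall>n\<ge>N. v (s m - s n) < e" using CauchyD[OF s] by blast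
    thus "\<exists>M. \<forall>m\<ge>M. \<forall>n\<ge>M. norm (v (s m) - v (s n)) < e"
      by (intro exI[of _ N]) (auto intro: le_less_trans[OF v_abs_diff])
  qed
  then obtain r where r: "(\<lambda>n. v (s n)) \<longlonglongrightarrow> r" by (auto simp: Cauchy_convergent_iff convergent_def)
  have all: "(\<lambda>n. v (t n)) \<longlonglongrightarrow> r" if "t \<in> cls s" for t
  proof -
    have "(\<lambda>n. v (s n - t n)) \<longlonglongrightarrow> 0" using that by (auto simp: cls_def padic_rel_def)
    hence "(\<lambda>n. v (s n) - v (t n)) \<longlonglongrightarrow> 0"
      by (rule tendsto_0_le[of _ _ _ 1]) (auto intro: v_abs_diff always_eventually)
    from tendsto_diff[OF r this] show ?thesis by simp
  qed
  have "s \<in> cls s" using s by (simp add: cls_def padic_rel_def)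
  have "padic_abs p (cls s) = r" unfolding padic_abs_def
  proof (rule the_equality)
    fix r' assume "\<forall>s\<in>cls s. (\<lambda>n. v (s n)) \<longlonglongrightarrow> r'"
    thus "r' = r" using \<open>s \<in> cls s\<close> r LIMSEQ_unique by blast
  qed (use all in blast)
  with r show ?thesis by simp
qed

abbreviation N :: "padic \<Rightarrow> real" where "N \<equiv> padic_abs p"

lemma N_of_rat [simp]: "N (padic_of_rat p q) = v q"
  unfolding of_rat_cls using LIMSEQ_unique[OF abs_lim[of "\<lambda>_. q"] tendsto_const] by simp

lemma N_nonneg [simp]: "x \<in> carrier (Qp p) \<Longrightarrow> N x \<ge> 0"
  by (elim carrier_cls) (auto intro: LIMSEQ_le_const[OF abs_lim])

lemma N_eq_0: "x \<in> carrier (Qp p) \<Longrightarrow> N x = 0 \<longleftrightarrow> x = \<zero>\<^bsub>Qp p\<^esub>"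
proof (elim carrier_cls)
  fix s assume s: "s \<in> padic_cauchy p" "x = cls s"
  have "N x = 0 \<longleftrightarrow> (\<lambda>n. v (s n)) \<longlonglongrightarrow> 0"
    using abs_lim[OF s(1)] LIMSEQ_unique[OF abs_lim[OF s(1)]] unfolding s(2) by (metis (no_types))
  thus ?thesis using s by (simp add: zero_cls cls_eq_iff)
qed

lemma N_mult: "x \<in> carrier (Qp p) \<Longrightarrow> y \<in> carrier (Qp p) \<Longrightarrow> N (x \<otimes>\<^bsub>Qp p\<^esub> y) = N x * N y"
proof (elim carrier_cls)
  fix s t assume s: "s \<in> padic_cauchy p" "x = cls s" "t \<in> padic_cauchy p" "y = cls t"
  show ?thesis using LIMSEQ_unique[OF abs_lim[OF Cauchy_mult[OF s(1,3)]]] tendsto_mult[OF abs_lim[OF s(1)] abs_lim[OF s(3)]] s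
    by (simp add: v_mult mult_cls)
qed

lemma N_minus: "x \<in> carrier (Qp p) \<Longrightarrow> y \<in> carrier (Qp p) \<Longrightarrow> N (x \<ominus>\<^bsub>Qp p\<^esub> y) \<le> max (N x) (N y)"
proof (elim carrier_cls)
  fix s t assume s: "s \<in> padic_cauchy p" "x = cls s" "t \<in> padic_cauchy p" "y = cls t"
  show ?thesis unfolding s minus_cls[OF s(1,3)]
    by (rule LIMSEQ_le[OF abs_lim[OF Cauchy_diff[OF s(1,3)]] tendsto_max[OF abs_lim[OF s(1)] abs_lim[OF s(3)]]])
      (auto intro: v_diff)
qed

lemma N_add: "x \<in> carrier (Qp p) \<Longrightarrow> y \<in> carrier (Qp p) \<Longrightarrow> N (x \<oplus>\<^bsub>Qp p\<^esub> y) \<le> max (N x) (N y)"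
proof (elim carrier_cls)
  fix s t assume s: "s \<in> padic_cauchy p" "x = cls s" "t \<in> padic_cauchy p" "y = cls t"
  show ?thesis unfolding s add_cls[OF s(1,3)]
    by (rule LIMSEQ_le[OF abs_lim[OF Cauchy_add[OF s(1,3)]] tendsto_max[OF abs_lim[OF s(1)] abs_lim[OF s(3)]]])
      (auto intro: v_add)
qed

lemma N_commute: "x \<in> carrier (Qp p) \<Longrightarrow> y \<in> carrier (Qp p) \<Longrightarrow> N (x \<ominus>\<^bsub>Qp p\<^esub> y) = N (y \<ominus>\<^bsub>Qp p\<^esub> x)"
proof (elim carrier_cls)
  fix s t assume s: "s \<in> padic_cauchy p" "x = cls s" "t \<in> padic_cauchy p" "y = cls t"
  show ?thesis using LIMSEQ_unique[OF abs_lim[OF Cauchy_diff[OF s(1,3)]]] abs_lim[OF Cauchy_diff[OF s(3,1)]] s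
    by (simp add: minus_cls v_diff_commute)
qed

lemma N_triangle:
  assumes "x \<in> carrier (Qp p)" "y \<in> carrier (Qp p)" "z \<in> carrier (Qp p)"
  shows "N (x \<ominus>\<^bsub>Qp p\<^esub> z) \<le> max (N (x \<ominus>\<^bsub>Qp p\<^esub> y)) (N (y \<ominus>\<^bsub>Qp p\<^esub> z))"
proof -
  have "x \<ominus>\<^bsub>Qp p\<^esub> z = (x \<ominus>\<^bsub>Qp p\<^esub> y) \<oplus>\<^bsub>Qp p\<^esub> (y \<ominus>\<^bsub>Qp p\<^esub> z)"
    using assms by (auto elim!: carrier_cls simp: minus_cls add_cls Cauchy_diff)
  thus ?thesis using N_add assms by simp
qed

text \<open>The completion has no new absolute values: along a Cauchy sequence with nonzero limit
  the values become stationary, since far out two members differ by less than their size.\<close>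

lemma N_values:
  assumes x: "x \<in> carrier (Qp p)" "x \<noteq> \<zero>\<^bsub>Qp p\<^esub>"
  shows "\<exists>k. N x = real p powi k"
proof -
  obtain s where s: "s \<in> padic_cauchy p" "x = cls s" using x(1) by (rule carrier_cls)
  define L where "L = N x"
  have L: "L > 0" using x N_eq_0 N_nonneg by (simp add: L_def order.strict_iff_order)
  have lim: "(\<lambda>n. v (s n)) \<longlonglongrightarrow> L" using abs_lim[OF s(1)] s by (simp add: L_def)
  have "\<forall>\<^sub>F n in sequentially. L / 2 < v (s n)" using L by (intro order_tendstoD(1)[OF lim]) simp
  then obtain M where M: "\<And>n. n \<ge> M \<Longrightarrow> L / 2 < v (s n)" unfolding eventually_sequentially by blast
  obtain K where K: "\<forall>m\<ge>K. \<forall>n\<ge>K. v (s m - s n) < L / 2" using CauchyD[OF s(1), of "L / 2"] L by auto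
  define n where "n = max M K"
  have "v (s m) = v (s n)" if "m \<ge> n" for m
  proof (rule v_eq_of_close)
    have "v (s m - s n) < L / 2" using K that by (simp add: n_def)
    also have "\<dots> < v (s n)" using M[of n] by (simp add: n_def)
    finally show "v (s m - s n) < v (s n)" .
  qed
  hence "(\<lambda>m. v (s m)) \<longlonglongrightarrow> v (s n)" by (intro tendsto_eventually eventually_sequentiallyI[of n])
  hence Ln: "L = v (s n)" using LIMSEQ_unique[OF lim] by blast
  have "s n \<noteq> 0"
  proof
    assume "s n = 0"
    thus False using L Ln by simp
  qed
  then obtain k where "v (s n) = real p powi k" using v_values by blast
  thus ?thesis using Ln unfolding L_def by metis
qed

lemma N_approx:
  assumes x: "x \<in> carrier (Qp p)"
  shows "\<exists>q. N (x \<ominus>\<^bsub>Qp p\<^esub> padic_of_rat p q) \<le> real p powi k"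
proof -
  obtain s where s: "s \<in> padic_cauchy p" "x = cls s" using x by (rule carrier_cls)
  obtain M where M: "\<forall>m\<ge>M. \<forall>n\<ge>M. v (s m - s n) < real p powi k" using CauchyD[OF s(1) powi_pos] by blast
  have c: "(\<lambda>n. s n - s M) \<in> padic_cauchy p" using Cauchy_diff[OF s(1) Cauchy_const] .
  have "N (cls (\<lambda>n. s n - s M)) \<le> real p powi k"
    by (rule LIMSEQ_le_const2[OF abs_lim[OF c]]) (use M in \<open>auto intro: less_imp_le\<close>)
  thus ?thesis using s by (intro exI[of _ "s M"]) (simp add: of_rat_cls minus_cls)
qed

end

section \<open>Existence of the Haar measure\<close>

context padic begin

lemma N_diff_of_rat: "N (padic_of_rat p a \<ominus>\<^bsub>Qp p\<^esub> padic_of_rat p b) = v (a - b)"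
proof -
  have "padic_of_rat p a \<ominus>\<^bsub>Qp p\<^esub> padic_of_rat p b = padic_of_rat p (a - b)"
    by (simp add: of_rat_cls minus_cls)
  thus ?thesis by simp
qed

text \<open>Being at distance at most \<open>e\<close> is an equivalence relation in an ultrametric
  space, so both points may be moved by \<open>e\<close>.\<close>

lemma N_close_iff:
  assumes c: "x \<in> carrier (Qp p)" "x' \<in> carrier (Qp p)" "y \<in> carrier (Qp p)" "y' \<in> carrier (Qp p)"
    and le: "N (x \<ominus>\<^bsub>Qp p\<^esub> x') \<le> e" "N (y \<ominus>\<^bsub>Qp p\<^esub> y') \<le> e"
  shows "N (x \<ominus>\<^bsub>Qp p\<^esub> y) \<le> e \<longleftrightarrow> N (x' \<ominus>\<^bsub>Qp p\<^esub> y') \<le> e"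
proof -
  have *: "N (x \<ominus>\<^bsub>Qp p\<^esub> y) \<le> e"
    if "x \<in> carrier (Qp p)" "x' \<in> carrier (Qp p)" "y \<in> carrier (Qp p)" "y' \<in> carrier (Qp p)"
      "N (x \<ominus>\<^bsub>Qp p\<^esub> x') \<le> e" "N (y' \<ominus>\<^bsub>Qp p\<^esub> y) \<le> e" "N (x' \<ominus>\<^bsub>Qp p\<^esub> y') \<le> e" for x x' y y'
    using N_triangle[of x x' y] N_triangle[of x' y' y] that by auto
  have le': "N (x' \<ominus>\<^bsub>Qp p\<^esub> x) \<le> e" "N (y' \<ominus>\<^bsub>Qp p\<^esub> y) \<le> e"
    using le N_commute[OF c(1,2)] N_commute[OF c(3,4)] by simp_all
  show ?thesis using *[OF c le(1) le'(2)] *[OF c(2,1,4,3) le'(1) le(2)] by blast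
qed

text \<open>The digit of \<open>r\<close> at p^j is sent to p^(-1-j). Keeping the digits with j
  \<ge> -n gives a rational number, the image of \<open>r\<close> modulo p^n.\<close>

definition trunc :: "real \<Rightarrow> int \<Rightarrow> rat" where
  "trunc r n = of_nat p powi n * radinv p (nat \<lfloor>r * real p powi n\<rfloor>)"

lemma trunc_step:
  assumes r: "r \<ge> 0"
  shows "v (trunc r (n + 1) - trunc r n) \<le> real p powi (- n)"
proof -
  define K where "K = nat \<lfloor>r * real p powi (n + 1)\<rfloor>"
  have "r * real p powi n = r * real p powi (n + 1) / real_of_int (int p)"
    using p_pos by (simp add: power_int_add)
  \<comment> \<open>The coarser truncation drops the last base p digit of the finer one; after
    mirroring this is the digit at p^n.\<close>
  hence "\<lfloor>r * real p powi n\<rfloor> = \<lfloor>r * real p powi (n + 1)\<rfloor> div int p"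
    by (metis floor_divide_real_eq_div of_nat_0_le_iff)
  hence Kd: "nat \<lfloor>r * real p powi n\<rfloor> = K div p"
    using r powi_pos[of "n + 1"] by (simp add: K_def nat_div_distrib)
  have p0: "(of_nat p :: rat) \<noteq> 0" using p_gt1 by simp
  have "trunc r (n + 1) = of_nat p powi n * (of_nat p * radinv p K)"
    using p0 by (simp add: trunc_def K_def power_int_add)
  also have "\<dots> = of_nat p powi n * of_nat (K mod p) + trunc r n"
    unfolding radinv_rec trunc_def Kd by (simp add: algebra_simps)
  finally have "trunc r (n + 1) - trunc r n = of_nat p powi n * of_int (int (K mod p))" by simp
  hence "v (trunc r (n + 1) - trunc r n) = real p powi (- n) * v (of_int (int (K mod p)))"
    by (simp only: v_mult v_powi)
  also have "\<dots> \<le> real p powi (- n) * 1" using powi_pos[of "- n"] by (intro mult_left_mono v_of_int_le) simp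
  finally show ?thesis by simp
qed

lemma trunc_diff_add:
  assumes r: "r \<ge> 0"
  shows "v (trunc r (n + int k) - trunc r n) \<le> real p powi (- n)"
proof (induction k)
  case 0 show ?case using powi_pos[of "- n"] by simp
next
  case (Suc k)
  have "v (trunc r (n + int k + 1) - trunc r (n + int k)) \<le> real p powi (- (n + int k))"
    by (rule trunc_step[OF r])
  also have "\<dots> \<le> real p powi (- n)" by (simp add: powi_le_iff)
  finally have "v (trunc r (n + int k + 1) - trunc r (n + int k)) \<le> real p powi (- n)" .
  with Suc v_triangle[of "trunc r (n + int k + 1)" "trunc r n" "trunc r (n + int k)"]
  show ?case by (simp add: algebra_simps)
qed

lemma trunc_diff: "r \<ge> 0 \<Longrightarrow> m \<ge> n \<Longrightarrow> v (trunc r m - trunc r n) \<le> real p powi (- n)"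
  using trunc_diff_add[of r n "nat (m - n)"] by simp

lemma powi_small: "e > 0 \<Longrightarrow> \<exists>n::nat. real p powi (- int n) < e"
  using real_arch_pow_inv[of e "1 / real p"] p_gt1
  by (simp add: power_int_minus power_one_over inverse_eq_divide)

lemma powi_big: "\<exists>n::nat. c < real p powi (int n)"
  using real_arch_pow[of "real p" c] p_gt1 by simp

lemma Cauchy_trunc:
  assumes r: "r \<ge> 0"
  shows "(\<lambda>n. trunc r (int n)) \<in> padic_cauchy p"
  unfolding padic_cauchy_def
proof (intro CollectI allI impI)
  fix e :: real assume "e > 0"
  then obtain M where M: "real p powi (- int M) < e" using powi_small by blast
  show "\<exists>N. \<forall>m\<ge>N. \<forall>n\<ge>N. v (trunc r (int m) - trunc r (int n)) < e"
  proof (intro exI[of _ M] allI impI)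
    fix m n assume mn: "m \<ge> M" "n \<ge> M"
    have "v (trunc r (int m) - trunc r (int n)) \<le>
        max (v (trunc r (int m) - trunc r (int M))) (v (trunc r (int M) - trunc r (int n)))" by (rule v_triangle)
    also have "\<dots> \<le> real p powi (- int M)"
      using trunc_diff[OF r, of "int M" "int m"] trunc_diff[OF r, of "int M" "int n"] mn
      by (simp add: v_diff_commute[of "trunc r (int M)"])
    finally show "v (trunc r (int m) - trunc r (int n)) < e" using M by simp
  qed
qed

text \<open>The Monna map reverses the base \<open>p\<close> expansion of a nonnegative real number around the
  point. It carries Lebesgue measure to a measure with the values prescribed for the Haar measure on
  balls, which is what makes the extension in \<open>padic_haar\<close> exist.\<close>

definition monna :: "real \<Rightarrow> padic" where
  "monna r = cls (\<lambda>n. trunc r (int n))"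

lemma monna_carrier [simp]: "r \<ge> 0 \<Longrightarrow> monna r \<in> carrier (Qp p)"
  by (simp add: monna_def Cauchy_trunc)

lemma monna_trunc:
  assumes r: "r \<ge> 0"
  shows "N (monna r \<ominus>\<^bsub>Qp p\<^esub> padic_of_rat p (trunc r k)) \<le> real p powi (- k)"
proof -
  have c: "(\<lambda>n. trunc r (int n) - trunc r k) \<in> padic_cauchy p"
    by (rule Cauchy_diff[OF Cauchy_trunc[OF r] Cauchy_const])
  have "N (cls (\<lambda>n. trunc r (int n) - trunc r k)) \<le> real p powi (- k)"
    by (rule LIMSEQ_le_const2[OF abs_lim[OF c]])
      (intro exI[of _ "nat k"] allI impI trunc_diff[OF r], simp)
  thus ?thesis by (simp add: monna_def of_rat_cls minus_cls Cauchy_trunc[OF r])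
qed

text \<open>After scaling by p^(-n) this is the statement that radical inverses represent all
  classes modulo Z_p; a rational approximation of \<open>a\<close> brings it into reach of
  \<open>radinv_surj\<close>.\<close>

lemma cball_center:
  assumes a: "a \<in> carrier (Qp p)"
  shows "\<exists>K. N (a \<ominus>\<^bsub>Qp p\<^esub> padic_of_rat p (of_nat p powi n * radinv p K)) \<le> real p powi (- n)"
proof -
  obtain q where q: "N (a \<ominus>\<^bsub>Qp p\<^esub> padic_of_rat p q) \<le> real p powi (- n)" using N_approx[OF a] by blast
  obtain j where j: "v (q * of_nat p powi (- n)) < real p ^ j" using real_arch_pow p_gt1(1) by blast
  then obtain K where K: "v (q * of_nat p powi (- n) - radinv p K) \<le> 1" using radinv_surj less_imp_le by blast
  have "(of_nat p :: rat) \<noteq> 0" using p_gt1 by simp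
  hence "q - of_nat p powi n * radinv p K = of_nat p powi n * (q * of_nat p powi (- n) - radinv p K)"
    by (simp add: algebra_simps power_int_minus)
  hence "v (q - of_nat p powi n * radinv p K) = real p powi (- n) * v (q * of_nat p powi (- n) - radinv p K)"
    by (simp only: v_mult v_powi)
  also have "\<dots> \<le> real p powi (- n) * 1" using K powi_pos[of "- n"] by (intro mult_left_mono) auto
  finally have "N (padic_of_rat p q \<ominus>\<^bsub>Qp p\<^esub> padic_of_rat p (of_nat p powi n * radinv p K)) \<le> real p powi (- n)"
    by (simp add: N_diff_of_rat)
  with q N_triangle[OF a of_rat_carrier of_rat_carrier, of "of_nat p powi n * radinv p K" q]
  show ?thesis by (intro exI[of _ K]) linarith
qed

text \<open>Up to p^(-n) the point \<open>monna r\<close> is p^n times the radical inverse of the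
  integer part of r p^n, and different integers give different classes modulo Z_p. So a ball pulls
  back to a single base p interval of length p^(-n), which is exactly its prescribed volume.\<close>

lemma monna_cball:
  assumes a: "a \<in> carrier (Qp p)"
  shows "\<exists>K. \<forall>r\<ge>0. monna r \<in> padic_cball p a n \<longleftrightarrow> nat \<lfloor>r * real p powi n\<rfloor> = K"
proof -
  obtain K where K: "N (a \<ominus>\<^bsub>Qp p\<^esub> padic_of_rat p (of_nat p powi n * radinv p K)) \<le> real p powi (- n)"
    using cball_center[OF a] by blast
  have "monna r \<in> padic_cball p a n \<longleftrightarrow> nat \<lfloor>r * real p powi n\<rfloor> = K" if r: "r \<ge> 0" for r
  proof -
    let ?K = "nat \<lfloor>r * real p powi n\<rfloor>"
    have "monna r \<in> padic_cball p a n \<longleftrightarrow> N (monna r \<ominus>\<^bsub>Qp p\<^esub> a) \<le> real p powi (- n)"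
      using r by (simp add: padic_cball_def)
    also have "\<dots> \<longleftrightarrow> v (trunc r n - of_nat p powi n * radinv p K) \<le> real p powi (- n)"
      unfolding N_diff_of_rat[symmetric] by (rule N_close_iff) (use r a K monna_trunc in auto)
    also have "trunc r n - of_nat p powi n * radinv p K = of_nat p powi n * (radinv p ?K - radinv p K)"
      by (simp add: trunc_def algebra_simps)
    also have "v \<dots> = real p powi (- n) * v (radinv p ?K - radinv p K)" by (simp only: v_mult v_powi)
    also have "\<dots> \<le> real p powi (- n) \<longleftrightarrow> v (radinv p ?K - radinv p K) \<le> 1"
      using powi_pos[of "- n"] by simp
    also have "\<dots> \<longleftrightarrow> ?K = K" using radinv_inj by auto
    finally show ?thesis .
  qed
  thus ?thesis by blast
qed

abbreviation \<mu> :: "padic measure" where "\<mu> \<equiv> padic_haar p"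

definition cballs :: "padic set set" where
  "cballs = (\<lambda>(a, n). padic_cball p a n) ` (carrier (Qp p) \<times> UNIV)"

lemma cballs_Pow: "cballs \<subseteq> Pow (carrier (Qp p))"
  by (auto simp: cballs_def padic_cball_def)

lemma space_haar [simp]: "space \<mu> = carrier (Qp p)"
  using cballs_Pow unfolding padic_haar_def cballs_def by (subst space_extend_measure) auto

lemma sets_haar: "sets \<mu> = sigma_sets (carrier (Qp p)) cballs"
  using cballs_Pow unfolding padic_haar_def cballs_def by (subst sets_extend_measure) auto

lemma cball_sets [measurable]: "a \<in> carrier (Qp p) \<Longrightarrow> padic_cball p a n \<in> sets \<mu>"
  unfolding sets_haar cballs_def by (intro sigma_sets.Basic) auto

lemma monna_preimage:
  assumes a: "a \<in> carrier (Qp p)"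
  shows "\<exists>c\<ge>0. monna -` padic_cball p a n \<inter> {0..} = {c..<c + real p powi (- n)}"
proof -
  obtain K where K: "\<And>r. r \<ge> 0 \<Longrightarrow> monna r \<in> padic_cball p a n \<longleftrightarrow> nat \<lfloor>r * real p powi n\<rfloor> = K"
    using monna_cball[OF a] by blast
  have pp: "real p powi n > 0" "real p powi (- n) = 1 / real p powi n"
    using powi_pos by (auto simp: power_int_minus field_simps)
  have "nat \<lfloor>r * real p powi n\<rfloor> = K \<longleftrightarrow> real K * real p powi (- n) \<le> r \<and> r < real K * real p powi (- n) + real p powi (- n)"
    if "r \<ge> 0" for r
  proof -
    have "r * real p powi n \<ge> 0" using that pp by simp
    hence "nat \<lfloor>r * real p powi n\<rfloor> = K \<longleftrightarrow> \<lfloor>r * real p powi n\<rfloor> = int K" by linarith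
    also have "\<dots> \<longleftrightarrow> real K \<le> r * real p powi n \<and> r * real p powi n < real K + 1" by (simp add: floor_eq_iff)
    also have "\<dots> \<longleftrightarrow> real K * real p powi (- n) \<le> r \<and> r < real K * real p powi (- n) + real p powi (- n)"
    proof -
      have "real K * real p powi (- n) = real K / real p powi n"
        "real K * real p powi (- n) + real p powi (- n) = (real K + 1) / real p powi n"
        unfolding pp by (simp_all add: add_divide_distrib)
      thus ?thesis by (simp only: pos_divide_le_eq[OF pp(1)] pos_less_divide_eq[OF pp(1)])
    qed
    finally show ?thesis .
  qed
  hence eq: "monna r \<in> padic_cball p a n \<longleftrightarrow> r \<in> {real K * real p powi (- n)..<real K * real p powi (- n) + real p powi (- n)}"
    if "r \<ge> 0" for r using K[OF that] that by simp
  have c: "real K * real p powi (- n) \<ge> 0" using powi_pos[of "- n"] by simp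
  have "monna -` padic_cball p a n \<inter> {0..} = {real K * real p powi (- n)..<real K * real p powi (- n) + real p powi (- n)}"
    (is "?L = ?R")
  proof (intro equalityI subsetI)
    fix r assume "r \<in> ?L" thus "r \<in> ?R" using eq[of r] by blast
  next
    fix r assume r: "r \<in> ?R"
    hence "r \<ge> 0" using c by (simp only: atLeastLessThan_iff) linarith
    thus "r \<in> ?L" using eq[of r] r by blast
  qed
  thus ?thesis using powi_pos[of "- n"] by (intro exI[of _ "real K * real p powi (- n)"]) simp
qed

text \<open>\<open>extend_measure\<close> selects some measure with the prescribed values, provided
  that there is one. The image of Lebesgue measure on the nonnegative reals under
  \<open>monna\<close> is the witness. All later p-adic integrals are computed from these volumes of
  balls.\<close>

lemma emeasure_cball:
  assumes a: "a \<in> carrier (Qp p)"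
  shows "emeasure \<mu> (padic_cball p a n) = ennreal (real p powi (- n))"
proof -
  define L where "L = restrict_space lborel {0::real..}"
  define S where "S = sigma (carrier (Qp p)) cballs"
  have sS: "space S = carrier (Qp p)" "sets S = sigma_sets (carrier (Qp p)) cballs"
    using cballs_Pow by (simp_all add: S_def)
  have sL: "space L = {0..}" by (simp add: L_def space_restrict_space)
  have meas: "monna \<in> measurable L S"
  proof (rule measurable_sigma_sets[OF sS(2) cballs_Pow])
    show "monna \<in> space L \<rightarrow> carrier (Qp p)" by (auto simp: sL)
    fix y assume "y \<in> cballs"
    then obtain a n where y: "a \<in> carrier (Qp p)" "y = padic_cball p a n" by (auto simp: cballs_def)
    then obtain c where "c \<ge> 0" "monna -` y \<inter> space L = {c..<c + real p powi (- n)}"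
      using monna_preimage sL by metis
    thus "monna -` y \<inter> space L \<in> sets L"
      unfolding L_def sets_restrict_space by (auto intro!: image_eqI[of _ _ "{c..<c + real p powi (- n)}"])
  qed
  define D where "D = distr L S monna"
  have D: "emeasure D (padic_cball p a n) = ennreal (real p powi (- n))" if a: "a \<in> carrier (Qp p)" for a n
  proof -
    obtain c where c: "c \<ge> 0" "monna -` padic_cball p a n \<inter> space L = {c..<c + real p powi (- n)}"
      using monna_preimage[OF a] sL by metis
    have "padic_cball p a n \<in> sets S" unfolding sS cballs_def by (intro sigma_sets.Basic) (use a in auto)
    hence "emeasure D (padic_cball p a n) = emeasure L {c..<c + real p powi (- n)}"
      unfolding D_def by (subst emeasure_distr[OF meas]) (simp_all add: c)
    also have "\<dots> = emeasure lborel {c..<c + real p powi (- n)}"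
      unfolding L_def using c by (subst emeasure_restrict_space) auto
    finally show ?thesis using powi_pos[of "- n"] by simp
  qed
  have "emeasure \<mu> ((\<lambda>(a, n). padic_cball p a n) (a, n)) = (\<lambda>(a, n). ennreal (real p powi (- n))) (a, n)"
  proof (rule emeasure_extend_measure[OF padic_haar_def, where \<mu>' = "emeasure D"])
    have "sets \<mu> = sets D" by (simp add: D_def sets_haar sS)
    thus "positive (sets \<mu>) (emeasure D)" "countably_additive (sets \<mu>) (emeasure D)"
      using measure_space[of D] by (simp_all add: measure_space_def)
  qed (use D a in \<open>auto simp: padic_cball_def\<close>)
  thus ?thesis by simp
qed

end

text \<open>A geometric series: the n-th shell has volume K (Q^n - Q^(n-1)), the innermost one
  volume K, and the integrand is geometric in n, so the ratio is Q W. All p-adic integrals below are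
  brought into this form.\<close>

lemma nn_integral_shells:
  fixes A :: "nat \<Rightarrow> 'a set" and f :: "'a \<Rightarrow> real"
  assumes A: "\<And>n. A n \<in> sets M" "mono A" "(\<Union>n. A n) = space M"
    and eA: "\<And>n. emeasure M (A n) = ennreal (K * Q ^ n)"
    and f: "\<And>n x. x \<in> disjointed A n \<Longrightarrow> f x = w0 * W ^ n"
    and pos: "K \<ge> 0" "Q \<ge> 1" "w0 \<ge> 0" "W \<ge> 0" "Q * W < 1"
  shows "(\<integral>\<^sup>+x. ennreal (f x) \<partial>M) = ennreal (K * w0 * (1 - W) / (1 - Q * W))"
proof -
  define D where "D = disjointed A"
  define \<mu> where "\<mu> n = (if n = 0 then K else K * Q ^ n - K * Q ^ (n - 1))" for n :: nat
  have [measurable]: "D n \<in> sets M" for n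
    unfolding D_def using sets.range_disjointed_sets[of A M] A(1) by blast
  have \<mu>: "\<mu> n \<ge> 0" "emeasure M (D n) = ennreal (\<mu> n)" for n
  proof -
    have KQ: "K * Q ^ m \<ge> 0" "K * Q ^ m \<le> K * Q ^ Suc m" for m
      using pos by (auto intro!: mult_left_mono)
    show "\<mu> n \<ge> 0" using KQ[of "n - 1"] pos by (cases n) (simp_all add: \<mu>_def)
    show "emeasure M (D n) = ennreal (\<mu> n)"
    proof (cases n)
      case 0 thus ?thesis using eA[of 0] by (simp add: D_def disjointed_def \<mu>_def)
    next
      case (Suc m)
      have "D n = A (Suc m) - A m" using A(2) Suc by (simp add: D_def disjointed_mono)
      also have "emeasure M \<dots> = emeasure M (A (Suc m)) - emeasure M (A m)"
        using A(1) monoD[OF A(2), of m "Suc m"] by (intro emeasure_Diff) (auto simp: eA)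
      also have "\<dots> = ennreal (\<mu> n)" using KQ[of m] by (simp add: eA Suc \<mu>_def ennreal_minus)
      finally show ?thesis .
    qed
  qed
  have fD: "ennreal (f x) = (\<Sum>n. ennreal (w0 * W ^ n) * indicator (D n) x)" if "x \<in> space M" for x
  proof -
    have "x \<in> (\<Union>n. D n)" using that A(3) unfolding D_def UN_disjointed_eq by simp
    then obtain n where n: "x \<in> D n" by blast
    have "(\<Sum>n. ennreal (w0 * W ^ n) * indicator (D n) x) = ennreal (w0 * W ^ n)"
      by (rule suminf_cmult_indicator[where i = n]) (use n in \<open>auto simp: D_def disjoint_family_disjointed\<close>)
    thus ?thesis using f n by (simp add: D_def)
  qed
  have "(\<integral>\<^sup>+x. ennreal (f x) \<partial>M) = (\<integral>\<^sup>+x. (\<Sum>n. ennreal (w0 * W ^ n) * indicator (D n) x) \<partial>M)"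
    by (intro nn_integral_cong fD)
  also have "\<dots> = (\<Sum>n. \<integral>\<^sup>+x. ennreal (w0 * W ^ n) * indicator (D n) x \<partial>M)"
    by (intro nn_integral_suminf) measurable
  also have "\<dots> = (\<Sum>n. ennreal (w0 * W ^ n * \<mu> n))"
    using pos \<mu> by (simp add: nn_integral_cmult_indicator ennreal_mult)
  also have "\<dots> = ennreal (K * w0 * (1 - W) / (1 - Q * W))"
  proof (rule suminf_ennreal_eq)
    have QW: "norm (Q * W) < 1" using pos by simp
    have "(\<lambda>n. K * w0 * (Q - 1) * W * (Q * W) ^ n) sums (K * w0 * (Q - 1) * W * (1 / (1 - Q * W)))"
      by (intro sums_mult geometric_sums QW)
    moreover have "w0 * W ^ Suc n * \<mu> (Suc n) = K * w0 * (Q - 1) * W * (Q * W) ^ n" for n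
      by (simp add: \<mu>_def algebra_simps power_mult_distrib)
    ultimately have "(\<lambda>n. w0 * W ^ Suc n * \<mu> (Suc n)) sums (K * w0 * (Q - 1) * W * (1 / (1 - Q * W)))"
      by presburger
    hence "(\<lambda>n. w0 * W ^ n * \<mu> n) sums (K * w0 * (Q - 1) * W * (1 / (1 - Q * W)) + w0 * W ^ 0 * \<mu> 0)"
      by (rule sums_Suc)
    also have "K * w0 * (Q - 1) * W * (1 / (1 - Q * W)) + w0 * W ^ 0 * \<mu> 0 = K * w0 * (1 - W) / (1 - Q * W)"
      using pos(5) by (simp add: \<mu>_def field_simps)
    finally show "(\<lambda>n. w0 * W ^ n * \<mu> n) sums (K * w0 * (1 - W) / (1 - Q * W))" .
  qed (use pos \<mu> in auto)
  finally show ?thesis .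
qed

text \<open>Puts the coordinate \<open>c\<close> outermost. On the chart d = 1 the norm of the
  second row depends on \<open>c\<close> alone, so it is a constant in the inner integral over the
  first row.\<close>

lemma nn_integral_pair3:
  assumes sf: "sigma_finite_measure M"
    and F [measurable]: "F \<in> borel_measurable (M \<Otimes>\<^sub>M (M \<Otimes>\<^sub>M M))"
  shows "(\<integral>\<^sup>+x. F x \<partial>(M \<Otimes>\<^sub>M (M \<Otimes>\<^sub>M M))) =
    (\<integral>\<^sup>+c. (\<integral>\<^sup>+y. F (fst y, snd y, c) \<partial>(M \<Otimes>\<^sub>M M)) \<partial>M)"
proof -
  interpret sigma_finite_measure M by fact
  interpret P: pair_sigma_finite M M ..
  have sf2: "sigma_finite_measure (M \<Otimes>\<^sub>M M)" ..
  have "(\<integral>\<^sup>+x. F x \<partial>(M \<Otimes>\<^sub>M (M \<Otimes>\<^sub>M M))) = (\<integral>\<^sup>+a. \<integral>\<^sup>+y. F (a, y) \<partial>(M \<Otimes>\<^sub>M M) \<partial>M)"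
    by (rule sigma_finite_measure.nn_integral_fst[OF sf2, symmetric]) measurable
  also have "\<dots> = (\<integral>\<^sup>+a. \<integral>\<^sup>+b. \<integral>\<^sup>+c. F (a, b, c) \<partial>M \<partial>M \<partial>M)"
    by (intro nn_integral_cong nn_integral_fst[symmetric]) simp
  also have "\<dots> = (\<integral>\<^sup>+a. \<integral>\<^sup>+c. \<integral>\<^sup>+b. F (a, b, c) \<partial>M \<partial>M \<partial>M)"
    by (intro nn_integral_cong P.Fubini') simp
  also have "\<dots> = (\<integral>\<^sup>+c. \<integral>\<^sup>+a. \<integral>\<^sup>+b. F (a, b, c) \<partial>M \<partial>M \<partial>M)"
    by (intro P.Fubini') measurable
  also have "\<dots> = (\<integral>\<^sup>+c. (\<integral>\<^sup>+y. F (fst y, snd y, c) \<partial>(M \<Otimes>\<^sub>M M)) \<partial>M)"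
    by (intro nn_integral_cong) (subst nn_integral_fst[symmetric], simp_all)
  finally show ?thesis .
qed

section \<open>Measurability and null sets over the p-adic numbers\<close>

context padic begin

lemma cball_0: "padic_cball p \<zero>\<^bsub>Qp p\<^esub> n = {x \<in> carrier (Qp p). N x \<le> real p powi (- n)}"
proof -
  have "x \<ominus>\<^bsub>Qp p\<^esub> \<zero>\<^bsub>Qp p\<^esub> = x" if "x \<in> carrier (Qp p)" for x
    using that by (elim carrier_cls) (simp add: zero_cls minus_cls)
  thus ?thesis by (auto simp: padic_cball_def)
qed

lemma N_bounded: "x \<in> carrier (Qp p) \<Longrightarrow> \<exists>n::nat. N x \<le> real p ^ n"
  using powi_big[of "N x"] by (auto intro: less_imp_le)

sublocale haar: sigma_finite_measure \<mu>
proof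
  show "\<exists>A. countable A \<and> A \<subseteq> sets \<mu> \<and> \<Union> A = space \<mu> \<and> (\<forall>a\<in>A. emeasure \<mu> a \<noteq> \<infinity>)"
    by (intro exI[of _ "range (\<lambda>n::nat. padic_cball p \<zero>\<^bsub>Qp p\<^esub> (- int n))"])
      (auto simp: emeasure_cball, auto simp: cball_0 dest: N_bounded)
qed

sublocale haar2: pair_sigma_finite \<mu> \<mu> ..

text \<open>As the values are powers of \<open>p\<close>, an open ball is a countable union of
  closed balls, and these generate the sigma-algebra.\<close>

lemma N_measurable [measurable]: "N \<in> borel_measurable \<mu>"
proof (rule borel_measurableI_less)
  fix y :: real
  show "{x \<in> space \<mu>. N x < y} \<in> sets \<mu>"
  proof (cases "y > 0")
    case False
    have "\<not> N x < y" if "x \<in> carrier (Qp p)" for x using N_nonneg[OF that] False by linarith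
    hence e: "{x \<in> space \<mu>. N x < y} = {}" by auto
    show ?thesis unfolding e by simp
  next
    case True
    have "{x \<in> space \<mu>. N x < y} = (\<Union>n\<in>{n. real p powi (- n) < y}. padic_cball p \<zero>\<^bsub>Qp p\<^esub> n)"
    proof (intro equalityI subsetI)
      fix x assume x: "x \<in> {x \<in> space \<mu>. N x < y}"
      show "x \<in> (\<Union>n\<in>{n. real p powi (- n) < y}. padic_cball p \<zero>\<^bsub>Qp p\<^esub> n)"
      proof (cases "x = \<zero>\<^bsub>Qp p\<^esub>")
        case True
        obtain n where "real p powi (- int n) < y" using powi_small \<open>y > 0\<close> by blast
        moreover have "N x = 0" using True N_eq_0 by simp
        ultimately show ?thesis using powi_pos[of "- int n"] x by (auto simp: cball_0)
      next
        case False
        then obtain k where "N x = real p powi k" using N_values x by auto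
        thus ?thesis using x by (auto simp: cball_0 intro!: exI[of _ "- k"])
      qed
    qed (auto simp: cball_0)
    also have "\<dots> \<in> sets \<mu>" by (intro sets.countable_UN'') (auto intro: cball_sets)
    finally show ?thesis .
  qed
qed

lemma cball_mono_center:
  assumes "x \<in> carrier (Qp p)" "q \<in> carrier (Qp p)" "N (x \<ominus>\<^bsub>Qp p\<^esub> q) \<le> real p powi (- m)"
  shows "x \<in> padic_cball p q m" "padic_cball p q m \<subseteq> padic_cball p x m"
proof -
  show "padic_cball p q m \<subseteq> padic_cball p x m"
  proof
    fix y assume "y \<in> padic_cball p q m"
    hence y: "y \<in> carrier (Qp p)" "N (y \<ominus>\<^bsub>Qp p\<^esub> q) \<le> real p powi (- m)" by (auto simp: padic_cball_def)
    thus "y \<in> padic_cball p x m"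
      using N_triangle[OF y(1) assms(2,1)] N_commute[OF assms(1,2)] assms(3) by (auto simp: padic_cball_def)
  qed
qed (use assms in \<open>simp add: padic_cball_def\<close>)

text \<open>The sigma-algebra is generated by balls and no topology is set up. Balls with rational
  centre form a countable base, so the preimage of a ball under a continuous map is a countable
  union of products of balls.\<close>

lemma measurable_continuous2:
  assumes car: "\<And>x y. x \<in> carrier (Qp p) \<Longrightarrow> y \<in> carrier (Qp p) \<Longrightarrow> f (x, y) \<in> carrier (Qp p)"
    and cont: "\<And>x y n. x \<in> carrier (Qp p) \<Longrightarrow> y \<in> carrier (Qp p) \<Longrightarrow>
      \<exists>m. \<forall>x'\<in>padic_cball p x m. \<forall>y'\<in>padic_cball p y m. N (f (x', y') \<ominus>\<^bsub>Qp p\<^esub> f (x, y)) \<le> real p powi (- n)"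
  shows "f \<in> measurable (\<mu> \<Otimes>\<^sub>M \<mu>) \<mu>"
proof (rule measurable_sigma_sets[OF sets_haar cballs_Pow])
  show "f \<in> space (\<mu> \<Otimes>\<^sub>M \<mu>) \<rightarrow> carrier (Qp p)" using car by (auto simp: space_pair_measure)
  fix B assume "B \<in> cballs"
  then obtain a n where B: "a \<in> carrier (Qp p)" "B = padic_cball p a n" by (auto simp: cballs_def)
  define I :: "(rat \<times> rat \<times> int) set" where "I = {(q, q', m).
    padic_cball p (padic_of_rat p q) m \<times> padic_cball p (padic_of_rat p q') m \<subseteq> f -` B \<inter> space (\<mu> \<Otimes>\<^sub>M \<mu>)}"
  have "f -` B \<inter> space (\<mu> \<Otimes>\<^sub>M \<mu>) =
      (\<Union>(q, q', m)\<in>I. padic_cball p (padic_of_rat p q) m \<times> padic_cball p (padic_of_rat p q') m)" (is "?L = ?R")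
  proof (intro equalityI subsetI)
    fix z assume z: "z \<in> ?L"
    obtain x y where xy: "z = (x, y)" "x \<in> carrier (Qp p)" "y \<in> carrier (Qp p)"
      using z by (auto simp: space_pair_measure)
    obtain m where m: "\<forall>x'\<in>padic_cball p x m. \<forall>y'\<in>padic_cball p y m. N (f (x', y') \<ominus>\<^bsub>Qp p\<^esub> f (x, y)) \<le> real p powi (- n)"
      using cont xy by blast
    obtain q where q: "N (x \<ominus>\<^bsub>Qp p\<^esub> padic_of_rat p q) \<le> real p powi (- m)" using N_approx xy by blast
    obtain q' where q': "N (y \<ominus>\<^bsub>Qp p\<^esub> padic_of_rat p q') \<le> real p powi (- m)" using N_approx xy by blast
    note Q = cball_mono_center[OF xy(2) of_rat_carrier q] and Q' = cball_mono_center[OF xy(3) of_rat_carrier q']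
    have "(x', y') \<in> ?L" if x': "x' \<in> padic_cball p (padic_of_rat p q) m" and y': "y' \<in> padic_cball p (padic_of_rat p q') m" for x' y'
    proof -
      have c: "x' \<in> carrier (Qp p)" "y' \<in> carrier (Qp p)" using x' y' by (auto simp: padic_cball_def)
      have "N (f (x', y') \<ominus>\<^bsub>Qp p\<^esub> f (x, y)) \<le> real p powi (- n)" using m x' y' Q Q' by blast
      moreover have "N (f (x, y) \<ominus>\<^bsub>Qp p\<^esub> a) \<le> real p powi (- n)" using z xy B by (auto simp: padic_cball_def)
      ultimately have "N (f (x', y') \<ominus>\<^bsub>Qp p\<^esub> a) \<le> real p powi (- n)"
        using N_triangle[OF car[OF c] car[OF xy(2,3)] B(1)] by simp
      thus ?thesis using car c B by (simp add: padic_cball_def space_pair_measure)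
    qed
    hence "(q, q', m) \<in> I" by (auto simp: I_def)
    thus "z \<in> ?R" using Q(1) Q'(1) xy(1) by blast
  qed (auto simp: I_def)
  also have "\<dots> \<in> sets (\<mu> \<Otimes>\<^sub>M \<mu>)"
    by (intro sets.countable_UN'') (auto intro!: pair_measureI cball_sets)
  finally show "f -` B \<inter> space (\<mu> \<Otimes>\<^sub>M \<mu>) \<in> sets (\<mu> \<Otimes>\<^sub>M \<mu>)" .
qed

lemma in_space_carrier: "f \<in> measurable M \<mu> \<Longrightarrow> x \<in> space M \<Longrightarrow> f x \<in> carrier (Qp p)"
  using measurable_space[of f M \<mu> x] by simp

lemma measurable_minus [measurable (raw)]:
  assumes [measurable]: "f \<in> measurable M \<mu>" "g \<in> measurable M \<mu>"
  shows "(\<lambda>x. f x \<ominus>\<^bsub>Qp p\<^esub> g x) \<in> measurable M \<mu>"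
proof -
  have [measurable]: "(\<lambda>z. fst z \<ominus>\<^bsub>Qp p\<^esub> snd z) \<in> measurable (\<mu> \<Otimes>\<^sub>M \<mu>) \<mu>"
  proof (rule measurable_continuous2)
    fix x y n assume xy: "x \<in> carrier (Qp p)" "y \<in> carrier (Qp p)"
    have "N ((x' \<ominus>\<^bsub>Qp p\<^esub> y') \<ominus>\<^bsub>Qp p\<^esub> (x \<ominus>\<^bsub>Qp p\<^esub> y)) \<le> real p powi (- n)"
      if "x' \<in> padic_cball p x n" "y' \<in> padic_cball p y n" for x' y'
    proof -
      have c: "x' \<in> carrier (Qp p)" "y' \<in> carrier (Qp p)" using that by (auto simp: padic_cball_def)
      have "(x' \<ominus>\<^bsub>Qp p\<^esub> y') \<ominus>\<^bsub>Qp p\<^esub> (x \<ominus>\<^bsub>Qp p\<^esub> y) = (x' \<ominus>\<^bsub>Qp p\<^esub> x) \<ominus>\<^bsub>Qp p\<^esub> (y' \<ominus>\<^bsub>Qp p\<^esub> y)"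
        using c xy by (elim carrier_cls) (simp add: minus_cls Cauchy_diff algebra_simps)
      thus ?thesis using N_minus[of "x' \<ominus>\<^bsub>Qp p\<^esub> x" "y' \<ominus>\<^bsub>Qp p\<^esub> y"] that c xy by (simp add: padic_cball_def)
    qed
    thus "\<exists>m. \<forall>x'\<in>padic_cball p x m. \<forall>y'\<in>padic_cball p y m.
        N ((fst (x', y') \<ominus>\<^bsub>Qp p\<^esub> snd (x', y')) \<ominus>\<^bsub>Qp p\<^esub> (fst (x, y) \<ominus>\<^bsub>Qp p\<^esub> snd (x, y))) \<le> real p powi (- n)" by auto
  qed simp
  have "(\<lambda>x. fst (f x, g x) \<ominus>\<^bsub>Qp p\<^esub> snd (f x, g x)) \<in> measurable M \<mu>" by measurable
  thus ?thesis by simp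
qed

lemma measurable_mult [measurable (raw)]:
  assumes [measurable]: "f \<in> measurable M \<mu>" "g \<in> measurable M \<mu>"
  shows "(\<lambda>x. f x \<otimes>\<^bsub>Qp p\<^esub> g x) \<in> measurable M \<mu>"
proof -
  have [measurable]: "(\<lambda>z. fst z \<otimes>\<^bsub>Qp p\<^esub> snd z) \<in> measurable (\<mu> \<Otimes>\<^sub>M \<mu>) \<mu>"
  proof (rule measurable_continuous2)
    fix x y n assume xy: "x \<in> carrier (Qp p)" "y \<in> carrier (Qp p)"
    obtain j where "max 1 (max (N x) (N y)) < real p powi (int j)" using powi_big by blast
    hence j: "1 \<le> real p powi int j" "N x \<le> real p powi int j" "N y \<le> real p powi int j"
      by (simp_all only: max_less_iff_conj less_imp_le)
    \<comment> \<open>\<open>n + int j\<close> compensates the factors of size up to p^j; the lower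
      bound 0 keeps the perturbed factor \<open>y'\<close> below p^j as well.\<close>
    define m where "m = max 0 (n + int j)"
    have le: "real p powi (- m) * real p powi (int j) \<le> real p powi (- n)"
    proof -
      have "real p powi (- m) * real p powi (int j) = real p powi (- m + int j)"
        by (rule power_int_add[symmetric]) (use p_pos in simp)
      also have "\<dots> \<le> real p powi (- n)" by (subst powi_le_iff) (simp add: m_def)
      finally show ?thesis .
    qed
    have m1: "real p powi (- m) \<le> 1" using powi_le_iff[of "- m" 0] by (simp add: m_def)
    have "N ((x' \<otimes>\<^bsub>Qp p\<^esub> y') \<ominus>\<^bsub>Qp p\<^esub> (x \<otimes>\<^bsub>Qp p\<^esub> y)) \<le> real p powi (- n)"
      if "x' \<in> padic_cball p x m" "y' \<in> padic_cball p y m" for x' y'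
    proof -
      have c: "x' \<in> carrier (Qp p)" "y' \<in> carrier (Qp p)" using that by (auto simp: padic_cball_def)
      have d: "N (x' \<ominus>\<^bsub>Qp p\<^esub> x) \<le> real p powi (- m)" "N (y' \<ominus>\<^bsub>Qp p\<^esub> y) \<le> real p powi (- m)"
        using that by (auto simp: padic_cball_def)
      have "y' = (y' \<ominus>\<^bsub>Qp p\<^esub> y) \<oplus>\<^bsub>Qp p\<^esub> y"
        using c xy by (elim carrier_cls) (simp add: minus_cls add_cls Cauchy_diff)
      hence "N y' \<le> max (N (y' \<ominus>\<^bsub>Qp p\<^esub> y)) (N y)" using N_add[of "y' \<ominus>\<^bsub>Qp p\<^esub> y" y] c xy by simp
      hence y': "N y' \<le> real p powi int j" using d m1 j by linarith
      have "(x' \<otimes>\<^bsub>Qp p\<^esub> y') \<ominus>\<^bsub>Qp p\<^esub> (x \<otimes>\<^bsub>Qp p\<^esub> y) =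
          ((x' \<ominus>\<^bsub>Qp p\<^esub> x) \<otimes>\<^bsub>Qp p\<^esub> y') \<oplus>\<^bsub>Qp p\<^esub> ((y' \<ominus>\<^bsub>Qp p\<^esub> y) \<otimes>\<^bsub>Qp p\<^esub> x)"
        using c xy by (elim carrier_cls) (simp add: minus_cls add_cls mult_cls Cauchy_diff Cauchy_mult algebra_simps)
      hence "N ((x' \<otimes>\<^bsub>Qp p\<^esub> y') \<ominus>\<^bsub>Qp p\<^esub> (x \<otimes>\<^bsub>Qp p\<^esub> y)) \<le>
          max (N (x' \<ominus>\<^bsub>Qp p\<^esub> x) * N y') (N (y' \<ominus>\<^bsub>Qp p\<^esub> y) * N x)"
        using c xy N_add[of "(x' \<ominus>\<^bsub>Qp p\<^esub> x) \<otimes>\<^bsub>Qp p\<^esub> y'" "(y' \<ominus>\<^bsub>Qp p\<^esub> y) \<otimes>\<^bsub>Qp p\<^esub> x"]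
        by (simp add: N_mult)
      also have "\<dots> \<le> real p powi (- m) * real p powi (int j)"
        using d y' j c xy powi_pos[of "- m"] by (intro max.boundedI mult_mono) simp_all
      finally show ?thesis using le by simp
    qed
    thus "\<exists>m. \<forall>x'\<in>padic_cball p x m. \<forall>y'\<in>padic_cball p y m.
        N ((fst (x', y') \<otimes>\<^bsub>Qp p\<^esub> snd (x', y')) \<ominus>\<^bsub>Qp p\<^esub> (fst (x, y) \<otimes>\<^bsub>Qp p\<^esub> snd (x, y))) \<le> real p powi (- n)"
      by (intro exI[of _ m]) simp
  qed simp
  have "(\<lambda>x. fst (f x, g x) \<otimes>\<^bsub>Qp p\<^esub> snd (f x, g x)) \<in> measurable M \<mu>" by measurable
  thus ?thesis by simp
qed

text \<open>A point lies in balls of volume p^(-n) for all n.\<close>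

lemma AE_neq: "AE x in \<mu>. x \<noteq> a"
proof (cases "a \<in> carrier (Qp p)")
  case True
  define I where "I = (\<Inter>n::nat. padic_cball p a (int n))"
  have I: "I \<in> sets \<mu>" unfolding I_def by (rule sets.countable_INT) (simp_all add: image_subset_iff cball_sets True)
  have "a \<ominus>\<^bsub>Qp p\<^esub> a = \<zero>\<^bsub>Qp p\<^esub>" using True by (elim carrier_cls) (simp add: minus_cls zero_cls)
  hence "N (a \<ominus>\<^bsub>Qp p\<^esub> a) = 0" by (simp add: N_eq_0)
  hence aI: "a \<in> I" unfolding I_def padic_cball_def using True less_imp_le[OF powi_pos] by simp
  have le: "emeasure \<mu> I \<le> ennreal (real p powi (- int n))" for n
    unfolding emeasure_cball[OF True, symmetric] by (intro emeasure_mono cball_sets True) (simp only: I_def, rule INF_lower, rule UNIV_I)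
  have eps: "emeasure \<mu> I \<le> ennreal e" if e: "e > 0" for e
  proof -
    obtain n where "real p powi (- int n) < e" using powi_small[OF e] by blast
    hence "ennreal (real p powi (- int n)) \<le> ennreal e" by (intro ennreal_leI less_imp_le)
    with le[of n] show ?thesis by (rule order_trans)
  qed
  have "emeasure \<mu> I \<le> 0" by (rule ennreal_le_epsilon) (simp add: eps)
  hence "emeasure \<mu> I = 0" by simp
  have "{x \<in> space \<mu>. \<not> x \<noteq> a} \<subseteq> I"
  proof
    fix x assume "x \<in> {x \<in> space \<mu>. \<not> x \<noteq> a}"
    hence "x = a" by simp
    with aI show "x \<in> I" by (simp only:)
  qed
  from AE_I[OF this \<open>emeasure \<mu> I = 0\<close> I] show ?thesis .
next
  case False
  show ?thesis
  proof (rule AE_I2)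
    fix x assume x: "x \<in> space \<mu>"
    show "x \<noteq> a"
    proof
      assume "x = a"
      with x have "a \<in> space \<mu>" by (simp only:)
      with False show False unfolding space_haar by contradiction
    qed
  qed
qed

end

section \<open>Local densities at the finite places\<close>

text \<open>With A and B the norms of the second row and of the matrix and d = |det|, the factor
  1/d^2 of the invariant form cancels the determinant in the inverse height for -K_X. The identity
  is shared by all places and by all three integrals of the constant; k = 0 is the case without a
  weight.\<close>

lemma tau_density_eq:
  fixes A B d k :: real
  assumes "A > 0" "B > 0" "d > 0"
  shows "1 / d\<^sup>2 * inverse ((A * B / d) powr 2 * (B / A) powr 1) * (B / A) powr (- k) =
    A powr (k - 1) * B powr (- (3 + k))"
proof -
  have "1 / d\<^sup>2 * inverse ((A * B / d) powr 2 * (B / A) powr 1) = inverse (A * B ^ 3)"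
    using assms by (simp add: field_simps power2_eq_square power3_eq_cube)
  also have "\<dots> = A powr (-1) * B powr (-3)"
    using assms by (simp add: powr_minus powr_numeral)
  finally have "1 / d\<^sup>2 * inverse ((A * B / d) powr 2 * (B / A) powr 1) * (B / A) powr (- k) =
      (A powr (-1) * A powr k) * (B powr (-3) * B powr (- k))"
    using assms by (simp add: powr_divide powr_minus field_simps)
  also have "\<dots> = A powr (-1 + k) * B powr (-3 + - k)" by (simp only: powr_add)
  finally show ?thesis by simp
qed

context padic begin

text \<open>The shells are the level sets of max(p^m, h). The innermost one is all of h \<le> p^m,
  where the maximum is constant; beyond it \<open>h\<close> runs through powers of
  \<open>p\<close>.\<close>

lemma nn_integral_max_powr:
  fixes h :: "'a \<Rightarrow> real" and m :: nat
  assumes A: "\<And>n::nat. {x \<in> space M. h x \<le> real p ^ n} \<in> sets M"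
    and eA: "\<And>n. emeasure M {x \<in> space M. h x \<le> real p ^ (m + n)} = ennreal (K * Q ^ n)"
    and vals: "\<And>x. x \<in> space M \<Longrightarrow> h x = 0 \<or> (\<exists>k. h x = real p powi k)"
    and pos: "K \<ge> 0" "Q \<ge> 1" "Q * p powr (- \<sigma>) < 1"
  shows "(\<integral>\<^sup>+x. ennreal (max (real p ^ m) (h x) powr (- \<sigma>)) \<partial>M) =
    ennreal (K * (real p ^ m) powr (- \<sigma>) * (1 - p powr (- \<sigma>)) / (1 - Q * p powr (- \<sigma>)))"
proof (rule nn_integral_shells)
  define A where "A n = {x \<in> space M. h x \<le> real p ^ (m + n)}" for n
  show A': "mono (\<lambda>n. {x \<in> space M. h x \<le> real p ^ (m + n)})"
  proof (rule monoI)
    fix n n' :: nat assume "n \<le> n'"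
    hence "real p ^ (m + n) \<le> real p ^ (m + n')" using p_gt1 by (intro power_increasing) auto
    thus "{x \<in> space M. h x \<le> real p ^ (m + n)} \<le> {x \<in> space M. h x \<le> real p ^ (m + n')}" by auto
  qed
  have "\<exists>n. h x \<le> real p ^ (m + n)" if "x \<in> space M" for x
  proof -
    obtain n where n: "h x < real p ^ n" using real_arch_pow p_gt1(1) by blast
    also have "\<dots> \<le> real p ^ (m + n)" using p_gt1 by (intro power_increasing) auto
    finally show ?thesis by (intro exI[of _ n]) simp
  qed
  thus "(\<Union>n. {x \<in> space M. h x \<le> real p ^ (m + n)}) = space M" by auto
  fix n x assume x: "x \<in> disjointed (\<lambda>n. {x \<in> space M. h x \<le> real p ^ (m + n)}) n"
  have "max (real p ^ m) (h x) = real p ^ (m + n)"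
  proof (cases n)
    case 0 thus ?thesis using x by (simp add: disjointed_def)
  next
    case (Suc n')
    hence x': "x \<in> space M" "h x \<le> real p ^ (m + n)" "h x > real p ^ (m + n')"
      using x A' by (auto simp: disjointed_mono)
    have "h x > 0" using x'(3) p_pos by (meson less_trans zero_less_power)
    then obtain k where k: "h x = real p powi k" using vals x' by fastforce
    have "real p powi k \<le> real p powi int (m + n)" "real p powi int (m + n') < real p powi k"
      using x' k by (simp_all only: power_int_of_nat)
    hence "k = int (m + n)" unfolding powi_le_iff powi_less_iff using Suc by simp
    hence h: "h x = real p ^ (m + n)" using k by (simp only: power_int_of_nat)
    have "real p ^ m \<le> real p ^ (m + n)" using p_gt1 by (intro power_increasing) auto
    thus ?thesis by (simp add: h)
  qed
  moreover have "(real p ^ (m + n)) powr (- \<sigma>) = (real p ^ m) powr (- \<sigma>) * (p powr (- \<sigma>)) ^ n"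
    using p_pos by (simp add: power_add powr_mult powr_power powr_realpow[symmetric] powr_powr mult.commute)
  ultimately show "max (real p ^ m) (h x) powr (- \<sigma>) = (real p ^ m) powr (- \<sigma>) * (p powr (- \<sigma>)) ^ n" by simp
qed (use A eA pos in auto)

lemma emeasure_ball: "emeasure \<mu> {x \<in> carrier (Qp p). N x \<le> real p ^ n} = ennreal (real p ^ n)"
  using emeasure_cball[of "\<zero>\<^bsub>Qp p\<^esub>" "- int n"] by (simp add: cball_0)

lemma N_values': "x \<in> carrier (Qp p) \<Longrightarrow> N x = 0 \<or> (\<exists>k. N x = real p powi k)"
  using N_values N_eq_0 by blast

lemma p_powr_less_1: "s > 0 \<Longrightarrow> p powr (- s) < 1"
  using p_gt1 by (simp add: powr_less_one)

lemma nn_integral_N_powr: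
  assumes "\<sigma> > 1"
  shows "(\<integral>\<^sup>+x. ennreal (max 1 (N x) powr (- \<sigma>)) \<partial>\<mu>) = ennreal ((1 - p powr (- \<sigma>)) / (1 - p powr (1 - \<sigma>)))"
proof -
  have Q: "real p * p powr (- \<sigma>) = p powr (1 - \<sigma>)" using p_pos by (simp add: powr_diff powr_minus field_simps)
  have "(\<integral>\<^sup>+x. ennreal (max (real p ^ 0) (N x) powr (- \<sigma>)) \<partial>\<mu>) =
      ennreal (1 * (real p ^ 0) powr (- \<sigma>) * (1 - p powr (- \<sigma>)) / (1 - real p * p powr (- \<sigma>)))"
  proof (rule nn_integral_max_powr)
    show "{x \<in> space \<mu>. N x \<le> real p ^ n} \<in> sets \<mu>" for n by measurable
    show "real p * p powr (- \<sigma>) < 1" unfolding Q using p_powr_less_1[of "\<sigma> - 1"] assms by simp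
  qed (use p_gt1 N_values' emeasure_ball in auto)
  thus ?thesis by (simp add: Q)
qed

lemma nn_integral_N2_powr:
  assumes "\<sigma> > 2"
  shows "(\<integral>\<^sup>+y. ennreal (max (real p ^ m) (max (N (fst y)) (N (snd y))) powr (- \<sigma>)) \<partial>(\<mu> \<Otimes>\<^sub>M \<mu>)) =
    ennreal ((real p ^ m) powr (2 - \<sigma>) * ((1 - p powr (- \<sigma>)) / (1 - p powr (2 - \<sigma>))))"
proof -
  have Q: "(real p)\<^sup>2 * p powr (- \<sigma>) = p powr (2 - \<sigma>)"
    using p_pos by (simp add: powr_diff powr_minus powr_numeral field_simps)
  have "(\<integral>\<^sup>+y. ennreal (max (real p ^ m) (max (N (fst y)) (N (snd y))) powr (- \<sigma>)) \<partial>(\<mu> \<Otimes>\<^sub>M \<mu>)) =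
    ennreal ((real p ^ m)\<^sup>2 * (real p ^ m) powr (- \<sigma>) * (1 - p powr (- \<sigma>)) / (1 - (real p)\<^sup>2 * p powr (- \<sigma>)))"
  proof (rule nn_integral_max_powr)
    show "{x \<in> space (\<mu> \<Otimes>\<^sub>M \<mu>). max (N (fst x)) (N (snd x)) \<le> real p ^ n} \<in> sets (\<mu> \<Otimes>\<^sub>M \<mu>)" for n by measurable
    show "(real p)\<^sup>2 * p powr (- \<sigma>) < 1" unfolding Q using p_powr_less_1[of "\<sigma> - 2"] assms by simp
    show "(real p)\<^sup>2 \<ge> 1" using p_gt1 by simp
    fix n
    let ?B = "{x \<in> carrier (Qp p). N x \<le> real p ^ (m + n)}"
    have "{x \<in> space (\<mu> \<Otimes>\<^sub>M \<mu>). max (N (fst x)) (N (snd x)) \<le> real p ^ (m + n)} = ?B \<times> ?B"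
      by (auto simp: space_pair_measure)
    moreover have "?B \<in> sets \<mu>"
    proof -
      have "{x \<in> space \<mu>. N x \<le> real p ^ (m + n)} \<in> sets \<mu>" by measurable
      thus ?thesis by simp
    qed
    ultimately have "emeasure (\<mu> \<Otimes>\<^sub>M \<mu>) {x \<in> space (\<mu> \<Otimes>\<^sub>M \<mu>). max (N (fst x)) (N (snd x)) \<le> real p ^ (m + n)} =
        ennreal (real p ^ (m + n)) * ennreal (real p ^ (m + n))"
      by (simp only: haar.emeasure_pair_measure_Times emeasure_ball)
    also have "\<dots> = ennreal ((real p ^ m)\<^sup>2 * (real p)\<^sup>2 ^ n)"
      by (simp add: ennreal_mult[symmetric] power_add power2_eq_square power_mult_distrib)
    finally show "emeasure (\<mu> \<Otimes>\<^sub>M \<mu>) {x \<in> space (\<mu> \<Otimes>\<^sub>M \<mu>). max (N (fst x)) (N (snd x)) \<le> real p ^ (m + n)} =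
      ennreal ((real p ^ m)\<^sup>2 * (real p)\<^sup>2 ^ n)" .
  next
    fix x assume "x \<in> space (\<mu> \<Otimes>\<^sub>M \<mu>)"
    hence "fst x \<in> carrier (Qp p)" "snd x \<in> carrier (Qp p)" by (auto simp: space_pair_measure)
    from N_values'[OF this(1)] N_values'[OF this(2)]
    show "max (N (fst x)) (N (snd x)) = 0 \<or> (\<exists>k. max (N (fst x)) (N (snd x)) = real p powi k)"
      unfolding max_def by auto
  qed auto
  also have "(real p ^ m)\<^sup>2 * (real p ^ m) powr (- \<sigma>) = (real p ^ m) powr (2 - \<sigma>)"
    using p_pos by (simp add: powr_diff powr_minus powr_numeral field_simps)
  finally show ?thesis by (simp add: Q)
qed

lemma H1_fin_max: "H1_fin p (a, b, c, d) = max (N c) (N d)"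
  and H2_fin_max: "H2_fin p (a, b, c, d) = max (N a) (max (N b) (max (N c) (N d)))"
  by simp_all

lemma N_one [simp]: "N \<one>\<^bsub>Qp p\<^esub> = 1"
  using N_of_rat[of 1] by (simp add: one_cls of_rat_cls)

lemma minus_eq_zero_iff:
  assumes "a \<in> carrier (Qp p)" "b \<in> carrier (Qp p)"
  shows "a \<ominus>\<^bsub>Qp p\<^esub> b = \<zero>\<^bsub>Qp p\<^esub> \<longleftrightarrow> a = b"
proof -
  obtain s where s: "s \<in> padic_cauchy p" "a = cls s" using assms(1) by (rule carrier_cls)
  obtain t where t: "t \<in> padic_cauchy p" "b = cls t" using assms(2) by (rule carrier_cls)
  show ?thesis using s(1) t(1) unfolding s(2) t(2)
    by (simp add: minus_cls zero_cls cls_eq_iff Cauchy_diff)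
qed

lemma N_det_pos:
  assumes "a \<in> carrier (Qp p)" "b \<in> carrier (Qp p)" "a \<noteq> b"
  shows "N (a \<ominus>\<^bsub>Qp p\<^esub> b) > 0"
proof -
  have "N (a \<ominus>\<^bsub>Qp p\<^esub> b) \<noteq> 0" using assms by (simp add: N_eq_0 minus_eq_zero_iff)
  moreover have "N (a \<ominus>\<^bsub>Qp p\<^esub> b) \<ge> 0" using assms by simp
  ultimately show ?thesis by linarith
qed

lemma N_eq_0_iff_minus:
  assumes "a \<in> carrier (Qp p)" "b \<in> carrier (Qp p)"
  shows "N (a \<ominus>\<^bsub>Qp p\<^esub> b) = 0 \<longleftrightarrow> a = b"
  using assms by (simp add: N_eq_0 minus_eq_zero_iff)

lemma mult_left_cancel:
  assumes "b \<in> carrier (Qp p)" "b \<noteq> \<zero>\<^bsub>Qp p\<^esub>" "c \<in> carrier (Qp p)" "c' \<in> carrier (Qp p)"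
    "b \<otimes>\<^bsub>Qp p\<^esub> c = b \<otimes>\<^bsub>Qp p\<^esub> c'"
  shows "c = c'"
proof -
  have "b \<otimes>\<^bsub>Qp p\<^esub> (c \<ominus>\<^bsub>Qp p\<^esub> c') = (b \<otimes>\<^bsub>Qp p\<^esub> c) \<ominus>\<^bsub>Qp p\<^esub> (b \<otimes>\<^bsub>Qp p\<^esub> c')"
    using assms(1,3,4) by (elim carrier_cls) (simp add: minus_cls mult_cls Cauchy_mult Cauchy_diff algebra_simps)
  hence "N (b \<otimes>\<^bsub>Qp p\<^esub> (c \<ominus>\<^bsub>Qp p\<^esub> c')) = 0" using assms by (simp add: N_eq_0 minus_eq_zero_iff)
  hence "N b * N (c \<ominus>\<^bsub>Qp p\<^esub> c') = 0" using assms by (simp add: N_mult)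
  moreover have "N b \<noteq> 0" using assms by (simp add: N_eq_0)
  ultimately show ?thesis using assms by (simp add: N_eq_0_iff_minus)
qed

lemma AE_mult_neq:
  assumes "b \<in> carrier (Qp p)" "b \<noteq> \<zero>\<^bsub>Qp p\<^esub>"
  shows "AE c in \<mu>. a \<noteq> b \<otimes>\<^bsub>Qp p\<^esub> c"
proof (cases "\<exists>c\<in>carrier (Qp p). a = b \<otimes>\<^bsub>Qp p\<^esub> c")
  case True
  then obtain c0 where c0: "c0 \<in> carrier (Qp p)" "a = b \<otimes>\<^bsub>Qp p\<^esub> c0" by (rule bexE)
  have "AE c in \<mu>. c \<in> carrier (Qp p)" by (rule AE_I2) simp
  with AE_neq[of c0] show ?thesis
  proof eventually_elim
    case (elim c)
    show ?case
    proof
      assume "a = b \<otimes>\<^bsub>Qp p\<^esub> c"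
      with c0 have "b \<otimes>\<^bsub>Qp p\<^esub> c = b \<otimes>\<^bsub>Qp p\<^esub> c0" by (simp only:)
      from mult_left_cancel[OF assms elim(2) c0(1) this] elim(1) show False by contradiction
    qed
  qed
next
  case False
  show ?thesis
  proof (rule AE_I2)
    fix c assume "c \<in> space \<mu>"
    hence "c \<in> carrier (Qp p)" by (simp only: space_haar)
    with False show "a \<noteq> b \<otimes>\<^bsub>Qp p\<^esub> c" by (metis (no_types))
  qed
qed

abbreviation \<mu>3 :: "(padic \<times> padic \<times> padic) measure" where "\<mu>3 \<equiv> \<mu> \<Otimes>\<^sub>M \<mu> \<Otimes>\<^sub>M \<mu>"

text \<open>For fixed a and b \<noteq> 0 the equation a = b c has at most one solution c, and points
  are null; Fubini is applied twice.\<close>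

lemma AE_det_neq_0: "AE x in \<mu>3. fst x \<noteq> fst (snd x) \<otimes>\<^bsub>Qp p\<^esub> snd (snd x)"
proof -
  have sf2: "sigma_finite_measure (\<mu> \<Otimes>\<^sub>M \<mu>)" ..
  interpret P: pair_sigma_finite \<mu> "\<mu> \<Otimes>\<^sub>M \<mu>"
    using sf2 haar.sigma_finite_measure_axioms by (simp add: pair_sigma_finite_def)
  \<comment> \<open>The set where two measurable functions differ is described through the absolute
    value of their difference, whose measurability is known.\<close>
  have meas: "{x \<in> space M. f x \<noteq> g x} \<in> sets M"
    if [measurable]: "f \<in> measurable M \<mu>" "g \<in> measurable M \<mu>" for f g :: "'z \<Rightarrow> padic" and M
  proof -
    have "{x \<in> space M. f x \<noteq> g x} = {x \<in> space M. N (f x \<ominus>\<^bsub>Qp p\<^esub> g x) \<noteq> 0}"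
      by (intro Collect_cong conj_cong refl) (simp add: N_eq_0_iff_minus in_space_carrier[OF that(1)] in_space_carrier[OF that(2)])
    also have "\<dots> \<in> sets M" by measurable
    finally show ?thesis .
  qed
  show ?thesis
  proof (rule P.AE_pair_measure)
    show "{x \<in> space \<mu>3. fst x \<noteq> fst (snd x) \<otimes>\<^bsub>Qp p\<^esub> snd (snd x)} \<in> sets \<mu>3"
      by (rule meas) measurable
    show "AE a in \<mu>. AE y in \<mu> \<Otimes>\<^sub>M \<mu>. fst (a, y) \<noteq> fst (snd (a, y)) \<otimes>\<^bsub>Qp p\<^esub> snd (snd (a, y))"
    proof (rule AE_I2)
      fix a assume "a \<in> space \<mu>"
      hence [measurable]: "(\<lambda>_. a) \<in> measurable (\<mu> \<Otimes>\<^sub>M \<mu>) \<mu>" by simp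
      show "AE y in \<mu> \<Otimes>\<^sub>M \<mu>. fst (a, y) \<noteq> fst (snd (a, y)) \<otimes>\<^bsub>Qp p\<^esub> snd (snd (a, y))"
        unfolding fst_conv snd_conv
      proof (rule haar2.AE_pair_measure)
        show "{x \<in> space (\<mu> \<Otimes>\<^sub>M \<mu>). a \<noteq> fst x \<otimes>\<^bsub>Qp p\<^esub> snd x} \<in> sets (\<mu> \<Otimes>\<^sub>M \<mu>)"
          by (rule meas) measurable
        have "AE b in \<mu>. b \<in> carrier (Qp p)" by (rule AE_I2) simp
        with AE_neq[of "\<zero>\<^bsub>Qp p\<^esub>"]
        show "AE b in \<mu>. AE c in \<mu>. a \<noteq> fst (b, c) \<otimes>\<^bsub>Qp p\<^esub> snd (b, c)"
          unfolding fst_conv snd_conv by eventually_elim (rule AE_mult_neq)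
      qed
    qed
  qed
qed

text \<open>The density is A^(k-1) B^(-(3+k)) with A = max(|c|, 1) and B = max(|a|, |b|, A). The
  integral over (a, b) is A^(2-(3+k)) times a constant, so that A^(-2) is left whatever
  \<open>k\<close> is; the weight influences only the constant of the inner integral.\<close>

lemma nn_integral_tau_fin:
  assumes k: "k \<ge> 0"
  shows "(\<integral>\<^sup>+x. ennreal (HE_fin p (fst x, fst (snd x), snd (snd x), \<one>\<^bsub>Qp p\<^esub>) powr (- k)) \<partial>tau_fin p) =
    ennreal ((1 - p powr (-2)) / (1 - p powr (-1)) * ((1 - p powr (- (3 + k))) / (1 - p powr (- (1 + k)))))"
proof -
  define F where "F x = (max (N (snd (snd x))) 1) powr (k - 1) *
    (max (N (fst x)) (max (N (fst (snd x))) (max (N (snd (snd x))) 1))) powr (- (3 + k))"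
    for x :: "padic \<times> padic \<times> padic"
  have [measurable]: "F \<in> borel_measurable \<mu>3" unfolding F_def by measurable
  let ?g = "\<lambda>x. ennreal (HE_fin p (fst x, fst (snd x), snd (snd x), \<one>\<^bsub>Qp p\<^esub>) powr (- k))"
  let ?g1 = "\<lambda>(a, b, c). ennreal (1 / (N (a \<ominus>\<^bsub>Qp p\<^esub> b \<otimes>\<^bsub>Qp p\<^esub> c))\<^sup>2)"
  let ?g2 = "\<lambda>(a, b, c). ennreal (inverse (height_fin p (a, b, c, \<one>\<^bsub>Qp p\<^esub>) (2, 1)))"
  have [measurable]: "(\<lambda>_. \<one>\<^bsub>Qp p\<^esub>) \<in> measurable M \<mu>" for M :: "'z measure" by simp
  have m1 [measurable]: "?g1 \<in> borel_measurable \<mu>3" by measurable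
  have m2 [measurable]: "?g2 \<in> borel_measurable \<mu>3"
    unfolding height_fin_def HD_fin_def HE_fin_def H1_fin_max H2_fin_max absdet_fin.simps case_prod_beta by measurable
  have m3 [measurable]: "?g \<in> borel_measurable \<mu>3"
    unfolding HE_fin_def H1_fin_max H2_fin_max by measurable
  have "(\<integral>\<^sup>+x. ?g x \<partial>tau_fin p) = (\<integral>\<^sup>+x. ?g1 x * (?g2 x * ?g x) \<partial>\<mu>3)"
    unfolding tau_fin_def omega_fin_def
    by (subst nn_integral_density, simp only: measurable_density_eq1 m2, simp only: measurable_density_eq1 m3,
        subst nn_integral_density, rule m1, measurable)
  also have "\<dots> = (\<integral>\<^sup>+x. ennreal (F x) \<partial>\<mu>3)"
  proof (rule nn_integral_cong_AE)
    have "AE x in \<mu>3. x \<in> space \<mu>3" by (rule AE_I2)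
    with AE_det_neq_0 show "AE x in \<mu>3. ?g1 x * (?g2 x * ?g x) = ennreal (F x)"
    proof eventually_elim
      case (elim x)
      obtain a b c where x: "x = (a, b, c)" by (cases x)
      have c: "a \<in> carrier (Qp p)" "b \<in> carrier (Qp p)" "c \<in> carrier (Qp p)"
        using elim(2) unfolding x by (simp_all add: space_pair_measure)
      have ne: "a \<noteq> b \<otimes>\<^bsub>Qp p\<^esub> c" using elim(1) unfolding x fst_conv snd_conv .
      define d where "d = N (a \<ominus>\<^bsub>Qp p\<^esub> b \<otimes>\<^bsub>Qp p\<^esub> c)"
      define A where "A = max (N c) 1"
      define B where "B = max (N a) (max (N b) (max (N c) 1))"
      have pos: "A > 0" "B > 0" "d > 0" using N_det_pos[OF c(1) _ ne] c unfolding A_def B_def d_def by auto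
      have "?g1 x = ennreal (1 / d\<^sup>2)" by (simp add: x d_def)
      moreover have "?g2 x = ennreal (inverse ((A * B / d) powr 2 * (B / A) powr 1))"
        using c by (simp only: x prod.case height_fin_def HD_fin_def HE_fin_def H1_fin_max H2_fin_max absdet_fin.simps
          A_def B_def d_def N_one Q.r_one)
      moreover have "?g x = ennreal ((B / A) powr (- k))"
        by (simp only: x fst_conv snd_conv HE_fin_def H1_fin_max H2_fin_max A_def B_def N_one)
      ultimately have "?g1 x * (?g2 x * ?g x) =
          ennreal (1 / d\<^sup>2 * inverse ((A * B / d) powr 2 * (B / A) powr 1) * (B / A) powr (- k))"
        by (simp only: ennreal_mult[symmetric] zero_le_power2 divide_nonneg_nonneg mult_nonneg_nonneg powr_ge_zero
            inverse_nonnegative_iff_nonnegative mult.assoc zero_le_one)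
      thus ?case unfolding tau_density_eq[OF pos] by (simp add: F_def x A_def B_def)
    qed
  qed
  also have "\<dots> = (\<integral>\<^sup>+c. (\<integral>\<^sup>+y. ennreal (F (fst y, snd y, c)) \<partial>(\<mu> \<Otimes>\<^sub>M \<mu>)) \<partial>\<mu>)"
    by (rule nn_integral_pair3[OF haar.sigma_finite_measure_axioms]) measurable
  also have "\<dots> = (\<integral>\<^sup>+c. ennreal ((1 - p powr (- (3 + k))) / (1 - p powr (- (1 + k)))) * ennreal (max 1 (N c) powr (-2)) \<partial>\<mu>)"
  proof (rule nn_integral_cong)
    fix c assume "c \<in> space \<mu>"
    hence c: "c \<in> carrier (Qp p)" by simp
    \<comment> \<open>A is a power of \<open>p\<close> with exponent \<ge> 0, as the shell formula
      for the inner integral requires.\<close>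
    have "\<exists>m::nat. max (N c) 1 = real p ^ m"
    proof (cases "N c \<le> 1")
      case True thus ?thesis by (intro exI[of _ 0]) simp
    next
      case False
      then obtain j where j: "N c = real p powi j" using N_values'[OF c] by auto
      hence "j > 0" using False powi_le_iff[of j 0] by simp
      hence "N c = real p ^ nat j" using j by (simp add: power_int_def)
      thus ?thesis using False by (intro exI[of _ "nat j"]) simp
    qed
    then obtain m where m: "max (N c) 1 = real p ^ m" by blast
    have "(\<integral>\<^sup>+y. ennreal (F (fst y, snd y, c)) \<partial>(\<mu> \<Otimes>\<^sub>M \<mu>)) =
      (\<integral>\<^sup>+y. ennreal ((real p ^ m) powr (k - 1)) * ennreal (max (real p ^ m) (max (N (fst y)) (N (snd y))) powr (- (3 + k))) \<partial>(\<mu> \<Otimes>\<^sub>M \<mu>))"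
    proof (intro nn_integral_cong)
      fix y :: "padic \<times> padic"
      have mx: "max x (max y z) = max z (max x y)" for x y z :: real by (auto simp: max_def)
      show "ennreal (F (fst y, snd y, c)) = ennreal ((real p ^ m) powr (k - 1)) *
          ennreal (max (real p ^ m) (max (N (fst y)) (N (snd y))) powr (- (3 + k)))"
        unfolding F_def fst_conv snd_conv m mx[of _ _ "real p ^ m"] by (simp only: ennreal_mult[symmetric] powr_ge_zero)
    qed
    also have "\<dots> = ennreal ((real p ^ m) powr (k - 1)) *
        ennreal ((real p ^ m) powr (2 - (3 + k)) * ((1 - p powr (- (3 + k))) / (1 - p powr (2 - (3 + k)))))"
      by (subst nn_integral_cmult) (measurable, subst nn_integral_N2_powr, use k in simp_all)
    also have "\<dots> = ennreal (((real p ^ m) powr (k - 1) * (real p ^ m) powr (2 - (3 + k))) *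
        ((1 - p powr (- (3 + k))) / (1 - p powr (2 - (3 + k)))))"
      using p_powr_less_1[of "3 + k"] p_powr_less_1[of "1 + k"] k
      by (subst ennreal_mult[symmetric]) (auto simp: mult.assoc intro!: mult_nonneg_nonneg divide_nonneg_nonneg)
    also have "(real p ^ m) powr (k - 1) * (real p ^ m) powr (2 - (3 + k)) = (real p ^ m) powr (-2)"
      by (simp add: powr_add[symmetric])
    also have "ennreal ((real p ^ m) powr (-2) * ((1 - p powr (- (3 + k))) / (1 - p powr (2 - (3 + k))))) =
        ennreal ((1 - p powr (- (3 + k))) / (1 - p powr (- (1 + k)))) * ennreal (max 1 (N c) powr (-2))"
      unfolding m[symmetric] max.commute[of 1]
      using p_powr_less_1[of "3 + k"] p_powr_less_1[of "1 + k"] k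
      by (subst ennreal_mult[symmetric]) (auto simp: mult.commute intro!: divide_nonneg_nonneg)
    finally show "(\<integral>\<^sup>+y. ennreal (F (fst y, snd y, c)) \<partial>(\<mu> \<Otimes>\<^sub>M \<mu>)) =
        ennreal ((1 - p powr (- (3 + k))) / (1 - p powr (- (1 + k)))) * ennreal (max 1 (N c) powr (-2))" .
  qed
  also have "\<dots> = ennreal ((1 - p powr (- (3 + k))) / (1 - p powr (- (1 + k)))) *
      ennreal ((1 - p powr (-2)) / (1 - p powr (1 - 2)))"
    by (subst nn_integral_cmult) (measurable, subst nn_integral_N_powr, simp_all)
  also have "\<dots> = ennreal ((1 - p powr (-2)) / (1 - p powr (-1)) * ((1 - p powr (- (3 + k))) / (1 - p powr (- (1 + k)))))"
    using p_powr_less_1[of "3 + k"] p_powr_less_1[of "1 + k"] p_powr_less_1[of 1] p_powr_less_1[of 2] k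
    by (subst ennreal_mult[symmetric]) (auto simp: mult.commute intro!: divide_nonneg_nonneg)
  finally show ?thesis .
qed

end

lemma LINT_eq:
  assumes "f \<in> borel_measurable M" "\<And>x. f x \<ge> 0" "(\<integral>\<^sup>+x. ennreal (f x) \<partial>M) = ennreal r" "r \<ge> 0"
  shows "integral\<^sup>L M f = (r :: real)"
  using assms by (subst integral_eq_nn_integral) auto

lemma cancel_square: "K \<noteq> 0 \<Longrightarrow> K * X * (K * Y) / (K * K * Z) = X * Y / (Z :: real)"
  by (simp add: mult.left_commute mult.assoc)

context padic begin

lemma H_fin_measurable [measurable]:
  "(\<lambda>_. \<one>\<^bsub>Qp p\<^esub>) \<in> measurable M \<mu>" by simp

lemma measurable_of_rat [measurable]: "(\<lambda>_. padic_of_rat p q) \<in> measurable M \<mu>" by simp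

text \<open>Addition is x - (0 - y), so the measurability of subtraction suffices.\<close>

lemma measurable_add [measurable (raw)]:
  assumes [measurable]: "f \<in> measurable M \<mu>" "g \<in> measurable M \<mu>"
  shows "(\<lambda>x. f x \<oplus>\<^bsub>Qp p\<^esub> g x) \<in> measurable M \<mu>"
proof -
  have eq: "f x \<oplus>\<^bsub>Qp p\<^esub> g x = f x \<ominus>\<^bsub>Qp p\<^esub> (padic_of_rat p 0 \<ominus>\<^bsub>Qp p\<^esub> g x)" if x: "x \<in> space M" for x
  proof -
    obtain s where s: "s \<in> padic_cauchy p" "f x = cls s" using in_space_carrier[OF assms(1) x] by (rule carrier_cls)
    obtain t where t: "t \<in> padic_cauchy p" "g x = cls t" using in_space_carrier[OF assms(2) x] by (rule carrier_cls)
    show ?thesis unfolding s(2) t(2) of_rat_cls using s(1) t(1)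
      by (simp add: minus_cls add_cls Cauchy_diff Cauchy_minus)
  qed
  show ?thesis by (subst measurable_cong[OF eq]) measurable
qed

lemma tau_fin_measure:
  "measure (tau_fin p) (space (tau_fin p)) =
    (1 - p powr (-2)) / (1 - p powr (-1)) * ((1 - p powr (-3)) / (1 - p powr (-1)))"
proof -
  have "HE_fin p (a, b, c, \<one>\<^bsub>Qp p\<^esub>) powr (- 0) = 1" for a b c
    unfolding HE_fin_def H1_fin_max H2_fin_max N_one by (auto simp: max_def)
  hence "emeasure (tau_fin p) (space (tau_fin p)) =
      ennreal ((1 - p powr (-2)) / (1 - p powr (-1)) * ((1 - p powr (-3)) / (1 - p powr (-1))))"
    using nn_integral_tau_fin[of 0] by simp
  thus ?thesis using p_powr_less_1[of 3] p_powr_less_1[of 1] p_powr_less_1[of 2]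
    by (simp add: measure_def)
qed

lemma integral_tau_fin:
  assumes k: "k \<ge> 0"
  shows "(LINT (a, b, c)|tau_fin p. HE_fin p (a, b, c, \<one>\<^bsub>Qp p\<^esub>) powr (- k)) =
    (1 - p powr (-2)) / (1 - p powr (-1)) * ((1 - p powr (- (3 + k))) / (1 - p powr (- (1 + k))))"
  unfolding case_prod_beta'
proof (rule LINT_eq)
  show "(\<lambda>x. HE_fin p (fst x, fst (snd x), snd (snd x), \<one>\<^bsub>Qp p\<^esub>) powr (- k)) \<in> borel_measurable (tau_fin p)"
    unfolding tau_fin_def omega_fin_def HE_fin_def H1_fin_max H2_fin_max measurable_density_eq1 by measurable
qed (use nn_integral_tau_fin[OF k] p_powr_less_1[of "3 + k"] p_powr_less_1[of "1 + k"] p_powr_less_1[of 1] p_powr_less_1[of 2] k in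
    \<open>auto intro!: mult_nonneg_nonneg divide_nonneg_nonneg\<close>)

lemma N_act:
  assumes t: "t \<in> carrier (Qp p)" and u: "u \<in> carrier (Qp p)"
    and a: "v a \<le> 1" and c: "v c \<le> 1"
  shows "N (t \<otimes>\<^bsub>Qp p\<^esub> padic_of_rat p a \<oplus>\<^bsub>Qp p\<^esub> u \<otimes>\<^bsub>Qp p\<^esub> padic_of_rat p c) \<le> max (N t) (N u)"
proof -
  have "N (x \<otimes>\<^bsub>Qp p\<^esub> padic_of_rat p q) \<le> N x" if "x \<in> carrier (Qp p)" "v q \<le> 1" for x q
    unfolding N_mult[OF that(1) of_rat_carrier] N_of_rat by (rule mult_left_le[OF that(2) N_nonneg[OF that(1)]])
  from max.mono[OF this[OF t a] this[OF u c]] show ?thesis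
    by (rule order_trans[OF N_add[OF Q.m_closed[OF t of_rat_carrier] Q.m_closed[OF u of_rat_carrier]]])
qed

lemma N_act_minus:
  assumes t: "t \<in> carrier (Qp p)" and u: "u \<in> carrier (Qp p)"
    and a: "v a \<le> 1" and c: "v c \<le> 1"
  shows "N (t \<otimes>\<^bsub>Qp p\<^esub> padic_of_rat p a \<ominus>\<^bsub>Qp p\<^esub> u \<otimes>\<^bsub>Qp p\<^esub> padic_of_rat p c) \<le> max (N t) (N u)"
proof -
  have "N (x \<otimes>\<^bsub>Qp p\<^esub> padic_of_rat p q) \<le> N x" if "x \<in> carrier (Qp p)" "v q \<le> 1" for x q
    unfolding N_mult[OF that(1) of_rat_carrier] N_of_rat by (rule mult_left_le[OF that(2) N_nonneg[OF that(1)]])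
  from max.mono[OF this[OF t a] this[OF u c]] show ?thesis
    by (rule order_trans[OF N_minus[OF Q.m_closed[OF t of_rat_carrier] Q.m_closed[OF u of_rat_carrier]]])
qed

text \<open>A matrix in SL_2(Z) preserves the maximum norm on Q_p^2 and its rows have norm 1. So the
  first row of the product has norm max(|t|, |u|), the second has norm 1 and the determinant is t:
  the integrand does not depend on the matrix.\<close>

lemma integral_sigma_fin:
  fixes a b c d :: int
  assumes det: "a * d - b * c = 1"
  shows "(LINT h|sigma_fin p. inverse (height_fin p (P_act_fin p h (map_mat2 (padic_of_rat p) (map_mat2 of_int (a, b, c, d)))) (2, 1))) =
    (1 - p powr (-3)) / (1 - p powr (-1))"
proof -
  define A B C D where "A = (of_int a :: rat)" and "B = (of_int b :: rat)" and "C = (of_int c :: rat)" and "D = (of_int d :: rat)"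
  have det': "A * D - B * C = 1" unfolding A_def B_def C_def D_def of_int_mult[symmetric] of_int_diff[symmetric] det by simp
  have le: "v A \<le> 1" "v B \<le> 1" "v C \<le> 1" "v D \<le> 1" by (simp_all add: A_def B_def C_def D_def v_of_int_le)
  \<comment> \<open>Were both entries of the second row divisible by \<open>p\<close>, the
    determinant could not be 1.\<close>
  have CD: "max (v C) (v D) = 1"
  proof -
    have "v (A * D) \<le> v D" "v (B * C) \<le> v C" using le by (simp_all add: v_mult mult_left_le_one_le)
    hence "v (A * D - B * C) \<le> max (v C) (v D)" using v_diff[of "A * D" "B * C"] by linarith
    hence "1 \<le> max (v C) (v D)" by (simp only: det' v_1)
    thus ?thesis using le by (intro antisym max.boundedI)
  qed
  define f where "f h = inverse (height_fin p (P_act_fin p h (padic_of_rat p A, padic_of_rat p B, padic_of_rat p C, padic_of_rat p D)) (2, 1))" for h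
  define a' where "a' h = fst h \<otimes>\<^bsub>Qp p\<^esub> padic_of_rat p A \<oplus>\<^bsub>Qp p\<^esub> snd h \<otimes>\<^bsub>Qp p\<^esub> padic_of_rat p C" for h
  define b' where "b' h = fst h \<otimes>\<^bsub>Qp p\<^esub> padic_of_rat p B \<oplus>\<^bsub>Qp p\<^esub> snd h \<otimes>\<^bsub>Qp p\<^esub> padic_of_rat p D" for h
  have [measurable]: "a' \<in> measurable (\<mu> \<Otimes>\<^sub>M \<mu>) \<mu>" unfolding a'_def by measurable
  have [measurable]: "b' \<in> measurable (\<mu> \<Otimes>\<^sub>M \<mu>) \<mu>" unfolding b'_def by measurable
  have act: "P_act_fin p h (padic_of_rat p A, padic_of_rat p B, padic_of_rat p C, padic_of_rat p D) =
      (a' h, b' h, padic_of_rat p C, padic_of_rat p D)" for h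
    by (cases h) (simp add: a'_def b'_def)
  have f: "f h = inverse ((max (v C) (v D) * max (N (a' h)) (max (N (b' h)) (max (v C) (v D))) /
      N (a' h \<otimes>\<^bsub>Qp p\<^esub> padic_of_rat p D \<ominus>\<^bsub>Qp p\<^esub> b' h \<otimes>\<^bsub>Qp p\<^esub> padic_of_rat p C)) powr 2 *
      (max (N (a' h)) (max (N (b' h)) (max (v C) (v D))) / max (v C) (v D)) powr 1)" for h
    by (simp only: f_def act height_fin_def HD_fin_def HE_fin_def H1_fin_max H2_fin_max absdet_fin.simps prod.case N_of_rat)
  have mf [measurable]: "f \<in> borel_measurable (\<mu> \<Otimes>\<^sub>M \<mu>)"
    unfolding f[abs_def] by measurable
  have m1: "(\<lambda>(t, u). ennreal (1 / (N t)\<^sup>2)) \<in> borel_measurable (\<mu> \<Otimes>\<^sub>M \<mu>)" by measurable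
  have pt: "1 / (N t)\<^sup>2 * f (t, u) = max 1 (max (N t) (N u)) powr (-3)"
    if tu: "t \<in> carrier (Qp p)" "u \<in> carrier (Qp p)" and nz: "t \<noteq> \<zero>\<^bsub>Qp p\<^esub>" for t u
  proof -
      have t0: "N t > 0" using nz N_nonneg[OF tu(1)] N_eq_0[OF tu(1)] by (simp add: order.strict_iff_order)
      obtain s where s: "s \<in> padic_cauchy p" "t = cls s" using tu(1) by (rule carrier_cls)
      obtain r where r: "r \<in> padic_cauchy p" "u = cls r" using tu(2) by (rule carrier_cls)
      \<comment> \<open>The inverse matrix recovers t and u from the new first row. Its entries are
        integral too, which gives the reverse inequality of norms.\<close>
      have e: "(s * A + r * C) * D - (s * B + r * D) * C = s" "(s * B + r * D) * A - (s * A + r * C) * B = r" for s r :: rat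
      proof -
        have "(s * A + r * C) * D - (s * B + r * D) * C = s * (A * D - B * C)"
          "(s * B + r * D) * A - (s * A + r * C) * B = r * (A * D - B * C)" by (simp_all add: algebra_simps)
        thus "(s * A + r * C) * D - (s * B + r * D) * C = s" "(s * B + r * D) * A - (s * A + r * C) * B = r"
          by (simp_all only: det' mult_1_right)
      qed
      have ct: "a' (t, u) \<otimes>\<^bsub>Qp p\<^esub> padic_of_rat p D \<ominus>\<^bsub>Qp p\<^esub> b' (t, u) \<otimes>\<^bsub>Qp p\<^esub> padic_of_rat p C = t"
        unfolding a'_def b'_def fst_conv snd_conv s(2) r(2) of_rat_cls using s(1) r(1)
        by (simp add: mult_cls add_cls minus_cls Cauchy_mult Cauchy_add Cauchy_diff e)
      have cu: "b' (t, u) \<otimes>\<^bsub>Qp p\<^esub> padic_of_rat p A \<ominus>\<^bsub>Qp p\<^esub> a' (t, u) \<otimes>\<^bsub>Qp p\<^esub> padic_of_rat p B = u"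
        unfolding a'_def b'_def fst_conv snd_conv s(2) r(2) of_rat_cls using s(1) r(1)
        by (simp add: mult_cls add_cls minus_cls Cauchy_mult Cauchy_add Cauchy_diff e)
      have ab: "a' (t, u) \<in> carrier (Qp p)" "b' (t, u) \<in> carrier (Qp p)" using tu by (simp_all add: a'_def b'_def)
      have "N (a' (t, u)) \<le> max (N t) (N u)" "N (b' (t, u)) \<le> max (N t) (N u)"
        unfolding a'_def b'_def fst_conv snd_conv by (rule N_act[OF tu le(1,3)], rule N_act[OF tu le(2,4)])
      moreover have "N t \<le> max (N (a' (t, u))) (N (b' (t, u)))"
        using N_act_minus[OF ab le(4,3)] unfolding ct .
      moreover have "N u \<le> max (N (b' (t, u))) (N (a' (t, u)))"
        using N_act_minus[OF ab(2,1) le(1,2)] unfolding cu .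
      ultimately have "max (N (a' (t, u))) (N (b' (t, u))) = max (N t) (N u)"
        by (intro antisym max.boundedI) (simp_all only: max.commute)
      hence mx: "max (N (a' (t, u))) (max (N (b' (t, u))) 1) = max 1 (max (N t) (N u))"
        by (simp only: max.assoc[symmetric] max.commute[of 1])
      define H where "H = max 1 (max (N t) (N u))"
      have H: "H > 0" by (simp add: H_def less_max_iff_disj)
      have "f (t, u) = inverse ((1 * H / N t) powr 2 * (H / 1) powr 1)"
        by (simp only: f CD ct mx H_def)
      hence "1 / (N t)\<^sup>2 * f (t, u) = H powr (-3)"
        using tau_density_eq[of 1 H "N t" 0] H t0 by simp
      thus "1 / (N t)\<^sup>2 * f (t, u) = max 1 (max (N t) (N u)) powr (-3)" by (simp only: H_def)
  qed
  have "(\<integral>\<^sup>+h. ennreal (f h) \<partial>sigma_fin p) = (\<integral>\<^sup>+h. (case h of (t, u) \<Rightarrow> ennreal (1 / (N t)\<^sup>2)) * ennreal (f h) \<partial>(\<mu> \<Otimes>\<^sub>M \<mu>))"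
    unfolding sigma_fin_def by (subst nn_integral_density, rule m1, measurable)
  also have "\<dots> = (\<integral>\<^sup>+y. ennreal (max (real p ^ 0) (max (N (fst y)) (N (snd y))) powr (- 3)) \<partial>(\<mu> \<Otimes>\<^sub>M \<mu>))"
  proof (rule nn_integral_cong_AE)
    have eq: "(case h of (t, u) \<Rightarrow> ennreal (1 / (N t)\<^sup>2)) * ennreal (f h) =
        ennreal (max (real p ^ 0) (max (N (fst h)) (N (snd h))) powr (- 3))"
      if "fst h \<noteq> \<zero>\<^bsub>Qp p\<^esub>" "h \<in> space (\<mu> \<Otimes>\<^sub>M \<mu>)" for h
    proof -
      have tu: "fst h \<in> carrier (Qp p)" "snd h \<in> carrier (Qp p)"
        using that(2) by (simp_all add: space_pair_measure mem_Times_iff)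
      have "(case h of (t, u) \<Rightarrow> ennreal (1 / (N t)\<^sup>2)) * ennreal (f h) =
          ennreal (1 / (N (fst h))\<^sup>2 * f (fst h, snd h))"
        by (cases h) (simp only: prod.case fst_conv snd_conv, rule ennreal_mult'[symmetric], simp)
      thus ?thesis unfolding pt[OF tu that(1)] by (simp only: power_0)
    qed
    have "AE x in \<mu> \<Otimes>\<^sub>M \<mu>. fst x \<noteq> \<zero>\<^bsub>Qp p\<^esub>"
    proof (rule haar2.AE_pair_measure)
      have "{x \<in> space (\<mu> \<Otimes>\<^sub>M \<mu>). N (fst x) \<noteq> 0} \<in> sets (\<mu> \<Otimes>\<^sub>M \<mu>)" by measurable
      also have "{x \<in> space (\<mu> \<Otimes>\<^sub>M \<mu>). N (fst x) \<noteq> 0} = {x \<in> space (\<mu> \<Otimes>\<^sub>M \<mu>). fst x \<noteq> \<zero>\<^bsub>Qp p\<^esub>}"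
        by (intro Collect_cong conj_cong refl) (simp add: space_pair_measure mem_Times_iff N_eq_0)
      finally show "{x \<in> space (\<mu> \<Otimes>\<^sub>M \<mu>). fst x \<noteq> \<zero>\<^bsub>Qp p\<^esub>} \<in> sets (\<mu> \<Otimes>\<^sub>M \<mu>)" .
      show "AE x in \<mu>. AE y in \<mu>. fst (x, y) \<noteq> \<zero>\<^bsub>Qp p\<^esub>"
        unfolding fst_conv using AE_neq[of "\<zero>\<^bsub>Qp p\<^esub>"] by eventually_elim (rule AE_I2)
    qed
    moreover have "AE x in \<mu> \<Otimes>\<^sub>M \<mu>. x \<in> space (\<mu> \<Otimes>\<^sub>M \<mu>)" by (rule AE_I2)
    ultimately show "AE h in \<mu> \<Otimes>\<^sub>M \<mu>. (case h of (t, u) \<Rightarrow> ennreal (1 / (N t)\<^sup>2)) * ennreal (f h) =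
        ennreal (max (real p ^ 0) (max (N (fst h)) (N (snd h))) powr (- 3))"
      by eventually_elim (rule eq)
  qed
  also have "\<dots> = ennreal ((1 - p powr (-3)) / (1 - p powr (-1)))"
    by (subst nn_integral_N2_powr) simp_all
  finally have eq: "(\<integral>\<^sup>+h. ennreal (f h) \<partial>sigma_fin p) = ennreal ((1 - p powr (-3)) / (1 - p powr (-1)))" .
  have "integral\<^sup>L (sigma_fin p) f = (1 - p powr (-3)) / (1 - p powr (-1))"
  proof (rule LINT_eq[OF _ _ eq])
    show "f \<in> borel_measurable (sigma_fin p)" unfolding sigma_fin_def measurable_density_eq1 by measurable
    show "f h \<ge> 0" for h unfolding f by simp
  qed (use p_powr_less_1[of 3] p_powr_less_1[of 1] in auto)
  thus ?thesis unfolding f_def[abs_def] A_def B_def C_def D_def map_mat2.simps .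
qed

section \<open>Heights of rational matrices and the product formula\<close>

lemma max_v_gcd: "max (v (of_int c)) (v (of_int d)) = v (of_int (gcd c d))"
proof (cases "c = 0 \<and> d = 0")
  case False
  define g where "g = gcd c d"
  have g: "g \<noteq> 0" using False by (simp add: g_def)
  obtain c' d' where cd: "c = g * c'" "d = g * d'" "coprime c' d'"
    using gcd_coprime_exists[of c d] g unfolding g_def by (metis mult.commute)
  have "\<not> (int p dvd c' \<and> int p dvd d')"
    using cd(3) prime by (metis coprime_common_divisor not_prime_unit prime_nat_int_transfer)
  hence "\<not> (v (of_int c') < 1 \<and> v (of_int d') < 1)"
    using v_less_1 v_int_dvd[of _ 1] by (force simp: power_int_minus field_simps)
  hence "max (v (of_int c')) (v (of_int d')) = 1" using v_of_int_le[of c'] v_of_int_le[of d'] by linarith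
  hence "max (v (of_int g) * v (of_int c')) (v (of_int g) * v (of_int d')) = v (of_int g)"
    using max_mult_distrib_left[of "v (of_int g)" "v (of_int c')" "v (of_int d')"] by simp
  moreover have "v (of_int c) = v (of_int g) * v (of_int c')" "v (of_int d) = v (of_int g) * v (of_int d')"
    unfolding v_mult[symmetric] of_int_mult[symmetric] cd(1,2)[symmetric] by (rule refl)+
  ultimately show ?thesis unfolding g_def[symmetric] by simp
qed simp

lemma height_fin_rat:
  "height_fin p (map_mat2 (padic_of_rat p) (a, b, c, d)) (s, w) =
    (max (v c) (v d) * max (v a) (max (v b) (max (v c) (v d))) / v (a * d - b * c)) powr s *
    (max (v a) (max (v b) (max (v c) (v d))) / max (v c) (v d)) powr w"
proof -
  have "padic_of_rat p a \<otimes>\<^bsub>Qp p\<^esub> padic_of_rat p d \<ominus>\<^bsub>Qp p\<^esub> padic_of_rat p b \<otimes>\<^bsub>Qp p\<^esub> padic_of_rat p c =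
      padic_of_rat p (a * d - b * c)"
    by (simp add: of_rat_cls mult_cls minus_cls)
  thus ?thesis
    by (simp only: map_mat2.simps height_fin_def HD_fin_def HE_fin_def H1_fin_max H2_fin_max absdet_fin.simps prod.case N_of_rat)
qed

lemma height_fin_scale:
  assumes "k \<noteq> 0"
  shows "height_fin p (map_mat2 (padic_of_rat p) (k * a, k * b, k * c, k * d)) sw =
    height_fin p (map_mat2 (padic_of_rat p) (a, b, c, d)) sw"
proof -
  have k: "v k > 0" using assms by (rule v_pos)
  have det: "k * a * (k * d) - k * b * (k * c) = k * k * (a * d - b * c)" by (simp add: algebra_simps)
  have mx: "max (v k * x) (v k * y) = v k * max x y" for x y
    using k max_mult_distrib_left[of "v k" x y] by simp
  have k0: "v k \<noteq> 0" using k by (metis less_irrefl)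
  obtain s w where sw: "sw = (s, w)" by (cases sw)
  show ?thesis unfolding sw height_fin_rat det v_mult mx cancel_square[OF k0]
      mult_divide_mult_cancel_left[OF k0] ..
qed

text \<open>For a primitive integer matrix with second row g (c, d), where c and d are coprime, the
  norm of the matrix is 1 at \<open>p\<close>, that of the second row is |g|, and the determinant is
  g (a d - b c).\<close>

lemma height_fin_prim:
  assumes cop: "coprime c d" and g: "g > 0" and gcd: "gcd a (gcd b g) = 1"
    and det: "a * d - b * c \<noteq> 0"
  shows "height_fin p (map_mat2 (padic_of_rat p) (map_mat2 of_int (a, b, g * c, g * d))) (s, w) =
    v (of_int g) powr (s - w) * v (of_int (g * (a * d - b * c))) powr (- s)"
proof -
  have gc: "gcd (g * c) (g * d) = g" using cop g by (simp add: gcd_mult_distrib_int[symmetric])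
  have m1: "max (v (of_int (g * c))) (v (of_int (g * d))) = v (of_int g)" by (simp only: max_v_gcd gc)
  have m2: "max (v (of_int a)) (max (v (of_int b)) (v (of_int g))) = 1" by (simp only: max_v_gcd gcd) simp
  have pos: "v (of_int g) > 0" "v (of_int (g * (a * d - b * c))) > 0" proof -
    have "g * (a * d - b * c) \<noteq> 0" using g det by simp
    hence "(of_int (g * (a * d - b * c)) :: rat) \<noteq> 0" by (simp only: of_int_eq_0_iff not_False_eq_True)
    thus "v (of_int (g * (a * d - b * c))) > 0" by (rule v_pos)
    show "v (of_int g) > 0" using g by (intro v_pos) simp
  qed
  have e: "of_int a * of_int (g * d) - of_int b * of_int (g * c) = (of_int (g * (a * d - b * c)) :: rat)"
    by (simp add: algebra_simps)
  show ?thesis unfolding map_mat2.simps[of of_int] height_fin_rat m1 m2 e using pos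
    by (simp add: powr_divide powr_diff powr_minus field_simps)
qed

end

lemma rat_padic_abs_nonneg: "prime p \<Longrightarrow> rat_padic_abs p q \<ge> 0"
  by (rule padic.v_nonneg) (rule padic.intro)

lemma rat_padic_abs_of_int:
  assumes p: "prime p" and k: "k \<noteq> 0"
  shows "rat_padic_abs p (of_int k) = 1 / real (p ^ multiplicity p (nat \<bar>k\<bar>))"
proof -
  have dv: "int p ^ n dvd k \<longleftrightarrow> p ^ n dvd nat \<bar>k\<bar>" for n
    by (metis int_dvd_int_iff int_nat_eq abs_ge_zero dvd_abs_iff of_nat_power)
  have "multiplicity (int p) k = multiplicity p (nat \<bar>k\<bar>)"
    unfolding multiplicity_def dv ..
  thus ?thesis using padic.v_of_int[OF padic.intro[OF p] k] by (simp add: power_int_minus inverse_eq_divide)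
qed

text \<open>The product formula. Away from the primes dividing \<open>m * n\<close> all factors are
  1, so the product is finite, and the prime factorization evaluates it.\<close>

lemma euler_prod_padic_abs:
  fixes m n :: int
  assumes "m \<noteq> 0" "n \<noteq> 0"
  shows "euler_prod (\<lambda>p. rat_padic_abs p (of_int m) powr s * rat_padic_abs p (of_int n) powr w) =
    \<bar>real_of_int m\<bar> powr (- s) * \<bar>real_of_int n\<bar> powr (- w)"
proof -
  define S where "S = {p. prime p \<and> p dvd nat \<bar>m * n\<bar>}"
  have mn: "nat \<bar>m * n\<bar> \<noteq> 0" using assms by simp
  have fin: "finite S" using finite_prime_divisors[OF mn] by (simp add: S_def)
  have one: "rat_padic_abs p (of_int k) = 1" if p: "prime p" "p \<notin> S" and k: "k \<noteq> 0" "k dvd m * n" for p k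
  proof -
    have "nat \<bar>k\<bar> dvd nat \<bar>m * n\<bar>" using k(2) by (simp add: nat_abs_dvd_iff dvd_nat_abs_iff)
    hence "\<not> p dvd nat \<bar>k\<bar>" using p by (auto simp: S_def intro: dvd_trans)
    thus ?thesis using rat_padic_abs_of_int[OF p(1) k(1)] by (simp add: not_dvd_imp_multiplicity_0)
  qed
  have prodS: "(\<Prod>p\<in>S. rat_padic_abs p (of_int k)) = 1 / \<bar>real_of_int k\<bar>" if k: "k \<noteq> 0" "k dvd m * n" for k
  proof -
    have "rat_padic_abs p (of_int k) = 1 / real (p ^ multiplicity p (nat \<bar>k\<bar>))" if "p \<in> S" for p
      using that k by (intro rat_padic_abs_of_int) (simp_all add: S_def)
    hence "(\<Prod>p\<in>S. rat_padic_abs p (of_int k)) = 1 / real (\<Prod>p\<in>S. p ^ multiplicity p (nat \<bar>k\<bar>))"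
      by (simp add: prod_dividef)
    also have "(\<Prod>p\<in>S. p ^ multiplicity p (nat \<bar>k\<bar>)) = (\<Prod>p\<in>prime_factors (nat \<bar>k\<bar>). p ^ multiplicity p (nat \<bar>k\<bar>))"
    proof (rule prod.mono_neutral_right[OF fin])
      show "prime_factors (nat \<bar>k\<bar>) \<subseteq> S"
      proof
        fix q assume q: "q \<in> prime_factors (nat \<bar>k\<bar>)"
        hence "q dvd nat \<bar>k\<bar>" "prime q" by auto
        moreover have "nat \<bar>k\<bar> dvd nat \<bar>m * n\<bar>" using k by (simp add: nat_abs_dvd_iff dvd_nat_abs_iff)
        ultimately show "q \<in> S" unfolding S_def using dvd_trans by blast
      qed
      show "\<forall>i\<in>S - prime_factors (nat \<bar>k\<bar>). i ^ multiplicity i (nat \<bar>k\<bar>) = 1"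
        using k by (auto simp: S_def prime_factors_dvd not_dvd_imp_multiplicity_0)
    qed
    also have "\<dots> = nat \<bar>k\<bar>" using prod_prime_factors[of "nat \<bar>k\<bar>"] k by simp
    finally show ?thesis by simp
  qed
  have "euler_prod (\<lambda>p. rat_padic_abs p (of_int m) powr s * rat_padic_abs p (of_int n) powr w) =
      (\<Prod>p\<in>S. if prime p then rat_padic_abs p (of_int m) powr s * rat_padic_abs p (of_int n) powr w else 1)"
    unfolding euler_prod_def using fin one assms by (intro prodinf_finite) auto
  also have "\<dots> = (\<Prod>p\<in>S. rat_padic_abs p (of_int m) powr s * rat_padic_abs p (of_int n) powr w)"
    by (intro prod.cong) (auto simp: S_def)
  also have "\<dots> = (\<Prod>p\<in>S. rat_padic_abs p (of_int m)) powr s * (\<Prod>p\<in>S. rat_padic_abs p (of_int n)) powr w"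
  proof -
    have "rat_padic_abs p q \<ge> 0" if "p \<in> S" for p q
      using that by (intro rat_padic_abs_nonneg) (simp add: S_def)
    thus ?thesis by (simp add: prod.distrib prod_powr_distrib)
  qed
  also have "\<dots> = \<bar>real_of_int m\<bar> powr (- s) * \<bar>real_of_int n\<bar> powr (- w)"
    using assms by (simp add: prodS powr_divide powr_minus inverse_eq_divide)
  finally show ?thesis .
qed

lemma euler_prod_cong: "(\<And>p. prime p \<Longrightarrow> f p = g p) \<Longrightarrow> euler_prod f = euler_prod g"
  unfolding euler_prod_def by (metis (mono_tags, lifting))

text \<open>\<open>HE\<close> and \<open>HD\<close> are homogeneous of degree zero, so each local
  factor is invariant by itself.\<close>

lemma height_scale:
  assumes "k \<noteq> 0"
  shows "height (k * a, k * b, k * c, k * d) sw = height (a, b, c, d) sw"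
proof -
  have "euler_prod (\<lambda>p. height_fin p (map_mat2 (padic_of_rat p) (k * a, k * b, k * c, k * d)) sw) =
      euler_prod (\<lambda>p. height_fin p (map_mat2 (padic_of_rat p) (a, b, c, d)) sw)"
    by (rule euler_prod_cong, rule padic.height_fin_scale[OF padic.intro assms])
  moreover have "height_inf (map_mat2 of_rat (k * a, k * b, k * c, k * d)) sw = height_inf (map_mat2 of_rat (a, b, c, d)) sw"
  proof -
    define r where "r = (of_rat k :: real)"
    have r: "r \<noteq> 0" using assms by (simp add: r_def)
    have "H1_inf (r * a, r * b, r * c, r * d) = \<bar>r\<bar> * H1_inf (a, b, c, d)" for a b c d
      by (simp add: power_mult_distrib distrib_left[symmetric] real_sqrt_mult)
    moreover have "H2_inf (r * a, r * b, r * c, r * d) = \<bar>r\<bar> * H2_inf (a, b, c, d)" for a b c d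
      by (simp add: power_mult_distrib distrib_left[symmetric] real_sqrt_mult)
    moreover have "absdet_inf (r * a, r * b, r * c, r * d) = \<bar>r\<bar> * \<bar>r\<bar> * absdet_inf (a, b, c, d)" for a b c d
    proof -
      have "r * a * (r * d) - r * b * (r * c) = r * r * (a * d - b * c)" by (simp add: algebra_simps)
      thus ?thesis by (simp add: abs_mult)
    qed
    moreover have "\<bar>r\<bar> \<noteq> 0" using r by simp
    ultimately show ?thesis
      by (simp only: map_mat2.simps of_rat_mult r_def[symmetric] height_inf_def HD_inf_def HE_inf_def
          cancel_square mult_divide_mult_cancel_left not_False_eq_True)
  qed
  ultimately show ?thesis by (simp only: height_def)
qed

text \<open>The finite places contribute g^(y-x) |D|^x with D the determinant of the matrix. This
  cancels the determinant and the powers of g at the real place and leaves a product of two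
  Euclidean norms.\<close>

lemma height_prim:
  fixes a b c d g :: int
  assumes cop: "coprime c d" and g: "g > 0" and gcd: "gcd a (gcd b g) = 1"
    and det: "a * d - b * c \<noteq> 0"
  shows "height (map_mat2 of_int (a, b, g * c, g * d)) (x, y) =
    sqrt (real_of_int (c\<^sup>2 + d\<^sup>2)) powr (x - y) * sqrt (real_of_int (a\<^sup>2 + b\<^sup>2 + g\<^sup>2 * (c\<^sup>2 + d\<^sup>2))) powr (x + y)"
proof -
  define D where "D = g * (a * d - b * c)"
  have D: "D \<noteq> 0" using g det by (simp add: D_def)
  define q where "q = sqrt (real_of_int (c\<^sup>2 + d\<^sup>2))"
  define H where "H = sqrt (real_of_int (a\<^sup>2 + b\<^sup>2 + g\<^sup>2 * (c\<^sup>2 + d\<^sup>2)))"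
  have "c \<noteq> 0 \<or> d \<noteq> 0" using cop by auto
  hence cd: "c\<^sup>2 + d\<^sup>2 > 0" by (simp add: sum_power2_gt_zero_iff)
  hence q: "q > 0" unfolding q_def by (metis of_int_0_less_iff real_sqrt_gt_zero)
  have "a\<^sup>2 + b\<^sup>2 + g\<^sup>2 * (c\<^sup>2 + d\<^sup>2) > 0" using g by (intro add_nonneg_pos mult_pos_pos cd) simp_all
  hence H: "H > 0" unfolding H_def by (metis of_int_0_less_iff real_sqrt_gt_zero)
  have "euler_prod (\<lambda>p. height_fin p (map_mat2 (padic_of_rat p) (map_mat2 of_int (a, b, g * c, g * d))) (x, y)) =
      euler_prod (\<lambda>p. rat_padic_abs p (of_int g) powr (x - y) * rat_padic_abs p (of_int D) powr (- x))"
    unfolding D_def by (rule euler_prod_cong, rule padic.height_fin_prim[OF padic.intro cop g gcd det])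
  also have "\<dots> = \<bar>real_of_int g\<bar> powr (- (x - y)) * \<bar>real_of_int D\<bar> powr (- (- x))"
    using D g by (intro euler_prod_padic_abs) auto
  finally have fin: "euler_prod (\<lambda>p. height_fin p (map_mat2 (padic_of_rat p) (map_mat2 of_int (a, b, g * c, g * d))) (x, y)) =
      real_of_int g powr (y - x) * \<bar>real_of_int D\<bar> powr x" using g by simp
  have "H1_inf (map_mat2 of_rat (map_mat2 of_int (a, b, g * c, g * d))) = sqrt ((real_of_int g)\<^sup>2 * real_of_int (c\<^sup>2 + d\<^sup>2))"
    by (simp add: power_mult_distrib distrib_left of_rat_mult)
  hence h1: "H1_inf (map_mat2 of_rat (map_mat2 of_int (a, b, g * c, g * d))) = g * q"
    using g by (simp add: real_sqrt_mult q_def)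
  have h2: "H2_inf (map_mat2 of_rat (map_mat2 of_int (a, b, g * c, g * d))) = H"
    by (simp add: H_def power_mult_distrib distrib_left of_rat_mult algebra_simps)
  have h3: "absdet_inf (map_mat2 of_rat (map_mat2 of_int (a, b, g * c, g * d))) = \<bar>real_of_int D\<bar>"
    by (simp add: D_def algebra_simps of_rat_mult)
  have inf: "height_inf (map_mat2 of_rat (map_mat2 of_int (a, b, g * c, g * d))) (x, y) =
      (g * q * H / \<bar>real_of_int D\<bar>) powr x * (H / (g * q)) powr y"
    by (simp only: height_inf_def HD_inf_def HE_inf_def h1 h2 h3 prod.case)
  have "height (map_mat2 of_int (a, b, g * c, g * d)) (x, y) =
      (g * q * H / \<bar>real_of_int D\<bar>) powr x * (H / (g * q)) powr y * (real_of_int g powr (y - x) * \<bar>real_of_int D\<bar> powr x)"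
    by (simp only: height_def inf fin)
  also have "\<dots> = q powr (x - y) * H powr (x + y)"
    using q H D g by (simp add: powr_mult powr_divide powr_diff powr_add field_simps)
  finally show ?thesis by (simp only: q_def H_def)
qed

section \<open>Local densities at the real place\<close>

lemma nn_integral_powr_atLeast:
  assumes "\<sigma> > 0" "m > 0"
  shows "(\<integral>\<^sup>+l. ennreal (\<sigma> * l powr (- \<sigma> - 1)) * indicator {m..} l \<partial>lborel) = ennreal (m powr (- \<sigma>))"
proof -
  have "(\<integral>\<^sup>+l. ennreal (\<sigma> * l powr (- \<sigma> - 1)) * indicator {m..} l \<partial>lborel) = ennreal (0 - (- (m powr (- \<sigma>))))"
  proof (rule nn_integral_FTC_atLeast)
    show "((\<lambda>l. - (l powr (- \<sigma>))) has_real_derivative \<sigma> * x powr (- \<sigma> - 1)) (at x)" if "m \<le> x" for x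
      using that assms by (auto intro!: derivative_eq_intros)
    have "((\<lambda>l::real. l powr (- \<sigma>)) \<longlongrightarrow> 0) at_top"
      using assms by (intro tendsto_neg_powr filterlim_ident) auto
    from tendsto_minus[OF this] show "((\<lambda>l. - (l powr (- \<sigma>))) \<longlongrightarrow> 0) at_top" by simp
  qed (use assms in auto)
  thus ?thesis by simp
qed

lemma nn_integral_disc_weight:
  fixes M \<sigma> :: real
  assumes \<sigma>: "\<sigma> > 1" and M: "M > 0"
  shows "(\<integral>\<^sup>+l. ennreal (\<sigma> * l powr (- \<sigma> - 1) * (pi * (l - M\<^sup>2))) * indicator {M\<^sup>2..} l \<partial>lborel) =
    ennreal (pi / (\<sigma> - 1) * M powr (2 - 2 * \<sigma>))"
proof -
  define F where "F l = pi * (\<sigma> / (1 - \<sigma>) * l powr (1 - \<sigma>) + M\<^sup>2 * l powr (- \<sigma>))" for l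
  have "(\<integral>\<^sup>+l. ennreal (\<sigma> * l powr (- \<sigma> - 1) * (pi * (l - M\<^sup>2))) * indicator {M\<^sup>2..} l \<partial>lborel) = ennreal (0 - F (M\<^sup>2))"
  proof (rule nn_integral_FTC_atLeast)
    show "(F has_real_derivative \<sigma> * x powr (- \<sigma> - 1) * (pi * (x - M\<^sup>2))) (at x)" if "M\<^sup>2 \<le> x" for x
    proof -
      have x: "x > 0" using that M by (meson less_le_trans zero_less_power)
      have D: "(F has_real_derivative pi * (\<sigma> / (1 - \<sigma>) * ((1 - \<sigma>) * x powr (1 - \<sigma> - 1)) + M\<^sup>2 * (- \<sigma> * x powr (- \<sigma> - 1)))) (at x)"
        unfolding F_def by (intro DERIV_cmult DERIV_add has_real_derivative_powr x)
      have "x powr (- \<sigma>) = x powr (- \<sigma> - 1) * x" using x by (simp add: powr_diff)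
      have "pi * (\<sigma> / (1 - \<sigma>) * ((1 - \<sigma>) * x powr (1 - \<sigma> - 1)) + M\<^sup>2 * (- \<sigma> * x powr (- \<sigma> - 1))) =
          \<sigma> * x powr (- \<sigma> - 1) * (pi * (x - M\<^sup>2))"
      proof -
        have e: "\<sigma> / (1 - \<sigma>) * ((1 - \<sigma>) * y) = \<sigma> * y" for y using \<sigma> by simp
        have Y: "x powr (1 - \<sigma> - 1) = x powr (- \<sigma> - 1) * x"
          using \<open>x powr (- \<sigma>) = x powr (- \<sigma> - 1) * x\<close> by simp
        show ?thesis unfolding e Y by (simp add: algebra_simps)
      qed
      with D show ?thesis by (rule DERIV_cong)
    qed
    have "((\<lambda>l::real. l powr (1 - \<sigma>)) \<longlongrightarrow> 0) at_top" "((\<lambda>l::real. l powr (- \<sigma>)) \<longlongrightarrow> 0) at_top"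
      using \<sigma> by (auto intro!: tendsto_neg_powr filterlim_ident)
    hence "((\<lambda>l. pi * (\<sigma> / (1 - \<sigma>) * l powr (1 - \<sigma>) + M\<^sup>2 * l powr (- \<sigma>))) \<longlongrightarrow> pi * (\<sigma> / (1 - \<sigma>) * 0 + M\<^sup>2 * 0)) at_top"
      by (intro tendsto_intros)
    thus "(F \<longlongrightarrow> 0) at_top" by (simp add: F_def[abs_def])
  qed (use \<sigma> in auto)
  also have "0 - F (M\<^sup>2) = pi / (\<sigma> - 1) * M powr (2 - 2 * \<sigma>)"
  proof -
    have p: "(M\<^sup>2) powr e = M powr (2 * e)" for e using M by (simp add: powr_powr[symmetric] powr_numeral)
    have "M\<^sup>2 * (M\<^sup>2) powr (- \<sigma>) = M powr (2 - 2 * \<sigma>)"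
      unfolding p using M by (simp add: powr_diff powr_minus powr_numeral field_simps)
    moreover have "(M\<^sup>2) powr (1 - \<sigma>) = M powr (2 - 2 * \<sigma>)" unfolding p by (simp add: algebra_simps)
    ultimately have "F (M\<^sup>2) = pi * (\<sigma> / (1 - \<sigma>) + 1) * M powr (2 - 2 * \<sigma>)" by (simp add: F_def algebra_simps)
    also have "\<sigma> / (1 - \<sigma>) + 1 = - (1 / (\<sigma> - 1))" using \<sigma> by (simp add: field_simps)
    finally show ?thesis by simp
  qed
  finally show ?thesis .
qed

text \<open>Layer cake: the power is written as an integral over levels l of the density \<sigma>
  l^(-\<sigma>-1). After the exchange of integrals the set below level l is a disc of area \<pi> (l
  - M^2), and a one-dimensional integral is left.\<close>

lemma nn_integral_plane_powr:
  fixes M \<sigma> :: real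
  assumes \<sigma>: "\<sigma> > 1" and M: "M > 0"
  shows "(\<integral>\<^sup>+y. ennreal ((M\<^sup>2 + (norm y)\<^sup>2) powr (- \<sigma>)) \<partial>(lborel :: (real \<times> real) measure)) =
    ennreal (pi / (\<sigma> - 1) * M powr (2 - 2 * \<sigma>))"
proof -
  let ?c = "\<lambda>l::real. ennreal (\<sigma> * l powr (- \<sigma> - 1))"
  have "(\<integral>\<^sup>+y. ennreal ((M\<^sup>2 + (norm y)\<^sup>2) powr (- \<sigma>)) \<partial>(lborel :: (real \<times> real) measure)) =
      (\<integral>\<^sup>+y. (\<integral>\<^sup>+l. ?c l * indicator {M\<^sup>2 + (norm y)\<^sup>2..} l \<partial>lborel) \<partial>(lborel :: (real \<times> real) measure))"
    using \<sigma> M by (intro nn_integral_cong nn_integral_powr_atLeast[symmetric] add_pos_nonneg) auto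
  also have "\<dots> = (\<integral>\<^sup>+y. (\<integral>\<^sup>+l. (if M\<^sup>2 + (norm y)\<^sup>2 \<le> l then ?c l else 0) \<partial>lborel) \<partial>(lborel :: (real \<times> real) measure))"
    by (intro nn_integral_cong) (auto split: split_indicator)
  also have "\<dots> = (\<integral>\<^sup>+l. (\<integral>\<^sup>+y. (if M\<^sup>2 + (norm y)\<^sup>2 \<le> l then ?c l else 0) \<partial>(lborel :: (real \<times> real) measure)) \<partial>lborel)"
    by (rule lborel_pair.Fubini') measurable
  also have "\<dots> = (\<integral>\<^sup>+l. ennreal (\<sigma> * l powr (- \<sigma> - 1) * (pi * (l - M\<^sup>2))) * indicator {M\<^sup>2..} l \<partial>lborel)"
  proof (rule nn_integral_cong)
    fix l :: real
    show "(\<integral>\<^sup>+y. (if M\<^sup>2 + (norm y)\<^sup>2 \<le> l then ?c l else 0) \<partial>(lborel :: (real \<times> real) measure)) =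
      ennreal (\<sigma> * l powr (- \<sigma> - 1) * (pi * (l - M\<^sup>2))) * indicator {M\<^sup>2..} l"
    proof (cases "M\<^sup>2 \<le> l")
      case True
      have "M\<^sup>2 + (norm y)\<^sup>2 \<le> l \<longleftrightarrow> norm y \<le> sqrt (l - M\<^sup>2)" for y :: "real \<times> real"
      proof -
        have "norm y \<le> sqrt (l - M\<^sup>2) \<longleftrightarrow> sqrt ((norm y)\<^sup>2) \<le> sqrt (l - M\<^sup>2)" by simp
        also have "\<dots> \<longleftrightarrow> (norm y)\<^sup>2 \<le> l - M\<^sup>2" by (rule real_sqrt_le_iff)
        finally show ?thesis by auto
      qed
      hence "(\<integral>\<^sup>+y. (if M\<^sup>2 + (norm y)\<^sup>2 \<le> l then ?c l else 0) \<partial>(lborel :: (real \<times> real) measure)) =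
          (\<integral>\<^sup>+y. ?c l * indicator (cball 0 (sqrt (l - M\<^sup>2))) y \<partial>(lborel :: (real \<times> real) measure))"
        by (intro nn_integral_cong) (auto split: split_indicator)
      also have "\<dots> = ?c l * emeasure lborel (cball (0 :: real \<times> real) (sqrt (l - M\<^sup>2)))"
        by (intro nn_integral_cmult_indicator) simp
      also have "\<dots> = ?c l * ennreal (pi * (l - M\<^sup>2))"
        using True by (simp add: emeasure_cball unit_ball_vol_2)
      also have "\<dots> = ennreal (\<sigma> * l powr (- \<sigma> - 1) * (pi * (l - M\<^sup>2)))"
        using True \<sigma> by (subst ennreal_mult[symmetric]) auto
      finally show ?thesis using True by simp
    next
      case False
      hence "\<not> M\<^sup>2 + (norm y)\<^sup>2 \<le> l" for y :: "real \<times> real" by (smt (verit) zero_le_power2)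
      thus ?thesis using False by simp
    qed
  qed
  also have "\<dots> = ennreal (pi / (\<sigma> - 1) * M powr (2 - 2 * \<sigma>))"
    by (rule nn_integral_disc_weight[OF \<sigma> M])
  finally show ?thesis .
qed

lemma nn_integral_inverse_1_square:
  "(\<integral>\<^sup>+c. ennreal (1 / (1 + c\<^sup>2)) \<partial>lborel) = ennreal pi"
proof -
  have half: "(\<integral>\<^sup>+c. ennreal (1 / (1 + c\<^sup>2)) * indicator {0..} c \<partial>lborel) = ennreal (pi / 2 - arctan 0)"
  proof (rule nn_integral_FTC_atLeast)
    show "(arctan has_real_derivative 1 / (1 + x\<^sup>2)) (at x)" for x
      by (auto intro!: derivative_eq_intros simp: inverse_eq_divide)
    show "(arctan \<longlongrightarrow> pi / 2) at_top" by (rule tendsto_arctan_at_top)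
  qed auto
  have "(\<integral>\<^sup>+c. ennreal (1 / (1 + c\<^sup>2)) * indicator {..<0} c \<partial>lborel) =
      ennreal \<bar>- 1 :: real\<bar> * (\<integral>\<^sup>+c. ennreal (1 / (1 + (0 + -1 * c)\<^sup>2)) * indicator {..<0} (0 + -1 * c) \<partial>lborel)"
    by (rule nn_integral_real_affine) auto
  also have "\<dots> = (\<integral>\<^sup>+c. ennreal (1 / (1 + c\<^sup>2)) * indicator {0<..} c \<partial>lborel)"
    by (simp, intro nn_integral_cong) (auto split: split_indicator)
  also have "\<dots> = (\<integral>\<^sup>+c. ennreal (1 / (1 + c\<^sup>2)) * indicator {0..} c \<partial>lborel)"
    using AE_lborel_singleton[of "0::real"]
    by (intro nn_integral_cong_AE) (auto elim!: eventually_mono split: split_indicator)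
  finally have half': "(\<integral>\<^sup>+c. ennreal (1 / (1 + c\<^sup>2)) * indicator {..<0} c \<partial>lborel) = ennreal (pi / 2)"
    using half by simp
  have "(\<integral>\<^sup>+c. ennreal (1 / (1 + c\<^sup>2)) \<partial>lborel) =
      (\<integral>\<^sup>+c. ennreal (1 / (1 + c\<^sup>2)) * indicator {0..} c + ennreal (1 / (1 + c\<^sup>2)) * indicator {..<0} c \<partial>lborel)"
    by (intro nn_integral_cong) (auto split: split_indicator)
  also have "\<dots> = ennreal (pi / 2) + ennreal (pi / 2)"
    using half half' by (subst nn_integral_add) auto
  also have "\<dots> = ennreal pi" by (simp add: ennreal_plus[symmetric] del: ennreal_plus)
  finally show ?thesis .
qed

lemma AE_lborel_det: "AE x in (lborel :: (real \<times> real \<times> real) measure). fst x \<noteq> fst (snd x) * snd (snd x)"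
proof -
  have "AE x in lborel \<Otimes>\<^sub>M (lborel \<Otimes>\<^sub>M lborel). fst x \<noteq> fst (snd x) * snd (snd x :: real \<times> real)"
  proof (rule pair_sigma_finite.AE_pair_measure)
    show "pair_sigma_finite (lborel :: real measure) (lborel \<Otimes>\<^sub>M lborel :: (real \<times> real) measure)"
      unfolding lborel_prod ..
    show "AE a in lborel. AE y in lborel \<Otimes>\<^sub>M lborel. fst (a, y) \<noteq> fst (snd (a, y)) * snd (snd (a, y) :: real \<times> real)"
    proof (rule AE_I2)
      fix a :: real
      show "AE y in lborel \<Otimes>\<^sub>M lborel. fst (a, y) \<noteq> fst (snd (a, y)) * snd (snd (a, y) :: real \<times> real)"
        unfolding fst_conv snd_conv
      proof (rule lborel_pair.AE_pair_measure)
        have "AE c in lborel. a \<noteq> b * c" if "b \<noteq> 0" for b :: real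
          using AE_lborel_singleton[of "a / b"] that by (auto elim!: eventually_mono)
        thus "AE b in lborel. AE c in lborel. a \<noteq> fst (b, c) * snd (b, c)"
          using AE_lborel_singleton[of "0::real"] by (auto elim!: eventually_mono)
      qed measurable
    qed
  qed measurable
  thus ?thesis unfolding lborel_prod .
qed

text \<open>The same reduction as at the finite places: the plane integral over the first row leaves
  A^(-2) = 1 / (1 + c^2) times 2 \<pi> / (1 + k), and the integral over c contributes \<pi>.\<close>

lemma nn_integral_tau_inf:
  assumes k: "k \<ge> 0"
  shows "(\<integral>\<^sup>+x. ennreal (HE_inf (fst x, fst (snd x), snd (snd x), 1) powr (- k)) \<partial>tau_inf) = ennreal (2 * pi\<^sup>2 / (1 + k))"
proof -
  define A where "A c = sqrt (c\<^sup>2 + 1\<^sup>2)" for c :: real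
  define B where "B x = sqrt ((fst x)\<^sup>2 + (fst (snd x))\<^sup>2 + (snd (snd x))\<^sup>2 + 1\<^sup>2)" for x :: "real \<times> real \<times> real"
  define F where "F x = A (snd (snd x)) powr (k - 1) * B x powr (- (3 + k))" for x
  have A: "A c > 0" "(A c)\<^sup>2 = c\<^sup>2 + 1" for c unfolding A_def by (auto simp: add_nonneg_pos)
  have B: "B x > 0" "(B x)\<^sup>2 = (fst x)\<^sup>2 + (fst (snd x))\<^sup>2 + (snd (snd x))\<^sup>2 + 1" for x
    unfolding B_def by (auto intro!: add_nonneg_pos)
  have [measurable]: "A \<in> borel_measurable borel" "B \<in> borel_measurable (borel \<Otimes>\<^sub>M borel \<Otimes>\<^sub>M borel)"
    unfolding A_def B_def by measurable
  have mF [measurable]: "F \<in> borel_measurable (borel \<Otimes>\<^sub>M borel \<Otimes>\<^sub>M borel)" unfolding F_def by measurable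
  let ?g = "\<lambda>x::real \<times> real \<times> real. ennreal (HE_inf (fst x, fst (snd x), snd (snd x), 1) powr (- k))"
  let ?g1 = "\<lambda>(a, b, c). ennreal (1 / \<bar>a - b * c\<bar>\<^sup>2)"
  let ?g2 = "\<lambda>(a, b, c). ennreal (inverse (height_inf (a, b, c, 1) (2, 1)))"
  have g: "?g = (\<lambda>x. ennreal ((B x / A (snd (snd x))) powr (- k)))"
    by (simp add: HE_inf_def A_def B_def)
  have g2: "?g2 = (\<lambda>x. ennreal (inverse ((A (snd (snd x)) * B x / \<bar>fst x - fst (snd x) * snd (snd x)\<bar>) powr 2 *
      (B x / A (snd (snd x))) powr 1)))"
    by (simp add: height_inf_def HD_inf_def HE_inf_def A_def B_def case_prod_beta')
  have m1: "?g1 \<in> borel_measurable lborel" unfolding lborel_prod[symmetric] by measurable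
  have m2: "?g2 \<in> borel_measurable lborel" unfolding g2 lborel_prod[symmetric] by measurable
  have m3: "?g \<in> borel_measurable lborel" unfolding g lborel_prod[symmetric] by measurable
  have "(\<integral>\<^sup>+x. ?g x \<partial>tau_inf) = (\<integral>\<^sup>+x. ?g1 x * (?g2 x * ?g x) \<partial>lborel)"
    unfolding tau_inf_def omega_inf_def
    by (subst nn_integral_density, simp only: measurable_density_eq1 m2, simp only: measurable_density_eq1 m3,
        subst nn_integral_density, rule m1, intro borel_measurable_times_ennreal m2 m3, rule refl)
  also have "\<dots> = (\<integral>\<^sup>+x. ennreal (F x) \<partial>lborel)"
  proof (rule nn_integral_cong_AE)
    show "AE x in lborel. ?g1 x * (?g2 x * ?g x) = ennreal (F x)"
      using AE_lborel_det
    proof eventually_elim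
      case (elim x)
      define d where "d = \<bar>fst x - fst (snd x) * snd (snd x)\<bar>"
      have d: "d > 0" using elim by (simp add: d_def)
      have "?g1 x = ennreal (1 / d\<^sup>2)" by (simp add: case_prod_beta' d_def)
      hence "?g1 x * (?g2 x * ?g x) = ennreal (1 / d\<^sup>2 * inverse ((A (snd (snd x)) * B x / d) powr 2 *
          (B x / A (snd (snd x))) powr 1) * (B x / A (snd (snd x))) powr (- k))"
        unfolding fun_cong[OF g2] fun_cong[OF g] d_def[symmetric]
        by (simp only: ennreal_mult[symmetric] zero_le_power2 divide_nonneg_nonneg mult_nonneg_nonneg powr_ge_zero
            inverse_nonnegative_iff_nonnegative mult.assoc zero_le_one)
      thus ?case unfolding tau_density_eq[OF A(1) B(1) d] F_def .
    qed
  qed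
  also have "\<dots> = (\<integral>\<^sup>+c. (\<integral>\<^sup>+y. ennreal (F (fst y, snd y, c)) \<partial>(lborel \<Otimes>\<^sub>M lborel)) \<partial>lborel)"
    unfolding lborel_prod[symmetric] by (rule nn_integral_pair3[OF lborel.sigma_finite_measure_axioms]) measurable
  also have "\<dots> = (\<integral>\<^sup>+c. ennreal (2 * pi / (1 + k)) * ennreal (1 / (1 + c\<^sup>2)) \<partial>lborel)"
  proof (rule nn_integral_cong)
    fix c :: real
    have "(\<integral>\<^sup>+y. ennreal (F (fst y, snd y, c)) \<partial>(lborel \<Otimes>\<^sub>M lborel)) =
        (\<integral>\<^sup>+y. ennreal (A c powr (k - 1)) * ennreal (((A c)\<^sup>2 + (norm y)\<^sup>2) powr (- ((3 + k) / 2))) \<partial>(lborel :: (real \<times> real) measure))"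
      unfolding lborel_prod
    proof (rule nn_integral_cong)
      fix y :: "real \<times> real"
      have n: "(norm y)\<^sup>2 = (fst y)\<^sup>2 + (snd y)\<^sup>2" by (cases y) (simp add: norm_Pair)
      have "(A c)\<^sup>2 + (norm y)\<^sup>2 = (B (fst y, snd y, c))\<^sup>2" unfolding A B n by simp
      hence "((A c)\<^sup>2 + (norm y)\<^sup>2) powr (- ((3 + k) / 2)) = (B (fst y, snd y, c) powr 2) powr (- ((3 + k) / 2))"
        using less_imp_le[OF B(1)] by (simp add: powr_numeral)
      also have "\<dots> = B (fst y, snd y, c) powr (- (3 + k))"
      proof -
        have "2 * - ((3 + k) / 2) = - (3 + k)" by (simp add: field_simps)
        thus ?thesis by (simp only: powr_powr)
      qed
      finally show "ennreal (F (fst y, snd y, c)) =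
          ennreal (A c powr (k - 1)) * ennreal (((A c)\<^sup>2 + (norm y)\<^sup>2) powr (- ((3 + k) / 2)))"
        by (simp add: F_def ennreal_mult)
    qed
    also have "\<dots> = ennreal (A c powr (k - 1)) * ennreal (pi / ((3 + k) / 2 - 1) * A c powr (2 - 2 * ((3 + k) / 2)))"
      using k A by (subst nn_integral_cmult, measurable) (subst nn_integral_plane_powr, auto)
    also have "\<dots> = ennreal (A c powr (k - 1) * (pi / ((3 + k) / 2 - 1) * A c powr (2 - 2 * ((3 + k) / 2))))"
      using k by (subst ennreal_mult[symmetric]) auto
    also have "A c powr (k - 1) * (pi / ((3 + k) / 2 - 1) * A c powr (2 - 2 * ((3 + k) / 2))) =
        (2 * pi / (1 + k)) * (A c powr (k - 1) * A c powr (- 1 - k))"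
    proof -
      have "2 - 2 * ((3 + k) / 2) = - 1 - k" "pi / ((3 + k) / 2 - 1) = 2 * pi / (1 + k)" using k by (simp_all add: field_simps)
      thus ?thesis by (simp only: mult_ac)
    qed
    also have "A c powr (k - 1) * A c powr (- 1 - k) = 1 / (1 + c\<^sup>2)"
      using A(1)[of c] A(2)[of c] by (simp add: powr_add[symmetric] powr_minus powr_numeral inverse_eq_divide add.commute)
    also have "ennreal (2 * pi / (1 + k) * (1 / (1 + c\<^sup>2))) = ennreal (2 * pi / (1 + k)) * ennreal (1 / (1 + c\<^sup>2))"
      using k by (subst ennreal_mult) auto
    finally show "(\<integral>\<^sup>+y. ennreal (F (fst y, snd y, c)) \<partial>(lborel \<Otimes>\<^sub>M lborel)) =
      ennreal (2 * pi / (1 + k)) * ennreal (1 / (1 + c\<^sup>2))" .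
  qed
  also have "\<dots> = ennreal (2 * pi / (1 + k)) * ennreal pi"
    by (subst nn_integral_cmult) (auto simp: nn_integral_inverse_1_square)
  also have "\<dots> = ennreal (2 * pi\<^sup>2 / (1 + k))"
    using k by (subst ennreal_mult[symmetric]) (auto simp: power2_eq_square)
  finally show ?thesis .
qed

lemma tau_inf_measure: "measure tau_inf (space tau_inf) = 2 * pi\<^sup>2"
proof -
  have "HE_inf (a, b, c, 1) powr (- 0) = 1" for a b c
    by (simp add: HE_inf_def) (smt (verit) zero_le_power2)
  hence "emeasure tau_inf (space tau_inf) = ennreal (2 * pi\<^sup>2)"
    using nn_integral_tau_inf[of 0] by simp
  thus ?thesis by (simp add: measure_def)
qed

lemma integral_tau_inf:
  assumes k: "k \<ge> 0"
  shows "(LINT (a, b, c)|tau_inf. HE_inf (a, b, c, 1) powr (- k)) = 2 * pi\<^sup>2 / (1 + k)"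
  unfolding case_prod_beta'
proof (rule LINT_eq)
  show "(\<lambda>x. HE_inf (fst x, fst (snd x), snd (snd x), 1) powr (- k)) \<in> borel_measurable tau_inf"
    unfolding tau_inf_def omega_inf_def measurable_density_eq1 HE_inf_def H1_inf.simps H2_inf.simps lborel_prod[symmetric]
    by measurable
qed (use nn_integral_tau_inf[OF k] k in auto)

text \<open>The first row t (a, b) + u (c, d) is split into its components along (c, d) and
  orthogonal to it. By det = 1 these are t m / q + q u and, up to sign, t / q. This is a linear
  change of variables of determinant \<plusminus>1, so the integral becomes the rotationally
  symmetric one, with an additional factor 1 / q from the density.\<close>

lemma integral_sigma_inf:
  fixes a b c d :: real
  assumes det: "a * d - b * c = 1"
  shows "(LINT h|sigma_inf. inverse (height_inf (P_act_inf h (a, b, c, d)) (2, 1))) = 2 * pi / (c\<^sup>2 + d\<^sup>2)"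
proof -
  define q where "q = sqrt (c\<^sup>2 + d\<^sup>2)"
  \<comment> \<open>The inner product of the two rows.\<close>
  define m where "m = a * c + b * d"
  have "c \<noteq> 0 \<or> d \<noteq> 0" using det by auto
  hence "c\<^sup>2 + d\<^sup>2 > 0" by (simp add: sum_power2_gt_zero_iff)
  hence q: "q > 0" "q\<^sup>2 = c\<^sup>2 + d\<^sup>2" by (simp_all add: q_def)
  define f where "f h = inverse (height_inf (P_act_inf h (a, b, c, d)) (2, 1))" for h
  define G where "G x y = (q\<^sup>2 + (x\<^sup>2 + y\<^sup>2)) powr (- (3 / 2))" for x y :: real
  define Q where "Q h = sqrt ((fst h * a + snd h * c)\<^sup>2 + (fst h * b + snd h * d)\<^sup>2 + c\<^sup>2 + d\<^sup>2)" for h :: "real \<times> real"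
  have Qpos: "Q h > 0" for h
  proof -
    have "0 < c\<^sup>2 + d\<^sup>2" unfolding q(2)[symmetric] using q(1) by simp
    from add_nonneg_pos[OF add_nonneg_nonneg[OF zero_le_power2 zero_le_power2] this]
    have "0 < (fst h * a + snd h * c)\<^sup>2 + (fst h * b + snd h * d)\<^sup>2 + (c\<^sup>2 + d\<^sup>2)" .
    thus ?thesis unfolding Q_def by (simp add: add.assoc)
  qed
  have act: "f (t, u) = inverse ((q * Q (t, u) / \<bar>t\<bar>) powr 2 * (Q (t, u) / q) powr 1)" for t u
  proof -
    have "(t * a + u * c) * d - (t * b + u * d) * c = t * (a * d - b * c)" by (simp add: algebra_simps)
    thus ?thesis unfolding det by (simp add: f_def height_inf_def HD_inf_def HE_inf_def q_def Q_def)
  qed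
  hence f: "f h = inverse ((q * Q h / \<bar>fst h\<bar>) powr 2 * (Q h / q) powr 1)" for h by (cases h) simp
  have Q2: "(Q (t, u))\<^sup>2 = q\<^sup>2 + ((t / q)\<^sup>2 + (t * m / q + q * u)\<^sup>2)" for t u
  proof -
    have "(Q (t, u))\<^sup>2 = (t * a + u * c)\<^sup>2 + (t * b + u * d)\<^sup>2 + c\<^sup>2 + d\<^sup>2" by (simp add: Q_def)
    also have "\<dots> = t\<^sup>2 * (a\<^sup>2 + b\<^sup>2) + 2 * t * u * m + u\<^sup>2 * q\<^sup>2 + q\<^sup>2"
      unfolding q(2) m_def by (simp add: power2_eq_square algebra_simps)
    also have "a\<^sup>2 + b\<^sup>2 = (1 + m\<^sup>2) / q\<^sup>2"
    proof -
      \<comment> \<open>Lagrange's identity, with the determinant equal to 1.\<close>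
      have "(a\<^sup>2 + b\<^sup>2) * (c\<^sup>2 + d\<^sup>2) = (a * d - b * c)\<^sup>2 + m\<^sup>2" by (simp add: m_def power2_eq_square algebra_simps)
      hence k1: "(a\<^sup>2 + b\<^sup>2) * q\<^sup>2 = 1 + m\<^sup>2" by (simp only: q(2) det one_power2)
      have k2: "q\<^sup>2 \<noteq> 0" using q(1) by simp
      show ?thesis using nonzero_eq_divide_eq[OF k2] k1 by blast
    qed
    also have "t\<^sup>2 * ((1 + m\<^sup>2) / q\<^sup>2) + 2 * t * u * m + u\<^sup>2 * q\<^sup>2 + q\<^sup>2 = q\<^sup>2 + ((t / q)\<^sup>2 + (t * m / q + q * u)\<^sup>2)"
    proof -
      have "2 * (t * m / q) * (q * u) = 2 * t * u * m" using q(1) by simp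
      thus ?thesis unfolding power2_sum by (simp add: power_divide power_mult_distrib add_divide_distrib algebra_simps)
    qed
    finally show ?thesis .
  qed
  have GQ: "Q (t, u) powr (-3) = G (t / q) (t * m / q + q * u)" for t u
  proof -
    have "G (t / q) (t * m / q + q * u) = (Q (t, u) powr 2) powr (- (3 / 2))"
      using less_imp_le[OF Qpos] by (simp add: G_def Q2[symmetric] powr_numeral)
    thus ?thesis by (simp add: powr_powr)
  qed
  have can: "ennreal (1 / q) * ennreal q = 1" "ennreal q * ennreal (1 / q) = 1"
    using q by (simp_all only: ennreal_mult'[symmetric] less_imp_le divide_nonneg_nonneg zero_le_one) simp_all
  have can1: "ennreal (1 / q) * (ennreal q * X) = X" and can2: "ennreal q * (ennreal (1 / q) * X) = X" for X
    by (simp_all only: mult.assoc[symmetric] can mult_1)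
  have mQ [measurable]: "Q \<in> borel_measurable (borel \<Otimes>\<^sub>M borel)" unfolding Q_def by measurable
  have "(\<lambda>h. ennreal (Q h powr (-3))) \<in> borel_measurable (borel \<Otimes>\<^sub>M borel)" by measurable
  hence mQ3: "(\<lambda>h. ennreal (Q h powr (-3))) \<in> borel_measurable lborel" by (simp add: borel_prod)
  have mG [measurable]: "(\<lambda>x. G (fst x) (snd x)) \<in> borel_measurable (borel \<Otimes>\<^sub>M borel)" unfolding G_def by measurable
  have [measurable]: "G x \<in> borel_measurable borel" for x unfolding G_def[abs_def] by measurable
  have "f \<in> borel_measurable (borel \<Otimes>\<^sub>M borel)" unfolding f[abs_def] by measurable
  hence mf: "f \<in> borel_measurable lborel" by (simp add: borel_prod)
  have m1: "(\<lambda>(t, u). ennreal (1 / \<bar>t\<bar>\<^sup>2)) \<in> borel_measurable (lborel :: (real \<times> real) measure)"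
    unfolding lborel_prod[symmetric] by measurable
  have "(\<integral>\<^sup>+h. ennreal (f h) \<partial>sigma_inf) = (\<integral>\<^sup>+h. (case h of (t, u) \<Rightarrow> ennreal (1 / \<bar>t\<bar>\<^sup>2)) * ennreal (f h) \<partial>lborel)"
    unfolding sigma_inf_def by (subst nn_integral_density, rule m1) (use mf in auto)
  also have "\<dots> = (\<integral>\<^sup>+h. ennreal (1 / q) * ennreal (Q h powr (-3)) \<partial>lborel)"
  proof (rule nn_integral_cong_AE)
    have "AE h in lborel \<Otimes>\<^sub>M lborel. fst h \<noteq> (0::real)"
    proof (rule lborel_pair.AE_pair_measure)
      show "AE x in lborel. AE y in lborel. fst (x, y) \<noteq> (0::real)"
        using AE_lborel_singleton[of "0::real"] by (auto elim!: eventually_mono)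
    qed measurable
    hence "AE h in lborel. fst h \<noteq> (0::real)" unfolding lborel_prod .
    thus "AE h in lborel. (case h of (t, u) \<Rightarrow> ennreal (1 / \<bar>t\<bar>\<^sup>2)) * ennreal (f h) =
        ennreal (1 / q) * ennreal (Q h powr (-3))"
    proof eventually_elim
      case (elim h)
      have "1 / \<bar>fst h\<bar>\<^sup>2 * f h = q powr (0 - 1) * Q h powr (- (3 + 0))"
        using tau_density_eq[OF q(1) Qpos[of h], of "\<bar>fst h\<bar>" 0] elim q Qpos[of h] by (simp add: f)
      also have "\<dots> = 1 / q * Q h powr (-3)" using q by (simp add: powr_minus inverse_eq_divide)
      finally have e: "1 / \<bar>fst h\<bar>\<^sup>2 * f h = 1 / q * Q h powr (-3)" .
      have "(case h of (t, u) \<Rightarrow> ennreal (1 / \<bar>t\<bar>\<^sup>2)) * ennreal (f h) = ennreal (1 / \<bar>fst h\<bar>\<^sup>2 * f h)"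
        by (cases h) (simp only: prod.case fst_conv, rule ennreal_mult'[symmetric], simp)
      also have "\<dots> = ennreal (1 / q) * ennreal (Q h powr (-3))" unfolding e using q by (intro ennreal_mult) auto
      finally show ?case .
    qed
  qed
  also have "\<dots> = ennreal (1 / q) * (\<integral>\<^sup>+h. ennreal (Q h powr (-3)) \<partial>(lborel \<Otimes>\<^sub>M lborel))"
    unfolding lborel_prod by (rule nn_integral_cmult[OF mQ3])
  also have "(\<integral>\<^sup>+h. ennreal (Q h powr (-3)) \<partial>(lborel \<Otimes>\<^sub>M lborel)) = (\<integral>\<^sup>+t. \<integral>\<^sup>+u. ennreal (Q (t, u) powr (-3)) \<partial>lborel \<partial>lborel)"
    by (rule lborel.nn_integral_fst[symmetric]) (use mQ3 in \<open>simp only: lborel_prod\<close>)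
  also have "\<dots> = (\<integral>\<^sup>+t. ennreal (1 / q) * (\<integral>\<^sup>+u. ennreal (G (t / q) u) \<partial>lborel) \<partial>lborel)"
  proof (rule nn_integral_cong)
    fix t :: real
    \<comment> \<open>The substitution in u gives a factor 1 / q, which the substitution in t below
      compensates by q.\<close>
    have "(\<integral>\<^sup>+u. ennreal (G (t / q) u) \<partial>lborel) = \<bar>q\<bar> * (\<integral>\<^sup>+u. ennreal (G (t / q) (t * m / q + q * u)) \<partial>lborel)"
      by (rule nn_integral_real_affine) (measurable, use q in simp)
    thus "(\<integral>\<^sup>+u. ennreal (Q (t, u) powr (-3)) \<partial>lborel) = ennreal (1 / q) * (\<integral>\<^sup>+u. ennreal (G (t / q) u) \<partial>lborel)"
      unfolding GQ abs_of_pos[OF q(1)] by (simp only: can1)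
  qed
  also have "\<dots> = (\<integral>\<^sup>+t. ennreal (G (fst t) (snd t)) \<partial>(lborel \<Otimes>\<^sub>M lborel))"
  proof -
    have mI [measurable]: "(\<lambda>t. \<integral>\<^sup>+u. ennreal (G t u) \<partial>lborel) \<in> borel_measurable borel"
    proof -
      have "(\<lambda>x. ennreal (G (fst x) (snd x))) \<in> borel_measurable (borel \<Otimes>\<^sub>M lborel)" by measurable
      from lborel.borel_measurable_nn_integral_fst[OF this] show ?thesis by simp
    qed
    have mIq: "(\<lambda>t. \<integral>\<^sup>+u. ennreal (G (t / q) u) \<partial>lborel) \<in> borel_measurable borel"
      by (rule measurable_compose[OF _ mI]) measurable
    have "(\<integral>\<^sup>+t. ennreal (1 / q) * (\<integral>\<^sup>+u. ennreal (G (t / q) u) \<partial>lborel) \<partial>lborel) =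
        \<bar>q\<bar> * (\<integral>\<^sup>+t. ennreal (1 / q) * (\<integral>\<^sup>+u. ennreal (G ((0 + q * t) / q) u) \<partial>lborel) \<partial>lborel)"
      by (rule nn_integral_real_affine[OF borel_measurable_times_ennreal[OF borel_measurable_const mIq]]) (use q in simp)
    also have "\<dots> = ennreal q * (ennreal (1 / q) * (\<integral>\<^sup>+t. (\<integral>\<^sup>+u. ennreal (G t u) \<partial>lborel) \<partial>lborel))"
    proof -
      have e: "(0 + q * t) / q = t" for t using q by simp
      show ?thesis unfolding e abs_of_pos[OF q(1)] using mI by (subst nn_integral_cmult) simp_all
    qed
    also have "\<dots> = (\<integral>\<^sup>+t. (\<integral>\<^sup>+u. ennreal (G t u) \<partial>lborel) \<partial>lborel)"
      by (rule can2)
    also have "\<dots> = (\<integral>\<^sup>+t. ennreal (G (fst t) (snd t)) \<partial>(lborel \<Otimes>\<^sub>M lborel))"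
    proof -
      have "(\<lambda>x. ennreal (G (fst x) (snd x))) \<in> borel_measurable (lborel \<Otimes>\<^sub>M lborel)" by measurable
      from lborel.nn_integral_fst[OF this] show ?thesis by simp
    qed
    finally show ?thesis .
  qed
  also have "\<dots> = (\<integral>\<^sup>+y. ennreal ((q\<^sup>2 + (norm y)\<^sup>2) powr (- (3 / 2))) \<partial>(lborel :: (real \<times> real) measure))"
    unfolding lborel_prod
  proof (rule nn_integral_cong)
    fix y :: "real \<times> real"
    show "ennreal (G (fst y) (snd y)) = ennreal ((q\<^sup>2 + (norm y)\<^sup>2) powr (- (3 / 2)))"
      by (cases y) (simp add: G_def norm_Pair)
  qed
  also have "\<dots> = ennreal (pi / (3 / 2 - 1) * q powr (2 - 2 * (3 / 2)))"
    using q by (intro nn_integral_plane_powr) auto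
  also have "ennreal (1 / q) * ennreal (pi / (3 / 2 - 1) * q powr (2 - 2 * (3 / 2))) = ennreal (2 * pi / (c\<^sup>2 + d\<^sup>2))"
  proof -
    have p: "2 - 2 * (3 / 2) = (-1 :: real)" by simp
    have e: "1 / q * (pi / (3 / 2 - 1) * q powr (-1)) = 2 * pi / q\<^sup>2"
      using q(1) by (simp add: powr_minus power2_eq_square inverse_eq_divide)
    have "ennreal (1 / q) * ennreal (pi / (3 / 2 - 1) * q powr (-1)) = ennreal (1 / q * (pi / (3 / 2 - 1) * q powr (-1)))"
      using q(1) by (intro ennreal_mult[symmetric] divide_nonneg_nonneg mult_nonneg_nonneg) simp_all
    thus ?thesis unfolding p e q(2) .
  qed
  finally have eq: "(\<integral>\<^sup>+h. ennreal (f h) \<partial>sigma_inf) = ennreal (2 * pi / (c\<^sup>2 + d\<^sup>2))" .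
  have "integral\<^sup>L sigma_inf f = 2 * pi / (c\<^sup>2 + d\<^sup>2)"
  proof (rule LINT_eq[OF _ _ eq])
    show "f \<in> borel_measurable sigma_inf" unfolding sigma_inf_def measurable_density_eq1 by (rule mf)
    show "f h \<ge> 0" for h unfolding f using q Qpos[of h] by simp
    show "0 \<le> 2 * pi / (c\<^sup>2 + d\<^sup>2)" by simp
  qed
  thus ?thesis unfolding f_def[abs_def] .
qed

section \<open>The effective cone\<close>

lemma Eff_eq: "Eff = {v. 0 \<le> fst v \<and> 0 \<le> fst v + snd v}"
proof
  have cc: "convex_cone {v :: real \<times> real. 0 \<le> fst v \<and> 0 \<le> fst v + snd v}"
    by (auto simp: convex_cone_iff distrib_left[symmetric])
  show "Eff \<subseteq> {v. 0 \<le> fst v \<and> 0 \<le> fst v + snd v}"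
    unfolding Eff_def using cc by (intro hull_minimal) (auto simp: cls_E_def cls_H_def)
  show "{v. 0 \<le> fst v \<and> 0 \<le> fst v + snd v} \<subseteq> Eff"
  proof
    fix v :: "real \<times> real" assume v: "v \<in> {v. 0 \<le> fst v \<and> 0 \<le> fst v + snd v}"
    have "v = (fst v + snd v) *\<^sub>R cls_E + fst v *\<^sub>R (cls_H - cls_E)"
      by (simp add: cls_E_def cls_H_def prod_eq_iff)
    also have "\<dots> \<in> Eff" using v unfolding Eff_def
      by (intro convex_cone_add convex_cone_scaleR convex_cone_convex_cone_hull hull_inc) auto
    finally show "v \<in> Eff" .
  qed
qed

lemma cls_K_eq: "cls_K = (-4, 1)"
  by (simp add: cls_K_def cls_D_def cls_E_def cls_H_def)

lemma pic_eq: "pic x y = (2 * x, y - x)"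
  by (simp add: pic_def cls_D_def cls_E_def cls_H_def)

text \<open>Each of the two facets of the cone bounds t from below, by 2/x and by 3/(x + y). Which
  bound is the larger one distinguishes the cases of the constant.\<close>

lemma manin_a_eq:
  assumes "x > 0" "x + y > 0"
  shows "manin_a (pic x y) = max (2 / x) (3 / (x + y))"
proof -
  have "t *\<^sub>R pic x y + cls_K \<in> Eff \<longleftrightarrow> max (2 / x) (3 / (x + y)) \<le> t" for t
  proof -
    have "t *\<^sub>R pic x y + cls_K \<in> Eff \<longleftrightarrow> 2 \<le> t * x \<and> 3 \<le> t * (x + y)"
    proof -
      have "t *\<^sub>R pic x y + cls_K = (2 * (t * x) - 4, t * (x + y) - 2 * (t * x) + 1)"
        by (simp add: pic_eq cls_K_eq right_diff_distrib distrib_left)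
      thus ?thesis unfolding Eff_eq by simp
    qed
    also have "2 \<le> t * x \<longleftrightarrow> 2 / x \<le> t" using assms(1) by (simp only: pos_divide_le_eq)
    also have "3 \<le> t * (x + y) \<longleftrightarrow> 3 / (x + y) \<le> t" using assms(2) by (simp only: pos_divide_le_eq)
    finally show ?thesis by (simp only: max.bounded_iff)
  qed
  hence "{t. t *\<^sub>R pic x y + cls_K \<in> Eff} = {max (2 / x) (3 / (x + y))..}" by (simp only: atLeast_def)
  thus ?thesis by (simp add: manin_a_def)
qed

lemma ray_E_face: "{v. fst v = 0 \<and> 0 \<le> snd v} face_of Eff"
proof -
  have "convex Eff" unfolding Eff_def by (rule convex_convex_cone_hull)
  hence "Eff \<inter> {v. (1, 0) \<bullet> v = 0} face_of Eff"
    by (rule face_of_Int_supporting_hyperplane_ge) (auto simp: Eff_eq inner_prod_def)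
  also have "Eff \<inter> {v. (1, 0) \<bullet> v = 0} = {v. fst v = 0 \<and> 0 \<le> snd v}"
    by (auto simp: Eff_eq inner_prod_def)
  finally show ?thesis .
qed

lemma ray_HE_face: "{v. fst v + snd v = 0 \<and> 0 \<le> fst v} face_of Eff"
proof -
  have "convex Eff" unfolding Eff_def by (rule convex_convex_cone_hull)
  hence "Eff \<inter> {v. (1, 1) \<bullet> v = 0} face_of Eff"
    by (rule face_of_Int_supporting_hyperplane_ge) (auto simp: Eff_eq inner_prod_def)
  also have "Eff \<inter> {v. (1, 1) \<bullet> v = 0} = {v. fst v + snd v = 0 \<and> 0 \<le> fst v}"
    by (auto simp: Eff_eq inner_prod_def)
  finally show ?thesis .
qed

lemma minimal_face_0: "minimal_face 0 = {0}"
proof -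
  have "{v. fst v = 0 \<and> 0 \<le> snd v} \<inter> {v. fst v + snd v = 0 \<and> 0 \<le> fst v} face_of Eff"
    by (rule face_of_Int[OF ray_E_face ray_HE_face])
  also have "{v. fst v = 0 \<and> 0 \<le> snd v} \<inter> {v. fst v + snd v = 0 \<and> 0 \<le> fst v} = {0 :: real \<times> real}"
    by (auto simp: prod_eq_iff)
  finally show ?thesis by (auto simp: minimal_face_def)
qed

text \<open>A point in the relative interior of an extremal ray lies in an open segment ending at
  any other point of the ray, so every face containing it contains the whole ray.\<close>

lemma aff_dim_minimal_face_ray:
  fixes w :: "real \<times> real"
  assumes R: "{t *\<^sub>R w |t. 0 \<le> t} face_of Eff" and w: "w \<noteq> 0" and l: "l > 0"
  shows "aff_dim (minimal_face (l *\<^sub>R w)) = 1"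
proof -
  define R where "R = {t *\<^sub>R w |t. 0 \<le> t}"
  have RE: "R \<subseteq> Eff" using face_of_imp_subset[OF R] by (simp add: R_def)
  have "R \<subseteq> F" if F: "F face_of Eff" "l *\<^sub>R w \<in> F" for F
  proof
    fix v assume "v \<in> R"
    then obtain t where t: "v = t *\<^sub>R w" "0 \<le> t" by (auto simp: R_def)
    have "t *\<^sub>R w \<in> F"
    proof (cases "t = l")
      case False
      \<comment> \<open>The other end of the segment must lie beyond \<open>l\<close> as seen from
        \<open>t\<close>.\<close>
      define s where "s = (if t > l then 0 else l + 1)"
      have "l *\<^sub>R w \<in> open_segment (t *\<^sub>R w) (s *\<^sub>R w)"
      proof -
        define u where "u = (l - t) / (s - t)"
        have st: "s - t \<noteq> 0" using False l by (auto simp: s_def)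
        hence "u * (s - t) = l - t" by (simp add: u_def)
        hence u3: "l = (1 - u) * t + u * s" by (simp add: algebra_simps)
        have u: "0 < u" "u < 1" using False l t unfolding u_def s_def
          by (auto simp: zero_less_divide_iff divide_less_eq_1)
        have "l *\<^sub>R w = (1 - u) *\<^sub>R (t *\<^sub>R w) + u *\<^sub>R (s *\<^sub>R w)"
          by (subst u3) (simp add: scaleR_add_left)
        moreover have "t *\<^sub>R w \<noteq> s *\<^sub>R w" using w st by simp
        ultimately show ?thesis using u unfolding in_segment by blast
      qed
      moreover have "r *\<^sub>R w \<in> Eff" if "r \<ge> 0" for r using RE that unfolding R_def by blast
      hence "t *\<^sub>R w \<in> Eff" "s *\<^sub>R w \<in> Eff" using t l by (simp_all add: s_def)
      moreover have "a \<in> F" if "a \<in> Eff" "b \<in> Eff" "x \<in> F" "x \<in> open_segment a b" for a b x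
        using F(1) that unfolding face_of_def by blast
      ultimately show ?thesis using F(2) by blast
    qed (use F in simp)
    thus "v \<in> F" using t by simp
  qed
  moreover have "l *\<^sub>R w \<in> R" using l by (auto simp: R_def intro!: exI[of _ l])
  ultimately have "minimal_face (l *\<^sub>R w) = R"
    unfolding minimal_face_def using R[folded R_def] by (intro antisym Inter_greatest Inter_lower) auto
  moreover have "aff_dim R = 1"
  proof -
    have "0 \<in> R" by (auto simp: R_def intro!: exI[of _ 0])
    hence "aff_dim R = int (dim R)" by (intro aff_dim_zero hull_inc)
    also have "span R = span {w}"
    proof (rule span_eq[THEN iffD2], intro conjI)
      show "R \<subseteq> span {w}"
      proof
        fix v assume "v \<in> R"
        then obtain t where "v = t *\<^sub>R w" unfolding R_def by blast
        thus "v \<in> span {w}" by (simp add: span_scale span_base)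
      qed
      have "w \<in> R" by (auto simp: R_def intro!: exI[of _ 1])
      thus "{w} \<subseteq> span R" by (simp add: span_base)
    qed
    hence "dim R = dim {w}" by (rule span_eq_dim)
    also have "dim {w} = 1" using w by simp
    finally show ?thesis by simp
  qed
  ultimately show ?thesis by simp
qed

text \<open>If the two lower bounds for t agree, the adjoint class is zero and its minimal face is a
  point. Otherwise one bound is strict and the class lies in the interior of a boundary ray, spanned
  by E if 2y > x and by H - E if 2y < x.\<close>

lemma manin_b_eq:
  assumes "x > 0" "x + y > 0"
  shows "manin_b (pic x y) = (if 2 * y = x then 2 else 1)"
proof -
  consider "2 * y = x" | "2 * y > x" | "2 * y < x" by linarith
  thus ?thesis
  proof cases
    case 1
    hence xy: "x = 2 * y" "y > 0" using assms by auto
    have "2 / x = 1 / y" "3 / (x + y) = 1 / y" using xy(2) by (simp_all add: xy(1))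
    hence "manin_a (pic x y) *\<^sub>R pic x y + cls_K = 0"
      unfolding manin_a_eq[OF assms] unfolding pic_eq cls_K_eq using xy(2) by (simp add: xy(1) zero_prod_def)
    thus ?thesis using 1 by (simp add: manin_b_def minimal_face_0)
  next
    case 2
    have "max (2 / x) (3 / (x + y)) = 2 / x" 
    proof (rule max_absorb1)
      show "3 / (x + y) \<le> 2 / x" using assms 2 by (simp add: pos_divide_le_eq pos_le_divide_eq)
    qed
    hence v: "manin_a (pic x y) *\<^sub>R pic x y + cls_K = (2 * y / x - 1) *\<^sub>R (0, 1)"
      unfolding manin_a_eq[OF assms] unfolding pic_eq cls_K_eq using assms(1) by (simp add: diff_divide_distrib right_diff_distrib)
    have "{v. fst v = 0 \<and> 0 \<le> snd v} = {t *\<^sub>R ((0, 1) :: real \<times> real) |t. 0 \<le> t}"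
      by (auto simp: prod_eq_iff)
    hence "aff_dim (minimal_face ((2 * y / x - 1) *\<^sub>R (0, 1))) = 1"
      using ray_E_face assms 2 by (intro aff_dim_minimal_face_ray) (simp_all add: zero_prod_def)
    thus ?thesis using 2 unfolding manin_b_def v by simp
  next
    case 3
    have "max (2 / x) (3 / (x + y)) = 3 / (x + y)" 
    proof (rule max_absorb2)
      show "2 / x \<le> 3 / (x + y)" using assms 3 by (simp add: pos_divide_le_eq pos_le_divide_eq)
    qed
    hence v: "manin_a (pic x y) *\<^sub>R pic x y + cls_K = ((2 * x - 4 * y) / (x + y)) *\<^sub>R (1, -1)"
    proof -
      have nz: "x + y \<noteq> 0" using assms(2) by simp
      have "3 / (x + y) * (2 * x) - 4 = (2 * x - 4 * y) / (x + y)" "3 / (x + y) * (y - x) + 1 = - ((2 * x - 4 * y) / (x + y))"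
        using nz by (simp_all add: divide_simps)
      thus ?thesis unfolding manin_a_eq[OF assms] unfolding pic_eq cls_K_eq
        unfolding \<open>max (2 / x) (3 / (x + y)) = 3 / (x + y)\<close> by simp
    qed
    have "{v. fst v + snd v = 0 \<and> 0 \<le> fst v} = {t *\<^sub>R ((1, -1) :: real \<times> real) |t. 0 \<le> t}"
      by (auto simp: prod_eq_iff)
    hence "aff_dim (minimal_face (((2 * x - 4 * y) / (x + y)) *\<^sub>R (1, -1))) = 1"
      using ray_HE_face assms 3 by (intro aff_dim_minimal_face_ray) (simp_all add: zero_prod_def)
    thus ?thesis using 3 unfolding manin_b_def v by simp
  qed
qed

section \<open>The dual cone and its exponential integral\<close>

lemma nn_integral_exp_atLeast:
  fixes c a :: real
  assumes c: "c > 0"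
  shows "(\<integral>\<^sup>+u. ennreal (exp (- (c * u))) * indicator {a..} u \<partial>lborel) = ennreal (exp (- (c * a)) / c)"
proof -
  have "(\<integral>\<^sup>+u. ennreal (exp (- (c * u))) * indicator {a..} u \<partial>lborel) = ennreal (0 - (- (exp (- (c * a)) / c)))"
  proof (rule nn_integral_FTC_atLeast)
    show "((\<lambda>u. - (exp (- (c * u)) / c)) has_real_derivative exp (- (c * u))) (at u)" for u
      using c by (auto intro!: derivative_eq_intros)
    have "filterlim (\<lambda>u. c * u) at_top at_top"
      using c by (intro filterlim_tendsto_pos_mult_at_top[OF tendsto_const]) (auto simp: filterlim_ident)
    hence "((\<lambda>u. exp (- (c * u))) \<longlongrightarrow> 0) at_top"
      by (intro filterlim_compose[OF exp_at_bot] filterlim_compose[OF filterlim_uminus_at_bot_at_top])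
    from tendsto_minus[OF tendsto_divide[OF this tendsto_const[of c]]]
    show "((\<lambda>u. - (exp (- (c * u)) / c)) \<longlongrightarrow> 0) at_top" using c by simp
  qed auto
  thus ?thesis by simp
qed

lemma Nef1_eq: "Nef1 = {\<xi>. 0 \<le> snd \<xi> \<and> snd \<xi> \<le> fst \<xi>}"
proof
  show "Nef1 \<subseteq> {\<xi>. 0 \<le> snd \<xi> \<and> snd \<xi> \<le> fst \<xi>}"
  proof
    fix \<xi> :: "real \<times> real" assume "\<xi> \<in> Nef1"
    hence *: "0 \<le> D \<bullet> \<xi>" if "0 \<le> fst D" "0 \<le> fst D + snd D" for D
      using that unfolding Nef1_def Eff_eq by blast
    show "\<xi> \<in> {\<xi>. 0 \<le> snd \<xi> \<and> snd \<xi> \<le> fst \<xi>}"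
      using *[of "(0, 1)"] *[of "(1, -1)"] by (auto simp: inner_prod_def)
  qed
  show "{\<xi>. 0 \<le> snd \<xi> \<and> snd \<xi> \<le> fst \<xi>} \<subseteq> Nef1"
  proof
    fix \<xi> :: "real \<times> real" assume \<xi>: "\<xi> \<in> {\<xi>. 0 \<le> snd \<xi> \<and> snd \<xi> \<le> fst \<xi>}"
    have "0 \<le> D \<bullet> \<xi>" if D: "0 \<le> fst D" "0 \<le> fst D + snd D" for D
    proof -
      have "D \<bullet> \<xi> = fst D * (fst \<xi> - snd \<xi>) + (fst D + snd D) * snd \<xi>"
        by (simp add: inner_prod_def algebra_simps)
      also have "\<dots> \<ge> 0" using D \<xi> by (intro add_nonneg_nonneg[OF mult_nonneg_nonneg mult_nonneg_nonneg]) auto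
      finally show ?thesis .
    qed
    thus "\<xi> \<in> Nef1" by (simp add: Nef1_def Eff_eq)
  qed
qed

text \<open>On the dual cone 0 \<le> v \<le> u the pairing is 2 x u + (y - x) v. Integrating over u
  \<ge> v first gives 1 / (2x) times the exponential of -(x + y) v.\<close>

lemma alpha_const_eq:
  assumes x: "x > 0" and y: "x + y > 0"
  shows "alpha_const (pic x y) = 1 / (2 * x * (x + y))"
proof -
  define f where "f \<xi> = indicator Nef1 \<xi> *\<^sub>R exp (- (pic x y \<bullet> \<xi>))" for \<xi>
  have f: "f = (\<lambda>\<xi>. if 0 \<le> snd \<xi> \<and> snd \<xi> \<le> fst \<xi> then exp (- (2 * x * fst \<xi> + (y - x) * snd \<xi>)) else 0)"
    by (auto simp: f_def Nef1_eq pic_eq inner_prod_def)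
  have mf: "f \<in> borel_measurable (lborel \<Otimes>\<^sub>M lborel)" unfolding f by measurable
  hence mf': "(\<lambda>\<xi>. ennreal (f \<xi>)) \<in> borel_measurable (lborel \<Otimes>\<^sub>M lborel)" by simp
  have "(\<integral>\<^sup>+\<xi>. ennreal (f \<xi>) \<partial>(lborel \<Otimes>\<^sub>M lborel)) = (\<integral>\<^sup>+v. (\<integral>\<^sup>+u. ennreal (f (u, v)) \<partial>lborel) \<partial>lborel)"
    using lborel_pair.nn_integral_snd[OF mf'] by simp
  also have "\<dots> = (\<integral>\<^sup>+v. ennreal (1 / (2 * x)) * (ennreal (exp (- ((x + y) * v))) * indicator {0..} v) \<partial>lborel)"
  proof (rule nn_integral_cong)
    fix v :: real
    show "(\<integral>\<^sup>+u. ennreal (f (u, v)) \<partial>lborel) = ennreal (1 / (2 * x)) * (ennreal (exp (- ((x + y) * v))) * indicator {0..} v)"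
    proof (cases "v \<ge> 0")
      case True
      have "(\<integral>\<^sup>+u. ennreal (f (u, v)) \<partial>lborel) =
          (\<integral>\<^sup>+u. ennreal (exp (- ((y - x) * v))) * (ennreal (exp (- (2 * x * u))) * indicator {v..} u) \<partial>lborel)"
        using True by (intro nn_integral_cong)
          (auto simp: f ennreal_mult[symmetric] exp_add[symmetric] algebra_simps split: split_indicator)
      also have "\<dots> = ennreal (exp (- ((y - x) * v))) * ennreal (exp (- (2 * x * v)) / (2 * x))"
        using x by (subst nn_integral_cmult, measurable) (subst nn_integral_exp_atLeast, auto)
      also have "\<dots> = ennreal (exp (- ((y - x) * v)) * (exp (- (2 * x * v)) / (2 * x)))"
        using x by (intro ennreal_mult[symmetric]) auto
      also have "exp (- ((y - x) * v)) * (exp (- (2 * x * v)) / (2 * x)) = 1 / (2 * x) * exp (- ((x + y) * v))"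
        by (simp add: exp_add[symmetric] algebra_simps)
      also have "ennreal \<dots> = ennreal (1 / (2 * x)) * ennreal (exp (- ((x + y) * v)))"
        using x by (intro ennreal_mult) auto
      finally show ?thesis using True by simp
    qed (simp add: f)
  qed
  also have "\<dots> = ennreal (1 / (2 * x)) * ennreal (exp (- ((x + y) * 0)) / (x + y))"
    using y by (subst nn_integral_cmult, measurable) (subst nn_integral_exp_atLeast, auto)
  also have "\<dots> = ennreal (1 / (2 * x) * (exp (- ((x + y) * 0)) / (x + y)))"
    using x y by (intro ennreal_mult[symmetric]) auto
  also have "1 / (2 * x) * (exp (- ((x + y) * 0)) / (x + y)) = 1 / (2 * x * (x + y))" by simp
  finally have "(\<integral>\<^sup>+\<xi>. ennreal (f \<xi>) \<partial>lborel) = ennreal (1 / (2 * x * (x + y)))" unfolding lborel_prod .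
  hence "integral\<^sup>L lborel f = 1 / (2 * x * (x + y))"
    using mf x y by (intro LINT_eq) (auto simp: f lborel_prod)
  thus ?thesis by (simp add: alpha_const_def set_lebesgue_integral_def f_def[abs_def])
qed

section \<open>Zeta values and Euler products\<close>

text \<open>Tannery's theorem for unordered sums: off a finite set both sums are bounded by the tail
  of \<open>h\<close>. It serves for Euler products, for the sum over \<open>z\<close> and for the
  sum over \<open>g\<close>.\<close>

lemma infsum_dominated:
  fixes f :: "'t \<Rightarrow> 'i \<Rightarrow> real"
  assumes lim: "\<And>i. i \<in> A \<Longrightarrow> ((\<lambda>t. f t i) \<longlongrightarrow> g i) F"
    and dom: "\<forall>\<^sub>F t in F. \<forall>i\<in>A. \<bar>f t i\<bar> \<le> h i"
    and h: "h summable_on A" and F: "F \<noteq> bot"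
  shows "((\<lambda>t. infsum (f t) A) \<longlongrightarrow> infsum g A) F"
proof (rule tendstoI)
  fix e :: real assume e: "e > 0"
  have gh: "\<bar>g i\<bar> \<le> h i" if i: "i \<in> A" for i
  proof (rule tendsto_upperbound[OF tendsto_rabs[OF lim[OF i]] _ F])
    show "\<forall>\<^sub>F t in F. \<bar>f t i\<bar> \<le> h i" using dom by eventually_elim (use i in blast)
  qed
  have hn: "h i \<ge> 0" if "i \<in> A" for i using gh[OF that] by linarith
  have sum_of: "f' summable_on A" if "\<And>i. i \<in> A \<Longrightarrow> \<bar>f' i\<bar> \<le> h i" for f' :: "'i \<Rightarrow> real"
  proof -
    have "(\<lambda>i. norm (h i)) summable_on A" using h summable_on_iff_abs_summable_on_real by blast
    hence "(\<lambda>i. norm (f' i)) summable_on A"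
      by (rule Infinite_Sum.abs_summable_on_comparison_test) (use that hn in auto)
    thus ?thesis using summable_on_iff_abs_summable_on_real by blast
  qed
  have tail: "\<bar>infsum f' A - sum f' A0\<bar> \<le> infsum h A - sum h A0"
    if A0: "finite A0" "A0 \<subseteq> A" and f': "\<And>i. i \<in> A \<Longrightarrow> \<bar>f' i\<bar> \<le> h i" for f' :: "'i \<Rightarrow> real" and A0
  proof -
    have d: "infsum k A - sum k A0 = infsum k (A - A0)" if "k summable_on A" for k :: "'i \<Rightarrow> real"
      using infsum_Diff[OF that _ A0(2)] A0(1) by simp
    have sf: "f' summable_on A" by (rule sum_of) (rule f')
    have sA: "f' summable_on (A - A0)" "h summable_on (A - A0)"
      using summable_on_subset_banach[OF sf] summable_on_subset_banach[OF h] by auto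
    have "infsum f' (A - A0) \<le> infsum h (A - A0)" using f' sA by (intro infsum_mono) force+
    moreover have "infsum (\<lambda>i. - h i) (A - A0) \<le> infsum f' (A - A0)"
      using f' sA by (intro infsum_mono) (auto simp: summable_on_uminus abs_le_iff minus_le_iff)
    ultimately show ?thesis unfolding d[OF sf] d[OF h] infsum_uminus by linarith
  qed
  obtain A0 where A0: "finite A0" "A0 \<subseteq> A" "dist (sum h A0) (infsum h A) \<le> e / 4"
    using infsum_finite_approximation[OF h, of "e / 4"] e by auto
  have "((\<lambda>t. sum (f t) A0) \<longlongrightarrow> sum g A0) F" using A0(2) by (intro tendsto_sum lim) auto
  hence "\<forall>\<^sub>F t in F. dist (sum (f t) A0) (sum g A0) < e / 4" by (rule tendstoD) (use e in simp)
  with dom show "\<forall>\<^sub>F t in F. dist (infsum (f t) A) (infsum g A) < e"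
  proof eventually_elim
    case (elim t)
    have "\<bar>infsum (f t) A - sum (f t) A0\<bar> \<le> e / 4" "\<bar>infsum g A - sum g A0\<bar> \<le> e / 4"
      using tail[OF A0(1,2), of "f t"] tail[OF A0(1,2), of g] elim gh A0(3) by (auto simp: dist_real_def)
    thus ?case using elim(2) unfolding dist_real_def by linarith
  qed
qed

definition zeta :: "real \<Rightarrow> real" where
  "zeta s = (\<Sum>\<^sub>\<infinity>n\<in>{1..}. real n powr (- s))"

lemma zeta_summable: "s > 1 \<Longrightarrow> (\<lambda>n. real n powr (- s)) summable_on {1::nat..}"
proof -
  assume "s > 1"
  hence "summable (\<lambda>n. real n powr (- s))" using summable_real_powr_iff[of "- s"] by simp
  hence "(\<lambda>n. real n powr (- s)) summable_on UNIV"
    by (subst summable_on_UNIV_nonneg_real_iff) auto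
  thus ?thesis by (rule summable_on_subset_banach) auto
qed

text \<open>A multiplicative weight that sees only which primes of \<open>P\<close> divide n. With
  weight 0 at all primes it singles out n = 1 among the positive integers, which yields the Euler
  product of zeta; with weight 1 - 1/p^2 it is the density used for the slices of a fibre.\<close>

definition dvd_prod :: "(nat \<Rightarrow> real) \<Rightarrow> nat set \<Rightarrow> nat \<Rightarrow> real" where
  "dvd_prod a P n = (\<Prod>p\<in>{p\<in>P. p dvd n}. a p)"

lemma dvd_prod_bounds:
  assumes "\<And>p. p \<in> P \<Longrightarrow> 0 \<le> a p \<and> a p \<le> 1"
  shows "0 \<le> dvd_prod a P n" "dvd_prod a P n \<le> 1"
  unfolding dvd_prod_def using assms by (auto intro!: prod_nonneg prod_le_1)

lemma dvd_prod_mult_prime: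
  assumes P: "\<And>q. q \<in> P \<Longrightarrow> prime q" "prime p" "p \<notin> P"
  shows "dvd_prod a P (p * n) = dvd_prod a P n"
proof -
  have "q dvd p * n \<longleftrightarrow> q dvd n" if q: "q \<in> P" for q
    using P q by (metis prime_dvd_mult_iff primes_dvd_imp_eq)
  hence "{q\<in>P. q dvd p * n} = {q\<in>P. q dvd n}" by auto
  thus ?thesis by (simp only: dvd_prod_def)
qed

lemma dvd_prod_insert:
  assumes "finite P" "p \<notin> P"
  shows "dvd_prod a (insert p P) n = (if p dvd n then a p * dvd_prod a P n else dvd_prod a P n)"
proof -
  have "{q \<in> insert p P. q dvd n} = (if p dvd n then insert p {q\<in>P. q dvd n} else {q\<in>P. q dvd n})" by auto
  thus ?thesis using assms by (simp add: dvd_prod_def)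
qed

text \<open>Adding a prime p multiplies the terms with p | n by \<open>a p\<close>. These terms sum
  to p^(-s) times the whole, because the weight for the other primes does not notice a factor p. So
  the sum is multiplied by 1 - (1 - a p) p^(-s).\<close>

lemma has_sum_dvd_prod:
  assumes s: "s > 1" and P: "finite P" "\<And>p. p \<in> P \<Longrightarrow> prime p"
  shows "((\<lambda>n. dvd_prod a P n * real n powr (- s)) has_sum (zeta s * (\<Prod>p\<in>P. 1 - (1 - a p) * real p powr (- s)))) {1..}"
  using P
proof (induction P rule: finite_induct)
  case empty
  show ?case using has_sum_infsum[OF zeta_summable[OF s]] by (simp add: dvd_prod_def zeta_def)
next
  case (insert p P)
  define F where "F n = dvd_prod a P n * real n powr (- s)" for n
  define T where "T = zeta s * (\<Prod>p\<in>P. 1 - (1 - a p) * real p powr (- s))"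
  have F: "(F has_sum T) {1..}" using insert by (simp add: F_def[abs_def] T_def)
  have pp: "prime p" using insert.prems by simp
  hence p0: "p > 0" by (rule prime_gt_0_nat)
  have "F (p * n) = real p powr (- s) * F n" for n
    using dvd_prod_mult_prime[of P p a n] insert pp by (simp add: F_def powr_mult)
  hence "((F \<circ> (*) p) has_sum (real p powr (- s) * T)) {1..}"
    using has_sum_cmult_right[OF F, of "real p powr (- s)"] by (simp add: o_def)
  hence "(F has_sum (real p powr (- s) * T)) ((*) p ` {1..})"
    using p0 by (subst has_sum_reindex) (auto simp: inj_on_def)
  also have "?this \<longleftrightarrow> ((\<lambda>n. if p dvd n then F n else 0) has_sum (real p powr (- s) * T)) {1..}"
  proof (rule has_sum_cong_neutral)
    fix n assume "n \<in> {1..} - (*) p ` {1..}"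
    hence "\<not> p dvd n" by (auto elim!: dvdE simp: image_iff)
    thus "(if p dvd n then F n else 0) = 0" by simp
  next
    fix n assume "n \<in> (*) p ` {1..} - {1..}"
    thus "F n = 0" using p0 by (auto simp: Suc_le_eq)
  qed auto
  finally have "((\<lambda>n. (1 - a p) * (if p dvd n then F n else 0)) has_sum ((1 - a p) * (real p powr (- s) * T))) {1..}"
    by (rule has_sum_cmult_right)
  hence "((\<lambda>n. - ((1 - a p) * (if p dvd n then F n else 0))) has_sum (- ((1 - a p) * (real p powr (- s) * T)))) {1..}"
    by (simp only: has_sum_uminus minus_minus)
  from has_sum_add[OF F this, unfolded add_uminus_conv_diff]
  have "((\<lambda>n. F n - (1 - a p) * (if p dvd n then F n else 0)) has_sum (T - (1 - a p) * (real p powr (- s) * T))) {1..}" .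
  moreover have "(\<lambda>n. F n - (1 - a p) * (if p dvd n then F n else 0)) = (\<lambda>n. dvd_prod a (insert p P) n * real n powr (- s))"
    using insert.hyps by (auto simp: dvd_prod_insert F_def algebra_simps)
  moreover have "T - (1 - a p) * (real p powr (- s) * T) = zeta s * (\<Prod>p\<in>insert p P. 1 - (1 - a p) * real p powr (- s))"
    using insert.hyps by (simp add: T_def algebra_simps)
  ultimately show ?case by (simp only:)
qed

definition primes_upto :: "nat \<Rightarrow> nat set" where
  "primes_upto m = {p. prime p \<and> p \<le> m}"

lemma primes_upto: "finite (primes_upto m)" "p \<in> primes_upto m \<Longrightarrow> prime p"
  by (auto simp: primes_upto_def intro: finite_subset[of _ "{..m}"])

lemma card_primes_upto: "card (primes_upto m) \<le> m"
proof -
  have "primes_upto m \<subseteq> {1..m}" by (auto simp: primes_upto_def dest: prime_gt_0_nat)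
  hence "card (primes_upto m) \<le> card {1..m}" by (intro card_mono) auto
  thus ?thesis by simp
qed

text \<open>For fixed n only primes up to n count, so each term is eventually constant in m, and all
  of them are dominated by n^(-s).\<close>

lemma dvd_prod_primes_upto_lim:
  assumes s: "s > 1" and a: "\<And>p. prime p \<Longrightarrow> 0 \<le> a p \<and> a p \<le> 1"
  shows "(\<lambda>m. zeta s * (\<Prod>p\<in>primes_upto m. 1 - (1 - a p) * real p powr (- s))) \<longlonglongrightarrow>
    (\<Sum>\<^sub>\<infinity>n\<in>{1..}. dvd_prod a {p. prime p} n * real n powr (- s))"
proof -
  have "(\<lambda>m. \<Sum>\<^sub>\<infinity>n\<in>{1..}. dvd_prod a (primes_upto m) n * real n powr (- s)) \<longlonglongrightarrow>
    (\<Sum>\<^sub>\<infinity>n\<in>{1..}. dvd_prod a {p. prime p} n * real n powr (- s))"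
  proof (rule infsum_dominated)
    fix n :: nat assume n: "n \<in> {1..}"
    have "dvd_prod a (primes_upto m) n = dvd_prod a {p. prime p} n" if "m \<ge> n" for m
    proof -
      have "{p \<in> primes_upto m. p dvd n} = {p \<in> {p. prime p}. p dvd n}"
      proof -
        have "p \<le> m" if "p dvd n" for p using dvd_imp_le[OF that] n \<open>m \<ge> n\<close> by auto
        thus ?thesis by (auto simp: primes_upto_def)
      qed
      thus ?thesis by (simp only: dvd_prod_def)
    qed
    thus "(\<lambda>m. dvd_prod a (primes_upto m) n * real n powr (- s)) \<longlonglongrightarrow> dvd_prod a {p. prime p} n * real n powr (- s)"
      by (intro tendsto_eventually eventually_sequentiallyI[of n]) simp
  next
    have "\<bar>dvd_prod a (primes_upto m) n * real n powr (- s)\<bar> \<le> real n powr (- s)" for m n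
      using dvd_prod_bounds[of "primes_upto m" a n] a primes_upto(2)
      by (simp add: abs_mult mult_left_le_one_le)
    thus "\<forall>\<^sub>F m in sequentially. \<forall>n\<in>{1..}. \<bar>dvd_prod a (primes_upto m) n * real n powr (- s)\<bar> \<le> real n powr (- s)"
      by simp
  qed (use zeta_summable[OF s] in auto)
  also have "(\<lambda>m. \<Sum>\<^sub>\<infinity>n\<in>{1..}. dvd_prod a (primes_upto m) n * real n powr (- s)) =
      (\<lambda>m. zeta s * (\<Prod>p\<in>primes_upto m. 1 - (1 - a p) * real p powr (- s)))"
    using primes_upto by (intro ext infsumI has_sum_dvd_prod[OF s]) auto
  finally show ?thesis .
qed

lemma zeta_pos: "s > 1 \<Longrightarrow> zeta s > 0"
proof -
  assume s: "s > 1"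
  have "(\<Sum>\<^sub>\<infinity>n\<in>{1::nat}. real n powr (- s)) \<le> zeta s"
    unfolding zeta_def using zeta_summable[OF s] by (intro infsum_mono2) auto
  thus ?thesis by simp
qed

lemma euler_zeta:
  assumes s: "s > 1"
  shows "(\<lambda>m. \<Prod>p\<in>primes_upto m. 1 - real p powr (- s)) \<longlonglongrightarrow> 1 / zeta s"
proof -
  have "dvd_prod (\<lambda>_. 0) {p. prime p} n * real n powr (- s) = (if n = 1 then 1 else 0)" if "n \<in> {1..}" for n
  proof (cases "n = 1")
    case False
    then obtain p where "prime p" "p dvd n" using prime_factor_nat by blast
    have "{p \<in> {p. prime p}. p dvd n} \<subseteq> {..n}"
    proof
      fix x assume "x \<in> {p \<in> {p. prime p}. p dvd n}"
      thus "x \<in> {..n}" using that by (simp add: dvd_imp_le)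
    qed
    hence "finite {p \<in> {p. prime p}. p dvd n}" by (rule finite_subset) simp
    hence "dvd_prod (\<lambda>_. 0) {p. prime p} n = 0" unfolding dvd_prod_def
      using \<open>prime p\<close> \<open>p dvd n\<close> by (intro prod_zero) auto
    thus ?thesis using False by simp
  next
    case True
    have e0: "{p \<in> {p. prime p}. p dvd (1::nat)} = {}" by auto
    have "dvd_prod (\<lambda>_. 0) {p. prime p} 1 = 1" unfolding dvd_prod_def e0 by (rule prod.empty)
    thus ?thesis using True by simp
  qed
  hence "(\<Sum>\<^sub>\<infinity>n\<in>{1..}. dvd_prod (\<lambda>_. 0) {p. prime p} n * real n powr (- s)) = (\<Sum>\<^sub>\<infinity>n\<in>{1..}. if n = (1::nat) then 1 else 0)"
    by (rule infsum_cong)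
  also have "\<dots> = (\<Sum>\<^sub>\<infinity>n\<in>{1::nat}. 1)" by (rule infsum_cong_neutral) auto
  also have "\<dots> = 1" by simp
  finally have E: "(\<Sum>\<^sub>\<infinity>n\<in>{1..}. dvd_prod (\<lambda>_. 0) {p. prime p} n * real n powr (- s)) = 1" .
  have "(\<lambda>m. zeta s * (\<Prod>p\<in>primes_upto m. 1 - (1 - 0) * real p powr (- s))) \<longlonglongrightarrow>
      (\<Sum>\<^sub>\<infinity>n\<in>{1..}. dvd_prod (\<lambda>_. 0) {p. prime p} n * real n powr (- s))"
    by (rule dvd_prod_primes_upto_lim[OF s]) simp
  hence "(\<lambda>m. zeta s * (\<Prod>p\<in>primes_upto m. 1 - real p powr (- s))) \<longlonglongrightarrow> 1"
    unfolding E by (simp only: diff_zero mult_1)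
  from tendsto_divide[OF this tendsto_const[of "zeta s"]] show ?thesis using zeta_pos[OF s] by simp
qed

text \<open>The proportion of the vectors in Z^2 that have no common divisor with n: modulo each
  prime p dividing n one class out of p^2 is excluded.\<close>

definition coprime_density :: "nat \<Rightarrow> real" where
  "coprime_density n = dvd_prod (\<lambda>p. 1 - 1 / (real p)\<^sup>2) {p. prime p} n"

lemma prime_inverse_square_bounds: "prime p \<Longrightarrow> 0 \<le> 1 - 1 / (real p)\<^sup>2 \<and> 1 - 1 / (real p)\<^sup>2 \<le> 1"
proof -
  assume "prime p"
  hence "1 \<le> (real p)\<^sup>2" using prime_gt_0_nat[of p] by (simp add: Suc_le_eq)
  from frac_le[OF zero_le_one order_refl zero_less_one this] show ?thesis by simp
qed

text \<open>Here the weight falls short of 1 by p^(-2), so the Euler factors of the correction are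
  those of zeta at s + 2.\<close>

lemma infsum_coprime_density:
  assumes s: "s > 1"
  shows "(\<Sum>\<^sub>\<infinity>n\<in>{1..}. coprime_density n * real n powr (- s)) = zeta s / zeta (s + 2)"
proof (rule LIMSEQ_unique)
  have e: "1 - (1 - (1 - 1 / (real p)\<^sup>2)) * real p powr (- s) = 1 - real p powr (- (s + 2))" if "prime p" for p
  proof -
    have "real p powr (- (s + 2)) = real p powr (- s) * real p powr (- 2)" by (simp add: powr_add[symmetric])
    also have "real p powr (- 2) = 1 / (real p)\<^sup>2"
      using prime_gt_0_nat[OF that] by (simp add: powr_minus powr_numeral inverse_eq_divide)
    finally show ?thesis by simp
  qed
  have "(\<lambda>m. zeta s * (\<Prod>p\<in>primes_upto m. 1 - (1 - (1 - 1 / (real p)\<^sup>2)) * real p powr (- s))) \<longlonglongrightarrow>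
      (\<Sum>\<^sub>\<infinity>n\<in>{1..}. coprime_density n * real n powr (- s))"
    unfolding coprime_density_def by (rule dvd_prod_primes_upto_lim[OF s prime_inverse_square_bounds])
  thus "(\<lambda>m. zeta s * (\<Prod>p\<in>primes_upto m. 1 - real p powr (- (s + 2)))) \<longlonglongrightarrow>
      (\<Sum>\<^sub>\<infinity>n\<in>{1..}. coprime_density n * real n powr (- s))"
    using e primes_upto(2) by (simp cong: prod.cong)
  show "(\<lambda>m. zeta s * (\<Prod>p\<in>primes_upto m. 1 - real p powr (- (s + 2)))) \<longlonglongrightarrow> zeta s / zeta (s + 2)"
    using tendsto_mult[OF tendsto_const[of "zeta s"] euler_zeta[of "s + 2"]] s by simp
qed

text \<open>Convergence of an infinite product includes that its limit is nonzero, whence the second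
  hypothesis; the partial products up to m are products over the primes up to m.\<close>

lemma euler_prod_eqI:
  assumes lim: "(\<lambda>m. \<Prod>p\<in>primes_upto m. f p) \<longlonglongrightarrow> L" and L: "L \<noteq> 0"
  shows "euler_prod f = L"
proof -
  have "(\<Prod>p\<le>m. if prime p then f p else 1) = (\<Prod>p\<in>primes_upto m. f p)" for m
  proof -
    have "(\<Prod>p\<le>m. if prime p then f p else 1) = (\<Prod>p\<in>{p \<in> {..m}. prime p}. f p)"
      by (rule prod.inter_filter[symmetric]) simp
    also have "{p \<in> {..m}. prime p} = primes_upto m" by (auto simp: primes_upto_def)
    finally show ?thesis .
  qed
  with lim have "(\<lambda>m. \<Prod>p\<le>m. if prime p then f p else 1) \<longlonglongrightarrow> L" by (simp only:)
  with L have "raw_has_prod (\<lambda>p. if prime p then f p else 1) 0 L"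
    by (simp only: raw_has_prod_def add_0_right) blast
  hence "(\<lambda>p. if prime p then f p else 1) has_prod L" by (simp add: has_prod_def)
  thus ?thesis unfolding euler_prod_def by (rule has_prod_unique[symmetric])
qed

text \<open>The set \<open>V\<close> is filtered by a norm \<open>N\<close> with \<open>\<kappa> Q r\<^sup>e\<close> elements below \<open>r\<close>, and multiplication
  by a prime maps \<open>V\<close> onto the elements divisible by it. Elements without a prime divisor are then counted
  with the factor \<open>1 / \<zeta>(e)\<close>. The constants \<open>\<kappa>\<close> and \<open>C\<close> are kept apart from the scale \<open>Q\<close> in order to
  have a bound which is uniform over the fibres below.\<close>

definition sieve_hyp :: "'v set \<Rightarrow> ('v \<Rightarrow> real) \<Rightarrow> (nat \<Rightarrow> 'v \<Rightarrow> bool) \<Rightarrow> (nat \<Rightarrow> 'v \<Rightarrow> 'v) \<Rightarrow> real \<Rightarrow> real \<Rightarrow> real \<Rightarrow> nat \<Rightarrow> bool"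
  where "sieve_hyp V N dv sc \<kappa> C Q e \<longleftrightarrow>
    (\<forall>r. finite {v\<in>V. N v < r}) \<and> (\<forall>v\<in>V. 1 \<le> N v) \<and>
    (\<forall>p. prime p \<longrightarrow> bij_betw (sc p) V {v\<in>V. dv p v}) \<and>
    (\<forall>p v. prime p \<longrightarrow> v \<in> V \<longrightarrow> N (sc p v) = real p * N v) \<and>
    (\<forall>p q v. prime p \<longrightarrow> prime q \<longrightarrow> p \<noteq> q \<longrightarrow> v \<in> V \<longrightarrow> (dv q (sc p v) \<longleftrightarrow> dv q v)) \<and>
    (\<forall>r>0. \<bar>real (card {v\<in>V. N v < r}) - \<kappa> * Q * r ^ e\<bar> \<le> C * Q * r ^ (e - 1)) \<and>
    \<kappa> \<ge> 0 \<and> C \<ge> 0 \<and> Q \<ge> 0 \<and> e \<ge> 2"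

text \<open>Multiplication by p is a bijection onto the elements divisible by p; it divides the
  bound by p in return and does not change divisibility by other primes.\<close>

lemma sieve_scale_eq:
  assumes H: "sieve_hyp V N dv sc \<kappa> C Q e" and p: "prime p" and P: "\<And>q. q \<in> P \<Longrightarrow> prime q" "p \<notin> P"
  shows "card {v\<in>V. N v < r \<and> (\<forall>q\<in>P. \<not> dv q v) \<and> dv p v} = card {v\<in>V. N v < r / real p \<and> (\<forall>q\<in>P. \<not> dv q v)}"
proof -
  have bij: "bij_betw (sc p) V {v\<in>V. dv p v}" and N: "\<And>v. v \<in> V \<Longrightarrow> N (sc p v) = real p * N v"
    using H p unfolding sieve_hyp_def by auto
  have dv: "dv q (sc p v) \<longleftrightarrow> dv q v" if "q \<in> P" "v \<in> V" for q v
  proof -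
    have "prime q" "p \<noteq> q" using P that by auto
    thus ?thesis using H p that unfolding sieve_hyp_def by blast
  qed
  have p0: "real p > 0" using prime_gt_0_nat[OF p] by simp
  have "{v\<in>V. N v < r \<and> (\<forall>q\<in>P. \<not> dv q v) \<and> dv p v} = sc p ` {v\<in>V. N v < r / real p \<and> (\<forall>q\<in>P. \<not> dv q v)}"
  proof (intro equalityI subsetI)
    fix w assume w: "w \<in> {v\<in>V. N v < r \<and> (\<forall>q\<in>P. \<not> dv q v) \<and> dv p v}"
    then obtain v where v: "v \<in> V" "w = sc p v" using bij unfolding bij_betw_def by blast
    have "N v < r / real p" using w v N[OF v(1)] p0 by (simp add: pos_less_divide_eq mult.commute)
    thus "w \<in> sc p ` {v\<in>V. N v < r / real p \<and> (\<forall>q\<in>P. \<not> dv q v)}" using w v dv by auto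
  next
    fix w assume "w \<in> sc p ` {v\<in>V. N v < r / real p \<and> (\<forall>q\<in>P. \<not> dv q v)}"
    then obtain v where v: "v \<in> V" "w = sc p v" "N v < r / real p" "\<forall>q\<in>P. \<not> dv q v" by auto
    have "w \<in> {v\<in>V. dv p v}" using bij v unfolding bij_betw_def by blast
    moreover have "N w < r" using v N[OF v(1)] p0 by (simp add: pos_less_divide_eq mult.commute)
    ultimately show "w \<in> {v\<in>V. N v < r \<and> (\<forall>q\<in>P. \<not> dv q v) \<and> dv p v}" using v dv by auto
  qed
  moreover have "inj_on (sc p) {v\<in>V. N v < r / real p \<and> (\<forall>q\<in>P. \<not> dv q v)}"
    using bij unfolding bij_betw_def by (auto intro: inj_on_subset)
  ultimately show ?thesis by (simp add: card_image)
qed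

text \<open>One prime at a time: the count for \<open>insert p P\<close> is the count for
  \<open>P\<close> at r minus that at r / p. The main term gains the factor 1 - p^(-e), and the
  error at most doubles. Since r / p may be small, the hypothesis is asked for all r > 0.\<close>

lemma sieve_finite:
  assumes H: "sieve_hyp V N dv sc \<kappa> C Q e" and P: "finite P" "\<And>q. q \<in> P \<Longrightarrow> prime q" and r: "r > 0"
  shows "\<bar>real (card {v\<in>V. N v < r \<and> (\<forall>q\<in>P. \<not> dv q v)}) - \<kappa> * (\<Prod>p\<in>P. 1 - 1 / real p ^ e) * Q * r ^ e\<bar>
    \<le> C * 2 ^ card P * Q * r ^ (e - 1)"
  using P r
proof (induction P arbitrary: r rule: finite_induct)
  case empty
  thus ?case using H unfolding sieve_hyp_def by simp
next
  case (insert p P)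
  have p: "prime p" and PP: "\<And>q. q \<in> P \<Longrightarrow> prime q" using insert.prems by auto
  have p1: "real p \<ge> 1" using prime_gt_0_nat[OF p] by (simp add: Suc_le_eq)
  have CQ: "C \<ge> 0" "Q \<ge> 0" using H unfolding sieve_hyp_def by auto
  define A where "A r = real (card {v\<in>V. N v < r \<and> (\<forall>q\<in>P. \<not> dv q v)})" for r
  define E where "E = (\<Prod>p\<in>P. 1 - 1 / real p ^ e)"
  define K where "K = C * 2 ^ card P * Q"
  have K: "K \<ge> 0" using CQ by (simp add: K_def)
  have fin: "finite {v\<in>V. N v < r}" for r using H unfolding sieve_hyp_def by auto
  have "{v\<in>V. N v < r \<and> (\<forall>q\<in>P. \<not> dv q v)} =
      {v\<in>V. N v < r \<and> (\<forall>q\<in>insert p P. \<not> dv q v)} \<union> {v\<in>V. N v < r \<and> (\<forall>q\<in>P. \<not> dv q v) \<and> dv p v}" by auto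
  hence "card {v\<in>V. N v < r \<and> (\<forall>q\<in>P. \<not> dv q v)} = card {v\<in>V. N v < r \<and> (\<forall>q\<in>insert p P. \<not> dv q v)} +
      card {v\<in>V. N v < r \<and> (\<forall>q\<in>P. \<not> dv q v) \<and> dv p v}"
    by (simp only:) (intro card_Un_disjoint finite_subset[OF _ fin[of r]], auto)
  hence eq: "real (card {v\<in>V. N v < r \<and> (\<forall>q\<in>insert p P. \<not> dv q v)}) = A r - A (r / real p)"
    using sieve_scale_eq[OF H p PP insert.hyps(2), of r] by (simp add: A_def)
  have b1: "\<bar>A r - \<kappa> * E * Q * r ^ e\<bar> \<le> K * r ^ (e - 1)"
    using insert.IH[OF PP insert.prems(2)] by (simp add: A_def E_def K_def)
  have "r / real p > 0" using insert.prems p1 by simp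
  hence b2: "\<bar>A (r / real p) - \<kappa> * E * Q * (r / real p) ^ e\<bar> \<le> K * (r / real p) ^ (e - 1)"
    using insert.IH[OF PP, of "r / real p"] by (simp add: A_def E_def K_def)
  have "r / real p \<le> r" using p1 insert.prems(2) by (simp add: divide_le_eq_1 mult_left_le pos_divide_le_eq)
  hence "(r / real p) ^ (e - 1) \<le> r ^ (e - 1)" using insert.prems(2) p1 by (intro power_mono) auto
  hence b3: "K * (r / real p) ^ (e - 1) \<le> K * r ^ (e - 1)" using K by (intro mult_left_mono)
  have "\<kappa> * (\<Prod>p\<in>insert p P. 1 - 1 / real p ^ e) * Q * r ^ e = \<kappa> * E * Q * r ^ e - \<kappa> * E * Q * (r / real p) ^ e"
    using insert.hyps by (simp add: E_def power_divide algebra_simps)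
  hence "\<bar>real (card {v\<in>V. N v < r \<and> (\<forall>q\<in>insert p P. \<not> dv q v)}) - \<kappa> * (\<Prod>p\<in>insert p P. 1 - 1 / real p ^ e) * Q * r ^ e\<bar>
      \<le> 2 * (K * r ^ (e - 1))"
    unfolding eq using b1 b2 b3 by linarith
  also have "\<dots> = C * 2 ^ card (insert p P) * Q * r ^ (e - 1)"
    using insert.hyps by (simp add: K_def)
  finally show ?case .
qed

text \<open>All norms are at least 1, so the count is empty for r \<le> 1, and beyond 1 the error is
  dominated by the power of the main term. The bound thus has no lower order term and can be summed
  over primes.\<close>

lemma sieve_upper:
  assumes H: "sieve_hyp V N dv sc \<kappa> C Q e" and r: "r > 0"
  shows "real (card {v\<in>V. N v < r}) \<le> (\<kappa> + C) * Q * r ^ e"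
proof (cases "r \<le> 1")
  case True
  hence "{v\<in>V. N v < r} = {}" using H unfolding sieve_hyp_def by force
  hence c: "card {v\<in>V. N v < r} = 0" by (simp only: card.empty)
  have "\<kappa> \<ge> 0" "C \<ge> 0" "Q \<ge> 0" using H unfolding sieve_hyp_def by auto
  thus ?thesis unfolding c using r by simp
next
  case False
  have CQ: "C * Q \<ge> 0" and e: "e \<ge> 2" using H unfolding sieve_hyp_def by auto
  have "\<bar>real (card {v\<in>V. N v < r}) - \<kappa> * Q * r ^ e\<bar> \<le> C * Q * r ^ (e - 1)"
    using H r unfolding sieve_hyp_def by blast
  moreover have "C * Q * r ^ (e - 1) \<le> C * Q * r ^ e"
    using False CQ e by (intro mult_left_mono power_increasing) auto
  ultimately show ?thesis by (simp add: algebra_simps abs_le_iff)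
qed

lemma sum_inverse_squares_tail:
  assumes "m \<ge> 1"
  shows "(\<Sum>n\<in>{m<..m+k}. 1 / (real n)\<^sup>2) \<le> 1 / real m - 1 / real (m + k)"
proof (induction k)
  case (Suc k)
  have "{m<..m + Suc k} = insert (m + Suc k) {m<..m+k}" by auto
  hence "(\<Sum>n\<in>{m<..m + Suc k}. 1 / (real n)\<^sup>2) = 1 / (real (m + Suc k))\<^sup>2 + (\<Sum>n\<in>{m<..m+k}. 1 / (real n)\<^sup>2)" by simp
  also have "\<dots> \<le> 1 / (real (m + Suc k))\<^sup>2 + (1 / real m - 1 / real (m + k))" using Suc by simp
  also have "1 / (real (m + Suc k))\<^sup>2 \<le> 1 / real (m + k) - 1 / real (m + Suc k)"
  proof -
    define a where "a = real (m + k)"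
    have a: "a \<ge> 1" using assms by (simp add: a_def)
    have "1 / (a + 1)\<^sup>2 \<le> 1 / (a * (a + 1))"
      using a by (intro divide_left_mono) (auto simp: power2_eq_square intro!: mult_right_mono)
    also have "1 / (a * (a + 1)) = 1 / a - 1 / (a + 1)" using a by (simp add: diff_frac_eq)
    finally show ?thesis by (simp add: a_def add.commute)
  qed
  finally show ?case by simp
qed simp

text \<open>The primes up to m are sieved exactly, with the error 2^m. The larger ones remove at
  most the sum of \<open>sieve_upper\<close> at r / p, and as e \<ge> 2 this is a tail of the sum of
  1/p^2, at most 1/m.\<close>

lemma sieve_bound:
  assumes H: "sieve_hyp V N dv sc \<kappa> C Q e" and r: "r > 0" and m: "m \<ge> 1"
  shows "\<bar>real (card {v\<in>V. N v < r \<and> (\<forall>q. prime q \<longrightarrow> \<not> dv q v)}) - \<kappa> * (\<Prod>p\<in>primes_upto m. 1 - 1 / real p ^ e) * Q * r ^ e\<bar>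
    \<le> C * 2 ^ m * Q * r ^ (e - 1) + (\<kappa> + C) * Q * r ^ e / real m"
proof -
  define A where "A = {v\<in>V. N v < r \<and> (\<forall>q\<in>primes_upto m. \<not> dv q v)}"
  define B where "B = {v\<in>V. N v < r \<and> (\<forall>q. prime q \<longrightarrow> \<not> dv q v)}"
  have fin: "finite {v\<in>V. N v < r}" for r using H unfolding sieve_hyp_def by auto
  have pos: "\<kappa> \<ge> 0" "C \<ge> 0" "Q \<ge> 0" "e \<ge> 2" using H unfolding sieve_hyp_def by auto
  have fA: "finite A" "finite B" unfolding A_def B_def by (auto intro: finite_subset[OF _ fin[of r]])
  have BA: "B \<subseteq> A" unfolding A_def B_def using primes_upto(2) by blast
  \<comment> \<open>Elements of norm below r have no prime divisor p \<ge> r, because the quotient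
    has norm at least 1. So the primes to be removed form a finite range.\<close>
  define k where "k = nat \<lceil>r\<rceil>"
  define D where "D p = {v\<in>V. N v < r \<and> dv p v}" for p
  have fD: "finite (D p)" for p unfolding D_def by (auto intro: finite_subset[OF _ fin[of r]])
  have cD: "real (card (D p)) \<le> (\<kappa> + C) * Q * r ^ e * (1 / (real p)\<^sup>2)" if p: "prime p" for p
  proof -
    have p1: "real p \<ge> 1" using prime_gt_0_nat[OF p] by (simp add: Suc_le_eq)
    have "real (card (D p)) = real (card {v\<in>V. N v < r / real p})"
      using sieve_scale_eq[OF H p, of "{}" r] by (simp add: D_def)
    also have "\<dots> \<le> (\<kappa> + C) * Q * (r / real p) ^ e" using r p1 by (intro sieve_upper[OF H]) simp
    also have "\<dots> = (\<kappa> + C) * Q * r ^ e * (1 / real p ^ e)" by (simp add: power_divide)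
    also have "\<dots> \<le> (\<kappa> + C) * Q * r ^ e * (1 / (real p)\<^sup>2)"
      using pos r p1 by (intro mult_left_mono divide_left_mono power_increasing) auto
    finally show ?thesis .
  qed
  have "A - B \<subseteq> (\<Union>p\<in>{p\<in>{m<..m+k}. prime p}. D p)"
  proof
    fix v assume v: "v \<in> A - B"
    then obtain p where p: "prime p" "dv p v" by (auto simp: A_def B_def)
    have vV: "v \<in> V" "N v < r" using v by (auto simp: A_def)
    have "p \<notin> primes_upto m" using v p by (auto simp: A_def)
    hence pm: "p > m" using p by (simp add: primes_upto_def)
    have "bij_betw (sc p) V {v\<in>V. dv p v}" using H p unfolding sieve_hyp_def by blast
    then obtain w where w: "w \<in> V" "v = sc p w" using vV p unfolding bij_betw_def by blast
    have "real p * 1 \<le> real p * N w" using H w unfolding sieve_hyp_def by (intro mult_left_mono) auto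
    also have "\<dots> = N v" using H w p unfolding sieve_hyp_def by simp
    also have "\<dots> < r" by fact
    finally have "real p < r" by simp
    hence "p \<le> k" unfolding k_def by linarith
    thus "v \<in> (\<Union>p\<in>{p\<in>{m<..m+k}. prime p}. D p)" using pm p vV by (auto simp: D_def)
  qed
  hence "card (A - B) \<le> card (\<Union>p\<in>{p\<in>{m<..m+k}. prime p}. D p)" using fD by (intro card_mono) auto
  also have "\<dots> \<le> (\<Sum>p\<in>{p\<in>{m<..m+k}. prime p}. card (D p))" by (rule card_UN_le) auto
  finally have "real (card (A - B)) \<le> (\<Sum>p\<in>{p\<in>{m<..m+k}. prime p}. real (card (D p)))"
    by (metis of_nat_le_iff of_nat_sum)
  also have "\<dots> \<le> (\<Sum>p\<in>{p\<in>{m<..m+k}. prime p}. (\<kappa> + C) * Q * r ^ e * (1 / (real p)\<^sup>2))"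
    using cD by (intro sum_mono) auto
  also have "\<dots> \<le> (\<Sum>p\<in>{m<..m+k}. (\<kappa> + C) * Q * r ^ e * (1 / (real p)\<^sup>2))"
    using pos r by (intro sum_mono2) auto
  also have "\<dots> = (\<kappa> + C) * Q * r ^ e * (\<Sum>p\<in>{m<..m+k}. 1 / (real p)\<^sup>2)" by (simp add: sum_distrib_left)
  also have "\<dots> \<le> (\<kappa> + C) * Q * r ^ e * (1 / real m)"
  proof (rule mult_left_mono)
    have "(\<Sum>p\<in>{m<..m+k}. 1 / (real p)\<^sup>2) \<le> 1 / real m - 1 / real (m + k)"
      using m by (rule sum_inverse_squares_tail)
    also have "\<dots> \<le> 1 / real m" by simp
    finally show "(\<Sum>p\<in>{m<..m+k}. 1 / (real p)\<^sup>2) \<le> 1 / real m" .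
  qed (use pos r in auto)
  finally have AB: "real (card (A - B)) \<le> (\<kappa> + C) * Q * r ^ e / real m" by simp
  have "card A = card B + card (A - B)" using fA BA by (simp add: card_Diff_subset card_mono)
  hence cAB: "real (card A) = real (card B) + real (card (A - B))" by simp
  have "\<bar>real (card A) - \<kappa> * (\<Prod>p\<in>primes_upto m. 1 - 1 / real p ^ e) * Q * r ^ e\<bar> \<le> C * 2 ^ card (primes_upto m) * Q * r ^ (e - 1)"
    unfolding A_def by (rule sieve_finite[OF H primes_upto r])
  also have "\<dots> \<le> C * 2 ^ m * Q * r ^ (e - 1)"
    using pos r card_primes_upto by (intro mult_right_mono mult_left_mono power_increasing) auto
  finally have "\<bar>real (card B) - \<kappa> * (\<Prod>p\<in>primes_upto m. 1 - 1 / real p ^ e) * Q * r ^ e\<bar>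
      \<le> C * 2 ^ m * Q * r ^ (e - 1) + (\<kappa> + C) * Q * r ^ e / real m"
    using AB cAB by linarith
  thus ?thesis by (simp only: B_def)
qed

text \<open>The cutoff m depends on \<epsilon>, \<kappa>, C and e only, and so does R. The scale Q
  is a common factor of main term and error, which makes the same R work for all sieve problems with
  these constants.\<close>

lemma sieve_uniform:
  assumes "\<kappa> \<ge> 0" "C \<ge> 0" and e: "e \<ge> 2" and eps: "\<epsilon> > 0"
  shows "\<exists>R>0. \<forall>V N dv sc Q r. sieve_hyp (V :: 'v set) N dv sc \<kappa> C Q e \<longrightarrow> r \<ge> R \<longrightarrow>
    \<bar>real (card {v\<in>V. N v < r \<and> (\<forall>q. prime q \<longrightarrow> \<not> dv q v)}) - \<kappa> / zeta (real e) * Q * r ^ e\<bar> \<le> \<epsilon> * Q * r ^ e"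
proof -
  define E where "E m = (\<Prod>p\<in>primes_upto m. 1 - 1 / real p ^ e)" for m
  have "E = (\<lambda>m. \<Prod>p\<in>primes_upto m. 1 - real p powr (- real e))"
    unfolding E_def[abs_def] using prime_gt_0_nat primes_upto(2)
    by (intro ext prod.cong refl) (simp add: powr_minus powr_realpow inverse_eq_divide)
  moreover have "real e > 1" using e by simp
  ultimately have "E \<longlonglongrightarrow> 1 / zeta (real e)" using euler_zeta[of "real e"] by (simp only:)
  hence "(\<lambda>m. \<kappa> * E m) \<longlonglongrightarrow> \<kappa> * (1 / zeta (real e))" by (rule tendsto_mult_left)
  hence 1: "\<forall>\<^sub>F m in sequentially. dist (\<kappa> * E m) (\<kappa> * (1 / zeta (real e))) < \<epsilon> / 3"
    using eps by (intro tendstoD) auto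
  have "(\<lambda>m. (\<kappa> + C) * (1 / real m)) \<longlonglongrightarrow> (\<kappa> + C) * 0" by (intro tendsto_mult_left lim_1_over_n)
  hence 2: "\<forall>\<^sub>F m in sequentially. dist ((\<kappa> + C) * (1 / real m)) ((\<kappa> + C) * 0) < \<epsilon> / 3"
    using eps by (intro tendstoD) auto
  obtain m where m: "m \<ge> 1" "dist (\<kappa> * E m) (\<kappa> * (1 / zeta (real e))) < \<epsilon> / 3"
    "dist ((\<kappa> + C) * (1 / real m)) ((\<kappa> + C) * 0) < \<epsilon> / 3"
    using eventually_happens'[OF _ eventually_conj[OF eventually_ge_at_top[of 1] eventually_conj[OF 1 2]]] by auto
  have mE: "\<bar>\<kappa> * E m - \<kappa> / zeta (real e)\<bar> \<le> \<epsilon> / 3" and mC: "(\<kappa> + C) / real m \<le> \<epsilon> / 3"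
  proof -
    show "\<bar>\<kappa> * E m - \<kappa> / zeta (real e)\<bar> \<le> \<epsilon> / 3" using m(2) by (simp add: dist_real_def)
    have "\<bar>(\<kappa> + C) / real m\<bar> < \<epsilon> / 3"
      using m(3) unfolding dist_real_def mult_zero_right diff_zero times_divide_eq_right mult_1_right .
    thus "(\<kappa> + C) / real m \<le> \<epsilon> / 3" by linarith
  qed
  \<comment> \<open>From here on the error C 2^m r^(e-1) is at most \<epsilon>/3 r^e; the summand 1
    keeps \<open>R\<close> positive.\<close>
  define R where "R = 1 + 3 * (C * 2 ^ m) / \<epsilon>"
  have R: "R > 0" using assms by (simp add: R_def add_pos_nonneg)
  have "\<bar>real (card {v\<in>V. N v < r \<and> (\<forall>q. prime q \<longrightarrow> \<not> dv q v)}) - \<kappa> / zeta (real e) * Q * r ^ e\<bar> \<le> \<epsilon> * Q * r ^ e"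
    if H: "sieve_hyp (V :: 'v set) N dv sc \<kappa> C Q e" and r: "r \<ge> R" for V N dv sc Q r
  proof -
    have Q: "Q \<ge> 0" using H unfolding sieve_hyp_def by auto
    have r0: "r > 0" using r R by simp
    have X: "Q * r ^ e \<ge> 0" using Q r0 by simp
    have "3 * (C * 2 ^ m) / \<epsilon> \<le> r" using r by (simp add: R_def)
    hence "C * 2 ^ m \<le> \<epsilon> / 3 * r" using eps by (simp add: pos_divide_le_eq mult.commute)
    hence "C * 2 ^ m * (Q * r ^ (e - 1)) \<le> \<epsilon> / 3 * r * (Q * r ^ (e - 1))" using Q r0 by (intro mult_right_mono) auto
    also have "\<dots> = \<epsilon> / 3 * (Q * (r * r ^ (e - 1)))" by simp
    also have "r * r ^ (e - 1) = r ^ e" using e by (simp add: power_Suc[symmetric] del: power_Suc)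
    finally have t1: "C * 2 ^ m * Q * r ^ (e - 1) \<le> \<epsilon> / 3 * (Q * r ^ e)" by (simp add: mult.assoc)
    have "(\<kappa> + C) / real m * (Q * r ^ e) \<le> \<epsilon> / 3 * (Q * r ^ e)" using mC X by (rule mult_right_mono)
    hence t2: "(\<kappa> + C) * Q * r ^ e / real m \<le> \<epsilon> / 3 * (Q * r ^ e)" by (simp add: mult.assoc)
    have "\<bar>\<kappa> * E m - \<kappa> / zeta (real e)\<bar> * (Q * r ^ e) \<le> \<epsilon> / 3 * (Q * r ^ e)" using mE X by (rule mult_right_mono)
    hence "\<bar>(\<kappa> * E m - \<kappa> / zeta (real e)) * (Q * r ^ e)\<bar> \<le> \<epsilon> / 3 * (Q * r ^ e)" by (simp only: abs_mult[of _ "Q * r ^ e"] abs_of_nonneg[OF X])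
    hence t3: "\<bar>\<kappa> * E m * Q * r ^ e - \<kappa> / zeta (real e) * Q * r ^ e\<bar> \<le> \<epsilon> / 3 * (Q * r ^ e)"
      by (simp add: left_diff_distrib mult.assoc)
    have t4: "\<epsilon> * Q * r ^ e = \<epsilon> / 3 * (Q * r ^ e) + \<epsilon> / 3 * (Q * r ^ e) + \<epsilon> / 3 * (Q * r ^ e)" by simp
    have tri: "\<bar>X - Z\<bar> \<le> W" if "\<bar>X - Y\<bar> \<le> U + U'" "U \<le> W'" "U' \<le> W'" "\<bar>Y - Z\<bar> \<le> W'" "W = W' + W' + W'"
      for X Y Z U U' W W' :: real using that by linarith
    show ?thesis by (rule tri[OF sieve_bound[OF H r0 m(1), folded E_def] t1 t2 t3 t4])
  qed
  with R show ?thesis by blast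
qed

section \<open>Counting primitive vectors\<close>

definition nrm :: "int \<times> int \<Rightarrow> real" where
  "nrm v = sqrt ((real_of_int (fst v))\<^sup>2 + (real_of_int (snd v))\<^sup>2)"

definition vec_det :: "int \<times> int \<Rightarrow> int \<times> int \<Rightarrow> int" where
  "vec_det z v = fst v * snd z - snd v * fst z"

definition dvd_vec :: "nat \<Rightarrow> int \<times> int \<Rightarrow> bool" where
  "dvd_vec p v \<longleftrightarrow> int p dvd fst v \<and> int p dvd snd v"

definition scale_vec :: "nat \<Rightarrow> int \<times> int \<Rightarrow> int \<times> int" where
  "scale_vec p v = (int p * fst v, int p * snd v)"

lemma nrm_norm: "nrm v = norm (real_of_int (fst v), real_of_int (snd v))"
  by (simp add: nrm_def norm_Pair)

lemma nrm_nonneg: "nrm v \<ge> 0"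
  by (simp add: nrm_def)

lemma nrm_sq: "(nrm v)\<^sup>2 = (real_of_int (fst v))\<^sup>2 + (real_of_int (snd v))\<^sup>2"
  by (simp add: nrm_def)

lemma nrm_ge_1:
  assumes "v \<noteq> (0, 0)" shows "nrm v \<ge> 1"
proof -
  have "fst v \<noteq> 0 \<or> snd v \<noteq> 0" using assms by (auto simp: prod_eq_iff)
  hence "(fst v)\<^sup>2 + (snd v)\<^sup>2 > 0" by (simp add: sum_power2_gt_zero_iff)
  hence "1 \<le> (fst v)\<^sup>2 + (snd v)\<^sup>2" by linarith
  hence "real_of_int 1 \<le> real_of_int ((fst v)\<^sup>2 + (snd v)\<^sup>2)" by (simp only: of_int_le_iff)
  hence "1 \<le> (real_of_int (fst v))\<^sup>2 + (real_of_int (snd v))\<^sup>2" by simp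
  thus ?thesis unfolding nrm_def by (rule real_le_rsqrt[of 1, unfolded one_power2])
qed

lemma nrm_scale: "nrm (k * fst v, k * snd v) = \<bar>real_of_int k\<bar> * nrm v"
proof -
  have "nrm (k * fst v, k * snd v) = sqrt ((real_of_int k)\<^sup>2 * ((real_of_int (fst v))\<^sup>2 + (real_of_int (snd v))\<^sup>2))"
    by (simp add: nrm_def power_mult_distrib distrib_left)
  thus ?thesis by (simp only: real_sqrt_mult real_sqrt_abs nrm_def)
qed

lemma finite_nrm: "finite {v. nrm v < r}"
proof (rule finite_subset)
  show "{v. nrm v < r} \<subseteq> {- \<lceil>r\<rceil>..\<lceil>r\<rceil>} \<times> {- \<lceil>r\<rceil>..\<lceil>r\<rceil>}"
  proof
    fix v assume v: "v \<in> {v. nrm v < r}"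
    have "\<bar>real_of_int (fst v)\<bar> \<le> nrm v" unfolding nrm_def by (rule real_sqrt_ge_abs1)
    hence 1: "\<bar>real_of_int (fst v)\<bar> < r" using v by simp
    have "\<bar>real_of_int (snd v)\<bar> \<le> nrm v" unfolding nrm_def by (rule real_sqrt_ge_abs2)
    hence 2: "\<bar>real_of_int (snd v)\<bar> < r" using v by simp
    have "fst v \<in> {- \<lceil>r\<rceil>..\<lceil>r\<rceil>}" "snd v \<in> {- \<lceil>r\<rceil>..\<lceil>r\<rceil>}" using 1 2 by (simp_all, linarith+)
    thus "v \<in> {- \<lceil>r\<rceil>..\<lceil>r\<rceil>} \<times> {- \<lceil>r\<rceil>..\<lceil>r\<rceil>}" by (simp add: mem_Times_iff)
  qed
qed simp

section \<open>Lattice points in discs\<close>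

definition unit_square :: "int \<times> int \<Rightarrow> (real \<times> real) set" where
  "unit_square v = {real_of_int (fst v)..<real_of_int (fst v) + 1} \<times> {real_of_int (snd v)..<real_of_int (snd v) + 1}"

lemma unit_square_iff: "x \<in> unit_square v \<longleftrightarrow> v = (\<lfloor>fst x\<rfloor>, \<lfloor>snd x\<rfloor>)"
proof -
  have "x \<in> unit_square v \<longleftrightarrow> \<lfloor>fst x\<rfloor> = fst v \<and> \<lfloor>snd x\<rfloor> = snd v"
    unfolding unit_square_def mem_Times_iff floor_eq_iff by auto
  thus ?thesis by (auto simp: prod_eq_iff)
qed

lemma emeasure_unit_square: "unit_square v \<in> sets lborel" "emeasure lborel (unit_square v) = 1"
proof -
  show "unit_square v \<in> sets lborel" unfolding unit_square_def lborel_prod[symmetric] by (intro pair_measureI) auto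
  show "emeasure lborel (unit_square v) = 1"
    unfolding unit_square_def lborel_prod[symmetric] by (subst lborel.emeasure_pair_measure_Times) auto
qed

lemma emeasure_disc: "r \<ge> 0 \<Longrightarrow> emeasure lborel (ball (0::real \<times> real) r) = ennreal (pi * r\<^sup>2)"
  by (simp add: emeasure_ball unit_ball_vol_2 power2_eq_square)

lemma unit_square_dist:
  assumes "x \<in> unit_square v"
  shows "norm (x - (real_of_int (fst v), real_of_int (snd v))) < 2"
proof -
  have "\<bar>fst x - real_of_int (fst v)\<bar> < 1" "\<bar>snd x - real_of_int (snd v)\<bar> < 1"
    using assms unfolding unit_square_def mem_Times_iff by auto
  moreover have "norm (x - (real_of_int (fst v), real_of_int (snd v))) \<le>
      norm (fst x - real_of_int (fst v)) + norm (snd x - real_of_int (snd v))"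
    using norm_Pair_le[of "fst x - real_of_int (fst v)" "snd x - real_of_int (snd v)"]
    by (simp add: minus_prod_def)
  ultimately show ?thesis by simp
qed

lemma emeasure_unit_square_Union:
  "emeasure lborel (\<Union>v\<in>{v. nrm v < r}. unit_square v) = ennreal (real (card {v. nrm v < r}))"
proof -
  have "emeasure lborel (\<Union>v\<in>{v. nrm v < r}. unit_square v) = (\<Sum>v\<in>{v. nrm v < r}. emeasure lborel (unit_square v))"
    by (rule sum_emeasure[symmetric])
      (use finite_nrm emeasure_unit_square(1) in \<open>auto simp: disjoint_family_on_def unit_square_iff\<close>)
  thus ?thesis by (simp add: emeasure_unit_square(2) ennreal_of_nat_eq_real_of_nat)
qed

text \<open>Gauss' argument: the half-open unit squares at the lattice points tile the plane and
  have diameter less than 2, so enlarging or shrinking the disc by 2 compares the count with an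
  area.\<close>

lemma card_disc_upper: "r \<ge> 0 \<Longrightarrow> real (card {v. nrm v < r}) \<le> pi * (r + 2)\<^sup>2"
proof -
  assume r: "r \<ge> 0"
  have "(\<Union>v\<in>{v. nrm v < r}. unit_square v) \<subseteq> ball 0 (r + 2)"
  proof
    fix x assume "x \<in> (\<Union>v\<in>{v. nrm v < r}. unit_square v)"
    then obtain v where v: "nrm v < r" "x \<in> unit_square v" by blast
    have "norm x \<le> norm (x - (real_of_int (fst v), real_of_int (snd v))) + norm (real_of_int (fst v), real_of_int (snd v))"
      using norm_triangle_ineq[of "x - (real_of_int (fst v), real_of_int (snd v))" "(real_of_int (fst v), real_of_int (snd v))"] by simp
    hence "norm x < r + 2" using unit_square_dist[OF v(2)] v(1) unfolding nrm_norm by linarith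
    thus "x \<in> ball 0 (r + 2)" by simp
  qed
  hence "ennreal (real (card {v. nrm v < r})) \<le> ennreal (pi * (r + 2)\<^sup>2)"
    unfolding emeasure_unit_square_Union[symmetric] using r
    by (subst emeasure_disc[symmetric]) (auto intro!: emeasure_mono)
  thus ?thesis by (subst (asm) ennreal_le_iff) auto
qed

lemma card_disc_lower: "r \<ge> 2 \<Longrightarrow> pi * (r - 2)\<^sup>2 \<le> real (card {v. nrm v < r})"
proof -
  assume r: "r \<ge> 2"
  have "ball 0 (r - 2) \<subseteq> (\<Union>v\<in>{v. nrm v < r}. unit_square v)"
  proof
    fix x :: "real \<times> real" assume x: "x \<in> ball 0 (r - 2)"
    define v where "v = (\<lfloor>fst x\<rfloor>, \<lfloor>snd x\<rfloor>)"
    have v: "x \<in> unit_square v" by (simp add: unit_square_iff v_def)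
    have "norm (real_of_int (fst v), real_of_int (snd v)) \<le> norm x + norm (x - (real_of_int (fst v), real_of_int (snd v)))"
      using norm_triangle_ineq4[of x "x - (real_of_int (fst v), real_of_int (snd v))"] by simp
    hence "nrm v < r" using unit_square_dist[OF v] x unfolding nrm_norm by simp
    thus "x \<in> (\<Union>v\<in>{v. nrm v < r}. unit_square v)" using v by blast
  qed
  moreover have "(\<Union>v\<in>{v. nrm v < r}. unit_square v) \<in> sets lborel"
    using finite_nrm emeasure_unit_square(1) by (intro sets.finite_UN) auto
  ultimately have "ennreal (pi * (r - 2)\<^sup>2) \<le> ennreal (real (card {v. nrm v < r}))"
    unfolding emeasure_unit_square_Union[symmetric] using r
    by (subst emeasure_disc[symmetric]) (auto intro!: emeasure_mono)
  thus ?thesis by (subst (asm) ennreal_le_iff) auto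
qed

definition nonzero_vecs :: "(int \<times> int) set" where "nonzero_vecs = - {(0, 0)}"

text \<open>The ring of width 2 has area 4 \<pi> r + 4 \<pi>, which is at most 8 \<pi> r for r \<ge>
  1.\<close>

definition disc_error :: real where "disc_error = 8 * pi + 1"

text \<open>The origin is left out so that a purely linear error holds down to r = 0: for r \<le> 1
  there is no vector at all, and r^2 is at most r. The sieve evaluates the count at such small
  radii.\<close>

lemma card_disc:
  assumes r: "r > 0"
  shows "\<bar>real (card {v\<in>nonzero_vecs. nrm v < r}) - pi * r\<^sup>2\<bar> \<le> disc_error * r"
proof -
  have n: "card {v. nrm v < r} = Suc (card {v\<in>nonzero_vecs. nrm v < r})"
  proof -
    have "{v. nrm v < r} = insert (0, 0) {v\<in>nonzero_vecs. nrm v < r}" using r by (auto simp: nonzero_vecs_def nrm_def)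
    moreover have "finite {v\<in>nonzero_vecs. nrm v < r}" by (rule finite_subset[OF _ finite_nrm[of r]]) auto
    ultimately show ?thesis by (simp add: nonzero_vecs_def)
  qed
  define c where "c = real (card {v\<in>nonzero_vecs. nrm v < r})"
  define X where "X = pi * r\<^sup>2"
  define Y where "Y = pi * r"
  have cn: "real (card {v. nrm v < r}) = c + 1" "c \<ge> 0" using n by (simp_all add: c_def)
  have pos: "X \<ge> 0" "Y \<ge> 0" using r by (simp_all add: X_def Y_def)
  have K: "disc_error * r = 8 * Y + r" by (simp add: disc_error_def Y_def distrib_right)
  have "pi * (r + 2)\<^sup>2 = X + 4 * Y + 4 * pi" unfolding X_def Y_def by (simp add: power2_eq_square algebra_simps)
  hence "real (card {v. nrm v < r}) \<le> X + 4 * Y + 4 * pi" using card_disc_upper[of r] r by (simp only: less_imp_le)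
  hence u: "c + 1 \<le> X + 4 * Y + 4 * pi" unfolding cn .
  consider "r \<le> 1" | "1 \<le> r" "r \<le> 2" | "r \<ge> 2" by linarith
  hence "\<bar>c - X\<bar> \<le> 8 * Y + r"
  proof cases
    case 1
    have "\<not> nrm v < r" if "v \<in> nonzero_vecs" for v using nrm_ge_1[of v] that 1 by (simp add: nonzero_vecs_def)
    hence "{v\<in>nonzero_vecs. nrm v < r} = {}" by blast
    hence "c = 0" unfolding c_def by (simp only: card.empty of_nat_0)
    moreover have "X \<le> Y" using 1 r unfolding X_def Y_def by (intro mult_left_mono) (auto simp: power2_eq_square)
    ultimately show ?thesis using pos r by linarith
  next
    case 2
    have "pi * r\<^sup>2 \<le> pi * (2 * r)" using 2 by (intro mult_left_mono) (auto simp: power2_eq_square)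
    hence "X \<le> 2 * Y" by (simp add: X_def Y_def mult.left_commute)
    moreover have "pi \<le> Y" unfolding Y_def using 2 by simp
    ultimately show ?thesis using u pos cn(2) r by linarith
  next
    case 3
    have "pi * (r - 2)\<^sup>2 = X - 4 * Y + 4 * pi" unfolding X_def Y_def by (simp add: power2_eq_square algebra_simps)
    hence "X - 4 * Y + 4 * pi \<le> real (card {v. nrm v < r})" using card_disc_lower[OF 3] by (simp only:)
    hence "X - 4 * Y + 4 * pi \<le> c + 1" unfolding cn .
    moreover have "pi \<le> Y" unfolding Y_def using 3 by simp
    ultimately show ?thesis using u pos cn(2) r pi_gt_zero 3 by linarith
  qed
  thus ?thesis unfolding K c_def X_def .
qed

lemma disc_error_pos: "disc_error \<ge> 0" by (simp add: disc_error_def)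

lemma sieve_hyp_nonzero_vecs: "sieve_hyp nonzero_vecs nrm dvd_vec scale_vec pi disc_error 1 2"
  unfolding sieve_hyp_def
proof (intro conjI allI impI ballI)
  fix r show "finite {v \<in> nonzero_vecs. nrm v < r}" by (rule finite_subset[OF _ finite_nrm[of r]]) auto
next
  fix v assume "v \<in> nonzero_vecs" thus "1 \<le> nrm v" using nrm_ge_1 by (auto simp: nonzero_vecs_def)
next
  fix p :: nat assume p: "prime p"
  hence p0: "p > 0" by (rule prime_gt_0_nat)
  show "bij_betw (scale_vec p) nonzero_vecs {v \<in> nonzero_vecs. dvd_vec p v}"
    unfolding bij_betw_def
  proof (intro conjI equalityI subsetI)
    show "inj_on (scale_vec p) nonzero_vecs" using p0 by (auto simp: inj_on_def scale_vec_def prod_eq_iff)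
  next
    fix w assume "w \<in> scale_vec p ` nonzero_vecs" thus "w \<in> {v \<in> nonzero_vecs. dvd_vec p v}" using p0 by (auto simp: scale_vec_def dvd_vec_def nonzero_vecs_def)
  next
    fix w assume w: "w \<in> {v \<in> nonzero_vecs. dvd_vec p v}"
    then obtain k l where "fst w = int p * k" "snd w = int p * l" by (auto simp: dvd_vec_def elim!: dvdE)
    hence "w = scale_vec p (k, l)" "(k, l) \<in> nonzero_vecs" using w by (auto simp: scale_vec_def nonzero_vecs_def prod_eq_iff)
    thus "w \<in> scale_vec p ` nonzero_vecs" by blast
  qed
next
  fix p v show "nrm (scale_vec p v) = real p * nrm v" unfolding scale_vec_def nrm_scale by simp
next
  fix p q :: nat and v assume pq: "prime p" "prime q" "p \<noteq> q"
  have "int q dvd int p * k \<longleftrightarrow> int q dvd k" for k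
    using pq by (metis prime_dvd_mult_iff prime_nat_int_transfer primes_dvd_imp_eq int_dvd_int_iff)
  thus "dvd_vec q (scale_vec p v) \<longleftrightarrow> dvd_vec q v" by (simp add: dvd_vec_def scale_vec_def)
next
  fix r :: real assume "r > 0"
  thus "\<bar>real (card {v \<in> nonzero_vecs. nrm v < r}) - pi * 1 * r ^ 2\<bar> \<le> disc_error * 1 * r ^ (2 - 1)"
    using card_disc[of r] by simp
qed (use disc_error_pos in auto)

text \<open>One of the two primitive vectors on each rational line, hence a model of the projective
  line over the rationals.\<close>

definition proj_reps :: "(int \<times> int) set" where
  "proj_reps = {v. coprime (fst v) (snd v) \<and> (fst v > 0 \<or> fst v = 0 \<and> snd v > 0)}"

lemma proj_reps_nonzero_vecs: "z \<in> proj_reps \<Longrightarrow> z \<in> nonzero_vecs" "z \<in> proj_reps \<Longrightarrow> nrm z \<ge> 1"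
proof -
  assume "z \<in> proj_reps"
  hence "z \<noteq> (0, 0)" unfolding proj_reps_def by force
  thus "z \<in> nonzero_vecs" "nrm z \<ge> 1" using nrm_ge_1[of z] by (simp_all add: nonzero_vecs_def)
qed

lemma coprime_iff_no_prime:
  fixes a b :: int
  shows "coprime a b \<longleftrightarrow> (\<forall>p. prime p \<longrightarrow> \<not> (int p dvd a \<and> int p dvd b))"
proof
  assume c: "coprime a b"
  show "\<forall>p. prime p \<longrightarrow> \<not> (int p dvd a \<and> int p dvd b)"
  proof (intro allI impI notI)
    fix p assume p: "prime p" and d: "int p dvd a \<and> int p dvd b"
    hence "is_unit (int p)" using c coprime_common_divisor by blast
    thus False using p by (simp add: prime_gt_1_nat less_imp_neq[symmetric])
  qed
next
  assume np: "\<forall>p. prime p \<longrightarrow> \<not> (int p dvd a \<and> int p dvd b)"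
  show "coprime a b"
  proof (rule ccontr)
    assume "\<not> coprime a b"
    hence "nat (gcd a b) \<noteq> 1" by (simp add: coprime_iff_gcd_eq_1 nat_eq_iff)
    then obtain p where p: "prime p" "p dvd nat (gcd a b)" using prime_factor_nat by blast
    hence "int p dvd gcd a b" by (simp add: int_dvd_int_iff[symmetric])
    thus False using np p(1) by auto
  qed
qed

lemma card_proj_reps: "2 * card {z\<in>proj_reps. nrm z < r} = card {v\<in>nonzero_vecs. nrm v < r \<and> (\<forall>q. prime q \<longrightarrow> \<not> dvd_vec q v)}"
proof -
  define A where "A = {z\<in>proj_reps. nrm z < r}"
  define m :: "int \<times> int \<Rightarrow> int \<times> int" where "m v = (- fst v, - snd v)" for v
  have nm: "nrm (m v) = nrm v" for v by (simp add: nrm_def m_def)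
  have fin: "finite A" unfolding A_def by (rule finite_subset[OF _ finite_nrm[of r]]) auto
  have "{v\<in>nonzero_vecs. nrm v < r \<and> (\<forall>q. prime q \<longrightarrow> \<not> dvd_vec q v)} = {v\<in>nonzero_vecs. nrm v < r \<and> coprime (fst v) (snd v)}"
    unfolding coprime_iff_no_prime dvd_vec_def ..
  also have "\<dots> = A \<union> m ` A"
  proof (intro equalityI subsetI)
    fix v assume v: "v \<in> {v\<in>nonzero_vecs. nrm v < r \<and> coprime (fst v) (snd v)}"
    show "v \<in> A \<union> m ` A"
    proof (cases "v \<in> proj_reps")
      case False
      have "fst v \<noteq> 0 \<or> snd v \<noteq> 0" using v by (auto simp: nonzero_vecs_def prod_eq_iff)
      hence "m v \<in> proj_reps" using v False by (auto simp: proj_reps_def m_def)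
      hence "m v \<in> A" using v nm[of v] unfolding A_def by simp
      moreover have "v = m (m v)" by (simp add: m_def)
      ultimately have "v \<in> m ` A" by (rule rev_image_eqI)
      thus ?thesis ..
    qed (use v in \<open>simp add: A_def\<close>)
  next
    fix v assume "v \<in> A \<union> m ` A"
    then obtain z where z: "z \<in> A" "v = z \<or> v = m z" by blast
    have "nrm v < r" using z nm[of z] by (auto simp: A_def)
    moreover have "coprime (fst v) (snd v)" using z by (auto simp: A_def proj_reps_def m_def)
    moreover have "v \<in> nonzero_vecs" using z by (auto simp: A_def proj_reps_def nonzero_vecs_def m_def)
    ultimately show "v \<in> {v\<in>nonzero_vecs. nrm v < r \<and> coprime (fst v) (snd v)}" by simp
  qed
  also have "card (A \<union> m ` A) = card A + card (m ` A)"
    using fin by (intro card_Un_disjoint) (auto simp: A_def proj_reps_def m_def)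
  also have "card (m ` A) = card A" by (intro card_image) (auto simp: inj_on_def m_def prod_eq_iff)
  finally show ?thesis by (simp add: A_def)
qed

text \<open>The multiplier is the Bezout combination for \<open>z\<close> applied to
  \<open>v\<close>; it is an integer because \<open>z\<close> is primitive.\<close>

lemma vec_det_0_multiple:
  assumes z: "z \<in> proj_reps" and d: "vec_det z v = 0"
  shows "\<exists>k. v = (k * fst z, k * snd z)"
proof -
  have "gcd (fst z) (snd z) = 1" using z by (simp add: proj_reps_def)
  then obtain u w where uw: "u * fst z + w * snd z = 1" using bezout_int[of "fst z" "snd z"] by auto
  have e: "fst v * snd z = snd v * fst z" using d by (simp add: vec_det_def)
  have "(u * fst v + w * snd v) * fst z = u * fst v * fst z + w * (snd v * fst z)" by (simp add: algebra_simps)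
  also have "\<dots> = fst v * (u * fst z + w * snd z)" unfolding e[symmetric] by (simp add: algebra_simps)
  finally have 1: "fst v = (u * fst v + w * snd v) * fst z" unfolding uw by simp
  have "(u * fst v + w * snd v) * snd z = u * (fst v * snd z) + w * snd v * snd z" by (simp add: algebra_simps)
  also have "\<dots> = snd v * (u * fst z + w * snd z)" unfolding e by (simp add: algebra_simps)
  finally have 2: "snd v = (u * fst v + w * snd v) * snd z" unfolding uw by simp
  show ?thesis by (rule exI[of _ "u * fst v + w * snd v"]) (use 1 2 in \<open>simp add: prod_eq_iff\<close>)
qed

lemma card_parallel:
  assumes z: "z \<in> proj_reps" and r: "r > 0"
  shows "real (card {v\<in>nonzero_vecs. nrm v < r \<and> vec_det z v = 0}) \<le> 2 * r"
proof -
  define k where "k = \<lfloor>r\<rfloor>"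
  have k: "k \<ge> 0" "real_of_int k \<le> r" using r by (auto simp: k_def)
  have "{v\<in>nonzero_vecs. nrm v < r \<and> vec_det z v = 0} \<subseteq> (\<lambda>j. (j * fst z, j * snd z)) ` ({-k..k} - {0})"
  proof
    fix v assume v: "v \<in> {v\<in>nonzero_vecs. nrm v < r \<and> vec_det z v = 0}"
    then obtain j where j: "v = (j * fst z, j * snd z)" using vec_det_0_multiple[OF z] by blast
    have "j \<noteq> 0" using v j by (auto simp: nonzero_vecs_def)
    have "\<bar>real_of_int j\<bar> * 1 \<le> \<bar>real_of_int j\<bar> * nrm z" using proj_reps_nonzero_vecs(2)[OF z] by (intro mult_left_mono) auto
    also have "\<dots> = nrm v" unfolding j by (rule nrm_scale[symmetric])
    also have "\<dots> < r" using v by simp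
    finally have "\<bar>real_of_int j\<bar> < r" by simp
    hence "\<bar>j\<bar> \<le> k" unfolding k_def by linarith
    hence "j \<in> {-k..k} - {0}" using \<open>j \<noteq> 0\<close> by auto
    thus "v \<in> (\<lambda>j. (j * fst z, j * snd z)) ` ({-k..k} - {0})" unfolding j by (rule imageI)
  qed
  hence "card {v\<in>nonzero_vecs. nrm v < r \<and> vec_det z v = 0} \<le> card ({-k..k} - {0})"
    by (meson card_image_le card_mono finite_Diff finite_atLeastAtMost_int finite_imageI le_trans)
  also have "card ({-k..k} - {0}) = nat (2 * k)" using k(1) by (simp add: card_Diff_singleton)
  finally have "card {v\<in>nonzero_vecs. nrm v < r \<and> vec_det z v = 0} \<le> nat (2 * k)" .
  hence "int (card {v\<in>nonzero_vecs. nrm v < r \<and> vec_det z v = 0}) \<le> 2 * k" using k(1) by linarith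
  hence "real_of_int (int (card {v\<in>nonzero_vecs. nrm v < r \<and> vec_det z v = 0})) \<le> real_of_int (2 * k)" by (simp only: of_int_le_iff)
  thus ?thesis using k(2) by simp
qed

text \<open>The singular vectors are integer multiples of a vector of norm at least 1, so there are
  at most 2 r of them. They disappear in the error of the lattice point count, uniformly in
  \<open>z\<close>.\<close>

lemma card_slice:
  assumes z: "z \<in> proj_reps" and r: "r > 0" and P: "finite P" "\<And>q. q \<in> P \<Longrightarrow> prime q"
  shows "\<bar>real (card {v\<in>nonzero_vecs. nrm v < r \<and> vec_det z v \<noteq> 0 \<and> (\<forall>q\<in>P. \<not> dvd_vec q v)}) - pi * (\<Prod>p\<in>P. 1 - 1 / (real p)\<^sup>2) * r\<^sup>2\<bar>
    \<le> (disc_error * 2 ^ card P + 2) * r"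
proof -
  define A where "A = {v\<in>nonzero_vecs. nrm v < r \<and> (\<forall>q\<in>P. \<not> dvd_vec q v)}"
  define B where "B = {v\<in>nonzero_vecs. nrm v < r \<and> vec_det z v \<noteq> 0 \<and> (\<forall>q\<in>P. \<not> dvd_vec q v)}"
  define D where "D = {v\<in>nonzero_vecs. nrm v < r \<and> vec_det z v = 0}"
  have fin: "finite A" "finite B" "finite D" unfolding A_def B_def D_def by (auto intro: finite_subset[OF _ finite_nrm[of r]])
  have a: "\<bar>real (card A) - pi * (\<Prod>p\<in>P. 1 - 1 / (real p)\<^sup>2) * r\<^sup>2\<bar> \<le> disc_error * 2 ^ card P * r"
    using sieve_finite[OF sieve_hyp_nonzero_vecs P r] by (simp add: A_def)
  have "A \<subseteq> B \<union> D" "B \<subseteq> A" by (auto simp: A_def B_def D_def)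
  hence "card A \<le> card (B \<union> D)" "card B \<le> card A" using fin by (auto intro!: card_mono)
  moreover have "card (B \<union> D) \<le> card B + card D" by (rule card_Un_le)
  ultimately have "real (card A) \<le> real (card B) + real (card D)" "real (card B) \<le> real (card A)" by linarith+
  moreover have "real (card D) \<le> 2 * r" unfolding D_def by (rule card_parallel[OF z r])
  ultimately have "\<bar>real (card B) - pi * (\<Prod>p\<in>P. 1 - 1 / (real p)\<^sup>2) * r\<^sup>2\<bar> \<le> disc_error * 2 ^ card P * r + 2 * r"
    using a by linarith
  thus ?thesis by (simp add: B_def distrib_right)
qed

text \<open>The pair \<open>(v, g)\<close> stands for the matrix with rows \<open>v\<close> and \<open>g z\<close>; \<open>fibre_norm z (v, g)\<close> is its
  norm divided by the norm of \<open>z\<close>.\<close>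

definition fibre_vecs :: "int \<times> int \<Rightarrow> ((int \<times> int) \<times> nat) set" where
  "fibre_vecs z = {(v, g). g \<ge> 1 \<and> vec_det z v \<noteq> 0}"

definition fibre_norm :: "int \<times> int \<Rightarrow> (int \<times> int) \<times> nat \<Rightarrow> real" where
  "fibre_norm z = (\<lambda>(v, g). sqrt ((nrm v)\<^sup>2 + (real g)\<^sup>2 * (nrm z)\<^sup>2) / nrm z)"

definition dvd_fibre :: "nat \<Rightarrow> (int \<times> int) \<times> nat \<Rightarrow> bool" where
  "dvd_fibre p = (\<lambda>(v, g). dvd_vec p v \<and> p dvd g)"

definition scale_fibre :: "nat \<Rightarrow> (int \<times> int) \<times> nat \<Rightarrow> (int \<times> int) \<times> nat" where
  "scale_fibre p = (\<lambda>(v, g). (scale_vec p v, p * g))"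

section \<open>Counting in a fibre, slice by slice\<close>

lemma fibre_norm_less_iff:
  assumes q: "nrm z > 0" and \<rho>: "\<rho> > 0"
  shows "fibre_norm z (v, g) < \<rho> \<longleftrightarrow> real g < \<rho> \<and> nrm v < nrm z * sqrt (\<rho>\<^sup>2 - (real g)\<^sup>2)"
proof -
  have "fibre_norm z (v, g) < \<rho> \<longleftrightarrow> sqrt ((nrm v)\<^sup>2 + (real g)\<^sup>2 * (nrm z)\<^sup>2) < sqrt ((\<rho> * nrm z)\<^sup>2)"
    using q \<rho> by (simp add: fibre_norm_def pos_divide_less_eq)
  also have "\<dots> \<longleftrightarrow> (nrm v)\<^sup>2 + (real g)\<^sup>2 * (nrm z)\<^sup>2 < (\<rho> * nrm z)\<^sup>2" by (rule real_sqrt_less_iff)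
  also have "\<dots> \<longleftrightarrow> (nrm v)\<^sup>2 < (nrm z)\<^sup>2 * (\<rho>\<^sup>2 - (real g)\<^sup>2)"
    by (auto simp: power_mult_distrib algebra_simps)
  also have "\<dots> \<longleftrightarrow> real g < \<rho> \<and> nrm v < nrm z * sqrt (\<rho>\<^sup>2 - (real g)\<^sup>2)"
  proof (cases "real g < \<rho>")
    case True
    hence p: "\<rho>\<^sup>2 - (real g)\<^sup>2 \<ge> 0" by (simp add: power_mono)
    have "nrm v < nrm z * sqrt (\<rho>\<^sup>2 - (real g)\<^sup>2) \<longleftrightarrow> sqrt ((nrm v)\<^sup>2) < sqrt ((nrm z)\<^sup>2 * (\<rho>\<^sup>2 - (real g)\<^sup>2))"
      using q nrm_nonneg[of v] by (simp add: real_sqrt_mult)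
    also have "\<dots> \<longleftrightarrow> (nrm v)\<^sup>2 < (nrm z)\<^sup>2 * (\<rho>\<^sup>2 - (real g)\<^sup>2)" by (rule real_sqrt_less_iff)
    finally show ?thesis using True by simp
  next
    case False
    hence "\<rho>\<^sup>2 - (real g)\<^sup>2 \<le> 0" using \<rho> by (simp add: power_mono)
    hence "(nrm z)\<^sup>2 * (\<rho>\<^sup>2 - (real g)\<^sup>2) \<le> 0" by (intro mult_nonneg_nonpos) auto
    moreover have "(nrm v)\<^sup>2 \<ge> 0" by simp
    ultimately show ?thesis using False by linarith
  qed
  finally show ?thesis .
qed

text \<open>For fixed \<open>g\<close> the first rows fill a disc of radius |z| sqrt(\<rho>^2 -
  g^2). The additional condition \<open>R\<close> is kept general: it is trivial for the volume of a
  fibre and a coprimality condition for the slices of the rigid case.\<close>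

lemma card_fibre_vecs_slices:
  assumes z: "z \<in> proj_reps" and \<rho>: "\<rho> > 0"
  shows "finite {w\<in>fibre_vecs z. fibre_norm z w < \<rho>}"
    and "card {w\<in>fibre_vecs z. fibre_norm z w < \<rho> \<and> R (fst w) (snd w)} =
      (\<Sum>g\<in>{g. 1 \<le> g \<and> real g < \<rho>}. card {v\<in>nonzero_vecs. nrm v < nrm z * sqrt (\<rho>\<^sup>2 - (real g)\<^sup>2) \<and> vec_det z v \<noteq> 0 \<and> R v g})"
proof -
  have q: "nrm z > 0" using proj_reps_nonzero_vecs(2)[OF z] by linarith
  define G where "G = {g::nat. 1 \<le> g \<and> real g < \<rho>}"
  have fG: "finite G"
  proof (rule finite_subset)
    show "G \<subseteq> {..nat \<lceil>\<rho>\<rceil>}" unfolding G_def by (auto, linarith)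
  qed simp
  have main: "{w\<in>fibre_vecs z. fibre_norm z w < \<rho> \<and> R (fst w) (snd w)} =
      prod.swap ` (SIGMA g:G. {v\<in>nonzero_vecs. nrm v < nrm z * sqrt (\<rho>\<^sup>2 - (real g)\<^sup>2) \<and> vec_det z v \<noteq> 0 \<and> R v g})" for R
  proof (intro equalityI subsetI)
    fix w assume w: "w \<in> {w\<in>fibre_vecs z. fibre_norm z w < \<rho> \<and> R (fst w) (snd w)}"
    obtain v g where vg: "w = (v, g)" by (cases w)
    have "v \<in> nonzero_vecs" using w by (auto simp: vg fibre_vecs_def nonzero_vecs_def vec_det_def)
    hence "(g, v) \<in> (SIGMA g:G. {v\<in>nonzero_vecs. nrm v < nrm z * sqrt (\<rho>\<^sup>2 - (real g)\<^sup>2) \<and> vec_det z v \<noteq> 0 \<and> R v g})"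
      using w fibre_norm_less_iff[OF q \<rho>, of v g] by (simp add: vg fibre_vecs_def G_def)
    thus "w \<in> prod.swap ` (SIGMA g:G. {v\<in>nonzero_vecs. nrm v < nrm z * sqrt (\<rho>\<^sup>2 - (real g)\<^sup>2) \<and> vec_det z v \<noteq> 0 \<and> R v g})"
      unfolding vg by (rule rev_image_eqI) simp
  next
    fix w assume "w \<in> prod.swap ` (SIGMA g:G. {v\<in>nonzero_vecs. nrm v < nrm z * sqrt (\<rho>\<^sup>2 - (real g)\<^sup>2) \<and> vec_det z v \<noteq> 0 \<and> R v g})"
    then obtain g v where vg: "w = (v, g)" "g \<in> G" "v \<in> nonzero_vecs" "nrm v < nrm z * sqrt (\<rho>\<^sup>2 - (real g)\<^sup>2)" "vec_det z v \<noteq> 0" "R v g"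
      by auto
    thus "w \<in> {w\<in>fibre_vecs z. fibre_norm z w < \<rho> \<and> R (fst w) (snd w)}"
      using fibre_norm_less_iff[OF q \<rho>, of v g] by (simp add: fibre_vecs_def G_def)
  qed
  have fS: "finite {v\<in>nonzero_vecs. nrm v < x \<and> vec_det z v \<noteq> 0 \<and> R v g}" for R x g
    by (rule finite_subset[OF _ finite_nrm[of x]]) auto
  have "{w\<in>fibre_vecs z. fibre_norm z w < \<rho>} = {w\<in>fibre_vecs z. fibre_norm z w < \<rho> \<and> True}" by simp
  also have "finite \<dots>" unfolding main[of "\<lambda>_ _. True"] by (intro finite_imageI finite_SigmaI fG fS)
  finally show "finite {w\<in>fibre_vecs z. fibre_norm z w < \<rho>}" .
  have "card {w\<in>fibre_vecs z. fibre_norm z w < \<rho> \<and> R (fst w) (snd w)} =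
      card (SIGMA g:G. {v\<in>nonzero_vecs. nrm v < nrm z * sqrt (\<rho>\<^sup>2 - (real g)\<^sup>2) \<and> vec_det z v \<noteq> 0 \<and> R v g})"
    unfolding main by (rule card_image) simp
  also have "\<dots> = (\<Sum>g\<in>G. card {v\<in>nonzero_vecs. nrm v < nrm z * sqrt (\<rho>\<^sup>2 - (real g)\<^sup>2) \<and> vec_det z v \<noteq> 0 \<and> R v g})"
    by (intro card_SigmaI fG ballI fS)
  finally show "card {w\<in>fibre_vecs z. fibre_norm z w < \<rho> \<and> R (fst w) (snd w)} =
      (\<Sum>g\<in>{g. 1 \<le> g \<and> real g < \<rho>}. card {v\<in>nonzero_vecs. nrm v < nrm z * sqrt (\<rho>\<^sup>2 - (real g)\<^sup>2) \<and> vec_det z v \<noteq> 0 \<and> R v g})"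
    by (simp only: G_def)
qed

lemma sum_square_slices:
  fixes r :: real
  shows "6 * (\<Sum>g\<in>{1..n::nat}. r\<^sup>2 - (real g)\<^sup>2) = 6 * real n * r\<^sup>2 - real n * (real n + 1) * (2 * real n + 1)"
  by (induction n) (simp_all add: algebra_simps power2_eq_square)

lemma slice_range:
  assumes "r > 0"
  shows "\<exists>n. {g::nat. 1 \<le> g \<and> real g < r} = {1..n} \<and> real n < r \<and> r \<le> real n + 1"
proof (intro exI conjI)
  \<comment> \<open>The inequality \<open>real g < r\<close> is strict, so an integral r does not
    count itself.\<close>
  define n where "n = nat (\<lceil>r\<rceil> - 1)"
  have n: "real n = of_int \<lceil>r\<rceil> - 1" using assms by (simp add: n_def)
  show "real n < r" "r \<le> real n + 1" unfolding n by linarith+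
  have "\<lceil>r\<rceil> \<ge> 1" using assms by simp
  hence ni: "int n = \<lceil>r\<rceil> - 1" by (simp add: n_def)
  have *: "real g < r \<longleftrightarrow> g \<le> n" for g
  proof -
    have "real g < r \<longleftrightarrow> int g < \<lceil>r\<rceil>" by (simp add: less_ceiling_iff)
    also have "\<dots> \<longleftrightarrow> int g \<le> int n" using ni by linarith
    also have "\<dots> \<longleftrightarrow> g \<le> n" by simp
    finally show ?thesis .
  qed
  show "{g::nat. 1 \<le> g \<and> real g < r} = {1..n}"
    by (intro equalityI subsetI) (simp_all only: mem_Collect_eq atLeastAtMost_iff *)
qed

text \<open>Compares a sum of squares with the integral of r^2 - g^2 over 0 \<le> g \<le> r. The
  error must be quadratic for small r too, where the range is empty and r \<le> 1.\<close>

lemma sum_slices_approx: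
  assumes r: "r > 0"
  shows "\<bar>(\<Sum>g\<in>{g::nat. 1 \<le> g \<and> real g < r}. r\<^sup>2 - (real g)\<^sup>2) - 2 * r ^ 3 / 3\<bar> \<le> 2 * r\<^sup>2"
    and "real (card {g::nat. 1 \<le> g \<and> real g < r}) \<le> r"
proof -
  obtain n where n: "{g::nat. 1 \<le> g \<and> real g < r} = {1..n}" "real n < r" "r \<le> real n + 1"
    using slice_range[OF r] by blast
  show "real (card {g::nat. 1 \<le> g \<and> real g < r}) \<le> r" unfolding n using n(2) by simp
  define t where "t = r - real n"
  define m where "m = real n"
  have t: "0 < t" "t \<le> 1" "t \<le> r" using n by (auto simp: t_def)
  have rm: "r = m + t" by (simp add: t_def m_def)
  have m0: "m \<ge> 0" by (simp add: m_def)
  have m1: "m \<le> m\<^sup>2" unfolding m_def power2_eq_square by (metis le_square of_nat_le_iff of_nat_mult)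
  have mr: "m\<^sup>2 \<le> r\<^sup>2" using m0 t unfolding rm by (intro power_mono) auto
  define S where "S = (\<Sum>g\<in>{1..n}. r\<^sup>2 - (real g)\<^sup>2)"
  have S: "6 * S = 6 * m * r\<^sup>2 - m * (m + 1) * (2 * m + 1)" unfolding S_def m_def by (rule sum_square_slices)
  \<comment> \<open>The difference is explicit in m and t = r - m. As 0 < t \<le> 1 and t \<le> r,
    all of its terms are at most quadratic in r.\<close>
  have eq: "4 * r ^ 3 - 6 * S = 6 * (r * t\<^sup>2) - 2 * t ^ 3 + 3 * m\<^sup>2 + m"
    unfolding S rm by (simp add: algebra_simps power2_eq_square power3_eq_cube)
  have t2: "t * t \<le> 1 * 1" using t by (intro mult_mono) auto
  have "t * t * t \<le> t * t * r" using t by (intro mult_left_mono) auto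
  hence a: "t ^ 3 \<le> r * t\<^sup>2" by (simp add: power2_eq_square power3_eq_cube mult_ac)
  have "r * t\<^sup>2 = r * (t * t)" by (simp add: power2_eq_square)
  also have "\<dots> \<le> r * (r * 1)" using t r by (intro mult_left_mono mult_mono) auto
  finally have b: "r * t\<^sup>2 \<le> r\<^sup>2" by (simp add: power2_eq_square)
  have c: "t ^ 3 \<ge> 0" using t by simp
  have "\<bar>6 * (r * t\<^sup>2) - 2 * t ^ 3 + 3 * m\<^sup>2 + m\<bar> \<le> 12 * r\<^sup>2" using a b c m0 m1 mr by linarith
  hence "\<bar>S - 2 * r ^ 3 / 3\<bar> \<le> 2 * r\<^sup>2" unfolding eq[symmetric] by linarith
  thus "\<bar>(\<Sum>g\<in>{g::nat. 1 \<le> g \<and> real g < r}. r\<^sup>2 - (real g)\<^sup>2) - 2 * r ^ 3 / 3\<bar> \<le> 2 * r\<^sup>2"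
    unfolding n S_def .
qed

text \<open>\<open>disc_error + 2\<close> is the error of one slice, of which there are at most r; 2
  \<pi> comes from replacing the sum over \<open>g\<close> by an integral.\<close>

definition fibre_error :: real where "fibre_error = disc_error + 2 + 2 * pi"

text \<open>The discs add up to half of an ellipsoid, as \<open>g\<close> is positive, and its
  volume is 2 \<pi> / 3 times |z|^2 r^3.\<close>

lemma card_fibre_vecs:
  assumes z: "z \<in> proj_reps" and r: "r > 0"
  shows "\<bar>real (card {w\<in>fibre_vecs z. fibre_norm z w < r}) - 2 * pi / 3 * (nrm z)\<^sup>2 * r ^ 3\<bar> \<le> fibre_error * (nrm z)\<^sup>2 * r\<^sup>2"
proof -
  define q where "q = nrm z"
  have q: "q \<ge> 1" using proj_reps_nonzero_vecs(2)[OF z] by (simp add: q_def)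
  define G where "G = {g::nat. 1 \<le> g \<and> real g < r}"
  define c where "c g = real (card {v\<in>nonzero_vecs. nrm v < q * sqrt (r\<^sup>2 - (real g)\<^sup>2) \<and> vec_det z v \<noteq> 0})" for g :: nat
  have "card {w\<in>fibre_vecs z. fibre_norm z w < r} = (\<Sum>g\<in>G. card {v\<in>nonzero_vecs. nrm v < q * sqrt (r\<^sup>2 - (real g)\<^sup>2) \<and> vec_det z v \<noteq> 0})"
    using card_fibre_vecs_slices(2)[OF z r, of "\<lambda>_ _. True"] by (simp add: G_def q_def)
  hence card: "real (card {w\<in>fibre_vecs z. fibre_norm z w < r}) = (\<Sum>g\<in>G. c g)" by (simp only: c_def of_nat_sum)
  have slice: "\<bar>c g - pi * q\<^sup>2 * (r\<^sup>2 - (real g)\<^sup>2)\<bar> \<le> (disc_error + 2) * q\<^sup>2 * r" if g: "g \<in> G" for g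
  proof -
    define s where "s = sqrt (r\<^sup>2 - (real g)\<^sup>2)"
    have "(real g)\<^sup>2 < r\<^sup>2" using g r unfolding G_def by (intro power_strict_mono) auto
    hence pos: "r\<^sup>2 - (real g)\<^sup>2 > 0" by simp
    have s: "s > 0" "s\<^sup>2 = r\<^sup>2 - (real g)\<^sup>2" using pos by (simp_all add: s_def)
    have "s\<^sup>2 \<le> r\<^sup>2" unfolding s(2) by simp
    hence sr: "s \<le> r" by (rule power2_le_imp_le) (use r in simp)
    have qs: "q * s > 0" using q s(1) by simp
    have "\<bar>c g - pi * (q * s)\<^sup>2\<bar> \<le> (disc_error + 2) * (q * s)"
      using card_slice[OF z qs, of "{}"] by (simp only: c_def s_def Ball_def empty_iff finite.emptyI simp_thms prod.empty card.empty power_0 mult_1_right)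
    also have "\<dots> \<le> (disc_error + 2) * (q\<^sup>2 * r)"
    proof (rule mult_left_mono)
      \<comment> \<open>The slice error is linear in |z|. As |z| \<ge> 1 it may be enlarged to
        |z|^2, the scale of the main term, and this gives an error bound that is uniform in
        \<open>z\<close>.\<close>
      have "q * s \<le> q * r" using q sr by (intro mult_left_mono) auto
      also have "\<dots> \<le> (q * q) * r" using q r by (intro mult_right_mono) auto
      finally show "q * s \<le> q\<^sup>2 * r" by (simp only: power2_eq_square)
    qed (use disc_error_pos in simp)
    finally show ?thesis unfolding power_mult_distrib s(2) by (simp only: mult.assoc)
  qed
  have E: "(\<Sum>g\<in>G. c g) - 2 * pi / 3 * q\<^sup>2 * r ^ 3 =
      (\<Sum>g\<in>G. c g - pi * q\<^sup>2 * (r\<^sup>2 - (real g)\<^sup>2)) + pi * q\<^sup>2 * ((\<Sum>g\<in>G. r\<^sup>2 - (real g)\<^sup>2) - 2 * r ^ 3 / 3)"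
  proof -
    have "(\<Sum>g\<in>G. c g - pi * q\<^sup>2 * (r\<^sup>2 - (real g)\<^sup>2)) = (\<Sum>g\<in>G. c g) - pi * q\<^sup>2 * (\<Sum>g\<in>G. r\<^sup>2 - (real g)\<^sup>2)"
      by (simp only: sum_subtractf[of c] sum_distrib_left)
    thus ?thesis by (simp add: right_diff_distrib[of "pi * q\<^sup>2" "\<Sum>g\<in>G. r\<^sup>2 - (real g)\<^sup>2"])
  qed
  have "\<bar>(\<Sum>g\<in>G. c g) - 2 * pi / 3 * q\<^sup>2 * r ^ 3\<bar> \<le> \<bar>\<Sum>g\<in>G. c g - pi * q\<^sup>2 * (r\<^sup>2 - (real g)\<^sup>2)\<bar> + \<bar>pi * q\<^sup>2 * ((\<Sum>g\<in>G. r\<^sup>2 - (real g)\<^sup>2) - 2 * r ^ 3 / 3)\<bar>"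
    unfolding E by (rule abs_triangle_ineq)
  also have "\<dots> \<le> (\<Sum>g\<in>G. \<bar>c g - pi * q\<^sup>2 * (r\<^sup>2 - (real g)\<^sup>2)\<bar>) + pi * q\<^sup>2 * \<bar>(\<Sum>g\<in>G. r\<^sup>2 - (real g)\<^sup>2) - 2 * r ^ 3 / 3\<bar>"
    by (intro add_mono sum_abs) (simp add: abs_mult)
  also have "\<dots> \<le> r * ((disc_error + 2) * q\<^sup>2 * r) + pi * q\<^sup>2 * (2 * r\<^sup>2)"
  proof (intro add_mono mult_left_mono)
    have "(\<Sum>g\<in>G. \<bar>c g - pi * q\<^sup>2 * (r\<^sup>2 - (real g)\<^sup>2)\<bar>) \<le> real (card G) * ((disc_error + 2) * q\<^sup>2 * r)"
      by (rule sum_bounded_above) (rule slice)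
    also have "\<dots> \<le> r * ((disc_error + 2) * q\<^sup>2 * r)"
      using sum_slices_approx(2)[OF r] disc_error_pos r unfolding G_def by (intro mult_right_mono mult_nonneg_nonneg) auto
    finally show "(\<Sum>g\<in>G. \<bar>c g - pi * q\<^sup>2 * (r\<^sup>2 - (real g)\<^sup>2)\<bar>) \<le> r * ((disc_error + 2) * q\<^sup>2 * r)" .
    show "\<bar>(\<Sum>g\<in>G. r\<^sup>2 - (real g)\<^sup>2) - 2 * r ^ 3 / 3\<bar> \<le> 2 * r\<^sup>2"
      unfolding G_def by (rule sum_slices_approx(1)[OF r])
  qed simp
  also have "\<dots> = fibre_error * q\<^sup>2 * r\<^sup>2" by (simp add: fibre_error_def power2_eq_square algebra_simps)
  finally show ?thesis unfolding card q_def .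
qed

text \<open>The point is that \<kappa> and C do not involve \<open>z\<close>, which enters through
  the scale Q = |z|^2 only. All fibres are then covered by one application of
  \<open>sieve_uniform\<close>.\<close>

lemma sieve_hyp_fibre_vecs:
  assumes z: "z \<in> proj_reps"
  shows "sieve_hyp (fibre_vecs z) (fibre_norm z) dvd_fibre scale_fibre (2 * pi / 3) fibre_error ((nrm z)\<^sup>2) 3"
  unfolding sieve_hyp_def
proof (intro conjI allI impI ballI)
  have q: "nrm z \<ge> 1" by (rule proj_reps_nonzero_vecs(2)[OF z])
  show "finite {w \<in> fibre_vecs z. fibre_norm z w < r}" for r
    by (rule finite_subset[OF _ card_fibre_vecs_slices(1)[OF z, of "max r 1"]]) auto
  show "1 \<le> fibre_norm z w" if w: "w \<in> fibre_vecs z" for w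
  proof -
    obtain v g where vg: "w = (v, g)" "g \<ge> 1" using w by (auto simp: fibre_vecs_def)
    have "nrm z * 1 \<le> nrm z * real g" using vg q by (intro mult_left_mono) auto
    also have "\<dots> \<le> sqrt ((nrm v)\<^sup>2 + (real g)\<^sup>2 * (nrm z)\<^sup>2)"
      by (rule real_le_rsqrt) (simp add: power_mult_distrib mult.commute)
    finally show ?thesis using q by (simp add: vg fibre_norm_def pos_le_divide_eq)
  qed
  have vec_det_sc: "vec_det z (scale_vec p v) = int p * vec_det z v" for p v by (simp add: vec_det_def scale_vec_def algebra_simps)
  show "bij_betw (scale_fibre p) (fibre_vecs z) {w \<in> fibre_vecs z. dvd_fibre p w}" if p: "prime p" for p
    unfolding bij_betw_def
  proof (intro conjI equalityI subsetI)
    have p0: "p > 0" using p by (rule prime_gt_0_nat)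
    show "inj_on (scale_fibre p) (fibre_vecs z)" using p0 by (auto simp: inj_on_def scale_fibre_def scale_vec_def)
    show "w \<in> {w \<in> fibre_vecs z. dvd_fibre p w}" if w: "w \<in> scale_fibre p ` fibre_vecs z" for w
    proof -
      obtain v g where vg: "w = (scale_vec p v, p * g)" "g \<ge> 1" "vec_det z v \<noteq> 0" using w by (auto simp: fibre_vecs_def scale_fibre_def)
      have "dvd_vec p (scale_vec p v)" by (simp add: dvd_vec_def scale_vec_def)
      thus ?thesis using vg p0 by (simp add: fibre_vecs_def dvd_fibre_def vec_det_sc)
    qed
    show "w \<in> scale_fibre p ` fibre_vecs z" if w: "w \<in> {w \<in> fibre_vecs z. dvd_fibre p w}" for w
    proof -
      obtain v g where vg: "w = (v, g)" "g \<ge> 1" "vec_det z v \<noteq> 0" "dvd_vec p v" "p dvd g"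
        using w by (auto simp: fibre_vecs_def dvd_fibre_def)
      obtain h where h: "g = p * h" using vg(5) by (rule dvdE)
      obtain k l where "fst v = int p * k" "snd v = int p * l" using vg(4) by (auto simp: dvd_vec_def elim!: dvdE)
      hence v: "v = scale_vec p (k, l)" by (simp add: scale_vec_def prod_eq_iff)
      have "h \<ge> 1" using h vg(2) by (cases h) auto
      moreover have "vec_det z (k, l) \<noteq> 0" using vg(3) unfolding v vec_det_sc by simp
      ultimately have "((k, l), h) \<in> fibre_vecs z" by (simp add: fibre_vecs_def)
      moreover have "w = scale_fibre p ((k, l), h)" by (simp add: scale_fibre_def vg(1) v h)
      ultimately show ?thesis by (rule rev_image_eqI)
    qed
  qed
  show "fibre_norm z (scale_fibre p w) = real p * fibre_norm z w" for p w
  proof -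
    obtain v g where vg: "w = (v, g)" by (cases w)
    have "nrm (scale_vec p v) = real p * nrm v" unfolding scale_vec_def nrm_scale by simp
    hence "(nrm (scale_vec p v))\<^sup>2 + (real (p * g))\<^sup>2 * (nrm z)\<^sup>2 = (real p)\<^sup>2 * ((nrm v)\<^sup>2 + (real g)\<^sup>2 * (nrm z)\<^sup>2)"
      by (simp add: power_mult_distrib algebra_simps)
    thus ?thesis unfolding vg by (simp only: scale_fibre_def fibre_norm_def prod.case real_sqrt_mult real_sqrt_abs) simp
  qed
  show "dvd_fibre q (scale_fibre p w) \<longleftrightarrow> dvd_fibre q w" if pq: "prime p" "prime q" "p \<noteq> q" for p q w
  proof -
    have "dvd_vec q (scale_vec p v) \<longleftrightarrow> dvd_vec q v" if "v \<in> nonzero_vecs" for v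
      using sieve_hyp_nonzero_vecs pq that unfolding sieve_hyp_def by blast
    moreover have "dvd_vec q (scale_vec p v) \<longleftrightarrow> dvd_vec q v" if "v \<notin> nonzero_vecs" for v
      using that by (simp add: nonzero_vecs_def dvd_vec_def scale_vec_def)
    ultimately have a: "dvd_vec q (scale_vec p v) \<longleftrightarrow> dvd_vec q v" for v by blast
    have "q dvd p * g \<longleftrightarrow> q dvd g" for g
      using pq by (metis prime_dvd_mult_iff primes_dvd_imp_eq)
    thus ?thesis using a by (cases w) (simp add: dvd_fibre_def scale_fibre_def)
  qed
  show "\<bar>real (card {w \<in> fibre_vecs z. fibre_norm z w < r}) - 2 * pi / 3 * (nrm z)\<^sup>2 * r ^ 3\<bar> \<le> fibre_error * (nrm z)\<^sup>2 * r ^ (3 - 1)"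
    if "r > 0" for r using card_fibre_vecs[OF z that] by simp
qed (use disc_error_pos in \<open>simp_all add: fibre_error_def\<close>)

section \<open>Counts and power sums over the projective line\<close>

definition proj_count :: "real \<Rightarrow> real" where "proj_count u = real (card {z\<in>proj_reps. nrm z < u})"

text \<open>The area \<pi> times the density 1 / \<zeta>(2) of primitive vectors, halved since
  \<open>z\<close> is taken up to sign.\<close>

definition proj_density :: real where "proj_density = pi / (2 * zeta 2)"

lemma finite_proj_reps: "finite {z\<in>proj_reps. nrm z < u}"
  by (rule finite_subset[OF _ finite_nrm[of u]]) auto

lemma proj_count_measurable [measurable]: "proj_count \<in> borel_measurable borel"
proof (rule borel_measurable_mono, rule monoI)
  fix u v :: real assume "u \<le> v"
  hence "{z\<in>proj_reps. nrm z < u} \<subseteq> {z\<in>proj_reps. nrm z < v}" by auto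
  from card_mono[OF finite_proj_reps this] show "proj_count u \<le> proj_count v" by (simp add: proj_count_def)
qed

lemma proj_count_nonneg: "proj_count u \<ge> 0" by (simp add: proj_count_def)

definition proj_bound :: real where "proj_bound = pi + disc_error"

lemma proj_bound_pos: "proj_bound > 0" using disc_error_pos pi_gt_zero by (simp add: proj_bound_def add_pos_nonneg)

lemma proj_count_le: "u > 0 \<Longrightarrow> proj_count u \<le> proj_bound * u\<^sup>2"
proof -
  assume u: "u > 0"
  have "card {z\<in>proj_reps. nrm z < u} \<le> card {v\<in>nonzero_vecs. nrm v < u}"
    by (rule card_mono) (auto intro: finite_subset[OF _ finite_nrm[of u]] proj_reps_nonzero_vecs(1))
  hence "proj_count u \<le> real (card {v\<in>nonzero_vecs. nrm v < u})" by (simp add: proj_count_def)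
  also have "\<dots> \<le> (pi + disc_error) * 1 * u ^ 2" by (rule sieve_upper[OF sieve_hyp_nonzero_vecs u])
  finally show ?thesis by (simp add: proj_bound_def)
qed

lemma proj_count_asymp: "((\<lambda>u. proj_count u / u\<^sup>2) \<longlongrightarrow> proj_density) at_top"
proof (rule tendstoI)
  fix e :: real assume e: "e > 0"
  obtain R where R: "R > 0" "\<forall>V N dv sc Q r. sieve_hyp (V :: (int \<times> int) set) N dv sc pi disc_error Q 2 \<longrightarrow> r \<ge> R \<longrightarrow>
    \<bar>real (card {v\<in>V. N v < r \<and> (\<forall>q. prime q \<longrightarrow> \<not> dv q v)}) - pi / zeta (real 2) * Q * r ^ 2\<bar> \<le> e * Q * r ^ 2"
    using sieve_uniform[of pi disc_error 2 e] disc_error_pos e by auto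
  show "\<forall>\<^sub>F u in at_top. dist (proj_count u / u\<^sup>2) proj_density < e"
  proof (rule eventually_mono[OF eventually_ge_at_top[of R]])
    fix u assume u: "R \<le> u"
    have "\<bar>real (card {v\<in>nonzero_vecs. nrm v < u \<and> (\<forall>q. prime q \<longrightarrow> \<not> dvd_vec q v)}) - pi / zeta (real 2) * 1 * u ^ 2\<bar> \<le> e * 1 * u ^ 2"
      using R(2) sieve_hyp_nonzero_vecs u by blast
    hence "\<bar>2 * proj_count u - 2 * proj_density * u\<^sup>2\<bar> \<le> e * u\<^sup>2" unfolding card_proj_reps[symmetric] by (simp add: proj_count_def proj_density_def)
    moreover have "2 * proj_count u - 2 * proj_density * u\<^sup>2 = 2 * (proj_count u - proj_density * u\<^sup>2)" by simp
    ultimately have "\<bar>proj_count u - proj_density * u\<^sup>2\<bar> \<le> e / 2 * u\<^sup>2" by (simp only: abs_mult)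
    also have "\<dots> < e * u\<^sup>2" using e u R(1) by simp
    finally have "\<bar>proj_count u - proj_density * u\<^sup>2\<bar> / u\<^sup>2 < e" using u R(1) by (simp add: pos_divide_less_eq)
    moreover have "proj_count u / u\<^sup>2 - proj_density = (proj_count u - proj_density * u\<^sup>2) / u\<^sup>2" using u R(1) by (simp add: diff_divide_distrib)
    ultimately show "dist (proj_count u / u\<^sup>2) proj_density < e" by (simp add: dist_real_def abs_divide)
  qed
qed

definition norm_sum :: "real \<Rightarrow> real \<Rightarrow> real" where
  "norm_sum \<gamma> X = (\<Sum>z\<in>{z\<in>proj_reps. nrm z < X}. nrm z powr \<gamma>)"

lemma powr_FTC:
  fixes a :: real
  assumes "0 < a" "a \<le> 1"
  shows "has_bochner_integral lborel (\<lambda>t. \<gamma> * t powr (\<gamma> - 1) * indicator {a<..1} t) (1 - a powr \<gamma>)"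
proof -
  have "has_bochner_integral lborel (\<lambda>t. \<gamma> * t powr (\<gamma> - 1) * indicator {a..1} t) (1 powr \<gamma> - a powr \<gamma>)"
  proof (rule has_bochner_integral_FTC_Icc_real)
    fix t assume t: "a \<le> t" "t \<le> 1"
    show "DERIV (\<lambda>t. t powr \<gamma>) t :> \<gamma> * t powr (\<gamma> - 1)" using t assms by (intro has_real_derivative_powr) auto
    show "isCont (\<lambda>t. \<gamma> * t powr (\<gamma> - 1)) t" using t assms by (intro continuous_intros) auto
  qed (rule assms)
  moreover have "has_bochner_integral lborel (\<lambda>t. \<gamma> * t powr (\<gamma> - 1) * indicator {a..1} t) (1 powr \<gamma> - a powr \<gamma>) \<longleftrightarrow>
      has_bochner_integral lborel (\<lambda>t. \<gamma> * t powr (\<gamma> - 1) * indicator {a<..1} t) (1 powr \<gamma> - a powr \<gamma>)"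
    by (intro has_bochner_integral_cong_AE eventually_mono[OF AE_lborel_singleton[of a]])
      (auto simp: indicator_def)
  ultimately show ?thesis by simp
qed

text \<open>Partial summation: 1 - (|z|/X)^\<gamma> is the integral of \<gamma> t^(\<gamma>-1) from
  |z|/X to 1, and the sum of the indicators over \<open>z\<close> is a value of
  \<open>proj_count\<close>. Scaling by X keeps the range of integration fixed, so that dominated
  convergence applies afterwards.\<close>

lemma norm_sum_eq_integral:
  assumes X: "X > 0"
  shows "norm_sum \<gamma> X / X powr \<gamma> = proj_count X - (LINT t|lborel. \<gamma> * t powr (\<gamma> - 1) * indicator {0<..1} t * proj_count (t * X))"
proof -
  define F where "F = {z\<in>proj_reps. nrm z < X}"
  have q: "nrm z > 0" if "z \<in> F" for z using proj_reps_nonzero_vecs(2)[of z] that by (simp add: F_def)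
  have "has_bochner_integral lborel (\<lambda>t. \<Sum>z\<in>F. \<gamma> * t powr (\<gamma> - 1) * indicator {nrm z / X<..1} t)
      (\<Sum>z\<in>F. 1 - (nrm z / X) powr \<gamma>)"
    using X q by (intro has_bochner_integral_sum powr_FTC) (auto simp: F_def less_imp_le)
  hence "(LINT t|lborel. (\<Sum>z\<in>F. \<gamma> * t powr (\<gamma> - 1) * indicator {nrm z / X<..1} t)) = (\<Sum>z\<in>F. 1 - (nrm z / X) powr \<gamma>)"
    by (rule has_bochner_integral_integral_eq)
  moreover have "(\<Sum>z\<in>F. \<gamma> * t powr (\<gamma> - 1) * indicator {nrm z / X<..1} t) = \<gamma> * t powr (\<gamma> - 1) * indicator {0<..1} t * proj_count (t * X)" for t
  proof (cases "t \<in> {0<..1}")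
    case True
    have tX: "t * X \<le> 1 * X" using True X by (intro mult_right_mono) auto
    have "(indicator {nrm z / X<..1} t :: real) = of_bool (nrm z < t * X)" for z
      using True X by (simp add: indicator_def pos_divide_less_eq)
    hence "(\<Sum>z\<in>F. (indicator {nrm z / X<..1} t :: real)) = real (card {z\<in>F. nrm z < t * X})"
      by (simp add: sum_of_bool_eq F_def finite_proj_reps Int_def)
    also have "{z\<in>F. nrm z < t * X} = {z\<in>proj_reps. nrm z < t * X}" using tX by (auto simp: F_def)
    finally show ?thesis using True unfolding sum_distrib_left[symmetric] by (simp add: proj_count_def)
  next
    case False
    have "t \<notin> {nrm z / X<..1}" if "z \<in> F" for z
    proof
      assume "t \<in> {nrm z / X<..1}"
      moreover have "nrm z / X > 0" using q[OF that] X by simp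
      ultimately show False using False by auto
    qed
    thus ?thesis using False by simp
  qed
  moreover have "(\<Sum>z\<in>F. 1 - (nrm z / X) powr \<gamma>) = proj_count X - norm_sum \<gamma> X / X powr \<gamma>"
  proof -
    have "(nrm z / X) powr \<gamma> = nrm z powr \<gamma> / X powr \<gamma>" for z using nrm_nonneg X by (simp add: powr_divide)
    thus ?thesis by (simp add: sum_subtractf proj_count_def norm_sum_def F_def sum_divide_distrib)
  qed
  ultimately show ?thesis by simp
qed

lemma powr_integral_unit:
  fixes a :: real
  assumes "a > -1"
  shows "has_bochner_integral lborel (\<lambda>t. t powr a * indicator {0<..1} t) (1 / (a + 1))"
proof (rule has_bochner_integral_nn_integral)
  have "((\<lambda>t. t powr a) has_integral (1 / (a + 1))) {0..1}"
    using has_integral_powr_from_0[OF assms, of 1] by simp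
  hence "((\<lambda>t. if t \<in> {0..1} then t powr a else 0) has_integral (1 / (a + 1))) UNIV"
    by (simp only: has_integral_restrict_UNIV)
  moreover have "(\<lambda>t. if t \<in> {0..1} then t powr a else 0) = (\<lambda>t. t powr a * indicator {0<..1} t)"
  proof
    fix t :: real
    show "(if t \<in> {0..1} then t powr a else 0) = t powr a * indicator {0<..1} t"
      by (cases "t = 0") (auto simp: indicator_def)
  qed
  ultimately have "((\<lambda>t. t powr a * indicator {0<..1} t) has_integral (1 / (a + 1))) UNIV" by simp
  thus "(\<integral>\<^sup>+t. ennreal (t powr a * indicator {0<..1} t) \<partial>lborel) = ennreal (1 / (a + 1))"
    by (intro nn_integral_has_integral_lborel) auto
qed (use assms in auto)

text \<open>After division by X^2 the integrand tends to a multiple of t^(\<gamma>+1) and is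
  dominated by another one, integrable because \<gamma> > -2. The boundary term contributes the
  density itself.\<close>

lemma norm_sum_asymp:
  assumes g: "\<gamma> > -2"
  shows "((\<lambda>X. norm_sum \<gamma> X / X powr (\<gamma> + 2)) \<longlongrightarrow> 2 * proj_density / (\<gamma> + 2)) at_top"
proof -
  define s where "s X t = \<gamma> * t powr (\<gamma> - 1) * indicator {0<..1} t * proj_count (t * X) / X\<^sup>2" for X t :: real
  define f where "f t = \<gamma> * proj_density * (t powr (\<gamma> + 1) * indicator {0<..1} t)" for t :: real
  define w where "w t = \<bar>\<gamma>\<bar> * proj_bound * (t powr (\<gamma> + 1) * indicator {0<..1} t)" for t :: real
  have hb: "has_bochner_integral lborel (\<lambda>t. t powr (\<gamma> + 1) * indicator {0<..1} t) (1 / (\<gamma> + 2))"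
    using powr_integral_unit[of "\<gamma> + 1"] g by (simp add: add.commute)
  have pw: "t powr (\<gamma> - 1) * t\<^sup>2 = t powr (\<gamma> + 1)" if "t > 0" for t :: real
  proof -
    have "t\<^sup>2 = t powr 2" using that by simp
    thus ?thesis by (simp add: powr_add[symmetric] add.commute)
  qed
  have "((\<lambda>X. integral\<^sup>L lborel (s X)) \<longlongrightarrow> integral\<^sup>L lborel f) at_top"
  proof (rule integral_dominated_convergence_at_top)
    show "f \<in> borel_measurable lborel" unfolding f_def by measurable
    show "s X \<in> borel_measurable lborel" for X unfolding s_def by measurable
    show "integrable lborel w" unfolding w_def using hb by (intro integrable_mult_right) (simp add: has_bochner_integral_iff)
    show "AE t in lborel. ((\<lambda>X. s X t) \<longlongrightarrow> f t) at_top"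
    proof (rule AE_I2)
      fix t :: real
      show "((\<lambda>X. s X t) \<longlongrightarrow> f t) at_top"
      proof (cases "t \<in> {0<..1}")
        case True
        hence t: "t > 0" by simp
        have "filterlim (\<lambda>X. t * X) at_top at_top"
          by (rule filterlim_tendsto_pos_mult_at_top[OF tendsto_const t filterlim_ident])
        hence "((\<lambda>X. proj_count (t * X) / (t * X)\<^sup>2) \<longlongrightarrow> proj_density) at_top" by (rule filterlim_compose[OF proj_count_asymp])
        hence "((\<lambda>X. \<gamma> * t powr (\<gamma> + 1) * (proj_count (t * X) / (t * X)\<^sup>2)) \<longlongrightarrow> \<gamma> * t powr (\<gamma> + 1) * proj_density) at_top"
          by (intro tendsto_intros)
        moreover have "\<gamma> * t powr (\<gamma> + 1) * (proj_count (t * X) / (t * X)\<^sup>2) = s X t" for X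
          using True t unfolding s_def pw[OF t, symmetric] power_mult_distrib by simp
        ultimately show ?thesis using True by (simp add: f_def mult_ac)
      qed (simp add: s_def f_def)
    qed
    show "\<forall>\<^sub>F X in at_top. AE t in lborel. norm (s X t) \<le> w t"
    proof (rule eventually_mono[OF eventually_gt_at_top[of 0]], rule AE_I2)
      fix X t :: real assume X: "X > 0"
      show "norm (s X t) \<le> w t"
      proof (cases "t \<in> {0<..1}")
        case True
        hence t: "t > 0" by simp
        have "proj_count (t * X) \<le> proj_bound * (t * X)\<^sup>2" using t X by (intro proj_count_le) simp
        hence "proj_count (t * X) / X\<^sup>2 \<le> proj_bound * t\<^sup>2" using X by (simp add: pos_divide_le_eq power_mult_distrib mult.assoc)
        hence "\<bar>\<gamma>\<bar> * t powr (\<gamma> - 1) * (proj_count (t * X) / X\<^sup>2) \<le> \<bar>\<gamma>\<bar> * t powr (\<gamma> - 1) * (proj_bound * t\<^sup>2)"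
          by (intro mult_left_mono) auto
        also have "\<dots> = \<bar>\<gamma>\<bar> * proj_bound * (t powr (\<gamma> - 1) * t\<^sup>2)" by (simp only: mult_ac)
        finally show ?thesis using True proj_count_nonneg[of "t * X"] unfolding pw[OF t]
          by (simp add: s_def w_def abs_mult abs_divide)
      qed (simp add: s_def w_def)
    qed
  qed
  moreover have "integral\<^sup>L lborel f = \<gamma> * proj_density / (\<gamma> + 2)"
    unfolding f_def integral_mult_right_zero has_bochner_integral_integral_eq[OF hb] by simp
  ultimately have "((\<lambda>X. proj_count X / X\<^sup>2 - integral\<^sup>L lborel (s X)) \<longlongrightarrow> proj_density - \<gamma> * proj_density / (\<gamma> + 2)) at_top"
    using proj_count_asymp by (intro tendsto_diff) auto
  moreover have "proj_density - \<gamma> * proj_density / (\<gamma> + 2) = 2 * proj_density / (\<gamma> + 2)" using g by (simp add: field_simps)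
  moreover have "\<forall>\<^sub>F X in at_top. proj_count X / X\<^sup>2 - integral\<^sup>L lborel (s X) = norm_sum \<gamma> X / X powr (\<gamma> + 2)"
  proof (rule eventually_mono[OF eventually_gt_at_top[of 0]])
    fix X :: real assume X: "X > 0"
    have "integral\<^sup>L lborel (s X) = (LINT t|lborel. \<gamma> * t powr (\<gamma> - 1) * indicator {0<..1} t * proj_count (t * X)) / X\<^sup>2"
      unfolding s_def by (rule integral_divide_zero)
    hence "proj_count X / X\<^sup>2 - integral\<^sup>L lborel (s X) = (norm_sum \<gamma> X / X powr \<gamma>) / X\<^sup>2"
      unfolding norm_sum_eq_integral[OF X] by (simp add: diff_divide_distrib)
    also have "\<dots> = norm_sum \<gamma> X / X powr (\<gamma> + 2)" using X by (simp add: powr_add)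
    finally show "proj_count X / X\<^sup>2 - integral\<^sup>L lborel (s X) = norm_sum \<gamma> X / X powr (\<gamma> + 2)" .
  qed
  ultimately show ?thesis by (simp add: tendsto_cong)
qed

text \<open>A bound for all X > 0 is needed, since it will be used at X = T g^(-1/\<beta>), which
  may be small. The sum is empty for X \<le> 1, monotone in a bounded range, and controlled by the
  asymptotics beyond it.\<close>

lemma norm_sum_bound:
  assumes g: "\<gamma> > -2"
  shows "\<exists>C>0. \<forall>X>0. norm_sum \<gamma> X \<le> C * X powr (\<gamma> + 2)"
proof -
  define L where "L = 2 * proj_density / (\<gamma> + 2)"
  have "\<forall>\<^sub>F X in at_top. norm_sum \<gamma> X / X powr (\<gamma> + 2) < \<bar>L\<bar> + 1"
  proof (rule order_tendstoD(2))
    show "((\<lambda>X. norm_sum \<gamma> X / X powr (\<gamma> + 2)) \<longlongrightarrow> L) at_top" unfolding L_def by (rule norm_sum_asymp[OF g])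
  qed linarith
  then obtain R0 where R0: "\<And>X. X \<ge> R0 \<Longrightarrow> norm_sum \<gamma> X / X powr (\<gamma> + 2) < \<bar>L\<bar> + 1"
    by (auto simp: eventually_at_top_linorder)
  define R where "R = max R0 1"
  have nn: "norm_sum \<gamma> X \<ge> 0" for X unfolding norm_sum_def by (intro sum_nonneg) simp
  define C where "C = \<bar>L\<bar> + 1 + norm_sum \<gamma> R"
  have "norm_sum \<gamma> X \<le> C * X powr (\<gamma> + 2)" if X: "X > 0" for X
  proof -
    have p: "X powr (\<gamma> + 2) > 0" using X by simp
    consider "X \<ge> R" | "1 < X" "X < R" | "X \<le> 1" by linarith
    thus ?thesis
    proof cases
      case 1
      have "norm_sum \<gamma> X / X powr (\<gamma> + 2) \<le> C" using R0[of X] 1 nn[of R] by (simp add: C_def R_def)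
      thus ?thesis using p by (simp add: pos_divide_le_eq)
    next
      case 2
      have "norm_sum \<gamma> X \<le> norm_sum \<gamma> R" unfolding norm_sum_def using 2 finite_proj_reps by (intro sum_mono2) auto
      also have "\<dots> \<le> C * 1" by (simp add: C_def)
      also have "\<dots> \<le> C * X powr (\<gamma> + 2)"
        using 2 g nn[of R] by (intro mult_left_mono ge_one_powr_ge_zero) (auto simp: C_def)
      finally show ?thesis .
    next
      case 3
      have "\<not> nrm z < X" if "z \<in> proj_reps" for z using proj_reps_nonzero_vecs(2)[OF that] 3 by linarith
      hence "{z\<in>proj_reps. nrm z < X} = {}" by blast
      hence "norm_sum \<gamma> X = 0" unfolding norm_sum_def by (simp only: sum.empty)
      moreover have "C \<ge> 0" using nn[of R] by (simp add: C_def)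
      ultimately show ?thesis using p by simp
    qed
  qed
  moreover have "C > 0" using nn[of R] by (simp add: C_def add_pos_nonneg)
  ultimately show ?thesis by blast
qed

text \<open>At the exponent -2 the limiting kernel would be 1/t. Replacing the radius t X by X^t
  makes the scale logarithmic: the factor ln X comes out, and the remaining integrand is bounded on
  a fixed interval.\<close>

lemma norm_sum_log_eq_integral:
  assumes X: "X > 1"
  shows "norm_sum (-2) X = proj_count X / X\<^sup>2 + 2 * ln X * (LINT t|lborel. indicator {0<..1} t * (proj_count (X powr t) / (X powr t)\<^sup>2))"
proof -
  have lX: "ln X > 0" using X by simp
  define F where "F = {z\<in>proj_reps. nrm z < X}"
  have q: "nrm z \<ge> 1" "ln (nrm z) / ln X < 1" "0 \<le> ln (nrm z) / ln X" if "z \<in> F" for z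
  proof -
    show 1: "nrm z \<ge> 1" using proj_reps_nonzero_vecs(2)[of z] that by (simp add: F_def)
    thus "0 \<le> ln (nrm z) / ln X" using lX by simp
    have "ln (nrm z) < ln X" using 1 that X by (simp add: F_def)
    thus "ln (nrm z) / ln X < 1" using lX by (simp add: pos_divide_less_eq)
  qed
  have sq: "(X powr t)\<^sup>2 = X powr (2 * t)" for t by (simp add: power2_eq_square powr_add[symmetric])
  have hb: "has_bochner_integral lborel (\<lambda>t. 2 * ln X * X powr (- 2 * t) * indicator {ln (nrm z) / ln X<..1} t)
      (nrm z powr -2 - X powr -2)" if z: "z \<in> F" for z
  proof -
    define a where "a = ln (nrm z) / ln X"
    have a: "a \<le> 1" using q[OF z] by (simp add: a_def)
    have "has_bochner_integral lborel (\<lambda>t. 2 * ln X * X powr (- 2 * t) * indicator {a..1} t)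
        (- (X powr (-2 * 1)) - - (X powr (-2 * a)))"
    proof (rule has_bochner_integral_FTC_Icc_real)
      fix t assume t: "a \<le> t" "t \<le> 1"
      show "DERIV (\<lambda>t. - (X powr (-2 * t))) t :> 2 * ln X * X powr (-2 * t)"
        using X by (auto intro!: derivative_eq_intros simp: powr_def)
      show "isCont (\<lambda>t. 2 * ln X * X powr (-2 * t)) t" using X by (intro continuous_intros) auto
    qed (rule a)
    moreover have "has_bochner_integral lborel (\<lambda>t. 2 * ln X * X powr (- 2 * t) * indicator {a..1} t) c \<longleftrightarrow>
        has_bochner_integral lborel (\<lambda>t. 2 * ln X * X powr (- 2 * t) * indicator {a<..1} t) c" for c
      by (intro has_bochner_integral_cong_AE eventually_mono[OF AE_lborel_singleton[of a]])
        (auto simp: indicator_def)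
    moreover have "X powr (-2 * a) = nrm z powr -2"
      using q(1)[OF z] X lX by (simp add: powr_def a_def)
    ultimately show ?thesis by (simp add: a_def)
  qed
  have "has_bochner_integral lborel (\<lambda>t. \<Sum>z\<in>F. 2 * ln X * X powr (- 2 * t) * indicator {ln (nrm z) / ln X<..1} t)
      (\<Sum>z\<in>F. nrm z powr -2 - X powr -2)"
    using hb by (rule has_bochner_integral_sum)
  hence "(LINT t|lborel. (\<Sum>z\<in>F. 2 * ln X * X powr (- 2 * t) * indicator {ln (nrm z) / ln X<..1} t)) =
      (\<Sum>z\<in>F. nrm z powr -2 - X powr -2)"
    by (rule has_bochner_integral_integral_eq)
  moreover have "(\<Sum>z\<in>F. 2 * ln X * X powr (- 2 * t) * indicator {ln (nrm z) / ln X<..1} t) =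
      2 * ln X * (indicator {0<..1} t * (proj_count (X powr t) / (X powr t)\<^sup>2))" for t
  proof (cases "t \<in> {0<..1}")
    case True
    have tX: "X powr t \<le> X powr 1" using True X by (intro powr_mono) auto
    have "ln (nrm z) / ln X < t \<longleftrightarrow> nrm z < X powr t" if "z \<in> F" for z
    proof -
      have "ln (nrm z) / ln X < t \<longleftrightarrow> ln (nrm z) < ln (X powr t)" using lX by (simp add: pos_divide_less_eq ln_powr)
      also have "\<dots> \<longleftrightarrow> nrm z < X powr t" using q(1)[OF that] X by (intro ln_less_cancel_iff) auto
      finally show ?thesis .
    qed
    hence "(indicator {ln (nrm z) / ln X<..1} t :: real) = of_bool (nrm z < X powr t)" if "z \<in> F" for z
      using True that by (simp add: indicator_def)
    hence "(\<Sum>z\<in>F. (indicator {ln (nrm z) / ln X<..1} t :: real)) = (\<Sum>z\<in>F. of_bool (nrm z < X powr t))"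
      by (rule sum.cong[OF refl])
    also have "\<dots> = real (card {z\<in>F. nrm z < X powr t})"
      by (simp add: sum_of_bool_eq F_def finite_proj_reps Int_def)
    also have "{z\<in>F. nrm z < X powr t} = {z\<in>proj_reps. nrm z < X powr t}" using tX X by (auto simp: F_def)
    finally have c: "(\<Sum>z\<in>F. (indicator {ln (nrm z) / ln X<..1} t :: real)) = proj_count (X powr t)" by (simp add: proj_count_def)
    have "X powr (-2 * t) = 1 / X powr (2 * t)" by (simp add: powr_minus inverse_eq_divide)
    thus ?thesis using True unfolding sum_distrib_left[symmetric] c sq by simp
  next
    case False
    have "t \<notin> {ln (nrm z) / ln X<..1}" if "z \<in> F" for z using False q(3)[OF that] by auto
    thus ?thesis using False by simp
  qed
  moreover have "(\<Sum>z\<in>F. nrm z powr -2 - X powr -2) = norm_sum (-2) X - proj_count X / X\<^sup>2"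
  proof -
    have "X powr -2 = 1 / X\<^sup>2" using X by (simp add: powr_minus inverse_eq_divide)
    thus ?thesis by (simp add: sum_subtractf proj_count_def norm_sum_def F_def)
  qed
  ultimately have "(LINT t|lborel. 2 * ln X * (indicator {0<..1} t * (proj_count (X powr t) / (X powr t)\<^sup>2))) = norm_sum (-2) X - proj_count X / X\<^sup>2"
    by simp
  thus ?thesis unfolding integral_mult_right_zero by linarith
qed

lemma norm_sum_log_asymp: "((\<lambda>X. norm_sum (-2) X / ln X) \<longlongrightarrow> 2 * proj_density) at_top"
proof -
  define s where "s X t = indicator {0<..1} t * (proj_count (X powr t) / (X powr t)\<^sup>2)" for X t :: real
  have "((\<lambda>X. integral\<^sup>L lborel (s X)) \<longlongrightarrow> (LINT t::real|lborel. indicator {0<..1} t * proj_density)) at_top"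
  proof (rule integral_dominated_convergence_at_top)
    show "(\<lambda>t::real. indicator {0<..1} t * proj_density) \<in> borel_measurable lborel" by measurable
    show "s X \<in> borel_measurable lborel" for X unfolding s_def by measurable
    show "integrable lborel (\<lambda>t::real. indicator {0<..1} t * proj_bound)" by simp
    show "AE t in lborel. ((\<lambda>X. s X t) \<longlongrightarrow> indicator {0<..1} t * proj_density) at_top"
    proof (rule AE_I2)
      fix t :: real
      show "((\<lambda>X. s X t) \<longlongrightarrow> indicator {0<..1} t * proj_density) at_top"
      proof (cases "t \<in> {0<..1}")
        case True
        hence t: "t > 0" by simp
        have "filterlim (\<lambda>X::real. X powr t) at_top at_top" 
        proof (rule filterlim_cong[THEN iffD1, OF refl refl])
          show "filterlim (\<lambda>X::real. exp (t * ln X)) at_top at_top"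
            by (intro filterlim_compose[OF exp_at_top] filterlim_tendsto_pos_mult_at_top[OF tendsto_const t ln_at_top])
          show "\<forall>\<^sub>F X::real in at_top. exp (t * ln X) = X powr t"
            using eventually_gt_at_top[of 0] by eventually_elim (simp add: powr_def)
        qed
        hence "((\<lambda>X. proj_count (X powr t) / (X powr t)\<^sup>2) \<longlongrightarrow> proj_density) at_top" by (rule filterlim_compose[OF proj_count_asymp])
        thus ?thesis using True by (simp add: s_def)
      qed (simp add: s_def)
    qed
    show "\<forall>\<^sub>F X in at_top. AE t::real in lborel. norm (s X t) \<le> indicator {0<..1} t * proj_bound"
    proof (rule eventually_mono[OF eventually_gt_at_top[of 0]], rule AE_I2)
      fix X t :: real assume X: "X > 0"
      have p: "X powr t > 0" using X by simp
      have "proj_count (X powr t) \<le> proj_bound * (X powr t)\<^sup>2" by (rule proj_count_le[OF p])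
      hence "proj_count (X powr t) / (X powr t)\<^sup>2 \<le> proj_bound" using p by (simp add: pos_divide_le_eq)
      thus "norm (s X t) \<le> indicator {0<..1} t * proj_bound" using proj_count_nonneg by (simp add: s_def indicator_def)
    qed
  qed
  hence i: "((\<lambda>X. 2 * integral\<^sup>L lborel (s X)) \<longlongrightarrow> 2 * proj_density) at_top"
    by (auto intro!: tendsto_eq_intros)
  have "((\<lambda>X. (proj_count X / X\<^sup>2) / ln X) \<longlongrightarrow> 0) at_top"
    by (rule tendsto_divide_0[OF proj_count_asymp filterlim_at_top_imp_at_infinity[OF ln_at_top]])
  from tendsto_add[OF this i] have "((\<lambda>X. (proj_count X / X\<^sup>2) / ln X + 2 * integral\<^sup>L lborel (s X)) \<longlongrightarrow> 2 * proj_density) at_top" by simp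
  moreover have "\<forall>\<^sub>F X in at_top. (proj_count X / X\<^sup>2) / ln X + 2 * integral\<^sup>L lborel (s X) = norm_sum (-2) X / ln X"
  proof (rule eventually_mono[OF eventually_gt_at_top[of 1]])
    fix X :: real assume X: "X > 1"
    hence "ln X > 0" by simp
    thus "(proj_count X / X\<^sup>2) / ln X + 2 * integral\<^sup>L lborel (s X) = norm_sum (-2) X / ln X"
      unfolding norm_sum_log_eq_integral[OF X] s_def by (simp add: add_divide_distrib)
  qed
  ultimately show ?thesis by (simp add: tendsto_cong)
qed

text \<open>Layer cake again: a finite partial sum is the integral of \<sigma> l^(-\<sigma>-1) times
  the number of \<open>z\<close> with norm at most l, and this number is at most quadratic in l,
  uniformly in the partial sum.\<close>

lemma nrm_powr_summable:
  assumes s: "\<sigma> > 2"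
  shows "(\<lambda>z. nrm z powr (- \<sigma>)) summable_on proj_reps"
proof (rule nonneg_bdd_above_summable_on)
  \<comment> \<open>The 4 arises since norms at most l are counted as norms below 2 l; \<sigma> /
    (\<sigma> - 2) is the integral of \<sigma> l^(1-\<sigma>) from 1 on.\<close>
  define K where "K = 4 * proj_bound * \<sigma> / (\<sigma> - 2)"
  have "(\<Sum>z\<in>F. nrm z powr (- \<sigma>)) \<le> K" if F: "F \<subseteq> proj_reps" "finite F" for F
  proof -
    have q: "nrm z \<ge> 1" if "z \<in> F" for z using proj_reps_nonzero_vecs(2) F that by blast
    have "ennreal (\<Sum>z\<in>F. nrm z powr (- \<sigma>)) = (\<Sum>z\<in>F. ennreal (nrm z powr (- \<sigma>)))" by (rule sum_ennreal[symmetric]) simp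
    also have "\<dots> = (\<Sum>z\<in>F. \<integral>\<^sup>+l. ennreal (\<sigma> * l powr (- \<sigma> - 1)) * indicator {nrm z..} l \<partial>lborel)"
    proof (rule sum.cong[OF refl])
      fix z assume "z \<in> F"
      hence "nrm z > 0" using q[of z] by linarith
      thus "ennreal (nrm z powr (- \<sigma>)) = (\<integral>\<^sup>+l. ennreal (\<sigma> * l powr (- \<sigma> - 1)) * indicator {nrm z..} l \<partial>lborel)"
        using s by (intro nn_integral_powr_atLeast[symmetric]) auto
    qed
    also have "\<dots> = (\<integral>\<^sup>+l. (\<Sum>z\<in>F. ennreal (\<sigma> * l powr (- \<sigma> - 1)) * indicator {nrm z..} l) \<partial>lborel)"
      by (rule nn_integral_sum[symmetric]) measurable
    also have "\<dots> \<le> (\<integral>\<^sup>+l. ennreal K * (ennreal ((\<sigma> - 2) * l powr (- (\<sigma> - 2) - 1)) * indicator {1..} l) \<partial>lborel)"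
    proof (rule nn_integral_mono)
      fix l :: real
      show "(\<Sum>z\<in>F. ennreal (\<sigma> * l powr (- \<sigma> - 1)) * indicator {nrm z..} l) \<le>
          ennreal K * (ennreal ((\<sigma> - 2) * l powr (- (\<sigma> - 2) - 1)) * indicator {1..} l)"
      proof (cases "l \<ge> 1")
        case True
        define c where "c = real (card {z\<in>F. nrm z \<le> l})"
        have "card {z\<in>F. nrm z \<le> l} \<le> card {z\<in>proj_reps. nrm z < 2 * l}"
          using F True by (intro card_mono finite_proj_reps) auto
        hence "c \<le> proj_count (2 * l)" by (simp add: c_def proj_count_def)
        also have "\<dots> \<le> proj_bound * (2 * l)\<^sup>2" using True by (intro proj_count_le) simp
        finally have c: "c \<le> 4 * proj_bound * l\<^sup>2" by (simp add: power_mult_distrib)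
        have "(\<Sum>z\<in>F. (indicator {nrm z..} l :: ennreal)) = ennreal c"
        proof -
          have "(\<Sum>z\<in>F. (indicator {nrm z..} l :: ennreal)) = (\<Sum>z\<in>F. of_bool (nrm z \<le> l))"
            by (simp add: indicator_def)
          also have "\<dots> = of_nat (card {z\<in>F. nrm z \<le> l})" using F by (simp add: sum_of_bool_eq Int_def)
          finally show ?thesis by (simp add: c_def ennreal_of_nat_eq_real_of_nat)
        qed
        hence "(\<Sum>z\<in>F. ennreal (\<sigma> * l powr (- \<sigma> - 1)) * indicator {nrm z..} l) = ennreal (\<sigma> * l powr (- \<sigma> - 1)) * ennreal c"
          unfolding sum_distrib_left[symmetric] by simp
        also have "\<dots> = ennreal (\<sigma> * l powr (- \<sigma> - 1) * c)" using s by (intro ennreal_mult[symmetric]) (auto simp: c_def)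
        also have "\<dots> \<le> ennreal (\<sigma> * l powr (- \<sigma> - 1) * (4 * proj_bound * l\<^sup>2))"
          using s c by (intro ennreal_leI mult_left_mono) auto
        also have "\<sigma> * l powr (- \<sigma> - 1) * (4 * proj_bound * l\<^sup>2) = K * ((\<sigma> - 2) * l powr (- (\<sigma> - 2) - 1))"
        proof -
          have "l\<^sup>2 = l powr 2" using True by simp
          hence "l powr (- \<sigma> - 1) * l\<^sup>2 = l powr (- (\<sigma> - 2) - 1)" by (simp add: powr_add[symmetric] add.commute)
          moreover have "K * (\<sigma> - 2) = 4 * proj_bound * \<sigma>" using s by (simp add: K_def)
          moreover have "\<sigma> * l powr (- \<sigma> - 1) * (4 * proj_bound * l\<^sup>2) = (4 * proj_bound * \<sigma>) * (l powr (- \<sigma> - 1) * l\<^sup>2)" by (simp only: mult_ac)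
          ultimately show ?thesis by (metis mult.assoc)
        qed
        also have "ennreal (K * ((\<sigma> - 2) * l powr (- (\<sigma> - 2) - 1))) = ennreal K * ennreal ((\<sigma> - 2) * l powr (- (\<sigma> - 2) - 1))"
          using s proj_bound_pos by (intro ennreal_mult) (auto simp: K_def)
        finally show ?thesis using True by simp
      next
        case False
        have "l \<notin> {nrm z..}" if "z \<in> F" for z using q[OF that] False by simp
        thus ?thesis by simp
      qed
    qed
    also have "\<dots> = ennreal K * (\<integral>\<^sup>+l. ennreal ((\<sigma> - 2) * l powr (- (\<sigma> - 2) - 1)) * indicator {1..} l \<partial>lborel)"
      by (rule nn_integral_cmult) measurable
    also have "\<dots> = ennreal K" using s by (subst nn_integral_powr_atLeast) auto
    finally show ?thesis using s proj_bound_pos by (subst (asm) ennreal_le_iff) (auto simp: K_def)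
  qed
  thus "bdd_above (sum (\<lambda>z. nrm z powr (- \<sigma>)) ` {F. F \<subseteq> proj_reps \<and> finite F})"
    by (intro bdd_aboveI[of _ K]) auto
qed simp

section \<open>Asymptotics of the count in the three cases\<close>

definition fibre_count :: "int \<times> int \<Rightarrow> real \<Rightarrow> real" where
  "fibre_count z \<rho> = real (card {w\<in>fibre_vecs z. fibre_norm z w < \<rho> \<and> (\<forall>q. prime q \<longrightarrow> \<not> dvd_fibre q w)})"

text \<open>With \<open>T = B\<^bsup>1/(2x)\<^esup>\<close> and \<open>\<beta> = 2x / (x + y)\<close> this counts the points of height below \<open>B\<close>,
  since the point of a pair \<open>(v, g)\<close> over \<open>z\<close> has height \<open>|z|\<^bsup>2x\<^esup>\<close> times the power \<open>x + y\<close> of its fibre norm.\<close>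

definition total_count :: "real \<Rightarrow> real \<Rightarrow> real" where
  "total_count \<beta> T = (\<Sum>z\<in>{z\<in>proj_reps. nrm z < T}. fibre_count z ((T / nrm z) powr \<beta>))"

text \<open>The volume constant of a fibre times the density 1 / \<zeta>(3) of primitive
  triples.\<close>

definition fibre_density :: real where "fibre_density = 2 * pi / 3 / zeta 3"

definition fibre_bound :: real where "fibre_bound = 2 * pi / 3 + fibre_error"

lemma fibre_error_nonneg: "fibre_error \<ge> 0" using disc_error_pos by (simp add: fibre_error_def)

lemma fibre_density_pos: "fibre_density > 0" using zeta_pos[of 3] by (simp add: fibre_density_def)

lemma fibre_bound_pos: "fibre_bound > 0" using fibre_error_nonneg pi_gt_zero by (simp add: fibre_bound_def add_pos_nonneg)

lemma proj_density_pos: "proj_density > 0" using zeta_pos[of 2] by (simp add: proj_density_def)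

lemma fibre_count_nonneg: "fibre_count z \<rho> \<ge> 0" by (simp add: fibre_count_def)

lemma fibre_count_le:
  assumes z: "z \<in> proj_reps" and r: "\<rho> > 0" shows "fibre_count z \<rho> \<le> fibre_bound * (nrm z)\<^sup>2 * \<rho> ^ 3"
proof -
  have "card {w\<in>fibre_vecs z. fibre_norm z w < \<rho> \<and> (\<forall>q. prime q \<longrightarrow> \<not> dvd_fibre q w)} \<le> card {w\<in>fibre_vecs z. fibre_norm z w < \<rho>}"
    by (rule card_mono[OF card_fibre_vecs_slices(1)[OF z r]]) blast
  hence "fibre_count z \<rho> \<le> real (card {w\<in>fibre_vecs z. fibre_norm z w < \<rho>})" by (simp only: fibre_count_def of_nat_le_iff)
  also have "\<dots> \<le> (2 * pi / 3 + fibre_error) * (nrm z)\<^sup>2 * \<rho> ^ 3" by (rule sieve_upper[OF sieve_hyp_fibre_vecs[OF z] r])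
  finally show ?thesis by (simp only: fibre_bound_def)
qed

lemma fibre_count_zero:
  assumes z: "z \<in> proj_reps" and r: "\<rho> \<le> 1" shows "fibre_count z \<rho> = 0"
proof -
  have "\<forall>w\<in>fibre_vecs z. 1 \<le> fibre_norm z w" using sieve_hyp_fibre_vecs[OF z] unfolding sieve_hyp_def by blast
  hence "{w\<in>fibre_vecs z. fibre_norm z w < \<rho> \<and> (\<forall>q. prime q \<longrightarrow> \<not> dvd_fibre q w)} = {}" using r by fastforce
  thus ?thesis unfolding fibre_count_def by (simp only: card.empty of_nat_0)
qed

text \<open>The bound R is chosen before \<open>z\<close>; the logarithmic case depends on this
  order of quantifiers.\<close>

lemma fibre_count_asymp:
  assumes e: "\<epsilon> > 0"
  shows "\<exists>R>0. \<forall>z\<in>proj_reps. \<forall>\<rho>\<ge>R. \<bar>fibre_count z \<rho> - fibre_density * ((nrm z)\<^sup>2 * \<rho> ^ 3)\<bar> \<le> \<epsilon> * ((nrm z)\<^sup>2 * \<rho> ^ 3)"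
proof -
  have p: "2 * pi / 3 \<ge> 0" by simp
  obtain R where R: "R > 0" "\<forall>V N dv sc Q r. sieve_hyp (V :: ((int \<times> int) \<times> nat) set) N dv sc (2 * pi / 3) fibre_error Q 3 \<longrightarrow> r \<ge> R \<longrightarrow>
    \<bar>real (card {v\<in>V. N v < r \<and> (\<forall>q. prime q \<longrightarrow> \<not> dv q v)}) - 2 * pi / 3 / zeta (real 3) * Q * r ^ 3\<bar> \<le> \<epsilon> * Q * r ^ 3"
    using sieve_uniform[OF p fibre_error_nonneg _ e, of 3] by auto
  show ?thesis
  proof (intro exI conjI ballI allI impI)
    fix z \<rho> assume z: "z \<in> proj_reps" and r: "R \<le> \<rho>"
    have "\<bar>fibre_count z \<rho> - 2 * pi / 3 / zeta (real 3) * (nrm z)\<^sup>2 * \<rho> ^ 3\<bar> \<le> \<epsilon> * (nrm z)\<^sup>2 * \<rho> ^ 3"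
      unfolding fibre_count_def using R(2) sieve_hyp_fibre_vecs[OF z] r by blast
    thus "\<bar>fibre_count z \<rho> - fibre_density * ((nrm z)\<^sup>2 * \<rho> ^ 3)\<bar> \<le> \<epsilon> * ((nrm z)\<^sup>2 * \<rho> ^ 3)"
      by (simp only: fibre_density_def mult.assoc of_nat_numeral)
  qed (rule R(1))
qed

lemma fibre_count_lim:
  assumes z: "z \<in> proj_reps"
  shows "((\<lambda>\<rho>. fibre_count z \<rho> / ((nrm z)\<^sup>2 * \<rho> ^ 3)) \<longlongrightarrow> fibre_density) at_top"
proof (rule tendstoI)
  fix e :: real assume e: "e > 0"
  obtain R where R: "R > 0" "\<forall>z\<in>proj_reps. \<forall>\<rho>\<ge>R. \<bar>fibre_count z \<rho> - fibre_density * ((nrm z)\<^sup>2 * \<rho> ^ 3)\<bar> \<le> e / 2 * ((nrm z)\<^sup>2 * \<rho> ^ 3)"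
    using fibre_count_asymp[of "e / 2"] e by auto
  show "\<forall>\<^sub>F \<rho> in at_top. dist (fibre_count z \<rho> / ((nrm z)\<^sup>2 * \<rho> ^ 3)) fibre_density < e"
  proof (rule eventually_mono[OF eventually_ge_at_top[of R]])
    fix \<rho> assume r: "R \<le> \<rho>"
    define D where "D = (nrm z)\<^sup>2 * \<rho> ^ 3"
    have D: "D > 0" using r R(1) proj_reps_nonzero_vecs(2)[OF z] by (auto simp: D_def intro!: mult_pos_pos)
    have "\<bar>fibre_count z \<rho> - fibre_density * D\<bar> \<le> e / 2 * D" using R(2) z r by (simp add: D_def)
    also have "\<dots> < e * D" using e D by simp
    finally have "\<bar>fibre_count z \<rho> - fibre_density * D\<bar> / D < e" using D by (simp add: pos_divide_less_eq)
    moreover have "fibre_count z \<rho> / D - fibre_density = (fibre_count z \<rho> - fibre_density * D) / D" using D by (simp add: diff_divide_distrib)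
    ultimately have "dist (fibre_count z \<rho> / D) fibre_density < e" using D by (simp add: dist_real_def abs_divide)
    thus "dist (fibre_count z \<rho> / ((nrm z)\<^sup>2 * \<rho> ^ 3)) fibre_density < e" by (simp only: D_def)
  qed
qed

section \<open>The fibration case and the anticanonical case\<close>

lemma powr_power2: "(u powr \<beta>)\<^sup>2 = u powr (2 * \<beta>)" for u :: real
  by (simp add: power2_eq_square powr_add[symmetric])

lemma powr_power3: "(u powr \<beta>) ^ 3 = u powr (3 * \<beta>)" for u :: real
  by (simp add: power3_eq_cube powr_add[symmetric])

lemma rho_volume:
  fixes q T :: real
  assumes q: "q > 0" and T: "T > 0"
  shows "q\<^sup>2 * ((T / q) powr \<beta>) ^ 3 = T powr (3 * \<beta>) * q powr (2 - 3 * \<beta>)"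
proof -
  have "q\<^sup>2 = q powr 2" using q by simp
  moreover have "(T / q) powr (3 * \<beta>) = T powr (3 * \<beta>) * q powr (- (3 * \<beta>))"
  proof -
    have "(T / q) powr (3 * \<beta>) = T powr (3 * \<beta>) / q powr (3 * \<beta>)" using q T by (simp only: powr_divide less_imp_le)
    thus ?thesis by (simp add: powr_minus divide_inverse)
  qed
  moreover have "q powr 2 * q powr (- (3 * \<beta>)) = q powr (2 - 3 * \<beta>)" by (simp add: powr_add[symmetric])
  ultimately show ?thesis unfolding powr_power3 by (simp add: mult.left_commute)
qed

lemma ratio_powr_at_top:
  assumes "q > 0" "\<beta> > 0" shows "filterlim (\<lambda>T::real. (T / q) powr \<beta>) at_top at_top"
proof (rule filterlim_cong[THEN iffD1, OF refl refl])
  have "filterlim (\<lambda>T. ln (T / q)) at_top at_top"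
  proof (rule filterlim_compose[OF ln_at_top])
    have "filterlim (\<lambda>T::real. inverse q * T) at_top at_top"
      using assms by (intro filterlim_tendsto_pos_mult_at_top[OF tendsto_const _ filterlim_ident]) auto
    thus "filterlim (\<lambda>T::real. T / q) at_top at_top" by (simp add: divide_inverse mult.commute)
  qed
  thus "filterlim (\<lambda>T::real. exp (\<beta> * ln (T / q))) at_top at_top"
    using assms by (intro filterlim_compose[OF exp_at_top] filterlim_tendsto_pos_mult_at_top[OF tendsto_const]) auto
  show "\<forall>\<^sub>F T::real in at_top. exp (\<beta> * ln (T / q)) = (T / q) powr \<beta>"
    using eventually_gt_at_top[of 0] by eventually_elim (use assms in \<open>simp add: powr_def\<close>)
qed

lemma total_count_fibration:
  assumes b: "\<beta> > 4 / 3"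
  shows "((\<lambda>T. total_count \<beta> T / T powr (3 * \<beta>)) \<longlongrightarrow> fibre_density * (\<Sum>\<^sub>\<infinity>z\<in>proj_reps. nrm z powr (2 - 3 * \<beta>))) at_top"
proof -
  define f where "f T z = fibre_count z ((T / nrm z) powr \<beta>) / T powr (3 * \<beta>)" for T z
  have q: "nrm z > 0" if "z \<in> proj_reps" for z using proj_reps_nonzero_vecs(2)[OF that] by linarith
  have vol: "(nrm z)\<^sup>2 * ((T / nrm z) powr \<beta>) ^ 3 = T powr (3 * \<beta>) * nrm z powr (2 - 3 * \<beta>)" if "z \<in> proj_reps" "T > 0" for z T
    using rho_volume[OF q[OF that(1)] that(2)] .
  have "((\<lambda>T. infsum (f T) proj_reps) \<longlongrightarrow> (\<Sum>\<^sub>\<infinity>z\<in>proj_reps. fibre_density * nrm z powr (2 - 3 * \<beta>))) at_top"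
  proof (rule infsum_dominated)
    fix z assume z: "z \<in> proj_reps"
    have "((\<lambda>T. fibre_count z ((T / nrm z) powr \<beta>) / ((nrm z)\<^sup>2 * ((T / nrm z) powr \<beta>) ^ 3)) \<longlongrightarrow> fibre_density) at_top"
      by (rule filterlim_compose[OF fibre_count_lim[OF z] ratio_powr_at_top[OF q[OF z]]]) (use b in simp)
    hence "((\<lambda>T. fibre_count z ((T / nrm z) powr \<beta>) / ((nrm z)\<^sup>2 * ((T / nrm z) powr \<beta>) ^ 3) * nrm z powr (2 - 3 * \<beta>)) \<longlongrightarrow>
        fibre_density * nrm z powr (2 - 3 * \<beta>)) at_top"
      by (intro tendsto_intros)
    moreover have "\<forall>\<^sub>F T in at_top. fibre_count z ((T / nrm z) powr \<beta>) / ((nrm z)\<^sup>2 * ((T / nrm z) powr \<beta>) ^ 3) * nrm z powr (2 - 3 * \<beta>) = f T z"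
    proof (rule eventually_mono[OF eventually_gt_at_top[of 0]])
      fix T :: real assume T: "T > 0"
      have "nrm z powr (2 - 3 * \<beta>) > 0" using q[OF z] by simp
      thus "fibre_count z ((T / nrm z) powr \<beta>) / ((nrm z)\<^sup>2 * ((T / nrm z) powr \<beta>) ^ 3) * nrm z powr (2 - 3 * \<beta>) = f T z"
        unfolding f_def vol[OF z T] by simp
    qed
    ultimately show "((\<lambda>T. f T z) \<longlongrightarrow> fibre_density * nrm z powr (2 - 3 * \<beta>)) at_top" by (rule Lim_transform_eventually)
  next
    show "\<forall>\<^sub>F T in at_top. \<forall>z\<in>proj_reps. \<bar>f T z\<bar> \<le> fibre_bound * nrm z powr (2 - 3 * \<beta>)"
    proof (rule eventually_mono[OF eventually_gt_at_top[of 0]], rule ballI)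
      fix T :: real and z assume T: "T > 0" and z: "z \<in> proj_reps"
      have "(T / nrm z) powr \<beta> > 0" using T q[OF z] by simp
      from fibre_count_le[OF z this] have "fibre_count z ((T / nrm z) powr \<beta>) \<le> fibre_bound * nrm z powr (2 - 3 * \<beta>) * T powr (3 * \<beta>)"
        unfolding mult.assoc vol[OF z T] by (simp only: mult.commute mult.left_commute)
      hence "f T z \<le> fibre_bound * nrm z powr (2 - 3 * \<beta>)" unfolding f_def using T by (simp add: pos_divide_le_eq)
      moreover have "f T z \<ge> 0" using fibre_count_nonneg T by (simp add: f_def)
      ultimately show "\<bar>f T z\<bar> \<le> fibre_bound * nrm z powr (2 - 3 * \<beta>)" by simp
    qed
    have "(\<lambda>z. nrm z powr (- (3 * \<beta> - 2))) summable_on proj_reps" using b by (intro nrm_powr_summable) simp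
    thus "(\<lambda>z. fibre_bound * nrm z powr (2 - 3 * \<beta>)) summable_on proj_reps" by (intro summable_on_cmult_right) simp
  qed simp
  \<comment> \<open>For |z| \<ge> T the bound \<rho> is at most 1 while all norms in a fibre are at
    least 1, so these terms vanish and the finite sum may be extended to all
    \<open>z\<close>.\<close>
  moreover have inf: "infsum (f T) proj_reps = total_count \<beta> T / T powr (3 * \<beta>)" if T: "T > 0" for T
  proof -
    have "infsum (f T) proj_reps = infsum (f T) {z\<in>proj_reps. nrm z < T}"
    proof (rule infsum_cong_neutral)
      fix z assume "z \<in> proj_reps - {z\<in>proj_reps. nrm z < T}"
      hence z: "z \<in> proj_reps" "T \<le> nrm z" by auto
      hence "0 \<le> T / nrm z" "T / nrm z \<le> 1" using q[OF z(1)] T by (simp_all add: pos_divide_le_eq)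
      hence "(T / nrm z) powr \<beta> \<le> 1" using b by (intro powr_le1) auto
      thus "f T z = 0" unfolding f_def using fibre_count_zero[OF z(1)] by simp
    qed auto
    also have "\<dots> = (\<Sum>z\<in>{z\<in>proj_reps. nrm z < T}. f T z)" by (rule infsum_finite[OF finite_proj_reps])
    finally show ?thesis by (simp only: total_count_def f_def sum_divide_distrib)
  qed
  ultimately have "((\<lambda>T. infsum (f T) proj_reps) \<longlongrightarrow> fibre_density * (\<Sum>\<^sub>\<infinity>z\<in>proj_reps. nrm z powr (2 - 3 * \<beta>))) at_top"
    by (simp only: infsum_cmult_right')
  thus ?thesis by (rule Lim_transform_eventually) (rule eventually_mono[OF eventually_gt_at_top[of 0] inf])
qed

text \<open>The fibre asymptotics are replaced by their main term up to a relative error e wherever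
  \<rho> \<ge> R. The remaining \<open>z\<close> have norm between T / l and T: there are at most of
  the order of T^2 of them, each contributing at most of the order of T^(-2) after division by T^4.
  Their total is bounded and disappears against ln T.\<close>

lemma total_count_anticanonical:
  assumes b: "\<beta> = 4 / 3"
  shows "((\<lambda>T. total_count \<beta> T / (T ^ 4 * ln T)) \<longlongrightarrow> 2 * fibre_density * proj_density) at_top"
proof -
  have q: "nrm z \<ge> 1" if "z \<in> proj_reps" for z using proj_reps_nonzero_vecs(2)[OF that] .
  have main: "\<exists>K. \<forall>T>0. \<bar>total_count \<beta> T / T ^ 4 - fibre_density * norm_sum (-2) T\<bar> \<le> e * norm_sum (-2) T + K" if e: "e > 0" for e
  proof -
    obtain R where R: "R > 0" "\<forall>z\<in>proj_reps. \<forall>\<rho>\<ge>R. \<bar>fibre_count z \<rho> - fibre_density * ((nrm z)\<^sup>2 * \<rho> ^ 3)\<bar> \<le> e * ((nrm z)\<^sup>2 * \<rho> ^ 3)"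
      using fibre_count_asymp[OF e] by blast
    \<comment> \<open>The threshold \<rho> = R, expressed through T / |z|.\<close>
    define l where "l = R powr (1 / \<beta>)"
    have l: "l > 0" "l powr \<beta> = R" using R(1) b by (simp_all add: l_def powr_powr)
    define K where "K = (fibre_bound + fibre_density) * l\<^sup>2 * proj_bound"
    have "\<bar>total_count \<beta> T / T ^ 4 - fibre_density * norm_sum (-2) T\<bar> \<le> e * norm_sum (-2) T + K" if T: "T > 0" for T
    proof -
      define F where "F = {z\<in>proj_reps. nrm z < T}"
      define g where "g z = fibre_count z ((T / nrm z) powr \<beta>) / T ^ 4" for z
      have fibre_count_bound: "\<bar>g z - fibre_density * nrm z powr -2\<bar> \<le> e * nrm z powr -2 + (fibre_bound + fibre_density) * (l\<^sup>2 / T\<^sup>2)" if z: "z \<in> F" for z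
      proof -
        have zZ: "z \<in> proj_reps" using z by (simp add: F_def)
        have qz: "nrm z > 0" using q[OF zZ] by linarith
        define \<rho> where "\<rho> = (T / nrm z) powr \<beta>"
        define G where "G = fibre_count z \<rho>"
        define D where "D = nrm z powr -2"
        have r: "\<rho> > 0" using T qz by (simp add: \<rho>_def)
        have b4: "3 * \<beta> = 4" "2 - 3 * \<beta> = -2" using b by simp_all
        have T4: "T powr (3 * \<beta>) = T ^ 4" unfolding b4 using T by simp
        have vol: "(nrm z)\<^sup>2 * \<rho> ^ 3 = D * T ^ 4"
          using rho_volume[OF qz T, of \<beta>] unfolding T4 b4(2) by (simp only: \<rho>_def D_def mult.commute)
        have T40: "T ^ 4 > 0" using T by simp
        have D0: "D > 0" using qz by (simp add: D_def)
        have gG: "g z = G / T ^ 4" by (simp add: g_def G_def \<rho>_def)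
        have rest: "(fibre_bound + fibre_density) * (l\<^sup>2 / T\<^sup>2) \<ge> 0" using fibre_bound_pos fibre_density_pos by (intro mult_nonneg_nonneg) auto
        have "\<bar>g z - fibre_density * D\<bar> \<le> e * D + (fibre_bound + fibre_density) * (l\<^sup>2 / T\<^sup>2)"
        proof (cases "T / nrm z \<ge> l")
          case True
          hence "\<rho> \<ge> R" unfolding \<rho>_def l(2)[symmetric] using l(1) b by (intro powr_mono2) auto
          hence "\<bar>G - fibre_density * (D * T ^ 4)\<bar> \<le> e * (D * T ^ 4)" using R(2) zZ unfolding G_def vol[symmetric] by blast
          moreover have "G - fibre_density * (D * T ^ 4) = (g z - fibre_density * D) * T ^ 4" using T40 by (simp add: gG left_diff_distrib)
          ultimately have "\<bar>g z - fibre_density * D\<bar> * T ^ 4 \<le> (e * D) * T ^ 4" using T40 by (simp add: abs_mult)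
          hence "\<bar>g z - fibre_density * D\<bar> \<le> e * D" using T40 by (simp only: mult_le_cancel_right_pos)
          thus ?thesis using rest by linarith
        next
          \<comment> \<open>Here no asymptotics are available; the upper bounds for both quantities
            suffice, since |z|^(-2) is at most (l/T)^2.\<close>
          case False
          hence "T / nrm z < l" by simp
          hence "T < l * nrm z" using qz by (simp add: pos_divide_less_eq)
          hence "T\<^sup>2 \<le> (l * nrm z)\<^sup>2" using T by (intro power_mono) auto
          hence "T\<^sup>2 * D \<le> (l * nrm z)\<^sup>2 * D" using D0 by (intro mult_right_mono) auto
          also have "\<dots> = l\<^sup>2" using qz by (simp add: D_def powr_minus power_mult_distrib)
          finally have Dl: "D \<le> l\<^sup>2 / T\<^sup>2" using T by (simp add: pos_le_divide_eq mult.commute)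
          have "G \<le> fibre_bound * (D * T ^ 4)" using fibre_count_le[OF zZ r] unfolding G_def mult.assoc vol .
          hence "g z \<le> fibre_bound * D" unfolding gG using T40 by (simp add: pos_divide_le_eq mult.assoc)
          moreover have "g z \<ge> 0" unfolding gG G_def using fibre_count_nonneg T40 by simp
          moreover have "fibre_bound * D \<ge> 0" "fibre_density * D \<ge> 0" "e * D \<ge> 0" using fibre_bound_pos fibre_density_pos D0 e by simp_all
          ultimately have "\<bar>g z - fibre_density * D\<bar> \<le> fibre_bound * D + fibre_density * D" by linarith
          also have "\<dots> = (fibre_bound + fibre_density) * D" by (simp add: distrib_right)
          also have "\<dots> \<le> (fibre_bound + fibre_density) * (l\<^sup>2 / T\<^sup>2)" using Dl fibre_bound_pos fibre_density_pos by (intro mult_left_mono) auto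
          finally show ?thesis using \<open>e * D \<ge> 0\<close> by linarith
        qed
        thus ?thesis by (simp only: D_def)
      qed
      have E: "total_count \<beta> T / T ^ 4 - fibre_density * norm_sum (-2) T = (\<Sum>z\<in>F. g z - fibre_density * nrm z powr -2)"
        by (simp only: total_count_def norm_sum_def F_def g_def sum_subtractf sum_divide_distrib sum_distrib_left)
      have "\<bar>total_count \<beta> T / T ^ 4 - fibre_density * norm_sum (-2) T\<bar> \<le> (\<Sum>z\<in>F. \<bar>g z - fibre_density * nrm z powr -2\<bar>)" unfolding E by (rule sum_abs)
      also have "\<dots> \<le> (\<Sum>z\<in>F. e * nrm z powr -2 + (fibre_bound + fibre_density) * (l\<^sup>2 / T\<^sup>2))" by (rule sum_mono) (rule fibre_count_bound)
      also have "\<dots> = e * norm_sum (-2) T + proj_count T * ((fibre_bound + fibre_density) * (l\<^sup>2 / T\<^sup>2))"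
        by (simp add: sum.distrib sum_distrib_left norm_sum_def F_def proj_count_def)
      also have "\<dots> \<le> e * norm_sum (-2) T + K"
      proof (rule add_left_mono)
        have "proj_count T * ((fibre_bound + fibre_density) * (l\<^sup>2 / T\<^sup>2)) \<le> proj_bound * T\<^sup>2 * ((fibre_bound + fibre_density) * (l\<^sup>2 / T\<^sup>2))"
          using proj_count_le[OF T] fibre_bound_pos fibre_density_pos by (intro mult_right_mono mult_nonneg_nonneg) auto
        also have "\<dots> = K" using T by (simp add: K_def)
        finally show "proj_count T * ((fibre_bound + fibre_density) * (l\<^sup>2 / T\<^sup>2)) \<le> K" .
      qed
      finally show ?thesis .
    qed
    thus ?thesis by blast
  qed
  have d: "((\<lambda>T. total_count \<beta> T / (T ^ 4 * ln T) - fibre_density * (norm_sum (-2) T / ln T)) \<longlongrightarrow> 0) at_top"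
  proof (rule tendstoI)
    fix e :: real assume e: "e > 0"
    define c where "c = 2 * proj_density + 1"
    have c: "c > 0" using proj_density_pos by (simp add: c_def)
    define e' where "e' = e / (2 * c)"
    have e': "e' > 0" using e c by (simp add: e'_def)
    have e'': "e' * c = e / 2" using c by (simp add: e'_def)
    obtain K where K: "\<forall>T>0. \<bar>total_count \<beta> T / T ^ 4 - fibre_density * norm_sum (-2) T\<bar> \<le> e' * norm_sum (-2) T + K" using main[OF e'] by blast
    have ev1: "\<forall>\<^sub>F T in at_top. norm_sum (-2) T / ln T < c"
      by (rule order_tendstoD(2)[OF norm_sum_log_asymp]) (simp add: c_def)
    have "((\<lambda>T::real. K / ln T) \<longlongrightarrow> 0) at_top"
      by (rule tendsto_divide_0[OF tendsto_const filterlim_at_top_imp_at_infinity[OF ln_at_top]])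
    hence ev2: "\<forall>\<^sub>F T::real in at_top. K / ln T < e / 2" by (rule order_tendstoD(2)) (use e in simp)
    show "\<forall>\<^sub>F T in at_top. dist (total_count \<beta> T / (T ^ 4 * ln T) - fibre_density * (norm_sum (-2) T / ln T)) 0 < e"
      using ev1 ev2 eventually_gt_at_top[of 1]
    proof eventually_elim
      case (elim T)
      have L: "ln T > 0" using elim(3) by simp
      define A where "A = total_count \<beta> T / T ^ 4 - fibre_density * norm_sum (-2) T"
      have eq: "total_count \<beta> T / (T ^ 4 * ln T) - fibre_density * (norm_sum (-2) T / ln T) = A / ln T"
        by (simp add: A_def diff_divide_distrib)
      have "\<bar>A\<bar> / ln T \<le> (e' * norm_sum (-2) T + K) / ln T"
        using K elim(3) L unfolding A_def by (intro divide_right_mono) auto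
      also have "\<dots> = e' * (norm_sum (-2) T / ln T) + K / ln T" by (simp add: add_divide_distrib)
      also have "\<dots> \<le> e' * c + K / ln T" using elim(1) e' by (intro add_right_mono mult_left_mono) auto
      also have "\<dots> < e" using elim(2) unfolding e'' by linarith
      finally show ?case unfolding eq using L by (simp add: dist_real_def abs_divide)
    qed
  qed
  have "((\<lambda>T. (total_count \<beta> T / (T ^ 4 * ln T) - fibre_density * (norm_sum (-2) T / ln T)) + fibre_density * (norm_sum (-2) T / ln T)) \<longlongrightarrow> 0 + fibre_density * (2 * proj_density)) at_top"
    by (intro tendsto_add d tendsto_mult tendsto_const norm_sum_log_asymp)
  thus ?thesis by (simp add: mult_ac)
qed

section \<open>The rigid case: slices of fixed g\<close>

definition slice :: "real \<Rightarrow> nat \<Rightarrow> real \<Rightarrow> int \<times> int \<Rightarrow> real" where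
  "slice \<beta> g T z = real (card {v\<in>nonzero_vecs. nrm v < nrm z * sqrt (((T / nrm z) powr \<beta>)\<^sup>2 - (real g)\<^sup>2) \<and>
     vec_det z v \<noteq> 0 \<and> (\<forall>q\<in>{q. prime q \<and> q dvd g}. \<not> dvd_vec q v)})"

definition level_count :: "real \<Rightarrow> nat \<Rightarrow> real \<Rightarrow> real" where
  "level_count \<beta> g T = (\<Sum>z\<in>{z\<in>proj_reps. nrm z < T}. slice \<beta> g T z)"

lemma slice_zero:
  assumes z: "z \<in> proj_reps" and g: "(T / nrm z) powr \<beta> \<le> real g" shows "slice \<beta> g T z = 0"
proof -
  have "((T / nrm z) powr \<beta>)\<^sup>2 \<le> (real g)\<^sup>2" using g by (intro power_mono) auto
  \<comment> \<open>A square root of a nonpositive number is nonpositive, so the radius is not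
    positive and the disc is empty.\<close>
  hence "nrm z * sqrt (((T / nrm z) powr \<beta>)\<^sup>2 - (real g)\<^sup>2) \<le> 0" using nrm_nonneg by (intro mult_nonneg_nonpos) auto
  hence "\<not> nrm v < nrm z * sqrt (((T / nrm z) powr \<beta>)\<^sup>2 - (real g)\<^sup>2)" for v using nrm_nonneg[of v] by linarith
  hence "{v\<in>nonzero_vecs. nrm v < nrm z * sqrt (((T / nrm z) powr \<beta>)\<^sup>2 - (real g)\<^sup>2) \<and>
     vec_det z v \<noteq> 0 \<and> (\<forall>q\<in>{q. prime q \<and> q dvd g}. \<not> dvd_vec q v)} = {}" by blast
  thus ?thesis unfolding slice_def by (simp only: card.empty of_nat_0)
qed

text \<open>Once \<open>g\<close> is fixed only its own prime divisors can be common divisors of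
  \<open>v\<close> and \<open>g\<close>. A finite sieve is therefore enough for a slice, and it
  produces \<open>coprime_density g\<close>.\<close>

lemma fibre_count_eq_slices:
  assumes z: "z \<in> proj_reps" and T: "T > 0" and n: "(T / nrm z) powr \<beta> \<le> real n"
  shows "fibre_count z ((T / nrm z) powr \<beta>) = (\<Sum>g\<in>{1..n}. slice \<beta> g T z)"
proof -
  define \<rho> where "\<rho> = (T / nrm z) powr \<beta>"
  have r: "\<rho> > 0" using T proj_reps_nonzero_vecs(2)[OF z] by (simp add: \<rho>_def)
  have dv: "(\<forall>q. prime q \<longrightarrow> \<not> dvd_fibre q w) \<longleftrightarrow> (\<forall>q\<in>{q. prime q \<and> q dvd snd w}. \<not> dvd_vec q (fst w))" for w
    by (cases w) (auto simp: dvd_fibre_def)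
  have "fibre_count z \<rho> = real (card {w\<in>fibre_vecs z. fibre_norm z w < \<rho> \<and> (\<forall>q\<in>{q. prime q \<and> q dvd snd w}. \<not> dvd_vec q (fst w))})"
    unfolding fibre_count_def dv ..
  also have "\<dots> = (\<Sum>g\<in>{g. 1 \<le> g \<and> real g < \<rho>}. slice \<beta> g T z)"
    unfolding card_fibre_vecs_slices(2)[OF z r, of "\<lambda>v g. \<forall>q\<in>{q. prime q \<and> q dvd g}. \<not> dvd_vec q v"] of_nat_sum
    by (simp only: slice_def \<rho>_def)
  also have "\<dots> = (\<Sum>g\<in>{1..n}. slice \<beta> g T z)"
  proof (rule sum.mono_neutral_left)
    show "{g. 1 \<le> g \<and> real g < \<rho>} \<subseteq> {1..n}" using n by (auto simp: \<rho>_def)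
    show "\<forall>g\<in>{1..n} - {g. 1 \<le> g \<and> real g < \<rho>}. slice \<beta> g T z = 0"
    proof
      fix g assume "g \<in> {1..n} - {g. 1 \<le> g \<and> real g < \<rho>}"
      hence "\<rho> \<le> real g" by auto
      thus "slice \<beta> g T z = 0" unfolding \<rho>_def by (rule slice_zero[OF z])
    qed
  qed simp
  finally show ?thesis by (simp only: \<rho>_def)
qed

lemma total_count_eq_level_counts:
  assumes T: "T > 0" and b: "\<beta> > 0"
  shows "total_count \<beta> T = (\<Sum>\<^sub>\<infinity>g\<in>{1..}. level_count \<beta> g T)"
proof -
  \<comment> \<open>As |z| \<ge> 1, no \<open>g\<close> beyond T^\<beta> occurs for any
    \<open>z\<close>, so both sums are finite and can be exchanged.\<close>
  define n where "n = nat \<lceil>T powr \<beta>\<rceil>"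
  have n: "T powr \<beta> \<le> real n" by (simp add: n_def)
  have rn: "(T / nrm z) powr \<beta> \<le> real n" if z: "z \<in> proj_reps" for z
  proof -
    have q: "nrm z \<ge> 1" by (rule proj_reps_nonzero_vecs(2)[OF z])
    hence "T / nrm z \<le> T / 1" using T by (intro divide_left_mono) auto
    hence "(T / nrm z) powr \<beta> \<le> T powr \<beta>" using T q b by (intro powr_mono2) auto
    thus ?thesis using n by linarith
  qed
  have "total_count \<beta> T = (\<Sum>z\<in>{z\<in>proj_reps. nrm z < T}. \<Sum>g\<in>{1..n}. slice \<beta> g T z)"
    unfolding total_count_def by (intro sum.cong refl fibre_count_eq_slices T rn) auto
  also have "\<dots> = (\<Sum>g\<in>{1..n}. level_count \<beta> g T)" unfolding level_count_def by (rule sum.swap)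
  also have "\<dots> = (\<Sum>\<^sub>\<infinity>g\<in>{1..n}. level_count \<beta> g T)" by simp
  also have "\<dots> = (\<Sum>\<^sub>\<infinity>g\<in>{1..}. level_count \<beta> g T)"
  proof (rule infsum_cong_neutral)
    fix g assume "g \<in> {1..} - {1..n}"
    hence "\<not> g \<le> n" by simp
    hence g: "real n \<le> real g" by simp
    show "level_count \<beta> g T = 0" unfolding level_count_def
    proof (rule sum.neutral, rule ballI)
      fix z assume "z \<in> {z\<in>proj_reps. nrm z < T}"
      hence z: "z \<in> proj_reps" by simp
      show "slice \<beta> g T z = 0" using rn[OF z] g by (intro slice_zero[OF z]) linarith
    qed
  qed auto
  finally show ?thesis .
qed

lemma slice_approx:
  assumes z: "z \<in> proj_reps" and g: "g \<ge> 1" and lt: "real g < (T / nrm z) powr \<beta>"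
  shows "\<bar>slice \<beta> g T z - pi * coprime_density g * ((nrm z)\<^sup>2 * (((T / nrm z) powr \<beta>)\<^sup>2 - (real g)\<^sup>2))\<bar>
      \<le> (disc_error * 2 ^ card {q. prime q \<and> q dvd g} + 2) * (nrm z * (T / nrm z) powr \<beta>)"
    and "slice \<beta> g T z \<le> proj_bound * ((nrm z)\<^sup>2 * ((T / nrm z) powr \<beta>)\<^sup>2)"
proof -
  define \<rho> where "\<rho> = (T / nrm z) powr \<beta>"
  define s where "s = sqrt (\<rho>\<^sup>2 - (real g)\<^sup>2)"
  define P where "P = {q. prime q \<and> q dvd g}"
  have q: "nrm z > 0" using proj_reps_nonzero_vecs(2)[OF z] by linarith
  have P: "finite P"
  proof (rule finite_subset)
    show "P \<subseteq> {..g}"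
    proof
      fix q assume "q \<in> P"
      hence "q dvd g" by (simp add: P_def)
      hence "q \<le> g" by (rule dvd_imp_le) (use g in simp)
      thus "q \<in> {..g}" by simp
    qed
  qed simp
  have "(real g)\<^sup>2 < \<rho>\<^sup>2" using lt by (intro power_strict_mono) (auto simp: \<rho>_def)
  hence pos: "\<rho>\<^sup>2 - (real g)\<^sup>2 > 0" by simp
  have s: "s > 0" "s\<^sup>2 = \<rho>\<^sup>2 - (real g)\<^sup>2" using pos by (simp_all add: s_def)
  have s2: "s\<^sup>2 \<le> \<rho>\<^sup>2" unfolding s(2) by simp
  hence sr: "s \<le> \<rho>" by (rule power2_le_imp_le) (simp add: \<rho>_def)
  have qs: "nrm z * s > 0" using q s(1) by simp
  define c where "c = slice \<beta> g T z"
  have c: "c = real (card {v\<in>nonzero_vecs. nrm v < nrm z * s \<and> vec_det z v \<noteq> 0 \<and> (\<forall>q\<in>P. \<not> dvd_vec q v)})"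
    by (simp only: c_def slice_def s_def \<rho>_def P_def)
  have h: "(\<Prod>p\<in>P. 1 - 1 / (real p)\<^sup>2) = coprime_density g" by (simp add: coprime_density_def dvd_prod_def P_def)
  have K: "disc_error * 2 ^ card P + 2 \<ge> 0" using disc_error_pos by simp
  have "\<bar>c - pi * coprime_density g * (nrm z * s)\<^sup>2\<bar> \<le> (disc_error * 2 ^ card P + 2) * (nrm z * s)"
    using card_slice[OF z qs P] unfolding c h by (simp add: P_def)
  also have "\<dots> \<le> (disc_error * 2 ^ card P + 2) * (nrm z * \<rho>)" using sr q K by (intro mult_left_mono) auto
  finally show "\<bar>slice \<beta> g T z - pi * coprime_density g * ((nrm z)\<^sup>2 * (((T / nrm z) powr \<beta>)\<^sup>2 - (real g)\<^sup>2))\<bar>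
      \<le> (disc_error * 2 ^ card {q. prime q \<and> q dvd g} + 2) * (nrm z * (T / nrm z) powr \<beta>)"
    unfolding power_mult_distrib s(2) by (simp only: c_def P_def \<rho>_def)
  have "card {v\<in>nonzero_vecs. nrm v < nrm z * s \<and> vec_det z v \<noteq> 0 \<and> (\<forall>q\<in>P. \<not> dvd_vec q v)} \<le> card {v\<in>nonzero_vecs. nrm v < nrm z * s}"
    by (rule card_mono) (auto intro: finite_subset[OF _ finite_nrm[of "nrm z * s"]])
  hence "c \<le> real (card {v\<in>nonzero_vecs. nrm v < nrm z * s})" unfolding c by (simp only: of_nat_le_iff)
  also have "\<dots> \<le> (pi + disc_error) * 1 * (nrm z * s) ^ 2" by (rule sieve_upper[OF sieve_hyp_nonzero_vecs qs])
  also have "\<dots> = proj_bound * ((nrm z)\<^sup>2 * s\<^sup>2)" by (simp add: proj_bound_def power_mult_distrib)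
  also have "\<dots> \<le> proj_bound * ((nrm z)\<^sup>2 * \<rho>\<^sup>2)" using s2 proj_bound_pos by (intro mult_left_mono) auto
  finally show "slice \<beta> g T z \<le> proj_bound * ((nrm z)\<^sup>2 * ((T / nrm z) powr \<beta>)\<^sup>2)" by (simp only: c_def \<rho>_def)
qed

lemma rho_area:
  fixes q T :: real
  assumes q: "q > 0" and T: "T > 0"
  shows "q\<^sup>2 * ((T / q) powr \<beta>)\<^sup>2 = T powr (2 * \<beta>) * q powr (2 - 2 * \<beta>)" "q * (T / q) powr \<beta> = T powr \<beta> * q powr (1 - \<beta>)"
proof -
  have d: "(T / q) powr a = T powr a * q powr (- a)" for a
  proof -
    have "(T / q) powr a = T powr a / q powr a" using q T by (simp only: powr_divide less_imp_le)
    thus ?thesis by (simp add: powr_minus divide_inverse)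
  qed
  have q2: "q\<^sup>2 = q powr 2" "q = q powr 1" using q by simp_all
  have "q powr 2 * q powr (- (2 * \<beta>)) = q powr (2 - 2 * \<beta>)" by (simp add: powr_add[symmetric])
  hence e: "q\<^sup>2 * q powr (- (2 * \<beta>)) = q powr (2 - 2 * \<beta>)" by (simp only: q2(1))
  have "((T / q) powr \<beta>)\<^sup>2 = T powr (2 * \<beta>) * q powr (- (2 * \<beta>))" unfolding powr_power2 by (rule d)
  thus "q\<^sup>2 * ((T / q) powr \<beta>)\<^sup>2 = T powr (2 * \<beta>) * q powr (2 - 2 * \<beta>)"
    by (simp only: mult.left_commute[of "q\<^sup>2"] e)
  have "q powr 1 * q powr (- \<beta>) = q powr (1 - \<beta>)" by (simp only: powr_add[symmetric] diff_conv_add_uminus)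
  hence "q * q powr (- \<beta>) = q powr (1 - \<beta>)" using q by simp
  thus "q * (T / q) powr \<beta> = T powr \<beta> * q powr (1 - \<beta>)"
    by (simp only: d mult.left_commute[of q])
qed

text \<open>A slice is nonempty only if g < (T/|z|)^\<beta>, that is |z| < T g^(-1/\<beta>). The
  dependence on \<open>g\<close> of the limit and of the dominating bound comes from this
  cutoff.\<close>

lemma level_count_restrict:
  assumes b: "\<beta> > 0" and g: "g \<ge> 1" and T: "T > 0"
  shows "level_count \<beta> g T = (\<Sum>z\<in>{z\<in>proj_reps. nrm z < T * real g powr (- 1 / \<beta>)}. slice \<beta> g T z)"
    and "z \<in> proj_reps \<Longrightarrow> nrm z < T * real g powr (- 1 / \<beta>) \<Longrightarrow> real g < (T / nrm z) powr \<beta>"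
proof -
  define Y where "Y = T * real g powr (- 1 / \<beta>)"
  have Y: "Y > 0" "Y \<le> T"
  proof -
    show "Y > 0" using T g by (simp add: Y_def)
    have nb: "- 1 / \<beta> \<le> 0" using b by simp
    have g1: "1 \<le> real g" using g by simp
    have "real g powr (- 1 / \<beta>) \<le> real g powr 0" by (rule powr_mono[OF nb g1])
    hence "real g powr (- 1 / \<beta>) \<le> 1" using g by simp
    from mult_left_mono[OF this less_imp_le[OF T]] show "Y \<le> T" by (simp only: Y_def mult_1_right)
  qed
  have iff: "nrm z < Y \<longleftrightarrow> real g < (T / nrm z) powr \<beta>" if z: "z \<in> proj_reps" for z
  proof -
    have q: "nrm z > 0" using proj_reps_nonzero_vecs(2)[OF z] by linarith
    have gb: "(real g powr (1 / \<beta>)) powr \<beta> = real g" using g b by (simp add: powr_powr)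
    have gp: "real g powr (1 / \<beta>) > 0" using g by simp
    have "Y = T / real g powr (1 / \<beta>)" by (simp add: Y_def powr_minus divide_inverse)
    hence "nrm z < Y \<longleftrightarrow> real g powr (1 / \<beta>) < T / nrm z" using q gp by (simp add: pos_less_divide_eq mult.commute)
    also have "\<dots> \<longleftrightarrow> (real g powr (1 / \<beta>)) powr \<beta> < (T / nrm z) powr \<beta>"
    proof
      assume "real g powr (1 / \<beta>) < T / nrm z"
      thus "(real g powr (1 / \<beta>)) powr \<beta> < (T / nrm z) powr \<beta>" using b by (intro powr_less_mono2) auto
    next
      assume *: "(real g powr (1 / \<beta>)) powr \<beta> < (T / nrm z) powr \<beta>"
      show "real g powr (1 / \<beta>) < T / nrm z"
      proof (rule ccontr)
        assume "\<not> real g powr (1 / \<beta>) < T / nrm z"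
        hence "(T / nrm z) powr \<beta> \<le> (real g powr (1 / \<beta>)) powr \<beta>" using b T q by (intro powr_mono2) auto
        thus False using * by linarith
      qed
    qed
    finally show ?thesis unfolding gb .
  qed
  show "z \<in> proj_reps \<Longrightarrow> nrm z < T * real g powr (- 1 / \<beta>) \<Longrightarrow> real g < (T / nrm z) powr \<beta>"
    using iff[of z] by (simp only: Y_def)
  have "level_count \<beta> g T = (\<Sum>z\<in>{z\<in>proj_reps. nrm z < Y}. slice \<beta> g T z)"
    unfolding level_count_def
  proof (rule sum.mono_neutral_right[OF finite_proj_reps])
    show "{z\<in>proj_reps. nrm z < Y} \<subseteq> {z\<in>proj_reps. nrm z < T}" using Y by auto
    show "\<forall>z\<in>{z\<in>proj_reps. nrm z < T} - {z\<in>proj_reps. nrm z < Y}. slice \<beta> g T z = 0"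
    proof
      fix z assume "z \<in> {z\<in>proj_reps. nrm z < T} - {z\<in>proj_reps. nrm z < Y}"
      hence z: "z \<in> proj_reps" "\<not> nrm z < Y" by auto
      thus "slice \<beta> g T z = 0" using iff[OF z(1)] by (intro slice_zero) auto
    qed
  qed
  thus "level_count \<beta> g T = (\<Sum>z\<in>{z\<in>proj_reps. nrm z < T * real g powr (- 1 / \<beta>)}. slice \<beta> g T z)" by (simp only: Y_def)
qed

lemma norm_sum_scaled_lim:
  assumes g: "\<gamma> > -2" and y: "y > 0"
  shows "((\<lambda>T. T powr (2 - \<gamma>) * norm_sum \<gamma> (T * y) / T ^ 4) \<longlongrightarrow> 2 * proj_density / (\<gamma> + 2) * y powr (\<gamma> + 2)) at_top"
proof -
  have "filterlim (\<lambda>T::real. y * T) at_top at_top"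
    by (rule filterlim_tendsto_pos_mult_at_top[OF tendsto_const y filterlim_ident])
  hence f: "filterlim (\<lambda>T::real. T * y) at_top at_top" by (simp only: mult.commute)
  have "((\<lambda>T. norm_sum \<gamma> (T * y) / (T * y) powr (\<gamma> + 2) * y powr (\<gamma> + 2)) \<longlongrightarrow> 2 * proj_density / (\<gamma> + 2) * y powr (\<gamma> + 2)) at_top"
    by (intro tendsto_mult tendsto_const filterlim_compose[OF norm_sum_asymp[OF g] f])
  moreover have "\<forall>\<^sub>F T in at_top. norm_sum \<gamma> (T * y) / (T * y) powr (\<gamma> + 2) * y powr (\<gamma> + 2) = T powr (2 - \<gamma>) * norm_sum \<gamma> (T * y) / T ^ 4"
  proof (rule eventually_mono[OF eventually_gt_at_top[of 0]])
    fix T :: real assume T: "T > 0"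
    define P where "P = norm_sum \<gamma> (T * y)"
    have "T powr (2 - \<gamma>) * T powr (\<gamma> + 2) = T powr 4" by (simp add: powr_add[symmetric])
    hence t: "T powr (2 - \<gamma>) * T powr (\<gamma> + 2) = T ^ 4" using T by simp
    have p: "T powr (2 - \<gamma>) > 0" "T powr (\<gamma> + 2) > 0" "y powr (\<gamma> + 2) > 0" using T y by simp_all
    have "(T * y) powr (\<gamma> + 2) = T powr (\<gamma> + 2) * y powr (\<gamma> + 2)" using T y by (simp add: powr_mult)
    hence "P / (T * y) powr (\<gamma> + 2) * y powr (\<gamma> + 2) = P / T powr (\<gamma> + 2)" using p by simp
    also have "\<dots> = T powr (2 - \<gamma>) * P / (T powr (2 - \<gamma>) * T powr (\<gamma> + 2))" using p by simp
    finally show "norm_sum \<gamma> (T * y) / (T * y) powr (\<gamma> + 2) * y powr (\<gamma> + 2) = T powr (2 - \<gamma>) * norm_sum \<gamma> (T * y) / T ^ 4"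
      unfolding t by (simp only: P_def)
  qed
  ultimately show ?thesis by (rule Lim_transform_eventually)
qed

text \<open>The main term \<pi> |z|^2 (\<rho>^2 - g^2) splits into two power sums over |z| < T
  g^(-1/\<beta>), with exponents 2 - 2\<beta> and 2; both are of order T^4, and \<beta> < 2 puts the
  first exponent above -2. The lattice point errors form a power sum with exponent 1 - \<beta> and
  are of order T^3.\<close>

lemma level_count_lim:
  assumes b: "\<beta> > 0" "\<beta> < 2" and g: "g \<ge> 1"
  shows "((\<lambda>T. level_count \<beta> g T / T ^ 4) \<longlongrightarrow> pi * proj_density * \<beta> / (2 * (2 - \<beta>)) * (coprime_density g * real g powr (- (4 / \<beta> - 2)))) at_top"
proof -
  define y where "y = real g powr (- 1 / \<beta>)"
  have y: "y > 0" using g by (simp add: y_def)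
  define h where "h = pi * coprime_density g"
  define K where "K = disc_error * 2 ^ card {q. prime q \<and> q dvd g} + 2"
  define A1 where "A1 T = T powr (2 - (2 - 2 * \<beta>)) * norm_sum (2 - 2 * \<beta>) (T * y) / T ^ 4" for T
  define A2 where "A2 T = T powr (2 - 2) * norm_sum 2 (T * y) / T ^ 4" for T
  define A3 where "A3 T = T powr (2 - (1 - \<beta>)) * norm_sum (1 - \<beta>) (T * y) / T ^ 4" for T
  define c where "c = real g powr (- (4 / \<beta> - 2))"
  have l1: "(A1 \<longlongrightarrow> 2 * proj_density / (2 - 2 * \<beta> + 2) * y powr (2 - 2 * \<beta> + 2)) at_top"
    unfolding A1_def by (rule norm_sum_scaled_lim) (use b y in auto)
  have l2: "(A2 \<longlongrightarrow> 2 * proj_density / (2 + 2) * y powr (2 + 2)) at_top"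
    unfolding A2_def by (rule norm_sum_scaled_lim) (use y in auto)
  have l3: "(A3 \<longlongrightarrow> 2 * proj_density / (1 - \<beta> + 2) * y powr (1 - \<beta> + 2)) at_top"
    unfolding A3_def by (rule norm_sum_scaled_lim) (use b y in auto)
  have est: "\<bar>level_count \<beta> g T / T ^ 4 - h * (A1 T - (real g)\<^sup>2 * A2 T)\<bar> \<le> K * (A3 T / T)" if T: "T > 0" for T
  proof -
    define F where "F = {z\<in>proj_reps. nrm z < T * y}"
    define m where "m z = h * (T powr (2 * \<beta>) * nrm z powr (2 - 2 * \<beta>) - (real g)\<^sup>2 * nrm z powr 2)" for z
    have z: "\<bar>slice \<beta> g T z - m z\<bar> \<le> K * (T powr \<beta> * nrm z powr (1 - \<beta>))" if zF: "z \<in> F" for z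
    proof -
      have zZ: "z \<in> proj_reps" using zF by (simp add: F_def)
      have q: "nrm z > 0" using proj_reps_nonzero_vecs(2)[OF zZ] by linarith
      have lt: "real g < (T / nrm z) powr \<beta>"
        by (rule level_count_restrict(2)[OF b(1) g T zZ]) (use zF in \<open>simp add: F_def y_def\<close>)
      have q2: "(nrm z)\<^sup>2 = nrm z powr 2" using q by simp
      have "(nrm z)\<^sup>2 * (((T / nrm z) powr \<beta>)\<^sup>2 - (real g)\<^sup>2) = (nrm z)\<^sup>2 * ((T / nrm z) powr \<beta>)\<^sup>2 - (real g)\<^sup>2 * (nrm z)\<^sup>2"
        by (simp only: right_diff_distrib mult.commute)
      hence "pi * coprime_density g * ((nrm z)\<^sup>2 * (((T / nrm z) powr \<beta>)\<^sup>2 - (real g)\<^sup>2)) = m z"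
        unfolding rho_area(1)[OF q T] by (simp only: m_def h_def q2)
      thus ?thesis using slice_approx(1)[OF zZ g lt] unfolding rho_area(2)[OF q T] by (simp only: K_def)
    qed
    have ms: "level_count \<beta> g T = (\<Sum>z\<in>F. slice \<beta> g T z)"
      using level_count_restrict(1)[OF b(1) g T] by (simp only: F_def y_def)
    have sm: "(\<Sum>z\<in>F. m z) = h * (T powr (2 * \<beta>) * norm_sum (2 - 2 * \<beta>) (T * y) - (real g)\<^sup>2 * norm_sum 2 (T * y))"
      unfolding m_def norm_sum_def F_def[symmetric] by (simp only: sum_distrib_left[symmetric] sum_subtractf)
    have T0: "T powr (2 - 2) = 1" "2 - (2 - 2 * \<beta>) = 2 * \<beta>" "2 - (1 - \<beta>) = \<beta> + 1" "T powr (\<beta> + 1) = T powr \<beta> * T"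
      using T by (simp_all add: powr_add)
    have "level_count \<beta> g T - (\<Sum>z\<in>F. m z) = (\<Sum>z\<in>F. slice \<beta> g T z - m z)" unfolding ms by (simp only: sum_subtractf)
    hence "\<bar>level_count \<beta> g T - (\<Sum>z\<in>F. m z)\<bar> \<le> (\<Sum>z\<in>F. \<bar>slice \<beta> g T z - m z\<bar>)" by (simp only: sum_abs)
    also have "\<dots> \<le> (\<Sum>z\<in>F. K * (T powr \<beta> * nrm z powr (1 - \<beta>)))" by (rule sum_mono) (rule z)
    also have "\<dots> = K * (T powr \<beta> * norm_sum (1 - \<beta>) (T * y))" by (simp only: sum_distrib_left norm_sum_def F_def)
    finally have e1: "\<bar>level_count \<beta> g T - (\<Sum>z\<in>F. m z)\<bar> \<le> K * (T powr \<beta> * norm_sum (1 - \<beta>) (T * y))" .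
    have T4: "T ^ 4 > 0" using T by simp
    have "level_count \<beta> g T / T ^ 4 - h * (A1 T - (real g)\<^sup>2 * A2 T) = (level_count \<beta> g T - (\<Sum>z\<in>F. m z)) / T ^ 4"
      unfolding sm A1_def A2_def T0 by (simp add: diff_divide_distrib right_diff_distrib)
    hence "\<bar>level_count \<beta> g T / T ^ 4 - h * (A1 T - (real g)\<^sup>2 * A2 T)\<bar> = \<bar>level_count \<beta> g T - (\<Sum>z\<in>F. m z)\<bar> / T ^ 4"
      using T4 by (simp only: abs_divide abs_of_pos)
    also have "\<dots> \<le> K * (T powr \<beta> * norm_sum (1 - \<beta>) (T * y)) / T ^ 4" using e1 T4 by (intro divide_right_mono) auto
    also have "\<dots> = K * (A3 T / T)" unfolding A3_def T0 using T by simp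
    finally show ?thesis .
  qed
  \<comment> \<open>Both power sums carry the same power of \<open>g\<close>, so it can be taken out
    of their difference.\<close>
  have c1: "y powr (2 - 2 * \<beta> + 2) = c" "(real g)\<^sup>2 * y powr (2 + 2) = c"
  proof -
    have "- 1 / \<beta> * (2 - 2 * \<beta> + 2) = - (4 / \<beta> - 2)" using b(1) by (simp add: field_simps)
    thus "y powr (2 - 2 * \<beta> + 2) = c" unfolding y_def c_def powr_powr by (simp only:)
    have e: "2 + - 1 / \<beta> * (2 + 2) = - (4 / \<beta> - 2)" by simp
    have "(real g)\<^sup>2 = real g powr 2" using g by simp
    thus "(real g)\<^sup>2 * y powr (2 + 2) = c" unfolding y_def c_def powr_powr by (simp only: powr_add[symmetric] e)
  qed
  have "((\<lambda>T. K * (A3 T / T)) \<longlongrightarrow> 0) at_top"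
    by (intro tendsto_mult_right_zero tendsto_divide_0[OF l3 filterlim_at_top_imp_at_infinity[OF filterlim_ident]])
  hence "((\<lambda>T. level_count \<beta> g T / T ^ 4 - h * (A1 T - (real g)\<^sup>2 * A2 T)) \<longlongrightarrow> 0) at_top"
    by (rule Lim_null_comparison[rotated]) (rule eventually_mono[OF eventually_gt_at_top[of 0]], use est in simp)
  moreover have "((\<lambda>T. h * (A1 T - (real g)\<^sup>2 * A2 T)) \<longlongrightarrow>
      h * (2 * proj_density / (2 - 2 * \<beta> + 2) * y powr (2 - 2 * \<beta> + 2) - (real g)\<^sup>2 * (2 * proj_density / (2 + 2) * y powr (2 + 2)))) at_top"
    by (intro tendsto_mult tendsto_diff tendsto_const l1 l2)
  ultimately have "((\<lambda>T. (level_count \<beta> g T / T ^ 4 - h * (A1 T - (real g)\<^sup>2 * A2 T)) + h * (A1 T - (real g)\<^sup>2 * A2 T)) \<longlongrightarrow>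
      0 + h * (2 * proj_density / (2 - 2 * \<beta> + 2) * y powr (2 - 2 * \<beta> + 2) - (real g)\<^sup>2 * (2 * proj_density / (2 + 2) * y powr (2 + 2)))) at_top"
    by (rule tendsto_add)
  moreover have "0 + h * (2 * proj_density / (2 - 2 * \<beta> + 2) * y powr (2 - 2 * \<beta> + 2) - (real g)\<^sup>2 * (2 * proj_density / (2 + 2) * y powr (2 + 2))) =
      pi * proj_density * \<beta> / (2 * (2 - \<beta>)) * (coprime_density g * c)"
  proof -
    define d where "d = 2 - \<beta>"
    have d: "d > 0" "2 - 2 * \<beta> + 2 = 2 * d" "\<beta> = 2 - d" using b(2) by (simp_all add: d_def)
    have "(real g)\<^sup>2 * (2 * proj_density / (2 + 2) * y powr (2 + 2)) = 2 * proj_density / (2 + 2) * ((real g)\<^sup>2 * y powr (2 + 2))"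
      by (rule mult.left_commute)
    hence e2: "(real g)\<^sup>2 * (2 * proj_density / (2 + 2) * y powr (2 + 2)) = proj_density / 2 * c" unfolding c1(2) by simp
    \<comment> \<open>With d = 2 - \<beta> the two limits combine as 1/d - 1/2 = \<beta> / (2 (2 -
      \<beta>)).\<close>
    have e3: "2 * proj_density / (2 * d) * c - proj_density / 2 * c = proj_density * (2 - d) / (2 * d) * c" using d(1) by (simp add: field_simps)
    show ?thesis unfolding c1(1) unfolding e2 unfolding d(2) unfolding e3 unfolding h_def d_def by simp
  qed
  ultimately show ?thesis by (simp add: c_def)
qed

text \<open>Dropping the term -g^2 and bounding the power sum for every cutoff yields a bound
  uniform in T and g. Its exponent 4/\<beta> - 2 exceeds 1 exactly for \<beta> < 4/3, and only then
  can it dominate the sum over \<open>g\<close>.\<close>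

lemma level_count_bound:
  assumes b: "\<beta> > 0" "\<beta> < 2"
  shows "\<exists>C. \<forall>T>0. \<forall>g\<ge>1. \<bar>level_count \<beta> g T / T ^ 4\<bar> \<le> C * real g powr (- (4 / \<beta> - 2))"
proof -
  obtain C where C: "C > 0" "\<forall>X>0. norm_sum (2 - 2 * \<beta>) X \<le> C * X powr (2 - 2 * \<beta> + 2)"
    using norm_sum_bound[of "2 - 2 * \<beta>"] b by auto
  have "\<bar>level_count \<beta> g T / T ^ 4\<bar> \<le> proj_bound * C * real g powr (- (4 / \<beta> - 2))" if T: "T > 0" and g: "g \<ge> 1" for T g
  proof -
    define y where "y = real g powr (- 1 / \<beta>)"
    have y: "y > 0" using g by (simp add: y_def)
    define F where "F = {z\<in>proj_reps. nrm z < T * y}"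
    have "slice \<beta> g T z \<le> proj_bound * (T powr (2 * \<beta>) * nrm z powr (2 - 2 * \<beta>))" if zF: "z \<in> F" for z
    proof -
      have zZ: "z \<in> proj_reps" using zF by (simp add: F_def)
      have q: "nrm z > 0" using proj_reps_nonzero_vecs(2)[OF zZ] by linarith
      have lt: "real g < (T / nrm z) powr \<beta>"
        by (rule level_count_restrict(2)[OF b(1) g T zZ]) (use zF in \<open>simp add: F_def y_def\<close>)
      show ?thesis using slice_approx(2)[OF zZ g lt] unfolding rho_area(1)[OF q T] .
    qed
    hence "(\<Sum>z\<in>F. slice \<beta> g T z) \<le> (\<Sum>z\<in>F. proj_bound * (T powr (2 * \<beta>) * nrm z powr (2 - 2 * \<beta>)))" by (rule sum_mono)
    also have "\<dots> = proj_bound * T powr (2 * \<beta>) * norm_sum (2 - 2 * \<beta>) (T * y)"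
      unfolding norm_sum_def F_def[symmetric] by (simp only: sum_distrib_left mult.assoc)
    also have "\<dots> \<le> proj_bound * T powr (2 * \<beta>) * (C * (T * y) powr (2 - 2 * \<beta> + 2))"
      using C(2) T y proj_bound_pos by (intro mult_left_mono) auto
    also have "\<dots> = proj_bound * C * real g powr (- (4 / \<beta> - 2)) * T ^ 4"
    proof -
      have "T powr (2 * \<beta>) * T powr (2 - 2 * \<beta> + 2) = T powr 4" by (simp add: powr_add[symmetric])
      hence t: "T powr (2 * \<beta>) * T powr (2 - 2 * \<beta> + 2) = T ^ 4" using T by simp
      have "- 1 / \<beta> * (2 - 2 * \<beta> + 2) = - (4 / \<beta> - 2)" using b(1) by (simp add: field_simps)
      hence yc: "y powr (2 - 2 * \<beta> + 2) = real g powr (- (4 / \<beta> - 2))" unfolding y_def powr_powr by (simp only:)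
      have m: "(T * y) powr (2 - 2 * \<beta> + 2) = T powr (2 - 2 * \<beta> + 2) * real g powr (- (4 / \<beta> - 2))"
        unfolding yc[symmetric] using T y by (simp only: powr_mult less_imp_le)
      show ?thesis unfolding m t[symmetric] by (simp only: mult_ac)
    qed
    finally have "level_count \<beta> g T \<le> proj_bound * C * real g powr (- (4 / \<beta> - 2)) * T ^ 4"
      using level_count_restrict(1)[OF b(1) g T] by (simp only: F_def y_def)
    moreover have "level_count \<beta> g T \<ge> 0" unfolding level_count_def slice_def by (intro sum_nonneg) simp
    ultimately show ?thesis using T by (simp add: pos_divide_le_eq)
  qed
  thus ?thesis by blast
qed

lemma total_count_rigid:
  assumes b: "\<beta> > 0" "\<beta> < 4 / 3"
  shows "((\<lambda>T. total_count \<beta> T / T ^ 4) \<longlongrightarrow> pi * proj_density * \<beta> / (2 * (2 - \<beta>)) * (zeta (4 / \<beta> - 2) / zeta (4 / \<beta>))) at_top"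
proof -
  have s: "4 / \<beta> - 2 > 1" using b by (simp add: pos_less_divide_eq)
  obtain C where C: "\<forall>T>0. \<forall>g\<ge>1. \<bar>level_count \<beta> g T / T ^ 4\<bar> \<le> C * real g powr (- (4 / \<beta> - 2))"
    using level_count_bound[of \<beta>] b by auto
  have "((\<lambda>T. \<Sum>\<^sub>\<infinity>g\<in>{1..}. level_count \<beta> g T / T ^ 4) \<longlongrightarrow>
      (\<Sum>\<^sub>\<infinity>g\<in>{1..}. pi * proj_density * \<beta> / (2 * (2 - \<beta>)) * (coprime_density g * real g powr (- (4 / \<beta> - 2))))) at_top"
  proof (rule infsum_dominated)
    show "((\<lambda>T. level_count \<beta> g T / T ^ 4) \<longlongrightarrow> pi * proj_density * \<beta> / (2 * (2 - \<beta>)) * (coprime_density g * real g powr (- (4 / \<beta> - 2)))) at_top"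
      if "g \<in> {1..}" for g using that b by (intro level_count_lim) auto
    show "\<forall>\<^sub>F T in at_top. \<forall>g\<in>{1..}. \<bar>level_count \<beta> g T / T ^ 4\<bar> \<le> C * real g powr (- (4 / \<beta> - 2))"
      by (rule eventually_mono[OF eventually_gt_at_top[of 0]]) (use C in simp)
    show "(\<lambda>g. C * real g powr (- (4 / \<beta> - 2))) summable_on {1..}"
      by (intro summable_on_cmult_right zeta_summable s)
  qed simp
  hence "((\<lambda>T. \<Sum>\<^sub>\<infinity>g\<in>{1..}. level_count \<beta> g T / T ^ 4) \<longlongrightarrow>
      pi * proj_density * \<beta> / (2 * (2 - \<beta>)) * (zeta (4 / \<beta> - 2) / zeta (4 / \<beta>))) at_top"
    unfolding infsum_cmult_right' infsum_coprime_density[OF s] by simp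
  moreover have "\<forall>\<^sub>F T in at_top. (\<Sum>\<^sub>\<infinity>g\<in>{1..}. level_count \<beta> g T / T ^ 4) = total_count \<beta> T / T ^ 4"
  proof (rule eventually_mono[OF eventually_gt_at_top[of 0]])
    fix T :: real assume T: "T > 0"
    show "(\<Sum>\<^sub>\<infinity>g\<in>{1..}. level_count \<beta> g T / T ^ 4) = total_count \<beta> T / T ^ 4"
      unfolding total_count_eq_level_counts[OF T b(1)] divide_inverse by (rule infsum_cmult_left')
  qed
  ultimately show ?thesis by (rule Lim_transform_eventually)
qed

section \<open>Rational points and primitive integer data\<close>

definition mat_rel :: "(rat mat2 \<times> rat mat2) set" where
  "mat_rel = {((a, b, c, d), (a', b', c', d')).
     \<exists>k. k \<noteq> 0 \<and> a' = k * a \<and> b' = k * b \<and> c' = k * c \<and> d' = k * d}"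

lemma mat_relE:
  assumes "(m, m') \<in> mat_rel"
  obtains a b c d k where "k \<noteq> 0" "m = (a, b, c, d)" "m' = (k * a, k * b, k * c, k * d)"
proof -
  obtain a b c d where m: "m = (a, b, c, d)" by (cases m)
  obtain a' b' c' d' where m': "m' = (a', b', c', d')" by (cases m')
  obtain k where "k \<noteq> 0 \<and> a' = k * a \<and> b' = k * b \<and> c' = k * c \<and> d' = k * d"
    using assms unfolding m m' mat_rel_def mem_Collect_eq prod.case by (elim exE)
  thus thesis using m m' by (intro that[of k a b c d]) simp_all
qed

lemma equiv_mat_rel: "equiv UNIV mat_rel"
proof (rule equivI)
  show "refl mat_rel" by (rule refl_onI) (auto simp: mat_rel_def intro: exI[of _ 1])
  show "sym mat_rel"
  proof (rule symI)
    fix m m' assume "(m, m') \<in> mat_rel"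
    then obtain a b c d k where m: "k \<noteq> 0" "m = (a, b, c, d)" "m' = (k * a, k * b, k * c, k * d)" by (rule mat_relE)
    show "(m', m) \<in> mat_rel" unfolding mat_rel_def m using m(1) by (auto intro!: exI[of _ "inverse k"])
  qed
  show "trans mat_rel"
  proof (rule transI)
    fix m m' m'' assume 1: "(m, m') \<in> mat_rel" and 2: "(m', m'') \<in> mat_rel"
    from 1 obtain a b c d k where m: "k \<noteq> 0" "m = (a, b, c, d)" "m' = (k * a, k * b, k * c, k * d)" by (rule mat_relE)
    from 2 obtain a' b' c' d' l where m': "l \<noteq> 0" "m' = (a', b', c', d')" "m'' = (l * a', l * b', l * c', l * d')" by (rule mat_relE)
    have e: "a' = k * a" "b' = k * b" "c' = k * c" "d' = k * d" using m(3) m'(2) by simp_all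
    show "(m, m'') \<in> mat_rel" unfolding mat_rel_def m(2) m'(3) e using m(1) m'(1) by (auto intro!: exI[of _ "l * k"])
  qed
qed simp

definition point_reps :: "((int \<times> int) \<times> (int \<times> int) \<times> nat) set" where
  "point_reps = (SIGMA z:proj_reps. {w\<in>fibre_vecs z. \<forall>q. prime q \<longrightarrow> \<not> dvd_fibre q w})"

definition rep_matrix :: "(int \<times> int) \<times> (int \<times> int) \<times> nat \<Rightarrow> rat mat2" where
  "rep_matrix = (\<lambda>(z, v, g). map_mat2 of_int (fst v, snd v, int g * fst z, int g * snd z))"

lemma primitive_iff_gcd:
  "(\<forall>q. prime q \<longrightarrow> \<not> dvd_fibre q (v, g)) \<longleftrightarrow> gcd (fst v) (gcd (snd v) (int g)) = 1"
proof
  assume np: "\<forall>q. prime q \<longrightarrow> \<not> dvd_fibre q (v, g)"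
  define G where "G = gcd (fst v) (gcd (snd v) (int g))"
  show "gcd (fst v) (gcd (snd v) (int g)) = 1"
  proof (rule ccontr)
    assume "gcd (fst v) (gcd (snd v) (int g)) \<noteq> 1"
    hence "nat G \<noteq> 1" by (simp add: G_def nat_eq_iff)
    then obtain p where p: "prime p" "p dvd nat G" using prime_factor_nat by blast
    have "G \<ge> 0" by (simp add: G_def)
    hence pG: "int p dvd G" using p(2) by (simp add: int_dvd_int_iff[symmetric])
    have "G dvd fst v" "G dvd snd v" "G dvd int g" unfolding G_def by (auto intro: dvd_trans[OF gcd_dvd2])
    hence "int p dvd fst v" "int p dvd snd v" "int p dvd int g" using pG dvd_trans by blast+
    hence "dvd_fibre p (v, g)" by (simp add: dvd_fibre_def dvd_vec_def int_dvd_int_iff)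
    thus False using np p(1) by blast
  qed
next
  assume 1: "gcd (fst v) (gcd (snd v) (int g)) = 1"
  show "\<forall>q. prime q \<longrightarrow> \<not> dvd_fibre q (v, g)"
  proof (intro allI impI notI)
    fix q assume q: "prime q" and "dvd_fibre q (v, g)"
    hence "int q dvd fst v" "int q dvd snd v" "int q dvd int g" by (simp_all add: dvd_fibre_def dvd_vec_def int_dvd_int_iff)
    hence "int q dvd gcd (fst v) (gcd (snd v) (int g))" by (intro gcd_greatest)
    hence "int q dvd 1" unfolding 1 .
    thus False using prime_gt_1_nat[OF q] by simp
  qed
qed

lemma rat_scale_int:
  assumes "(of_int a' :: rat) = of_int m / of_int n * of_int a" "n > 0"
  shows "n * a' = m * a"
proof -
  have "(of_int n :: rat) \<noteq> 0" using assms(2) by simp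
  hence "of_int n * (of_int a' :: rat) = of_int m * of_int a" unfolding assms(1) by simp
  thus ?thesis by (simp only: of_int_mult[symmetric] of_int_eq_iff)
qed

lemma rat_quotient:
  fixes k :: rat
  obtains m n :: int where "k = of_int m / of_int n" "n > 0"
proof -
  obtain m n where mn: "quotient_of k = (m, n)" by (cases "quotient_of k")
  show thesis by (rule that[OF quotient_of_div[OF mn] quotient_of_denom_pos[OF mn]])
qed

text \<open>Comparing greatest common divisors gives n = |m|, and the sign convention of
  \<open>proj_reps\<close> excludes a negative m.\<close>

lemma proj_reps_parallel:
  assumes z: "z \<in> proj_reps" "z' \<in> proj_reps" and n: "n > 0" and m: "m \<noteq> 0"
    and e: "n * fst z' = m * fst z" "n * snd z' = m * snd z"
  shows "z' = z \<and> n = m"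
proof -
  have g: "gcd (fst z) (snd z) = 1" "gcd (fst z') (snd z') = 1" using z by (simp_all add: proj_reps_def)
  have "\<bar>n\<bar> * gcd (fst z') (snd z') = gcd (n * fst z') (n * snd z')" by (rule gcd_mult_distrib_int)
  also have "\<dots> = \<bar>m\<bar> * gcd (fst z) (snd z)" unfolding e by (rule gcd_mult_distrib_int[symmetric])
  finally have nm: "n = \<bar>m\<bar>" using g n by simp
  show ?thesis
  proof (cases "m > 0")
    case True
    thus ?thesis using e nm m by (simp add: prod_eq_iff)
  next
    case False
    hence "n * fst z' = n * (- fst z)" "n * snd z' = n * (- snd z)" using e nm by simp_all
    hence "fst z' = - fst z" "snd z' = - snd z" using n by (simp_all only: mult_cancel_left) auto
    thus ?thesis using z by (auto simp: proj_reps_def)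
  qed
qed

text \<open>The second rows determine \<open>z\<close> and give n g' = m g, so m is positive along
  with g and g'. Comparing the contents of the two matrices, both equal to 1, then yields n =
  m.\<close>

lemma rep_matrix_inj:
  assumes i: "(z, v, g) \<in> point_reps" and i': "(z', v', g') \<in> point_reps" and r: "(rep_matrix (z, v, g), rep_matrix (z', v', g')) \<in> mat_rel"
  shows "(z, v, g) = (z', v', g')"
proof -
  obtain k :: rat where k: "k \<noteq> 0" "of_int (fst v') = k * of_int (fst v)" "of_int (snd v') = k * of_int (snd v)"
    "of_int (int g' * fst z') = k * of_int (int g * fst z)" "of_int (int g' * snd z') = k * of_int (int g * snd z)"
    using r by (auto simp: mat_rel_def rep_matrix_def)
  obtain m n where mn: "k = of_int m / of_int n" "n > 0" by (rule rat_quotient)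
  have m: "m \<noteq> 0" using k(1) mn by auto
  note e = k(2-5)[unfolded mn(1), THEN rat_scale_int, OF mn(2)]
  have z: "z \<in> proj_reps" "z' \<in> proj_reps" using i i' by (simp_all add: point_reps_def)
  have g: "int g > 0" "int g' > 0" using i i' by (auto simp: point_reps_def fibre_vecs_def)
  have "z' = z \<and> n * int g' = m * int g"
  proof (rule proj_reps_parallel[OF z])
    show "n * int g' > 0" using mn(2) g by simp
    show "m * int g \<noteq> 0" using m g by simp
    show "n * int g' * fst z' = m * int g * fst z" "n * int g' * snd z' = m * int g * snd z"
      using e(3,4) by (simp_all only: mult.assoc)
  qed
  hence zz: "z' = z" and gg: "n * int g' = m * int g" by auto
  have "m * int g > 0" using gg mn(2) g by (metis mult_pos_pos)
  hence m0: "m > 0" using g(1) zero_less_mult_pos2 by blast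
  have c: "gcd (fst v) (gcd (snd v) (int g)) = 1" "gcd (fst v') (gcd (snd v') (int g')) = 1"
    using i i' unfolding primitive_iff_gcd[symmetric] by (simp_all add: point_reps_def)
  have G: "gcd (l * a) (gcd (l * b) (l * d)) = l * gcd a (gcd b d)" if "l > 0" for l a b d :: int
    using that by (simp add: gcd_mult_distrib_int[symmetric])
  have "n * 1 = gcd (n * fst v') (gcd (n * snd v') (n * int g'))" unfolding c(2)[symmetric] by (rule G[OF mn(2), symmetric])
  also have "\<dots> = m * 1" unfolding e(1,2) gg c(1)[symmetric] by (rule G[OF m0])
  finally have "n = m" by simp
  hence "fst v' = fst v" "snd v' = snd v" "g' = g" using e(1,2) gg m0 by auto
  thus ?thesis using zz by (simp add: prod_eq_iff)
qed

lemma common_denominator: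
  fixes a b c d :: rat
  shows "\<exists>N A B C D. N > 0 \<and> of_int N * a = of_int A \<and> of_int N * b = of_int B \<and> of_int N * c = of_int C \<and> of_int N * d = of_int D"
proof -
  obtain a1 a2 where a: "a = of_int a1 / of_int a2" "a2 > 0" by (rule rat_quotient)
  obtain b1 b2 where b: "b = of_int b1 / of_int b2" "b2 > 0" by (rule rat_quotient)
  obtain c1 c2 where c: "c = of_int c1 / of_int c2" "c2 > 0" by (rule rat_quotient)
  obtain d1 d2 where d: "d = of_int d1 / of_int d2" "d2 > 0" by (rule rat_quotient)
  define N where "N = a2 * b2 * c2 * d2"
  have "N > 0" using a b c d by (simp add: N_def)
  moreover have "of_int N * a = of_int (a1 * b2 * c2 * d2)" using a by (simp add: N_def)
  moreover have "of_int N * b = of_int (a2 * b1 * c2 * d2)" using b by (simp add: N_def)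
  moreover have "of_int N * c = of_int (a2 * b2 * c1 * d2)" using c by (simp add: N_def)
  moreover have "of_int N * d = of_int (a2 * b2 * c2 * d1)" using d by (simp add: N_def)
  ultimately show ?thesis by blast
qed

lemma proj_reps_sign:
  fixes c d :: int
  assumes "coprime c d"
  obtains \<epsilon> :: int where "\<epsilon> = 1 \<or> \<epsilon> = -1" "(\<epsilon> * c, \<epsilon> * d) \<in> proj_reps"
proof -
  have "\<not> (c = 0 \<and> d = 0)" using assms by auto
  then consider "c > 0 \<or> c = 0 \<and> d > 0" | "c < 0 \<or> c = 0 \<and> d < 0" by linarith
  thus thesis
  proof cases
    case 1 thus ?thesis using assms by (intro that[of 1]) (auto simp: proj_reps_def)
  next
    case 2 thus ?thesis using assms by (intro that[of "-1"]) (auto simp: proj_reps_def)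
  qed
qed

text \<open>Denominators are cleared by N. The second row is its greatest common divisor \<gamma>
  times a primitive vector, whose sign \<epsilon> is adjusted, and the common divisor G of the first
  row and \<gamma> is divided out. The scalar is therefore \<epsilon> N / G.\<close>

lemma rep_matrix_surj:
  fixes a b c d :: rat
  assumes det: "a * d - b * c \<noteq> 0"
  shows "\<exists>i\<in>point_reps. ((a, b, c, d), rep_matrix i) \<in> mat_rel"
proof -
  obtain N A B C D where N: "N > 0" "of_int N * a = of_int A" "of_int N * b = of_int B" "of_int N * c = of_int C" "of_int N * d = of_int D"
    using common_denominator[of a b c d] by blast
  have "(of_int (A * D - B * C) :: rat) = (of_int N * a) * (of_int N * d) - (of_int N * b) * (of_int N * c)"
    unfolding N(2-5) by simp
  also have "\<dots> = of_int N * of_int N * (a * d - b * c)" by (simp add: algebra_simps)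
  finally have "(of_int (A * D - B * C) :: rat) \<noteq> 0" using det N(1) by simp
  hence det': "A * D - B * C \<noteq> 0" by (metis of_int_0)
  define \<gamma> where "\<gamma> = gcd C D"
  have g0: "\<gamma> \<noteq> 0" using det' by (auto simp: \<gamma>_def)
  obtain c' d' where cd: "C = c' * \<gamma>" "D = d' * \<gamma>" "coprime c' d'"
    using gcd_coprime_exists[of C D] g0 unfolding \<gamma>_def by blast
  have gp: "\<gamma> > 0" using g0 unfolding \<gamma>_def by (simp add: less_le)
  obtain \<epsilon> where eps: "\<epsilon> = 1 \<or> \<epsilon> = -1" "(\<epsilon> * c', \<epsilon> * d') \<in> proj_reps" by (rule proj_reps_sign[OF cd(3)])
  define G where "G = gcd A (gcd B \<gamma>)"
  have G: "G > 0" using g0 unfolding G_def by (simp add: less_le)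
  have "G dvd A" "G dvd B" "G dvd \<gamma>" unfolding G_def by (auto intro: dvd_trans[OF gcd_dvd2])
  then obtain A1 B1 g1 where AB: "A = G * A1" "B = G * B1" "\<gamma> = G * g1" by (auto elim!: dvdE)
  have "G * gcd A1 (gcd B1 g1) = gcd (G * A1) (gcd (G * B1) (G * g1))" using G by (simp add: gcd_mult_distrib_int[symmetric])
  hence "G * gcd A1 (gcd B1 g1) = G * 1" unfolding AB[symmetric] by (simp add: G_def)
  hence gcd1: "gcd A1 (gcd B1 g1) = 1" using G by simp
  have g1: "g1 > 0" using gp G unfolding AB by (simp add: zero_less_mult_iff)
  define z v g where "z = (\<epsilon> * c', \<epsilon> * d')" and "v = (\<epsilon> * A1, \<epsilon> * B1)" and "g = nat g1"
  have g: "int g = g1" "g \<ge> 1" using g1 by (simp_all add: g_def)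
  have ee: "\<epsilon> * \<epsilon> = 1" using eps(1) by auto
  have "vec_det z v = (\<epsilon> * \<epsilon>) * (A1 * d' - B1 * c')" by (simp add: vec_det_def z_def v_def algebra_simps)
  moreover have "A * D - B * C = G * \<gamma> * (A1 * d' - B1 * c')" unfolding cd AB(1,2) by (simp add: algebra_simps)
  ultimately have "vec_det z v \<noteq> 0" using det' ee by auto
  hence "(v, g) \<in> fibre_vecs z" using g by (simp add: fibre_vecs_def)
  moreover have "gcd (fst v) (gcd (snd v) (int g)) = 1" using gcd1 eps(1) unfolding g by (auto simp: v_def)
  ultimately have I: "(z, v, g) \<in> point_reps" using eps(2) primitive_iff_gcd[of v g] by (simp add: point_reps_def z_def)
  define k :: rat where "k = of_int \<epsilon> * of_int N / of_int G"
  have k: "k \<noteq> 0" using N(1) G eps(1) by (auto simp: k_def)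
  have kk: "k * x = of_int (\<epsilon> * Y)" if "of_int N * x = of_int (G * Y)" for x Y
  proof -
    have "k * x = of_int \<epsilon> * (of_int N * x) / of_int G" by (simp add: k_def)
    thus ?thesis unfolding that using G by simp
  qed
  have "k * a = of_int (fst v)" using kk[of a A1] N(2) by (simp only: AB v_def fst_conv)
  moreover have "k * b = of_int (snd v)" using kk[of b B1] N(3) by (simp only: AB v_def snd_conv)
  moreover have "C = G * (g1 * c')" "D = G * (g1 * d')" unfolding cd(1,2) AB(3) by (simp_all only: mult_ac)
  hence "k * c = of_int (\<epsilon> * (g1 * c'))" "k * d = of_int (\<epsilon> * (g1 * d'))"
    using kk[of c "g1 * c'"] kk[of d "g1 * d'"] N(4,5) by (simp_all only:)
  hence "k * c = of_int (int g * fst z)" "k * d = of_int (int g * snd z)"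
    unfolding g z_def fst_conv snd_conv by (simp_all only: mult.left_commute)
  ultimately have "((a, b, c, d), rep_matrix (z, v, g)) \<in> mat_rel"
    unfolding mat_rel_def rep_matrix_def using k by (auto intro!: exI[of _ k])
  thus ?thesis using I by blast
qed

lemma rep_matrix_bij: "bij_betw (\<lambda>i. mat_rel `` {rep_matrix i}) point_reps PGL2_Q"
  unfolding bij_betw_def
proof (intro conjI equalityI subsetI)
  show "inj_on (\<lambda>i. mat_rel `` {rep_matrix i}) point_reps"
  proof (rule inj_onI)
    fix i j assume i: "i \<in> point_reps" and j: "j \<in> point_reps" and eq: "mat_rel `` {rep_matrix i} = mat_rel `` {rep_matrix j}"
    obtain z v g where zi: "i = (z, v, g)" by (cases i)
    obtain z' v' g' where zj: "j = (z', v', g')" by (cases j)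
    have "(rep_matrix i, rep_matrix j) \<in> mat_rel" using eq_equiv_class_iff[OF equiv_mat_rel, of "rep_matrix i" "rep_matrix j"] eq by blast
    thus "i = j" unfolding zi zj by (rule rep_matrix_inj[OF i[unfolded zi] j[unfolded zj]])
  qed
next
  fix X assume "X \<in> (\<lambda>i. mat_rel `` {rep_matrix i}) ` point_reps"
  then obtain z v g where i: "(z, v, g) \<in> point_reps" "X = mat_rel `` {rep_matrix (z, v, g)}" by auto
  have ne: "int g * vec_det z v \<noteq> 0" using i(1) by (auto simp: point_reps_def fibre_vecs_def)
  have e: "fst v * (int g * snd z) - snd v * (int g * fst z) = int g * vec_det z v" by (simp add: vec_det_def algebra_simps)
  have "fst v * (int g * snd z) - snd v * (int g * fst z) \<noteq> 0" unfolding e by (rule ne)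
  hence "(of_int (fst v * (int g * snd z) - snd v * (int g * fst z)) :: rat) \<noteq> 0"
    by (simp only: of_int_eq_0_iff simp_thms)
  hence "rep_matrix (z, v, g) \<in> {(a, b, c, d). a * d - b * c \<noteq> 0}" by (simp add: rep_matrix_def)
  thus "X \<in> PGL2_Q" unfolding PGL2_Q_def mat_rel_def[symmetric] i(2) by (rule quotientI)
next
  fix X assume "X \<in> PGL2_Q"
  then obtain m where m: "X = mat_rel `` {m}" "m \<in> {(a, b, c, d). a * d - b * c \<noteq> 0}"
    unfolding PGL2_Q_def mat_rel_def[symmetric] by (rule quotientE)
  obtain a b c d where abcd: "m = (a, b, c, d)" by (cases m)
  obtain i where i: "i \<in> point_reps" "(m, rep_matrix i) \<in> mat_rel" using rep_matrix_surj[of a d b c] m(2) unfolding abcd by auto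
  have "X = mat_rel `` {rep_matrix i}" unfolding m(1) by (rule equiv_class_eq[OF equiv_mat_rel i(2)])
  thus "X \<in> (\<lambda>i. mat_rel `` {rep_matrix i}) ` point_reps" using i(1) by blast
qed

lemma powr_less_iff_base:
  fixes u v a :: real
  assumes "a > 0" "u \<ge> 0" "v \<ge> 0" shows "u powr a < v powr a \<longleftrightarrow> u < v"
proof
  assume "u < v" thus "u powr a < v powr a" using assms by (intro powr_less_mono2) auto
next
  assume *: "u powr a < v powr a"
  show "u < v"
  proof (rule ccontr)
    assume "\<not> u < v"
    hence "v powr a \<le> u powr a" using assms by (intro powr_mono2) auto
    thus False using * by linarith
  qed
qed

lemma height_rep_matrix:
  assumes i: "(z, v, g) \<in> point_reps"
  shows "height (rep_matrix (z, v, g)) (x, y) = nrm z powr (2 * x) * fibre_norm z (v, g) powr (x + y)"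
proof -
  have z: "z \<in> proj_reps" and g: "g \<ge> 1" and d: "vec_det z v \<noteq> 0" and c: "gcd (fst v) (gcd (snd v) (int g)) = 1"
    using i primitive_iff_gcd[of v g] by (auto simp: point_reps_def fibre_vecs_def)
  have q: "nrm z > 0" using proj_reps_nonzero_vecs(2)[OF z] by linarith
  have "height (rep_matrix (z, v, g)) (x, y) = sqrt (real_of_int ((fst z)\<^sup>2 + (snd z)\<^sup>2)) powr (x - y) *
      sqrt (real_of_int ((fst v)\<^sup>2 + (snd v)\<^sup>2 + (int g)\<^sup>2 * ((fst z)\<^sup>2 + (snd z)\<^sup>2))) powr (x + y)"
    unfolding rep_matrix_def prod.case
    by (rule height_prim) (use z g d c in \<open>auto simp: proj_reps_def vec_det_def\<close>)
  moreover have "sqrt (real_of_int ((fst z)\<^sup>2 + (snd z)\<^sup>2)) = nrm z" by (simp add: nrm_def)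
  moreover have "sqrt (real_of_int ((fst v)\<^sup>2 + (snd v)\<^sup>2 + (int g)\<^sup>2 * ((fst z)\<^sup>2 + (snd z)\<^sup>2))) = nrm z * fibre_norm z (v, g)"
    using q by (simp add: fibre_norm_def nrm_sq)
  moreover have "nrm z powr (x - y) * (nrm z * fibre_norm z (v, g)) powr (x + y) = nrm z powr (2 * x) * fibre_norm z (v, g) powr (x + y)"
  proof -
    have "fibre_norm z (v, g) \<ge> 0" using q by (simp add: fibre_norm_def)
    hence "(nrm z * fibre_norm z (v, g)) powr (x + y) = nrm z powr (x + y) * fibre_norm z (v, g) powr (x + y)" using q by (simp add: powr_mult)
    moreover have "nrm z powr (x - y) * nrm z powr (x + y) = nrm z powr (2 * x)" by (simp add: powr_add[symmetric])
    ultimately show ?thesis by (simp only: mult.assoc[symmetric])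
  qed
  ultimately show ?thesis by (simp only:)
qed

lemma counting_eq_total_count:
  assumes x: "x > 0" and xy: "x + y > 0" and B: "B > 0"
  shows "real (counting (x, y) B) = total_count (2 * x / (x + y)) (B powr (1 / (2 * x)))"
proof -
  define T where "T = B powr (1 / (2 * x))"
  define \<beta> where "\<beta> = 2 * x / (x + y)"
  have T: "T > 0" using B by (simp add: T_def)
  have b: "\<beta> > 0" using x xy by (simp add: \<beta>_def)
  define J where "J = (SIGMA z:{z\<in>proj_reps. nrm z < T}. {w\<in>fibre_vecs z. fibre_norm z w < (T / nrm z) powr \<beta> \<and> (\<forall>q. prime q \<longrightarrow> \<not> dvd_fibre q w)})"
  have less: "height (rep_matrix (z, v, g)) (x, y) < B \<longleftrightarrow> fibre_norm z (v, g) < (T / nrm z) powr \<beta>" if i: "(z, v, g) \<in> point_reps" for z v g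
  proof -
    have z: "z \<in> proj_reps" using i by (simp add: point_reps_def)
    have q: "nrm z > 0" using proj_reps_nonzero_vecs(2)[OF z] by linarith
    have N: "fibre_norm z (v, g) \<ge> 0" using q by (simp add: fibre_norm_def)
    have "((T / nrm z) powr \<beta>) powr (x + y) = (T / nrm z) powr (2 * x)" using xy by (simp add: powr_powr \<beta>_def)
    also have "\<dots> = T powr (2 * x) / nrm z powr (2 * x)" using T q by (simp only: powr_divide less_imp_le)
    also have "T powr (2 * x) = B" using B x by (simp add: T_def powr_powr)
    finally have u: "((T / nrm z) powr \<beta>) powr (x + y) = B / nrm z powr (2 * x)" .
    have "height (rep_matrix (z, v, g)) (x, y) < B \<longleftrightarrow> fibre_norm z (v, g) powr (x + y) < B / nrm z powr (2 * x)"
      unfolding height_rep_matrix[OF i] using q by (simp add: pos_less_divide_eq mult.commute)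
    also have "\<dots> \<longleftrightarrow> fibre_norm z (v, g) < (T / nrm z) powr \<beta>"
      unfolding u[symmetric] by (rule powr_less_iff_base[OF xy N]) simp
    finally show ?thesis .
  qed
  have J: "{i\<in>point_reps. height (rep_matrix i) (x, y) < B} = J"
  proof (intro equalityI subsetI)
    fix i assume i: "i \<in> {i\<in>point_reps. height (rep_matrix i) (x, y) < B}"
    obtain z v g where zi: "i = (z, v, g)" by (cases i)
    have I: "(z, v, g) \<in> point_reps" using i by (simp add: zi)
    hence z: "z \<in> proj_reps" and V: "(v, g) \<in> fibre_vecs z" by (simp_all add: point_reps_def)
    have N: "fibre_norm z (v, g) < (T / nrm z) powr \<beta>" using i less[OF I] by (simp add: zi)
    \<comment> \<open>Fibre norms are at least 1, so a point of height below B has |z| < T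
      automatically and the sum over \<open>z\<close> is finite.\<close>
    have "\<forall>w\<in>fibre_vecs z. 1 \<le> fibre_norm z w" using sieve_hyp_fibre_vecs[OF z] unfolding sieve_hyp_def by blast
    hence "1 powr \<beta> < (T / nrm z) powr \<beta>" using V N by force
    hence "1 < T / nrm z" using T proj_reps_nonzero_vecs(2)[OF z] by (subst (asm) powr_less_iff_base[OF b]) auto
    hence "nrm z < T" using proj_reps_nonzero_vecs(2)[OF z] by (simp add: pos_less_divide_eq)
    thus "i \<in> J" using I N by (simp add: zi J_def point_reps_def)
  next
    fix i assume i: "i \<in> J"
    obtain z v g where zi: "i = (z, v, g)" by (cases i)
    have I: "(z, v, g) \<in> point_reps" using i by (simp add: zi J_def point_reps_def)
    thus "i \<in> {i\<in>point_reps. height (rep_matrix i) (x, y) < B}" using i less[OF I] by (simp add: zi J_def)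
  qed
  \<comment> \<open>All matrices of a class have the same height, so the representative decides
    whether the class is counted.\<close>
  have ex: "(\<exists>m\<in>mat_rel `` {rep_matrix i}. height m (x, y) < B) \<longleftrightarrow> height (rep_matrix i) (x, y) < B" for i
  proof
    assume "\<exists>m\<in>mat_rel `` {rep_matrix i}. height m (x, y) < B"
    then obtain m where m: "(rep_matrix i, m) \<in> mat_rel" "height m (x, y) < B" by blast
    obtain a b c d where M: "rep_matrix i = (a, b, c, d)" by (cases "rep_matrix i")
    obtain k where k: "k \<noteq> 0" "m = (k * a, k * b, k * c, k * d)" using m(1) unfolding M mat_rel_def by auto
    show "height (rep_matrix i) (x, y) < B" using m(2) unfolding M k(2) height_scale[OF k(1)] .
  next
    assume "height (rep_matrix i) (x, y) < B"
    moreover have "rep_matrix i \<in> mat_rel `` {rep_matrix i}" using equiv_class_self[OF equiv_mat_rel] by simp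
    ultimately show "\<exists>m\<in>mat_rel `` {rep_matrix i}. height m (x, y) < B" by blast
  qed
  have im: "(\<lambda>i. mat_rel `` {rep_matrix i}) ` point_reps = PGL2_Q" and inj: "inj_on (\<lambda>i. mat_rel `` {rep_matrix i}) point_reps"
    using rep_matrix_bij by (auto simp: bij_betw_def)
  have "{\<gamma> \<in> PGL2_Q. \<exists>m\<in>\<gamma>. height m (x, y) < B} = (\<lambda>i. mat_rel `` {rep_matrix i}) ` {i\<in>point_reps. height (rep_matrix i) (x, y) < B}"
    unfolding im[symmetric] using ex by blast
  hence "counting (x, y) B = card ((\<lambda>i. mat_rel `` {rep_matrix i}) ` J)" unfolding counting_def J by (simp only:)
  also have "\<dots> = card J" by (rule card_image[OF inj_on_subset[OF inj]]) (use J in blast)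
  also have "\<dots> = (\<Sum>z\<in>{z\<in>proj_reps. nrm z < T}. card {w\<in>fibre_vecs z. fibre_norm z w < (T / nrm z) powr \<beta> \<and> (\<forall>q. prime q \<longrightarrow> \<not> dvd_fibre q w)})"
    unfolding J_def
  proof (rule card_SigmaI[OF finite_proj_reps], rule ballI)
    fix z assume "z \<in> {z\<in>proj_reps. nrm z < T}"
    hence z: "z \<in> proj_reps" by simp
    have "(T / nrm z) powr \<beta> > 0" using T proj_reps_nonzero_vecs(2)[OF z] by simp
    from card_fibre_vecs_slices(1)[OF z this]
    show "finite {w\<in>fibre_vecs z. fibre_norm z w < (T / nrm z) powr \<beta> \<and> (\<forall>q. prime q \<longrightarrow> \<not> dvd_fibre q w)}"
      by (rule rev_finite_subset) blast
  qed
  finally show ?thesis by (simp only: total_count_def fibre_count_def of_nat_sum T_def \<beta>_def)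
qed

section \<open>The constant\<close>

lemma prime_powr_factor:
  fixes p :: nat
  assumes "prime p"
  shows "1 - 1 / real p = 1 - real p powr (-1)" "s > 0 \<Longrightarrow> 1 - real p powr (- s) \<noteq> 0"
proof -
  have p: "real p > 1" using prime_gt_1_nat[OF assms] by simp
  show "1 - 1 / real p = 1 - real p powr (-1)" using p by (simp add: powr_minus inverse_eq_divide)
  assume s: "s > 0"
  have "real p powr (- s) < real p powr 0" using p s by (intro powr_less_mono) auto
  also have "\<dots> = 1" using p by simp
  finally show "1 - real p powr (- s) \<noteq> 0" by linarith
qed

text \<open>The convergence factors (1 - 1/p)^2 cancel the two denominators of the local volume and
  leave (1 - p^(-2)) (1 - p^(-3)).\<close>

lemma tau_X_eq: "tau_X = 2 * pi\<^sup>2 / (zeta 2 * zeta 3)"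
proof -
  have z: "zeta 2 > 0" "zeta 3 > 0" using zeta_pos by simp_all
  have "euler_prod (\<lambda>p. (1 - 1 / real p)\<^sup>2 * measure (tau_fin p) (space (tau_fin p))) = 1 / zeta 2 * (1 / zeta 3)"
  proof (rule euler_prod_eqI)
    have "(\<Prod>p\<in>primes_upto m. (1 - 1 / real p)\<^sup>2 * measure (tau_fin p) (space (tau_fin p))) =
        (\<Prod>p\<in>primes_upto m. 1 - real p powr -2) * (\<Prod>p\<in>primes_upto m. 1 - real p powr -3)" for m
      unfolding prod.distrib[symmetric]
    proof (rule prod.cong[OF refl])
      fix p assume "p \<in> primes_upto m"
      hence p: "prime p" by (rule primes_upto)
      define u where "u = 1 - real p powr -1"
      have u: "u \<noteq> 0" "1 - 1 / real p = u" using prime_powr_factor(1)[OF p] prime_powr_factor(2)[OF p zero_less_one] by (simp_all only: u_def simp_thms)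
      show "(1 - 1 / real p)\<^sup>2 * measure (tau_fin p) (space (tau_fin p)) = (1 - real p powr -2) * (1 - real p powr -3)"
        unfolding padic.tau_fin_measure[OF padic.intro[OF p]] u_def[symmetric] u(2) using u(1) by (simp add: power2_eq_square)
    qed
    thus "(\<lambda>m. \<Prod>p\<in>primes_upto m. (1 - 1 / real p)\<^sup>2 * measure (tau_fin p) (space (tau_fin p))) \<longlonglongrightarrow> 1 / zeta 2 * (1 / zeta 3)"
      using tendsto_mult[OF euler_zeta[of 2] euler_zeta[of 3]] by simp
  qed (use z in simp)
  thus ?thesis by (simp add: tau_X_def tau_inf_measure)
qed

text \<open>A single convergence factor is present here, so the denominator 1 - p^(-(1+k)) survives;
  its product converges because k > 0 and accounts for the zeta value in the numerator.\<close>

lemma tau_rigid_eq: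
  assumes k: "k > 0"
  shows "tau_rigid k = 2 * pi\<^sup>2 / (1 + k) * (zeta (1 + k) / (zeta 2 * zeta (3 + k)))"
proof -
  have z: "zeta 2 > 0" "zeta (3 + k) > 0" "zeta (1 + k) > 0" using zeta_pos k by simp_all
  have "euler_prod (\<lambda>p. (1 - 1 / real p) * (LINT (a, b, c)|tau_fin p. HE_fin p (a, b, c, \<one>\<^bsub>Qp p\<^esub>) powr (- k))) =
      1 / zeta 2 * (1 / zeta (3 + k)) / (1 / zeta (1 + k))"
  proof (rule euler_prod_eqI)
    have "(\<Prod>p\<in>primes_upto m. (1 - 1 / real p) * (LINT (a, b, c)|tau_fin p. HE_fin p (a, b, c, \<one>\<^bsub>Qp p\<^esub>) powr (- k))) =
        (\<Prod>p\<in>primes_upto m. 1 - real p powr -2) * (\<Prod>p\<in>primes_upto m. 1 - real p powr (- (3 + k))) /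
        (\<Prod>p\<in>primes_upto m. 1 - real p powr (- (1 + k)))" for m
      unfolding prod.distrib[symmetric] prod_dividef[symmetric]
    proof (rule prod.cong[OF refl])
      fix p assume "p \<in> primes_upto m"
      hence p: "prime p" by (rule primes_upto)
      define u where "u = 1 - real p powr -1"
      have u: "u \<noteq> 0" "1 - 1 / real p = u" using prime_powr_factor(1)[OF p] prime_powr_factor(2)[OF p zero_less_one] by (simp_all only: u_def simp_thms)
      show "(1 - 1 / real p) * (LINT (a, b, c)|tau_fin p. HE_fin p (a, b, c, \<one>\<^bsub>Qp p\<^esub>) powr (- k)) =
          (1 - real p powr -2) * (1 - real p powr (- (3 + k))) / (1 - real p powr (- (1 + k)))"
        unfolding padic.integral_tau_fin[OF padic.intro[OF p] less_imp_le[OF k]] u_def[symmetric] u(2) using u(1) by simp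
    qed
    thus "(\<lambda>m. \<Prod>p\<in>primes_upto m. (1 - 1 / real p) * (LINT (a, b, c)|tau_fin p. HE_fin p (a, b, c, \<one>\<^bsub>Qp p\<^esub>) powr (- k)))
        \<longlonglongrightarrow> 1 / zeta 2 * (1 / zeta (3 + k)) / (1 / zeta (1 + k))"
      using tendsto_divide[OF tendsto_mult[OF euler_zeta[of 2] euler_zeta[of "3 + k"]] euler_zeta[of "1 + k"]] k z by simp
  qed (use z in simp)
  thus ?thesis unfolding tau_rigid_def integral_tau_inf[OF less_imp_le[OF k]] by simp
qed

lemma euler_prod_sigma: "euler_prod (\<lambda>p. (1 - 1 / real p) * ((1 - real p powr (-3)) / (1 - real p powr (-1)))) = 1 / zeta 3"
proof (rule euler_prod_eqI)
  have "(\<Prod>p\<in>primes_upto m. (1 - 1 / real p) * ((1 - real p powr (-3)) / (1 - real p powr (-1)))) = (\<Prod>p\<in>primes_upto m. 1 - real p powr -3)" for m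
  proof (rule prod.cong[OF refl])
    fix p assume "p \<in> primes_upto m"
    hence p: "prime p" by (rule primes_upto)
    define u where "u = 1 - real p powr -1"
    have u: "u \<noteq> 0" "1 - 1 / real p = u" using prime_powr_factor(1)[OF p] prime_powr_factor(2)[OF p zero_less_one] by (simp_all only: u_def simp_thms)
    show "(1 - 1 / real p) * ((1 - real p powr (-3)) / (1 - real p powr (-1))) = 1 - real p powr -3"
      unfolding u_def[symmetric] u(2) using u(1) by simp
  qed
  thus "(\<lambda>m. \<Prod>p\<in>primes_upto m. (1 - 1 / real p) * ((1 - real p powr (-3)) / (1 - real p powr (-1)))) \<longlonglongrightarrow> 1 / zeta 3"
    using euler_zeta[of 3] by simp
  show "1 / zeta 3 \<noteq> 0" using zeta_pos[of 3] by simp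
qed

section \<open>The base of the fibration\<close>

definition proj_point_rel :: "((rat \<times> rat) \<times> (rat \<times> rat)) set" where
  "proj_point_rel = {((c, d), (c', d')). \<exists>k. k \<noteq> 0 \<and> c' = k * c \<and> d' = k * d}"

definition proj_point :: "int \<times> int \<Rightarrow> (rat \<times> rat) set" where
  "proj_point z = proj_point_rel `` {(of_int (fst z), of_int (snd z))}"

lemma proj_point_relE:
  assumes "(m, m') \<in> proj_point_rel"
  obtains c d k where "k \<noteq> 0" "m = (c, d)" "m' = (k * c, k * d)"
proof -
  obtain c d where m: "m = (c, d)" by (cases m)
  obtain c' d' where m': "m' = (c', d')" by (cases m')
  obtain k where "k \<noteq> 0 \<and> c' = k * c \<and> d' = k * d"
    using assms unfolding m m' proj_point_rel_def mem_Collect_eq prod.case by (elim exE)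
  thus thesis using m m' by (intro that[of k c d]) simp_all
qed

lemma equiv_proj_point_rel: "equiv UNIV proj_point_rel"
proof (rule equivI)
  show "refl proj_point_rel" by (rule refl_onI) (auto simp: proj_point_rel_def intro: exI[of _ 1])
  show "sym proj_point_rel"
  proof (rule symI)
    fix m m' assume "(m, m') \<in> proj_point_rel"
    then obtain c d k where m: "k \<noteq> 0" "m = (c, d)" "m' = (k * c, k * d)" by (rule proj_point_relE)
    show "(m', m) \<in> proj_point_rel" unfolding proj_point_rel_def m using m(1) by (auto intro!: exI[of _ "inverse k"])
  qed
  show "trans proj_point_rel"
  proof (rule transI)
    fix m m' m'' assume 1: "(m, m') \<in> proj_point_rel" and 2: "(m', m'') \<in> proj_point_rel"
    from 1 obtain c d k where m: "k \<noteq> 0" "m = (c, d)" "m' = (k * c, k * d)" by (rule proj_point_relE)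
    from 2 obtain c' d' l where m': "l \<noteq> 0" "m' = (c', d')" "m'' = (l * c', l * d')" by (rule proj_point_relE)
    have e: "c' = k * c" "d' = k * d" using m(3) m'(2) by simp_all
    show "(m, m'') \<in> proj_point_rel" unfolding proj_point_rel_def m(2) m'(3) e using m(1) m'(1) by (auto intro!: exI[of _ "l * k"])
  qed
qed simp

lemma proj_point_member:
  assumes "(of_int c, of_int d) \<in> proj_point z"
  obtains m n :: int where "n > 0" "m \<noteq> 0" "n * c = m * fst z" "n * d = m * snd z"
proof -
  obtain k :: rat where k: "k \<noteq> 0" "of_int c = k * of_int (fst z)" "of_int d = k * of_int (snd z)"
    using assms by (auto simp: proj_point_def proj_point_rel_def)
  obtain m n where mn: "k = of_int m / of_int n" "n > 0" by (rule rat_quotient)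
  note e = k(2-3)[unfolded mn(1), THEN rat_scale_int, OF mn(2)]
  show thesis by (rule that[OF mn(2) _ e]) (use k(1) mn in auto)
qed

lemma proj_point_bij: "bij_betw proj_point proj_reps P1_Q"
  unfolding bij_betw_def
proof (intro conjI equalityI subsetI)
  show "inj_on proj_point proj_reps"
  proof (rule inj_onI)
    fix z z' assume z: "z \<in> proj_reps" "z' \<in> proj_reps" and eq: "proj_point z = proj_point z'"
    have "(of_int (fst z'), of_int (snd z')) \<in> proj_point z" unfolding eq unfolding proj_point_def
      by (rule equiv_class_self[OF equiv_proj_point_rel UNIV_I])
    then obtain m n where "n > 0" "m \<noteq> 0" "n * fst z' = m * fst z" "n * snd z' = m * snd z" by (rule proj_point_member)
    thus "z = z'" using proj_reps_parallel[OF z] by blast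
  qed
next
  fix X assume "X \<in> proj_point ` proj_reps"
  then obtain z where z: "z \<in> proj_reps" "X = proj_point z" by blast
  have "z \<in> nonzero_vecs" by (rule proj_reps_nonzero_vecs(1)[OF z(1)])
  hence "(of_int (fst z) :: rat, of_int (snd z) :: rat) \<in> UNIV - {(0, 0)}" by (auto simp: nonzero_vecs_def prod_eq_iff)
  thus "X \<in> P1_Q" unfolding z(2) proj_point_def P1_Q_def proj_point_rel_def[symmetric] by (rule quotientI)
next
  fix X assume "X \<in> P1_Q"
  then obtain m where m: "X = proj_point_rel `` {m}" "m \<in> UNIV - {(0, 0)}"
    unfolding P1_Q_def proj_point_rel_def[symmetric] by (rule quotientE)
  obtain c d where cd: "m = (c, d)" by (cases m)
  obtain N A B C D where N: "N > 0" "of_int N * (0::rat) = of_int A" "of_int N * (0::rat) = of_int B" "of_int N * c = of_int C" "of_int N * d = of_int D"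
    using common_denominator[of 0 0 c d] by blast
  define \<gamma> where "\<gamma> = gcd C D"
  have "\<not> (C = 0 \<and> D = 0)"
  proof
    assume "C = 0 \<and> D = 0"
    hence "of_int N * c = 0" "of_int N * d = 0" using N by simp_all
    thus False using N(1) m(2) by (simp add: cd)
  qed
  hence g0: "\<gamma> \<noteq> 0" by (simp add: \<gamma>_def)
  obtain c' d' where cd': "C = c' * \<gamma>" "D = d' * \<gamma>" "coprime c' d'"
    using gcd_coprime_exists[of C D] g0 unfolding \<gamma>_def by blast
  obtain \<epsilon> where eps: "\<epsilon> = 1 \<or> \<epsilon> = -1" "(\<epsilon> * c', \<epsilon> * d') \<in> proj_reps" by (rule proj_reps_sign[OF cd'(3)])
  define k :: rat where "k = of_int \<epsilon> * of_int N / of_int \<gamma>"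
  have k: "k \<noteq> 0" using N(1) g0 eps(1) by (auto simp: k_def)
  have kk: "k * x = of_int (\<epsilon> * Y)" if "of_int N * x = of_int (Y * \<gamma>)" for x Y
  proof -
    have "k * x = of_int \<epsilon> * (of_int N * x) / of_int \<gamma>" by (simp add: k_def)
    thus ?thesis unfolding that using g0 by simp
  qed
  have "k * c = of_int (\<epsilon> * c')" "k * d = of_int (\<epsilon> * d')"
    using kk[of c c'] kk[of d d'] N(4,5) by (simp_all only: cd')
  hence "(m, (of_int (fst (\<epsilon> * c', \<epsilon> * d')), of_int (snd (\<epsilon> * c', \<epsilon> * d')))) \<in> proj_point_rel"
    unfolding proj_point_rel_def cd using k by (auto intro!: exI[of _ k])
  hence "X = proj_point (\<epsilon> * c', \<epsilon> * d')" unfolding m(1) proj_point_def by (rule equiv_class_eq[OF equiv_proj_point_rel])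
  thus "X \<in> proj_point ` proj_reps" using eps(2) by blast
qed

text \<open>The matrix is chosen by \<open>SOME\<close>, so nothing is known about its first row.
  The second row is primitive and proportional to \<open>z\<close>, hence equal to it up to sign,
  and its norm is determined.\<close>

lemma SL2_rep_proj_point:
  assumes z: "z \<in> proj_reps"
  obtains a b c d :: int where "SL2_rep (proj_point z) = map_mat2 of_int (a, b, c, d)" "a * d - b * c = 1"
    "coprime c d" "nrm (c, d) = nrm z"
proof -
  define P where "P = (\<lambda>(a, b, c, d). a * d - b * c = (1::int) \<and> (of_int c, of_int d) \<in> proj_point z)"
  have g: "gcd (fst z) (snd z) = 1" using z by (simp add: proj_reps_def)
  then obtain u w where uw: "u * fst z + w * snd z = 1" using bezout_int[of "fst z" "snd z"] by auto
  have "(of_int (fst z), of_int (snd z)) \<in> proj_point z" unfolding proj_point_def by (rule equiv_class_self[OF equiv_proj_point_rel UNIV_I])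
  \<comment> \<open>The Bezout coefficients of \<open>z\<close> give a first row with determinant 1,
    so the choice is not void.\<close>
  hence "P (w, - u, fst z, snd z)" using uw by (cases z) (simp add: P_def add.commute)
  hence S: "P (SOME m. P m)" by (rule someI)
  obtain a b c d where m: "(SOME m. P m) = (a, b, c, d)" by (cases "SOME m. P m")
  have det: "a * d - b * c = 1" and mem: "(of_int c, of_int d) \<in> proj_point z" using S unfolding m by (simp_all add: P_def)
  have rep: "SL2_rep (proj_point z) = map_mat2 of_int (a, b, c, d)" unfolding SL2_rep_def P_def[symmetric] m ..
  have "gcd c d dvd a * d - b * c" by (intro dvd_diff dvd_mult) auto
  hence cop: "coprime c d" unfolding det by (simp add: coprime_iff_gcd_eq_1)
  obtain m n where mn: "n > 0" "m \<noteq> 0" "n * c = m * fst z" "n * d = m * snd z" using mem by (rule proj_point_member)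
  have "\<bar>n\<bar> * gcd c d = gcd (n * c) (n * d)" by (rule gcd_mult_distrib_int)
  also have "\<dots> = \<bar>m\<bar> * gcd (fst z) (snd z)" unfolding mn(3,4) by (rule gcd_mult_distrib_int[symmetric])
  finally have nm: "n = \<bar>m\<bar>" using g cop mn(1) by simp
  have "nrm (n * fst (c, d), n * snd (c, d)) = nrm (m * fst z, m * snd z)" by (simp add: mn(3,4))
  hence "\<bar>real_of_int n\<bar> * nrm (c, d) = \<bar>real_of_int m\<bar> * nrm z" unfolding nrm_scale .
  hence "nrm (c, d) = nrm z" using nm mn(1,2) by simp
  thus thesis by (rule that[OF rep det cop])
qed

text \<open>The adjoint class is a multiple of D - E, so its exponents add up to zero and the norm
  of the whole matrix drops out of the height. That is why the unknown first row of the
  representative has no influence; a power of |z| is left, to which the volume of the fibre adds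
  |z|^(-2).\<close>

lemma fibre_term:
  assumes z: "z \<in> proj_reps" and xy: "x + y > 0"
  shows "1 / (x + y) * inverse (height (SL2_rep (proj_point z)) (3 / (x + y) * x - 2, 3 / (x + y) * y - 1)) * tau_S (proj_point z) =
    2 * pi / ((x + y) * zeta 3) * nrm z powr (2 - 3 * (2 * x / (x + y)))"
proof -
  obtain a b c d where r: "SL2_rep (proj_point z) = map_mat2 of_int (a, b, c, d)" "a * d - b * c = 1"
    "coprime c d" "nrm (c, d) = nrm z" by (rule SL2_rep_proj_point[OF z])
  have q: "nrm z > 0" using proj_reps_nonzero_vecs(2)[OF z] by linarith
  define t where "t = x + y"
  have t: "t > 0" "y = t - x" using xy by (simp_all add: t_def)
  define s w where "s = 3 / t * x - 2" and "w = 3 / t * y - 1"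
  have sw: "s + w = 0"
  proof -
    have "s + w = 3 / t * t - 3" unfolding s_def w_def t(2) by (simp add: right_diff_distrib)
    thus ?thesis using t(1) by simp
  qed
  have cd: "sqrt (real_of_int (c\<^sup>2 + d\<^sup>2)) = nrm z" unfolding r(4)[symmetric] by (simp add: nrm_def)
  have cd2: "(real_of_int c)\<^sup>2 + (real_of_int d)\<^sup>2 = (nrm z)\<^sup>2" unfolding r(4)[symmetric] by (simp add: nrm_sq)
  have pos: "sqrt (real_of_int (a\<^sup>2 + b\<^sup>2 + 1\<^sup>2 * (c\<^sup>2 + d\<^sup>2))) > 0"
  proof -
    have "(real_of_int a)\<^sup>2 + (real_of_int b)\<^sup>2 + ((real_of_int c)\<^sup>2 + (real_of_int d)\<^sup>2) > 0"
      unfolding cd2 using q by (intro add_nonneg_pos) auto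
    thus ?thesis by simp
  qed
  have "height (map_mat2 of_int (a, b, 1 * c, 1 * d)) (s, w) =
      sqrt (real_of_int (c\<^sup>2 + d\<^sup>2)) powr (s - w) * sqrt (real_of_int (a\<^sup>2 + b\<^sup>2 + 1\<^sup>2 * (c\<^sup>2 + d\<^sup>2))) powr (s + w)"
    by (rule height_prim[OF r(3)]) (use r(2) in simp_all)
  hence h: "height (SL2_rep (proj_point z)) (s, w) = nrm z powr (s - w)"
    unfolding cd sw using pos r(1) by simp
  have "(of_int a * of_int d - of_int b * of_int c :: real) = of_int (a * d - b * c)" by simp
  hence det: "(of_int a * of_int d - of_int b * of_int c :: real) = 1" unfolding r(2) by simp
  have "map_mat2 of_rat (SL2_rep (proj_point z)) = (of_int a :: real, of_int b, of_int c, of_int d)" unfolding r(1) by simp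
  hence si: "(LINT h|sigma_inf. inverse (height_inf (P_act_inf h (map_mat2 of_rat (SL2_rep (proj_point z)))) (2, 1))) = 2 * pi / (nrm z)\<^sup>2"
    using integral_sigma_inf[OF det] by (simp only: cd2)
  have "euler_prod (\<lambda>p. (1 - 1 / real p) * (LINT h|sigma_fin p.
          inverse (height_fin p (P_act_fin p h (map_mat2 (padic_of_rat p) (SL2_rep (proj_point z)))) (2, 1)))) =
      euler_prod (\<lambda>p. (1 - 1 / real p) * ((1 - real p powr (-3)) / (1 - real p powr (-1))))"
    by (rule euler_prod_cong) (simp only: r(1) padic.integral_sigma_fin[OF padic.intro r(2)])
  hence tau: "tau_S (proj_point z) = 2 * pi / (nrm z)\<^sup>2 * (1 / zeta 3)"
    unfolding tau_S_def si euler_prod_sigma by simp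
  \<comment> \<open>The exponent matches the power of |z| in the count over
    \<open>z\<close>.\<close>
  have e: "- (s - w) + - 2 = 2 - 3 * (2 * x / t)"
  proof -
    have "s - w = 2 * (3 / t * x) - 3 / t * t - 1" unfolding s_def w_def t(2) by (simp add: right_diff_distrib)
    thus ?thesis using t(1) by simp
  qed
  have q2: "(nrm z)\<^sup>2 = nrm z powr 2" using q by simp
  have "inverse (nrm z powr (s - w)) * inverse ((nrm z)\<^sup>2) = nrm z powr (2 - 3 * (2 * x / t))"
    unfolding q2 powr_minus[symmetric] powr_add[symmetric] e ..
  moreover have "1 / t * inverse (nrm z powr (s - w)) * (2 * pi / (nrm z)\<^sup>2 * (1 / zeta 3)) =
      2 * pi / (t * zeta 3) * (inverse (nrm z powr (s - w)) * inverse ((nrm z)\<^sup>2))"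
    by (simp add: divide_inverse)
  ultimately show ?thesis unfolding t_def[symmetric] s_def[symmetric] w_def[symmetric] h tau by (simp only:)
qed

lemma asymp_equiv_compose:
  assumes lim: "((\<lambda>T. n T / \<phi> T) \<longlongrightarrow> L) at_top" and L: "L \<noteq> 0"
    and T: "filterlim T at_top at_top"
    and f: "\<forall>\<^sub>F B in at_top. f B = n (T B)" and g: "\<forall>\<^sub>F B in at_top. g B = L * \<phi> (T B)"
  shows "(f :: real \<Rightarrow> real) \<sim>[at_top] g"
proof (rule asymp_equivI')
  have "((\<lambda>B. n (T B) / \<phi> (T B) / L) \<longlongrightarrow> L / L) at_top"
    by (intro tendsto_divide tendsto_const filterlim_compose[OF lim T] L)
  moreover have "\<forall>\<^sub>F B in at_top. n (T B) / \<phi> (T B) / L = f B / g B"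
    using f g by eventually_elim (simp add: mult.commute)
  ultimately show "((\<lambda>B. f B / g B) \<longlongrightarrow> 1) at_top" using L by (simp add: Lim_transform_eventually)
qed

theorem theorem1p1:
  fixes x y :: real
  assumes "x \<in> \<rat>" and "y \<in> \<rat>"
    and "x > 0" and "x + y > 0"
  shows "(\<lambda>B. real (counting (x, y) B)) \<sim>[at_top]
    (\<lambda>B. manin_c x y / (manin_a (pic x y) * fact (manin_b (pic x y) - 1)) *
       B powr manin_a (pic x y) * ln B ^ (manin_b (pic x y) - 1))"
proof -
  note x = \<open>x > 0\<close> and xy = \<open>x + y > 0\<close>
  define \<beta> where "\<beta> = 2 * x / (x + y)"
  define T where "T B = B powr (1 / (2 * x))" for B :: real
  note a = manin_a_eq[OF x xy] and b = manin_b_eq[OF x xy]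
  have bpos: "\<beta> > 0" using x xy by (simp add: \<beta>_def)
  have "filterlim (\<lambda>B::real. (B / 1) powr (1 / (2 * x))) at_top at_top" by (rule ratio_powr_at_top) (use x in simp_all)
  hence Tlim: "filterlim T at_top at_top" by (simp add: T_def[abs_def])
  have count: "\<forall>\<^sub>F B in at_top. real (counting (x, y) B) = total_count \<beta> (T B)"
    by (rule eventually_mono[OF eventually_gt_at_top[of 0]]) (simp add: counting_eq_total_count[OF x xy] \<beta>_def T_def)
  have T4: "T B ^ 4 = B powr (2 / x)" if "B > 0" for B
  proof -
    have "T B > 0" using that by (simp add: T_def)
    hence "T B ^ 4 = T B powr 4" by simp
    also have "\<dots> = B powr (2 / x)" by (simp add: T_def powr_powr)
    finally show ?thesis .
  qed
  have cmp: "2 / x \<le> 3 / (x + y) \<longleftrightarrow> 2 * y \<le> x" "3 / (x + y) \<le> 2 / x \<longleftrightarrow> x \<le> 2 * y"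
    using x xy by (auto simp: field_simps)
  have z: "zeta 2 > 0" "zeta 3 > 0" using zeta_pos by simp_all
  consider (fibration) "2 * y < x" | (anticanonical) "2 * y = x" | (rigid) "2 * y > x" by linarith
  thus ?thesis
  proof cases
    case fibration
    have am: "manin_a (pic x y) = 3 / (x + y)" unfolding a using cmp(1) fibration by simp
    have bm: "manin_b (pic x y) = 1" unfolding b using fibration by simp
    have bb: "\<beta> > 4 / 3" using fibration xy by (simp add: \<beta>_def pos_less_divide_eq)
    define S where "S = (\<Sum>\<^sub>\<infinity>z\<in>proj_reps. nrm z powr (2 - 3 * \<beta>))"
    \<comment> \<open>The term of (1, 0) is 1. The limit has to be nonzero in order to pass from
      convergence of a quotient to asymptotic equivalence.\<close>
    have "S \<ge> (\<Sum>\<^sub>\<infinity>z\<in>{(1, 0)}. nrm z powr (2 - 3 * \<beta>))"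
      unfolding S_def
    proof (rule infsum_mono2)
      show "(\<lambda>z. nrm z powr (2 - 3 * \<beta>)) summable_on proj_reps"
        using nrm_powr_summable[of "3 * \<beta> - 2"] bb by simp
    qed (auto simp: proj_reps_def)
    hence S: "S > 0" by (simp add: nrm_def)
    have "manin_c x y = (\<Sum>\<^sub>\<infinity>X\<in>P1_Q. 1 / (x + y) *
        inverse (height (SL2_rep X) (3 / (x + y) * x - 2, 3 / (x + y) * y - 1)) * tau_S X)"
      using fibration by (simp add: manin_c_def am)
    also have "\<dots> = (\<Sum>\<^sub>\<infinity>z\<in>proj_reps. 1 / (x + y) *
        inverse (height (SL2_rep (proj_point z)) (3 / (x + y) * x - 2, 3 / (x + y) * y - 1)) * tau_S (proj_point z))"
      by (rule infsum_reindex_bij_betw[OF proj_point_bij, symmetric])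
    also have "\<dots> = (\<Sum>\<^sub>\<infinity>z\<in>proj_reps. 2 * pi / ((x + y) * zeta 3) * nrm z powr (2 - 3 * \<beta>))"
      unfolding \<beta>_def by (rule infsum_cong) (rule fibre_term[OF _ xy])
    also have "\<dots> = 2 * pi / ((x + y) * zeta 3) * S" unfolding S_def by (rule infsum_cmult_right')
    finally have c: "manin_c x y / (3 / (x + y)) = fibre_density * S" using xy by (simp add: fibre_density_def)
    show ?thesis
    proof (rule asymp_equiv_compose[OF total_count_fibration[OF bb] _ Tlim count])
      show "fibre_density * (\<Sum>\<^sub>\<infinity>z\<in>proj_reps. nrm z powr (2 - 3 * \<beta>)) \<noteq> 0" using S fibre_density_pos unfolding S_def by simp
      have "1 / (2 * x) * (3 * \<beta>) = 3 / (x + y)" using x by (simp add: \<beta>_def)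
      hence "T B powr (3 * \<beta>) = B powr (3 / (x + y))" for B unfolding T_def powr_powr by (simp only:)
      thus "\<forall>\<^sub>F B in at_top. manin_c x y / (manin_a (pic x y) * fact (manin_b (pic x y) - 1)) *
          B powr manin_a (pic x y) * ln B ^ (manin_b (pic x y) - 1) =
          fibre_density * (\<Sum>\<^sub>\<infinity>z\<in>proj_reps. nrm z powr (2 - 3 * \<beta>)) * T B powr (3 * \<beta>)"
        unfolding bm am S_def[symmetric] c[symmetric] by simp
    qed
  next
    case anticanonical
    hence yx: "x + y = 3 / 2 * x" by simp
    have am: "manin_a (pic x y) = 2 / x" unfolding a using cmp(2) anticanonical by simp
    have bm: "manin_b (pic x y) = 2" unfolding b using anticanonical by simp
    have bb: "\<beta> = 4 / 3" unfolding \<beta>_def yx using x by simp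
    have "manin_c x y = 1 / (2 * x * (3 / 2 * x)) * (2 * pi\<^sup>2 / (zeta 2 * zeta 3))"
      using anticanonical by (simp add: manin_c_def alpha_const_eq[OF x xy] tau_X_eq yx)
    \<comment> \<open>The divisor 2 x is left over for the logarithm, since ln T = ln B /
      (2x).\<close>
    hence c: "manin_c x y / (2 / x) = 2 * fibre_density * proj_density / (2 * x)"
      using x z by (simp add: fibre_density_def proj_density_def power2_eq_square)
    show ?thesis
    proof (rule asymp_equiv_compose[OF total_count_anticanonical[OF bb] _ Tlim count])
      show "2 * fibre_density * proj_density \<noteq> 0" using fibre_density_pos proj_density_pos by simp
      show "\<forall>\<^sub>F B in at_top. manin_c x y / (manin_a (pic x y) * fact (manin_b (pic x y) - 1)) *
          B powr manin_a (pic x y) * ln B ^ (manin_b (pic x y) - 1) = 2 * fibre_density * proj_density * (T B ^ 4 * ln (T B))"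
      proof (rule eventually_mono[OF eventually_gt_at_top[of 0]])
        fix B :: real assume B: "B > 0"
        have "ln (T B) = ln B / (2 * x)" using B by (simp add: T_def ln_powr)
        thus "manin_c x y / (manin_a (pic x y) * fact (manin_b (pic x y) - 1)) *
            B powr manin_a (pic x y) * ln B ^ (manin_b (pic x y) - 1) = 2 * fibre_density * proj_density * (T B ^ 4 * ln (T B))"
          unfolding T4[OF B] am bm using c by simp
      qed
    qed
  next
    case rigid
    define k where "k = 2 * y / x - 1"
    have k: "k > 0" using rigid x by (simp add: k_def pos_less_divide_eq)
    have am: "manin_a (pic x y) = 2 / x" unfolding a using cmp(2) rigid by simp
    have bm: "manin_b (pic x y) = 1" unfolding b using rigid by simp
    have bb: "\<beta> < 4 / 3" using rigid xy by (simp add: \<beta>_def pos_divide_less_eq)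
    \<comment> \<open>Everything is expressed through the weight exponent k: then \<beta> = 4 / (3 +
      k), and the zeta arguments 4/\<beta> - 2 and 4/\<beta> of the count become 1 + k and 3 + k,
      those of \<open>tau_rigid_eq\<close>.\<close>
    have y: "y = (1 + k) / 2 * x" using x by (simp add: k_def)
    have bk: "\<beta> = 4 / (3 + k)"
    proof -
      have "x + y = (3 + k) / 2 * x" unfolding y by (simp add: field_simps)
      hence "\<beta> = 2 * x / ((3 + k) / 2 * x)" by (simp only: \<beta>_def)
      also have "\<dots> = 4 / (3 + k)" using x by simp
      finally show ?thesis .
    qed
    have b4: "4 / \<beta> - 2 = 1 + k" "4 / \<beta> = 3 + k" unfolding bk using k by simp_all
    have zk: "zeta (1 + k) > 0" "zeta (3 + k) > 0" using zeta_pos k by simp_all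
    define L where "L = pi * proj_density * \<beta> / (2 * (2 - \<beta>)) * (zeta (1 + k) / zeta (3 + k))"
    have b2: "\<beta> / (2 - \<beta>) = 2 / (1 + k)"
    proof -
      have e: "2 - \<beta> = 2 * (1 + k) / (3 + k)" unfolding bk using k by (simp add: field_simps)
      have "4 / d / (2 * c / d) = 2 / c" if "d \<noteq> 0" "c \<noteq> 0" for c d :: real using that by simp
      from this[of "3 + k" "1 + k"] k show ?thesis unfolding e unfolding bk by simp
    qed
    have "L = pi * proj_density / 2 * (\<beta> / (2 - \<beta>)) * (zeta (1 + k) / zeta (3 + k))" by (simp add: L_def)
    hence Leq: "L = pi * proj_density / (1 + k) * (zeta (1 + k) / zeta (3 + k))" unfolding b2 by simp
    have "manin_c x y = 1 / (2 * x) * (2 * pi\<^sup>2 / (1 + k) * (zeta (1 + k) / (zeta 2 * zeta (3 + k))))"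
      using rigid tau_rigid_eq[OF k] by (simp add: manin_c_def k_def)
    hence c: "manin_c x y / (2 / x) = L" unfolding Leq using x z by (simp add: proj_density_def power2_eq_square mult_ac)
    have lim: "((\<lambda>T. total_count \<beta> T / T ^ 4) \<longlongrightarrow> L) at_top"
      using total_count_rigid[OF bpos bb] unfolding b4(1) unfolding b4(2) L_def .
    show ?thesis
    proof (rule asymp_equiv_compose[OF lim _ Tlim count])
      show "L \<noteq> 0" unfolding Leq using proj_density_pos k zk by simp
      show "\<forall>\<^sub>F B in at_top. manin_c x y / (manin_a (pic x y) * fact (manin_b (pic x y) - 1)) *
          B powr manin_a (pic x y) * ln B ^ (manin_b (pic x y) - 1) = L * T B ^ 4"
      proof (rule eventually_mono[OF eventually_gt_at_top[of 0]])
        fix B :: real assume B: "B > 0"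
        show "manin_c x y / (manin_a (pic x y) * fact (manin_b (pic x y) - 1)) *
          B powr manin_a (pic x y) * ln B ^ (manin_b (pic x y) - 1) = L * T B ^ 4"
          unfolding T4[OF B] am bm c[symmetric] by simp
      qed
    qed
  qed
qed

end
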